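(* Let $\rho\in[0,1]$, $m<n(\rho-1)$ and $a\in L^\infty S^m_\rho$. Then: (i) $T_a$ is bounded on $L^p(w)$ for all $1<p<\infty$ and $w\in A_p^\infty$; (ii) for each $b\in BMO_\infty$, the commutator $[b,T_a]$ is bounded on $L^p(w)$ for all $1<p<\infty$ and $w\in A_p^\infty$.
   Context: Write $\langle \xi\rangle=(1+|\xi|^2)^{1/2}$. For $m\in\mathbb{R}$, $\rho\in[0,1]$, a symbol $a:\mathbb{R}^n\times\mathbb{R}^n\to\mathbb{C}$ belongs to $L^\infty S^m_\rho$ if for each multi-index $\alpha$ there is a constant $C$ with $\|\partial_\xi^\alpha a(\cdot,\xi)\|_{L^\infty}\le C\langle\xi\rangle^{m-\rho|\alpha|}$ for all $\xi$ (here $a(x,\xi)$ is smooth in $\xi$ and the $L^\infty$ norm is in the $x$ variable). The pseudo-differential operator $T_a$ is given formally, for $f\in C_0^\infty(\mathbb{R}^n)$, by $$T_af(x)=\frac{1}{(2\pi)^n}\int_{\mathbb{R}^n}\int_{\mathbb{R}^n}a(x,\xi)e^{i\langle x-y,\xi\rangle}f(y)\,dy\,d\xi .$$ The commutator is $[b,T_a]f=b\,T_af-T_a(bf)$. For $1<p<\infty$ and $\theta\ge 0$, $A_p^\theta$ is the set of weights $w$ (nonnegative locally integrable functions) for which there is $C$ with $$\Big(\int_Bw\Big)^{1/p}\Big(\int_Bw^{-\frac{1}{p-1}}\Big)^{1/p'}\le C|B|(1+r_B)^\theta$$ for all balls $B=B(x_B,r_B)\subset\mathbb{R}^n$, where $1/p+1/p'=1$;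 $A_p^\infty=\bigcup_{\theta\geq 0}A_p^\theta$. $L^p(w)$ is the space with norm $(\int|f|^pw\,dx)^{1/p}$. For $\theta\ge0$, $BMO_\theta$ is the set of locally integrable $b$ for which there is $C$ with $\frac{1}{|B|}\int_B|b(y)-b_B|dy\le C(1+r_B)^\theta$ for all balls $B=B(x_B,r_B)$, where $b_B=\frac1{|B|}\int_Bb$; $BMO_\infty=\bigcup_{\theta>0}BMO_\theta$. *)

theory Defs
  imports "HOL-Analysis.Analysis" "HOL-Probability.Essential_Supremum"
begin

section \<open>Smooth functions and multi-indices\<close>

definition partial_deriv :: "'n::finite \<Rightarrow> (real^'n \<Rightarrow> complex) \<Rightarrow> real^'n \<Rightarrow> complex" where
  "partial_deriv i f x = frechet_derivative f (at x) (axis i 1)"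

fun iter_partial :: "'n::finite list \<Rightarrow> (real^'n \<Rightarrow> complex) \<Rightarrow> real^'n \<Rightarrow> complex" where
  "iter_partial [] f = f"
| "iter_partial (i # is) f = partial_deriv i (iter_partial is f)"

text \<open>Every iterated partial derivative is Frechet differentiable, hence continuous; this is
  \<open>C\<^sup>\<infinity>\<close>.\<close>

definition smooth :: "(real^'n::finite \<Rightarrow> complex) \<Rightarrow> bool" where
  "smooth f \<longleftrightarrow> (\<forall>is x. iter_partial is f differentiable (at x))"

text \<open>A multi-index is a function \<open>\<alpha> :: 'n \<Rightarrow> nat\<close>. The index type carries no order, so the order
  in which the partial derivatives are taken is chosen arbitrarily; for smooth functions it is
  immaterial.\<close>

definition multi_deriv :: "('n::finite \<Rightarrow> nat) \<Rightarrow> (real^'n \<Rightarrow> complex) \<Rightarrow> real^'n \<Rightarrow> complex" where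
  "multi_deriv \<alpha> = iter_partial (SOME is. \<forall>i. count_list is i = \<alpha> i)"

definition test_functions :: "(real^'n::finite \<Rightarrow> complex) set" where
  "test_functions = {f. smooth f \<and> compact (closure {x. f x \<noteq> 0})}"

section \<open>Symbols and pseudo-differential operators\<close>

definition jap :: "'a::real_normed_vector \<Rightarrow> real" where
  "jap \<xi> = (1 + (norm \<xi>)\<^sup>2) powr (1/2)"

definition Linf_norm :: "(real^'n::finite \<Rightarrow> complex) \<Rightarrow> ennreal" where
  "Linf_norm g = esssup lebesgue (\<lambda>x. ennreal (norm (g x)))"

definition symbol_class ::
  "real \<Rightarrow> real \<Rightarrow> (real^'n::finite \<Rightarrow> real^'n \<Rightarrow> complex) set" where
  "symbol_class m \<rho> = {a. (\<forall>x. smooth (a x)) \<and>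
     (\<forall>\<alpha>. (\<forall>\<xi>. (\<lambda>x. multi_deriv \<alpha> (a x) \<xi>) \<in> borel_measurable lebesgue) \<and>
        (\<exists>C::real. \<forall>\<xi>. Linf_norm (\<lambda>x. multi_deriv \<alpha> (a x) \<xi>)
             \<le> ennreal (C * jap \<xi> powr (m - \<rho> * real (\<Sum>i\<in>UNIV. \<alpha> i)))))}"

text \<open>For a test function \<open>f\<close> and a symbol \<open>a\<close> the iterated integral converges absolutely in
  \<open>y\<close>, and then in \<open>\<xi>\<close> for almost every \<open>x\<close>.\<close>

definition psido ::
  "(real^'n::finite \<Rightarrow> real^'n \<Rightarrow> complex) \<Rightarrow> (real^'n \<Rightarrow> complex) \<Rightarrow> real^'n \<Rightarrow> complex" where
  "psido a f x = complex_of_real (1 / (2 * pi) ^ CARD('n)) *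
     (LINT \<xi>|lebesgue. LINT y|lebesgue.
        a x \<xi> * exp (\<i> * complex_of_real ((x - y) \<bullet> \<xi>)) * f y)"

definition commutator ::
  "('a \<Rightarrow> complex) \<Rightarrow> (('a \<Rightarrow> complex) \<Rightarrow> 'a \<Rightarrow> complex) \<Rightarrow> ('a \<Rightarrow> complex) \<Rightarrow> 'a \<Rightarrow> complex" where
  "commutator b T f = (\<lambda>x. b x * T f x - T (\<lambda>y. b y * f y) x)"

section \<open>Weights\<close>

definition locally_integrable ::
  "(real^'n::finite \<Rightarrow> 'b::{banach, second_countable_topology}) \<Rightarrow> bool" where
  "locally_integrable f \<longleftrightarrow> (\<forall>K. compact K \<longrightarrow> set_integrable lebesgue K f)"

text \<open>Powers with nonzero exponent in \<open>[0,\<infinity>]\<close>. In particular \<open>0\<close> to a negative power is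
  \<open>\<infinity>\<close>, whereas \<^const>\<open>powr\<close> would give \<open>0\<close>.\<close>

definition ennpowr :: "ennreal \<Rightarrow> real \<Rightarrow> ennreal" where
  "ennpowr x s = (if (x = 0 \<and> s < 0) \<or> (x = top \<and> s > 0) then top else ennreal (enn2real x powr s))"

definition weight :: "(real^'n::finite \<Rightarrow> real) \<Rightarrow> bool" where
  "weight w \<longleftrightarrow> (\<forall>x. 0 \<le> w x) \<and> locally_integrable w"

text \<open>The conjugate exponent enters through \<open>1/p' = 1 - 1/p\<close>.\<close>

definition Ap_theta :: "real \<Rightarrow> real \<Rightarrow> (real^'n::finite \<Rightarrow> real) set" where
  "Ap_theta p \<theta> = {w. weight w \<and>
     (\<exists>C::real. \<forall>x r. r > 0 \<longrightarrow>
        ennpowr (\<integral>\<^sup>+y\<in>ball x r. ennreal (w y) \<partial>lebesgue) (1 / p) *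
        ennpowr (\<integral>\<^sup>+y\<in>ball x r. ennpowr (ennreal (w y)) (- (1 / (p - 1))) \<partial>lebesgue) (1 - 1 / p)
        \<le> ennreal (C * measure lebesgue (ball x r) * (1 + r) powr \<theta>))}"

definition Ap_infty :: "real \<Rightarrow> (real^'n::finite \<Rightarrow> real) set" where
  "Ap_infty p = (\<Union>\<theta>\<in>{0..}. Ap_theta p \<theta>)"

section \<open>The spaces BMO\<close>

definition ball_mean :: "(real^'n::finite \<Rightarrow> complex) \<Rightarrow> real^'n \<Rightarrow> real \<Rightarrow> complex" where
  "ball_mean b x r = (LINT y:ball x r|lebesgue. b y) / complex_of_real (measure lebesgue (ball x r))"

definition BMO :: "real \<Rightarrow> (real^'n::finite \<Rightarrow> complex) set" where
  "BMO \<theta> = {b. locally_integrable b \<and>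
     (\<exists>C::real. \<forall>x r. r > 0 \<longrightarrow>
        (LINT y:ball x r|lebesgue. norm (b y - ball_mean b x r)) / measure lebesgue (ball x r)
        \<le> C * (1 + r) powr \<theta>)}"

definition BMO_infty :: "(real^'n::finite \<Rightarrow> complex) set" where
  "BMO_infty = (\<Union>\<theta>\<in>{0<..}. BMO \<theta>)"

section \<open>Boundedness on weighted Lebesgue spaces\<close>

definition Lp_norm :: "(real^'n::finite \<Rightarrow> real) \<Rightarrow> real \<Rightarrow> (real^'n \<Rightarrow> complex) \<Rightarrow> ennreal" where
  "Lp_norm w p f = ennpowr (\<integral>\<^sup>+x. ennreal (norm (f x) powr p * w x) \<partial>lebesgue) (1 / p)"

definition Lp :: "(real^'n::finite \<Rightarrow> real) \<Rightarrow> real \<Rightarrow> (real^'n \<Rightarrow> complex) set" where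
  "Lp w p = {f \<in> borel_measurable lebesgue. Lp_norm w p f < top}"

text \<open>\<open>S\<close> is a bounded linear operator on \<open>L\<^sup>p(w)\<close> that agrees with \<open>T\<close> on test functions.
  Elements of \<open>L\<^sup>p(w)\<close> are represented by functions, so all identities hold almost everywhere
  with respect to \<open>w(x) dx\<close>; linearity and the norm bound make \<open>S\<close> well defined on equivalence
  classes. As test functions are dense in \<open>L\<^sup>p(w)\<close>, \<open>S\<close> is determined by \<open>T\<close>.\<close>

definition bounded_extension ::
  "(real^'n::finite \<Rightarrow> real) \<Rightarrow> real \<Rightarrow> ((real^'n \<Rightarrow> complex) \<Rightarrow> real^'n \<Rightarrow> complex) \<Rightarrow>
   ((real^'n \<Rightarrow> complex) \<Rightarrow> real^'n \<Rightarrow> complex) \<Rightarrow> bool" where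
  "bounded_extension w p T S \<longleftrightarrow>
     (\<forall>f\<in>Lp w p. S f \<in> Lp w p) \<and>
     (\<forall>f\<in>Lp w p. \<forall>g\<in>Lp w p.
        AE x in density lebesgue w. S (\<lambda>y. f y + g y) x = S f x + S g x) \<and>
     (\<forall>c. \<forall>f\<in>Lp w p. AE x in density lebesgue w. S (\<lambda>y. c * f y) x = c * S f x) \<and>
     (\<exists>C::real. \<forall>f\<in>Lp w p. Lp_norm w p (S f) \<le> ennreal C * Lp_norm w p f) \<and>
     (\<forall>f\<in>test_functions. AE x in density lebesgue w. S f x = T f x)"

definition bounded_on_Lp ::
  "(real^'n::finite \<Rightarrow> real) \<Rightarrow> real \<Rightarrow> ((real^'n \<Rightarrow> complex) \<Rightarrow> real^'n \<Rightarrow> complex) \<Rightarrow> bool" where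
  "bounded_on_Lp w p T \<longleftrightarrow> (\<exists>S. bounded_extension w p T S)"

text \<open>For \<open>f\<close> a test function, \<open>b f\<close> is in general not one, so in \<open>[b,T]f = b T f - T(b f)\<close> the
  operator \<open>T\<close> has to be read as its extension to \<open>L\<^sup>p(w)\<close>, and \<open>b f\<close> has to lie in that space.
  The extension is unique modulo null functions.\<close>

definition commutator_bounded_on_Lp ::
  "(real^'n::finite \<Rightarrow> real) \<Rightarrow> real \<Rightarrow> (real^'n \<Rightarrow> complex) \<Rightarrow>
   ((real^'n \<Rightarrow> complex) \<Rightarrow> real^'n \<Rightarrow> complex) \<Rightarrow> bool" where
  "commutator_bounded_on_Lp w p b T \<longleftrightarrow>
     (\<forall>f\<in>test_functions. (\<lambda>x. b x * f x) \<in> Lp w p) \<and>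
     (\<exists>S. bounded_extension w p T S) \<and>
     (\<forall>S. bounded_extension w p T S \<longrightarrow> bounded_on_Lp w p (commutator b S))"

end

theory Submission
  imports Defs "HOL-Computational_Algebra.Polynomial"
begin

text \<open>
  The hypothesis \<open>m < n (\<rho> - 1)\<close> makes the Schwartz kernel of \<open>T\<^sub>a\<close> so tame that estimates of its
  absolute value suffice: with constants that do not depend on \<open>x\<close>, the kernel is \<open>O(|x - y|\<^bsup>\<epsilon>-n\<^esup>)\<close> for some
  \<open>\<epsilon> > 0\<close>, and it is \<open>O(|x - y|\<^bsup>-L\<^esup>)\<close> for every \<open>L\<close> when \<open>|x - y| \<ge> 1\<close>
  (\<open>kernel_pieces_sum_bound\<close>). To see this, cut the symbol into pieces of frequency about \<open>2\<^sup>j\<close> by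
  differences of Gaussians. A piece has a kernel of size at most \<open>2\<^bsup>j(n+1)\<^esup>\<close>, and integrating by parts
  \<open>k \<ge> n\<close> times in one coordinate direction bounds it by \<open>2\<^bsup>-j\<delta>\<^esup> |z|\<^bsup>-k\<^esup>\<close>, where \<open>\<delta>\<close> is part of
  the gap in \<open>m < n (\<rho> - 1)\<close>. A geometric mean of the two estimates, weighted slightly towards the
  second, is summable in \<open>j\<close>; it behaves like \<open>|z|\<^bsup>-n(1-s)\<^esup>\<close> for \<open>k = n\<close> and decays as fast as
  desired for large \<open>k\<close>.

  A positive kernel of this kind is dominated by a sum over dyadic radii \<open>r\<close> of averages over balls
  of radius \<open>r\<close>, with a gain of \<open>r\<^sup>\<epsilon>\<close> for small \<open>r\<close> and of any power of \<open>1/r\<close> for large \<open>r\<close>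
  (\<open>decaying_kernel_bound\<close>). At a single radius Hoelder's inequality and Tonelli's theorem reduce the
  weighted bound to the product of the masses of \<open>w\<close> and of its dual weight \<open>w\<^bsup>-1/(p-1)\<^esup>\<close> on a ball,
  which is what the \<open>A\<^sub>p\<^sup>\<theta>\<close> condition controls (\<open>one_scale_bound\<close>). The factor \<open>(1 + r)\<^sup>\<theta>\<close> that
  distinguishes \<open>A\<^sub>p\<^sup>\<theta>\<close> from the classical condition is bounded for small radii and is absorbed by the
  rapid decay for large ones.

  The commutator has the kernel of \<open>T\<^sub>a\<close> times \<open>b(x) - b(y)\<close>. The same summation works if the
  single-radius test holds with the additional factor \<open>|b(x) - b(y)|\<close> (\<open>scale_test_oscillation\<close>), and
  this is a statement about moments of \<open>b\<close> on cubes against \<open>w\<close> and against its dual weight. They are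
  bounded by a John-Nirenberg inequality for the measure \<open>w dx\<close> (\<open>weighted_John_Nirenberg\<close>), proved by
  stopping-time induction on dyadic averages; of the weight it uses only that a set filling half
  of a cube carries a definite part of its mass, up to a power of the side length.

  Two points concern the extension of operators from test functions to \<open>L\<^sup>p(w)\<close>. The integral operator
  with the kernel of \<open>T\<^sub>a\<close> is one bounded extension, and the commutator is built from an arbitrary one,
  so uniqueness of bounded extensions is required (\<open>extensions_agree\<close>); it comes down to approximating
  indicators of boxes by smooth bumps, followed by a Dynkin class argument. Furthermore a weight that
  vanishes almost everywhere belongs to \<open>A\<^sub>p\<^sup>\<theta>\<close>, because \<open>0 \<cdot> \<infinity> = 0\<close>; then \<open>L\<^sup>p(w)\<close> is trivial and
  so is the claim. For every other weight both masses in the \<open>A\<^sub>p\<^sup>\<theta>\<close> condition are finite on each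
  ball (\<open>Ap_infty_dual_weights\<close>).
\<close>

section \<open>Powers and Hoelder inequality in the extended nonnegative reals\<close>

lemma ennreal_lincomb:
  assumes "0 \<le> c" "0 \<le> x" "0 \<le> d" "0 \<le> y"
  shows "ennreal c * ennreal x + ennreal d * ennreal y = ennreal (c * x + d * y)"
  by (simp only: assms ennreal_mult ennreal_plus mult_nonneg_nonneg)

lemma ennpowr_ennreal: "0 \<le> a \<Longrightarrow> s > 0 \<Longrightarrow> ennpowr (ennreal a) s = ennreal (a powr s)"
  by (simp add: ennpowr_def)

lemma ennpowr_top [simp]: "s > 0 \<Longrightarrow> ennpowr top s = top"
  by (simp add: ennpowr_def)

lemma ennpowr_0 [simp]: "s > 0 \<Longrightarrow> ennpowr 0 s = 0"
  by (simp add: ennpowr_def)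

lemma ennpowr_eq_0_iff: "s > 0 \<Longrightarrow> ennpowr x s = 0 \<longleftrightarrow> x = 0"
  by (cases x) (auto simp: ennpowr_ennreal ennreal_eq_0_iff)

lemma ennpowr_less_top_iff: "s > 0 \<Longrightarrow> ennpowr x s < top \<longleftrightarrow> x < top"
  by (cases x) (auto simp: ennpowr_ennreal)

lemma ennpowr_mono: "s > 0 \<Longrightarrow> x \<le> y \<Longrightarrow> ennpowr x s \<le> ennpowr y s"
  by (cases x; cases y) (auto simp: ennpowr_ennreal top_unique intro!: ennreal_leI powr_mono2)

lemma ennpowr_mult: "s > 0 \<Longrightarrow> ennpowr (x * y) s = ennpowr x s * ennpowr y s"
proof (cases x; cases y)
  fix a b assume "s > 0" "x = ennreal a" "0 \<le> a" "y = ennreal b" "0 \<le> b"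
  then show ?thesis by (simp add: ennpowr_ennreal powr_mult flip: ennreal_mult)
qed (auto simp: ennpowr_ennreal ennreal_mult_top ennreal_top_mult)

lemma ennpowr_ennpowr: "s > 0 \<Longrightarrow> t > 0 \<Longrightarrow> ennpowr (ennpowr x s) t = ennpowr x (s * t)"
  by (cases x) (auto simp: ennpowr_ennreal powr_powr)

lemma ennpowr_1 [simp]: "ennpowr x 1 = x"
  by (cases x) (auto simp: ennpowr_ennreal)

lemma borel_measurable_ennpowr [measurable]: "s > 0 \<Longrightarrow> (\<lambda>x. ennpowr x s) \<in> borel_measurable borel"
proof -
  assume s: "s > 0"
  have "(\<lambda>x. ennpowr x s) = (\<lambda>x. if x = top then top else ennreal (enn2real x powr s))"
    using s by (auto simp: ennpowr_def fun_eq_iff)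
  also have "\<dots> \<in> borel_measurable borel" by measurable
  finally show ?thesis .
qed

lemma borel_measurable_ennpowr' [measurable (raw)]:
  "f \<in> borel_measurable M \<Longrightarrow> s > 0 \<Longrightarrow> (\<lambda>x. ennpowr (f x) s) \<in> borel_measurable M"
  by measurable

lemma ennpowr_add_le:
  assumes "s > 0" shows "ennpowr (x + y) s \<le> ennreal (2 powr s) * (ennpowr x s + ennpowr y s)"
proof -
  have "x + y \<le> ennreal 2 * max x y"
    by (metis add_mono ennreal_numeral max.cobounded1 max.cobounded2 mult_2)
  then have "ennpowr (x + y) s \<le> ennpowr (ennreal 2 * max x y) s"
    by (rule ennpowr_mono[OF assms])
  also have "\<dots> = ennreal (2 powr s) * ennpowr (max x y) s"
    using assms by (simp add: ennpowr_mult ennpowr_ennreal del: ennreal_numeral)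
  also have "\<dots> \<le> ennreal (2 powr s) * (ennpowr x s + ennpowr y s)"
    by (intro mult_left_mono) (auto simp: max_def)
  finally show ?thesis .
qed

text \<open>The free parameters \<open>a\<close> and \<open>b\<close> are the normalising factors of the two terms: if \<open>f\<^sup>p\<close> has integral
  \<open>a\<close> and \<open>g\<^sup>q\<close> has integral \<open>b\<close>, then integrating the bound gives Hoelder's inequality, as the
  right-hand side integrates to \<open>k (1/p + 1/q) = k\<close>.\<close>

lemma Young_ennpowr:
  assumes p: "p > 1" and q: "q > 1" "1 / p + 1 / q = 1" and ab: "0 < a" "0 < b"
  defines "k \<equiv> a powr (1 / p) * b powr (1 / q)"
  shows "x * y \<le> ennreal (k / (p * a)) * ennpowr x p + ennreal (k / (q * b)) * ennpowr y q"
proof -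
  have k: "k > 0" using ab by (simp add: k_def)
  consider "x = top \<or> y = top" | u v where "x = ennreal u" "y = ennreal v" "0 \<le> u" "0 \<le> v"
    by (cases x; cases y) auto
  then show ?thesis
  proof cases
    case 1
    have "0 < k / (p * a)" "0 < k / (q * b)" using k p q ab by simp_all
    with 1 p q show ?thesis
      by (auto simp: ennreal_mult_top ennreal_top_mult)
  next
    case 2
    have "u * v = k * ((u / a powr (1/p)) * (v / b powr (1/q)))"
      using ab by (simp add: k_def)
    also have "\<dots> \<le> k * ((u / a powr (1/p)) powr p / p + (v / b powr (1/q)) powr q / q)"
      using 2 ab p q k by (intro mult_left_mono Youngs_inequality) auto
    also have "\<dots> = k / (p * a) * u powr p + k / (q * b) * v powr q"
      using 2 ab p q by (simp add: powr_divide powr_powr field_simps)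
    finally have "ennreal (u * v) \<le> ennreal (k / (p * a) * u powr p + k / (q * b) * v powr q)"
      by (rule ennreal_leI)
    also have "\<dots> = ennreal (k / (p * a)) * ennreal (u powr p) + ennreal (k / (q * b)) * ennreal (v powr q)"
      by (rule ennreal_lincomb[symmetric]) (use k p q ab in simp_all)
    finally show ?thesis
      using 2 p q by (simp add: ennpowr_ennreal ennreal_mult)
  qed
qed

text \<open>Hoelder's inequality raised to the power \<open>p\<close>, with values in \<open>[0,\<infinity>]\<close>. The dual weight of a weight may
  be infinite, so neither factor can be assumed integrable; the degenerate cases are consistent with
  \<open>0 \<cdot> \<infinity> = 0\<close> because a vanishing factor on the right forces \<open>f g = 0\<close> almost everywhere.\<close>

proposition Hoelder_ennpowr:
  assumes [measurable]: "f \<in> borel_measurable M" "g \<in> borel_measurable M"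
    and p: "p > 1" and q: "q > 1" "1 / p + 1 / q = 1"
  shows "ennpowr (\<integral>\<^sup>+x. f x * g x \<partial>M) p \<le>
    (\<integral>\<^sup>+x. ennpowr (f x) p \<partial>M) * ennpowr (\<integral>\<^sup>+x. ennpowr (g x) q \<partial>M) (p - 1)"
proof -
  have q_eq: "p / q = p - 1" using p q by (simp add: field_simps)
  define A where "A = (\<integral>\<^sup>+x. ennpowr (f x) p \<partial>M)"
  define B where "B = (\<integral>\<^sup>+x. ennpowr (g x) q \<partial>M)"
  have [measurable]: "(\<lambda>x. ennpowr (f x) p) \<in> borel_measurable M" "(\<lambda>x. ennpowr (g x) q) \<in> borel_measurable M"
    using p q by simp_all
  consider "A = 0 \<or> B = 0" | "A \<noteq> 0" "B \<noteq> 0" "A = top \<or> B = top" |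
    a b where "A = ennreal a" "B = ennreal b" "a > 0" "b > 0"
    by (cases A; cases B) (auto simp: ennreal_eq_0_iff not_le less_top less_le)
  then show ?thesis
  proof cases
    case 1
    then have "AE x in M. f x * g x = 0"
    proof
      assume "A = 0"
      then have "AE x in M. ennpowr (f x) p = 0" unfolding A_def by (subst (asm) nn_integral_0_iff_AE) auto
      then show ?thesis by eventually_elim (use p in \<open>auto simp: ennpowr_eq_0_iff\<close>)
    next
      assume "B = 0"
      then have "AE x in M. ennpowr (g x) q = 0" unfolding B_def by (subst (asm) nn_integral_0_iff_AE) auto
      then show ?thesis by eventually_elim (use q in \<open>auto simp: ennpowr_eq_0_iff\<close>)
    qed
    then have "(\<integral>\<^sup>+x. f x * g x \<partial>M) = 0" by (subst nn_integral_0_iff_AE) auto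
    then show ?thesis using p by simp
  next
    case 2
    then have "A * ennpowr B (p - 1) = top"
      using p by (auto simp: ennreal_mult_eq_top_iff ennpowr_eq_0_iff)
    then show ?thesis by (simp add: A_def B_def)
  next
    case 3
    define k where "k = a powr (1 / p) * b powr (1 / q)"
    have k: "k > 0" using 3 by (simp add: k_def)
    have "(\<integral>\<^sup>+x. f x * g x \<partial>M) \<le>
       (\<integral>\<^sup>+x. ennreal (k / (p * a)) * ennpowr (f x) p + ennreal (k / (q * b)) * ennpowr (g x) q \<partial>M)"
      unfolding k_def by (intro nn_integral_mono Young_ennpowr p q 3)
    also have "\<dots> = ennreal (k / (p * a)) * A + ennreal (k / (q * b)) * B"
      by (simp add: nn_integral_add nn_integral_cmult A_def B_def)
    also have "\<dots> = ennreal (k / (p * a) * a + k / (q * b) * b)"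
      using 3 k p q by (simp only: ennreal_lincomb less_imp_le divide_nonneg_nonneg mult_nonneg_nonneg)
    also have "k / (p * a) * a + k / (q * b) * b = k * (1 / p + 1 / q)"
      using 3 p q by (simp add: field_simps)
    finally have "ennpowr (\<integral>\<^sup>+x. f x * g x \<partial>M) p \<le> ennpowr (ennreal k) p"
      using q p by (intro ennpowr_mono) auto
    also have "\<dots> = ennreal (a * b powr (p - 1))"
      using 3 k p q q_eq by (subst ennpowr_ennreal) (simp_all add: k_def powr_mult powr_powr)
    also have "\<dots> = A * ennpowr B (p - 1)"
      using 3 p by (simp add: ennpowr_ennreal ennreal_mult)
    finally show ?thesis by (simp add: A_def B_def)
  qed
qed

text \<open>A substitute for Minkowski's inequality that suffices for geometric weights \<open>u\<close>: every \<open>a l\<close> is at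
  most the \<open>1/p\<close>-th power of the sum of the \<open>p\<close>-th powers.\<close>

lemma ennpowr_suminf_le:
  assumes p: "p > 0"
  shows "ennpowr (\<Sum>l. u l * a l) p \<le> ennpowr (\<Sum>l. u l) p * (\<Sum>l. ennpowr (a l) p)"
proof -
  define M where "M = (\<Sum>l. ennpowr (a l) p)"
  have le: "a l \<le> ennpowr M (1 / p)" for l
  proof -
    have "ennpowr (a l) p \<le> M"
      unfolding M_def using sum_le_suminf[of "\<lambda>l. ennpowr (a l) p" "{l}"] by simp
    then have "ennpowr (ennpowr (a l) p) (1 / p) \<le> ennpowr M (1 / p)"
      using p by (intro ennpowr_mono) auto
    then show ?thesis using p by (simp add: ennpowr_ennpowr)
  qed
  have "(\<Sum>l. u l * a l) \<le> (\<Sum>l. u l * ennpowr M (1 / p))"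
    by (intro suminf_le mult_left_mono le) auto
  also have "\<dots> = (\<Sum>l. u l) * ennpowr M (1 / p)" by simp
  finally have "ennpowr (\<Sum>l. u l * a l) p \<le> ennpowr ((\<Sum>l. u l) * ennpowr M (1 / p)) p"
    using p by (intro ennpowr_mono) auto
  also have "\<dots> = ennpowr (\<Sum>l. u l) p * M"
    using p by (simp add: ennpowr_mult ennpowr_ennpowr)
  finally show ?thesis by (simp add: M_def)
qed

section \<open>Positive kernels on weighted spaces\<close>

lemma sigma_finite_lebesgue: "sigma_finite_measure (lebesgue :: 'a::euclidean_space measure)"
proof
  show "\<exists>A. countable A \<and> A \<subseteq> sets (lebesgue :: 'a measure) \<and> \<Union>A = space lebesgue \<and>
      (\<forall>a\<in>A. emeasure lebesgue a \<noteq> \<infinity>)"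
  proof (intro exI[of _ "range (\<lambda>n::nat. cball (0::'a) (real n))"] conjI ballI)
    show "\<Union> (range (\<lambda>n::nat. cball (0::'a) (real n))) = space lebesgue"
      using real_arch_simple by (auto simp: mem_cball_0)
    show "emeasure lebesgue a \<noteq> \<infinity>" if "a \<in> range (\<lambda>n::nat. cball (0::'a) (real n))" for a
      using that emeasure_lborel_cball_finite[where 'a='a] by (auto simp: less_top)
  qed auto
qed

interpretation lebesgue: sigma_finite_measure "lebesgue :: 'a::euclidean_space measure"
  by (rule sigma_finite_lebesgue)

interpretation lebesgue_pair: pair_sigma_finite "lebesgue :: 'a::euclidean_space measure"
  "lebesgue :: 'b::euclidean_space measure" ..

lemma measurable_ident_lebesgue [measurable]: "(\<lambda>x. x) \<in> measurable lebesgue borel"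
  by (intro measurable_completion) simp

lemma measurable_fst_lebesgue [measurable]:
  "fst \<in> measurable (lebesgue \<Otimes>\<^sub>M M) borel"
  using measurable_compose[OF measurable_fst measurable_ident_lebesgue] by simp

lemma measurable_snd_lebesgue [measurable]:
  "snd \<in> measurable (M \<Otimes>\<^sub>M lebesgue) borel"
  using measurable_compose[OF measurable_snd measurable_ident_lebesgue] by simp

lemma measurable_indicator_ball [measurable]:
  "(\<lambda>(x, y). indicator (ball x r) y :: ennreal) \<in>
     borel_measurable (lebesgue \<Otimes>\<^sub>M (lebesgue :: 'a::euclidean_space measure))"
proof -
  have "(\<lambda>z :: 'a \<times> 'a. if dist (fst z) (snd z) < r then 1 else 0 :: ennreal) \<in> borel_measurable (lebesgue \<Otimes>\<^sub>M lebesgue)"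
    by measurable
  also have "(\<lambda>z :: 'a \<times> 'a. if dist (fst z) (snd z) < r then 1 else 0 :: ennreal) = (\<lambda>(x, y). indicator (ball x r) y)"
    by (auto simp: fun_eq_iff indicator_def)
  finally show ?thesis .
qed

text \<open>Write \<open>F = (F W\<^bsup>1/p\<^esup>) V\<^bsup>1/q\<^esup>\<close> and apply Hoelder's inequality in \<open>y\<close> on \<open>ball x r\<close>. By symmetry of
  \<open>y \<in> ball x r\<close> in \<open>x\<close> and \<open>y\<close>, Tonelli's theorem then moves everything except \<open>F\<^sup>p W\<close> into an
  integral over \<open>ball y r\<close>, which is the quantity bounded by \<open>\<kappa>\<close>.\<close>

lemma one_scale_bound:
  fixes W V F :: "'a::euclidean_space \<Rightarrow> ennreal" and D :: "'a \<Rightarrow> 'a \<Rightarrow> ennreal"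
  assumes [measurable]: "W \<in> borel_measurable lebesgue" "V \<in> borel_measurable lebesgue"
      "F \<in> borel_measurable lebesgue"
      "(\<lambda>(x, y). D x y) \<in> borel_measurable (lebesgue \<Otimes>\<^sub>M lebesgue)"
    and p: "p > 1" and q: "q > 1" "1 / p + 1 / q = 1"
    and dual: "AE x in lebesgue. ennpowr (W x) (1 / p) * ennpowr (V x) (1 / q) = 1"
    and test: "\<And>y. (\<integral>\<^sup>+x\<in>ball y r. W x * ennpowr (\<integral>\<^sup>+z\<in>ball x r. ennpowr (D x z) q * V z \<partial>lebesgue) (p - 1)
        \<partial>lebesgue) \<le> \<kappa>"
  shows "(\<integral>\<^sup>+x. ennpowr (\<integral>\<^sup>+y\<in>ball x r. D x y * F y \<partial>lebesgue) p * W x \<partial>lebesgue) \<le>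
    \<kappa> * (\<integral>\<^sup>+y. ennpowr (F y) p * W y \<partial>lebesgue)"
proof -
  have p0: "0 < p" "0 < q" "0 < p - 1" "0 < 1 / p" "0 < 1 / q" using p q by auto
  note [measurable] = borel_measurable_ennpowr'[OF _ p0(1)] borel_measurable_ennpowr'[OF _ p0(2)]
     borel_measurable_ennpowr'[OF _ p0(3)] borel_measurable_ennpowr'[OF _ p0(4)] borel_measurable_ennpowr'[OF _ p0(5)]
  have [measurable]: "(\<lambda>y. D x y) \<in> borel_measurable lebesgue" for x
    using measurable_compose[OF measurable_Pair1'[of x lebesgue lebesgue] assms(4)] by simp
  define U where "U x = ennpowr (\<integral>\<^sup>+z. ennpowr (D x z) q * V z * indicator (ball x r) z \<partial>lebesgue) (p - 1)" for x
  have [measurable]: "U \<in> borel_measurable lebesgue" unfolding U_def by measurable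
  have pt: "ennpowr (\<integral>\<^sup>+y\<in>ball x r. D x y * F y \<partial>lebesgue) p \<le>
      (\<integral>\<^sup>+y. ennpowr (F y) p * W y * indicator (ball x r) y \<partial>lebesgue) * U x" for x
  proof -
    have ind: "ennpowr (indicator A y) s = indicator A y" if "s > 0" for A and y :: 'a and s
      using that ennpowr_ennreal[of 1 s] by (auto simp: indicator_def)
    have "(\<integral>\<^sup>+y\<in>ball x r. D x y * F y \<partial>lebesgue) =
      (\<integral>\<^sup>+y. (F y * ennpowr (W y) (1 / p) * indicator (ball x r) y) *
             (D x y * ennpowr (V y) (1 / q) * indicator (ball x r) y) \<partial>lebesgue)"
    proof (rule nn_integral_cong_AE)
      show "AE y in lebesgue. D x y * F y * indicator (ball x r) y =
        (F y * ennpowr (W y) (1 / p) * indicator (ball x r) y) *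
             (D x y * ennpowr (V y) (1 / q) * indicator (ball x r) y)"
        using dual
      proof eventually_elim
        case (elim y)
        have "(F y * ennpowr (W y) (1 / p) * indicator (ball x r) y) *
             (D x y * ennpowr (V y) (1 / q) * indicator (ball x r) y) =
             D x y * F y * (ennpowr (W y) (1 / p) * ennpowr (V y) (1 / q)) *
              (indicator (ball x r) y * indicator (ball x r) y)"
          by (simp only: ac_simps)
        then show ?case unfolding elim by (simp add: indicator_def)
      qed
    qed
    also have "ennpowr \<dots> p \<le>
       (\<integral>\<^sup>+y. ennpowr (F y * ennpowr (W y) (1 / p) * indicator (ball x r) y) p \<partial>lebesgue) *
       ennpowr (\<integral>\<^sup>+y. ennpowr (D x y * ennpowr (V y) (1 / q) * indicator (ball x r) y) q \<partial>lebesgue) (p - 1)"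
      by (rule Hoelder_ennpowr[OF _ _ p q]) measurable
    also have "\<dots> = (\<integral>\<^sup>+y. ennpowr (F y) p * W y * indicator (ball x r) y \<partial>lebesgue) * U x"
      unfolding U_def using p0 p q by (simp add: ennpowr_mult ennpowr_ennpowr ind)
    finally show ?thesis .
  qed
  have "(\<integral>\<^sup>+x. ennpowr (\<integral>\<^sup>+y\<in>ball x r. D x y * F y \<partial>lebesgue) p * W x \<partial>lebesgue) \<le>
     (\<integral>\<^sup>+x. (\<integral>\<^sup>+y. ennpowr (F y) p * W y * indicator (ball x r) y * (U x * W x) \<partial>lebesgue) \<partial>lebesgue)"
  proof (rule nn_integral_mono)
    fix x
    have "ennpowr (\<integral>\<^sup>+y\<in>ball x r. D x y * F y \<partial>lebesgue) p * W x \<le>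
      (\<integral>\<^sup>+y. ennpowr (F y) p * W y * indicator (ball x r) y \<partial>lebesgue) * U x * W x"
      by (intro mult_right_mono pt) auto
    also have "\<dots> = (\<integral>\<^sup>+y. ennpowr (F y) p * W y * indicator (ball x r) y * (U x * W x) \<partial>lebesgue)"
      by (subst nn_integral_multc) (auto simp: mult.assoc)
    finally show "ennpowr (\<integral>\<^sup>+y\<in>ball x r. D x y * F y \<partial>lebesgue) p * W x \<le> \<dots>" .
  qed
  also have "\<dots> = (\<integral>\<^sup>+y. (\<integral>\<^sup>+x. ennpowr (F y) p * W y * indicator (ball x r) y * (U x * W x) \<partial>lebesgue) \<partial>lebesgue)"
    by (rule lebesgue_pair.Fubini') measurable
  also have "\<dots> = (\<integral>\<^sup>+y. ennpowr (F y) p * W y * (\<integral>\<^sup>+x\<in>ball y r. W x * U x \<partial>lebesgue) \<partial>lebesgue)"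
  proof (rule nn_integral_cong)
    fix y
    have "(\<integral>\<^sup>+x. ennpowr (F y) p * W y * indicator (ball x r) y * (U x * W x) \<partial>lebesgue) =
      (\<integral>\<^sup>+x. ennpowr (F y) p * W y * (W x * U x * indicator (ball y r) x) \<partial>lebesgue)"
      by (intro nn_integral_cong) (auto simp: indicator_def dist_commute ac_simps)
    then show "(\<integral>\<^sup>+x. ennpowr (F y) p * W y * indicator (ball x r) y * (U x * W x) \<partial>lebesgue) =
      ennpowr (F y) p * W y * (\<integral>\<^sup>+x\<in>ball y r. W x * U x \<partial>lebesgue)"
      by (simp add: nn_integral_cmult)
  qed
  also have "\<dots> \<le> (\<integral>\<^sup>+y. ennpowr (F y) p * W y * \<kappa> \<partial>lebesgue)"
    by (intro nn_integral_mono mult_left_mono) (use test in \<open>auto simp: U_def\<close>)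
  also have "\<dots> = \<kappa> * (\<integral>\<^sup>+y. ennpowr (F y) p * W y \<partial>lebesgue)"
    by (subst nn_integral_multc) (auto simp: mult.commute)
  finally show ?thesis .
qed

text \<open>The coefficient of each scale is split as \<open>u l * v l\<close>: the first factor pays for the interchange of
  the sum with the power \<open>p\<close>, the second one for the growth of the single-scale bounds.\<close>

lemma sum_of_scales_bound:
  fixes h :: "nat \<Rightarrow> 'a \<Rightarrow> ennreal"
  assumes [measurable]: "\<And>l. h l \<in> borel_measurable M" "W \<in> borel_measurable M" and p: "p > 0"
    and bd: "\<And>l. (\<integral>\<^sup>+x. ennpowr (h l x) p * W x \<partial>M) \<le> \<kappa> l * I"
  shows "(\<integral>\<^sup>+x. ennpowr (\<Sum>l. u l * v l * h l x) p * W x \<partial>M) \<le>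
    ennpowr (\<Sum>l. u l) p * (\<Sum>l. ennpowr (v l) p * \<kappa> l) * I"
proof -
  note [measurable] = borel_measurable_ennpowr'[OF _ p]
  have "(\<integral>\<^sup>+x. ennpowr (\<Sum>l. u l * v l * h l x) p * W x \<partial>M) \<le>
    (\<integral>\<^sup>+x. ennpowr (\<Sum>l. u l) p * (\<Sum>l. ennpowr (v l) p * (ennpowr (h l x) p * W x)) \<partial>M)"
  proof (rule nn_integral_mono)
    fix x
    have "ennpowr (\<Sum>l. u l * (v l * h l x)) p * W x \<le>
        ennpowr (\<Sum>l. u l) p * (\<Sum>l. ennpowr (v l * h l x) p) * W x"
      by (intro mult_right_mono ennpowr_suminf_le p) auto
    also have "\<dots> = ennpowr (\<Sum>l. u l) p * ((\<Sum>l. ennpowr (v l * h l x) p) * W x)"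
      by (simp add: mult.assoc)
    also have "(\<Sum>l. ennpowr (v l * h l x) p) * W x = (\<Sum>l. ennpowr (v l) p * (ennpowr (h l x) p * W x))"
      using p by (simp add: ennpowr_mult mult.assoc flip: ennreal_suminf_multc)
    finally show "ennpowr (\<Sum>l. u l * v l * h l x) p * W x \<le>
        ennpowr (\<Sum>l. u l) p * (\<Sum>l. ennpowr (v l) p * (ennpowr (h l x) p * W x))"
      by (simp add: mult.assoc)
  qed
  also have "\<dots> = ennpowr (\<Sum>l. u l) p * (\<Sum>l. ennpowr (v l) p * (\<integral>\<^sup>+x. ennpowr (h l x) p * W x \<partial>M))"
    by (simp add: nn_integral_cmult nn_integral_suminf)
  also have "\<dots> \<le> ennpowr (\<Sum>l. u l) p * (\<Sum>l. ennpowr (v l) p * (\<kappa> l * I))"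
    by (intro mult_left_mono suminf_le bd) auto
  also have "\<dots> = ennpowr (\<Sum>l. u l) p * (\<Sum>l. ennpowr (v l) p * \<kappa> l) * I"
    by (simp add: mult.assoc flip: ennreal_suminf_multc)
  finally show ?thesis .
qed

text \<open>Only almost everywhere with respect to \<open>w\<close>: where \<open>w\<close> vanishes, nothing can be said about \<open>h\<close>.\<close>

lemma AE_density_finite:
  assumes p: "p > 0" and [measurable]: "w \<in> borel_measurable M" "h \<in> borel_measurable M"
    and fin: "(\<integral>\<^sup>+x. ennpowr (h x) p * ennreal (w x) \<partial>M) < top"
  shows "AE x in density M w. h x < top"
proof -
  note [measurable] = borel_measurable_ennpowr'[OF _ p]
  have "AE x in M. ennpowr (h x) p * ennreal (w x) \<noteq> \<infinity>"
    using fin by (intro nn_integral_PInf_AE) (auto simp: less_top)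
  then have "AE x in M. 0 < ennreal (w x) \<longrightarrow> h x < top"
  proof eventually_elim
    case (elim x)
    then show ?case using p by (cases "h x = top") (auto simp: ennreal_top_mult less_top)
  qed
  then show ?thesis by (subst AE_density) auto
qed

definition kernel_operator :: "('a::euclidean_space \<Rightarrow> 'a \<Rightarrow> complex) \<Rightarrow> ('a \<Rightarrow> complex) \<Rightarrow> 'a \<Rightarrow> complex" where
  "kernel_operator k f x = (LINT y|lebesgue. k x y * f y)"

lemma Lp_norm_eq:
  assumes "p > 1" "\<And>x. 0 \<le> w x"
  shows "Lp_norm w p f = ennpowr (\<integral>\<^sup>+x. ennpowr (ennreal (norm (f x))) p * ennreal (w x) \<partial>lebesgue) (1 / p)"
  unfolding Lp_norm_def using assms by (simp add: ennpowr_ennreal ennreal_mult)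

text \<open>Passage from a positive kernel to a complex one. The bound for \<open>|k|\<close> shows that the integral defining
  the operator converges absolutely for almost every \<open>x\<close> with respect to \<open>w\<close>, which gives
  additivity, and the triangle inequality transfers the norm bound.\<close>

lemma kernel_operator_bounded:
  fixes k :: "real^'n::finite \<Rightarrow> real^'n \<Rightarrow> complex" and w :: "real^'n \<Rightarrow> real"
  assumes p: "p > 1" and w0: "\<And>x. 0 \<le> w x" and [measurable]: "w \<in> borel_measurable lebesgue"
    and k [measurable]: "(\<lambda>(x, y). k x y) \<in> borel_measurable (lebesgue \<Otimes>\<^sub>M lebesgue)"
    and bd: "\<And>F. F \<in> borel_measurable lebesgue \<Longrightarrow>
       (\<integral>\<^sup>+x. ennpowr (\<integral>\<^sup>+y. ennreal (norm (k x y)) * F y \<partial>lebesgue) p * ennreal (w x) \<partial>lebesgue)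
         \<le> ennreal C * (\<integral>\<^sup>+y. ennpowr (F y) p * ennreal (w y) \<partial>lebesgue)"
  shows "\<And>f. f \<in> Lp w p \<Longrightarrow> AE x in density lebesgue w. integrable lebesgue (\<lambda>y. k x y * f y)"
    and "(\<And>f. f \<in> test_functions \<Longrightarrow> AE x in density lebesgue w. T f x = kernel_operator k f x) \<Longrightarrow>
       bounded_extension w p T (kernel_operator k)"
proof -
  have p0: "p > 0" "1 / p > 0" using p by auto
  note [measurable] = borel_measurable_ennpowr'[OF _ p0(1)] borel_measurable_ennpowr'[OF _ p0(2)]
  have k1 [measurable]: "(\<lambda>y. k x y) \<in> borel_measurable lebesgue" for x
    using measurable_compose[OF measurable_Pair1'[of x lebesgue lebesgue] k] by simp
  define I where "I f = (\<integral>\<^sup>+x. ennpowr (ennreal (norm (f x))) p * ennreal (w x) \<partial>lebesgue)" for f :: "real^'n \<Rightarrow> complex"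
  have Lp: "f \<in> Lp w p \<longleftrightarrow> f \<in> borel_measurable lebesgue \<and> I f < top" for f
    using p0 by (simp add: Lp_def Lp_norm_eq[OF p w0] I_def ennpowr_less_top_iff)
  show int: "AE x in density lebesgue w. integrable lebesgue (\<lambda>y. k x y * f y)" if "f \<in> Lp w p" for f
  proof -
    have [measurable]: "f \<in> borel_measurable lebesgue" and "I f < top" using that Lp by auto
    define g where "g x = (\<integral>\<^sup>+y. ennreal (norm (k x y)) * ennreal (norm (f y)) \<partial>lebesgue)" for x
    have [measurable]: "g \<in> borel_measurable lebesgue" unfolding g_def by measurable
    have "(\<integral>\<^sup>+x. ennpowr (g x) p * ennreal (w x) \<partial>lebesgue) \<le> ennreal C * I f"
      unfolding g_def I_def by (rule bd) measurable
    also have "\<dots> < top" using \<open>I f < top\<close> by (simp add: ennreal_mult_less_top)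
    finally have "AE x in density lebesgue w. g x < top"
      by (intro AE_density_finite[OF p0(1)]) measurable
    then show ?thesis
    proof eventually_elim
      case (elim x)
      then show ?case unfolding g_def
        by (intro integrableI_bounded) (auto simp: norm_mult ennreal_mult)
    qed
  qed
  have meas: "kernel_operator k f \<in> borel_measurable lebesgue" if "f \<in> Lp w p" for f
  proof -
    have [measurable]: "f \<in> borel_measurable lebesgue" using that Lp by auto
    show ?thesis unfolding kernel_operator_def by measurable
  qed
  have norm_le: "Lp_norm w p (kernel_operator k f) \<le> ennreal (max C 0 powr (1 / p)) * Lp_norm w p f" if "f \<in> Lp w p" for f
  proof -
    have [measurable]: "f \<in> borel_measurable lebesgue" using that Lp by auto
    have "I (kernel_operator k f) \<le>
       (\<integral>\<^sup>+x. ennpowr (\<integral>\<^sup>+y. ennreal (norm (k x y)) * ennreal (norm (f y)) \<partial>lebesgue) p * ennreal (w x) \<partial>lebesgue)"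
      unfolding I_def
    proof (intro nn_integral_mono mult_right_mono ennpowr_mono p0)
      fix x
      have "ennreal (norm (kernel_operator k f x)) \<le> (\<integral>\<^sup>+y. ennreal (norm (k x y * f y)) \<partial>lebesgue)"
      proof (cases "integrable lebesgue (\<lambda>y. k x y * f y)")
        case True
        then show ?thesis unfolding kernel_operator_def by (rule integral_norm_bound_ennreal)
      qed (simp add: kernel_operator_def not_integrable_integral_eq)
      then show "ennreal (norm (kernel_operator k f x)) \<le> (\<integral>\<^sup>+y. ennreal (norm (k x y)) * ennreal (norm (f y)) \<partial>lebesgue)"
        by (simp add: norm_mult ennreal_mult)
    qed auto
    also have "\<dots> \<le> ennreal C * I f" unfolding I_def by (rule bd) measurable
    also have "\<dots> = ennreal (max C 0) * I f" by (simp add: max_def ennreal_neg)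
    finally have "ennpowr (I (kernel_operator k f)) (1 / p) \<le> ennpowr (ennreal (max C 0) * I f) (1 / p)"
      by (rule ennpowr_mono[OF p0(2)])
    then show ?thesis
      using p0 by (simp add: Lp_norm_eq[OF p w0] I_def ennpowr_mult ennpowr_ennreal)
  qed
  show "bounded_extension w p T (kernel_operator k)"
    if T: "\<And>f. f \<in> test_functions \<Longrightarrow> AE x in density lebesgue w. T f x = kernel_operator k f x"
    unfolding bounded_extension_def
  proof (intro conjI ballI allI)
    fix f assume f: "f \<in> Lp w p"
    have "Lp_norm w p f < top" using f by (simp add: Lp_def)
    then have "Lp_norm w p (kernel_operator k f) < top"
      by (intro le_less_trans[OF norm_le[OF f]]) (simp add: ennreal_mult_less_top)
    with meas[OF f] show "kernel_operator k f \<in> Lp w p" by (simp add: Lp_def)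
    show "AE x in density lebesgue w. kernel_operator k (\<lambda>y. f y + g y) x = kernel_operator k f x + kernel_operator k g x"
      if g: "g \<in> Lp w p" for g
      using int[OF f] int[OF g] by eventually_elim (simp add: kernel_operator_def distrib_left)
    show "AE x in density lebesgue w. kernel_operator k (\<lambda>y. c * f y) x = c * kernel_operator k f x" for c
      by (simp add: kernel_operator_def mult.left_commute)
  next
    show "\<exists>C. \<forall>f\<in>Lp w p. Lp_norm w p (kernel_operator k f) \<le> ennreal C * Lp_norm w p f"
      using norm_le by blast
  next
    fix f :: "real^'n \<Rightarrow> complex" assume "f \<in> test_functions"
    from T[OF this] show "AE x in density lebesgue w. kernel_operator k f x = T f x"
      by eventually_elim simp
  qed
qed

section \<open>Dyadic cubes and the weighted John-Nirenberg inequality\<close>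

text \<open>Half-open cubes, so that the \<open>2\<^sup>n\<close> children of a cube partition it.\<close>

definition cube :: "real^'n::finite \<Rightarrow> real \<Rightarrow> (real^'n) set" where
  "cube c s = {x. \<forall>i. c $ i \<le> x $ i \<and> x $ i < c $ i + s}"

definition corners :: "(real^'n::finite) set" where
  "corners = {v. \<forall>i. v $ i \<in> {0, 1}}"

lemma finite_corners [simp]: "finite (corners :: (real^'n::finite) set)"
proof (rule finite_subset)
  show "corners \<subseteq> range (\<lambda>S. \<chi> i::'n. if i \<in> S then 1 else (0::real))"
  proof
    fix v :: "real^'n" assume "v \<in> corners"
    then have "v = (\<chi> i. if i \<in> {i. v $ i = 1} then 1 else 0)"
      by (auto simp: corners_def vec_eq_iff)
    then show "v \<in> range (\<lambda>S. \<chi> i::'n. if i \<in> S then 1 else (0::real))" by blast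
  qed
qed simp

abbreviation child :: "real^'n::finite \<Rightarrow> real \<Rightarrow> real^'n \<Rightarrow> (real^'n) set" where
  "child c s v \<equiv> cube (c + (s / 2) *\<^sub>R v) (s / 2)"

lemma cube_eq_children:
  assumes "s > 0" shows "cube c s = (\<Union>v\<in>corners. child c s v)"
proof (intro equalityI subsetI)
  fix x assume x: "x \<in> cube c s"
  define v :: "real^'a" where "v = (\<chi> i. if x $ i < c $ i + s / 2 then 0 else 1)"
  have "v \<in> corners" by (simp add: corners_def v_def)
  moreover have "x \<in> child c s v"
    using x by (auto simp: cube_def v_def) (metis add.commute)
  ultimately show "x \<in> (\<Union>v\<in>corners. child c s v)" by blast
next
  fix x assume "x \<in> (\<Union>v\<in>corners. child c s v)"
  then obtain v where v: "v \<in> corners" "x \<in> child c s v" by blast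
  show "x \<in> cube c s" unfolding cube_def
  proof safe
    fix i
    have "v $ i = 0 \<or> v $ i = 1" using v(1) by (auto simp: corners_def)
    moreover have "c $ i + s / 2 * v $ i \<le> x $ i" "x $ i < c $ i + s / 2 * v $ i + s / 2"
      using v(2) by (auto simp: cube_def)
    ultimately show "c $ i \<le> x $ i" "x $ i < c $ i + s" using assms by auto
  qed
qed

lemma disjoint_children:
  assumes "s > 0" shows "disjoint_family_on (child c s) corners"
  unfolding disjoint_family_on_def
proof (intro ballI impI)
  fix v w :: "real^'a" assume vw: "v \<in> corners" "w \<in> corners" "v \<noteq> w"
  then obtain i where i: "v $ i \<noteq> w $ i" by (auto simp: vec_eq_iff)
  have "v $ i = 0 \<or> v $ i = 1" "w $ i = 0 \<or> w $ i = 1" using vw by (auto simp: corners_def)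
  then show "child c s v \<inter> child c s w = {}"
    using i assms by (fastforce simp: cube_def dest: spec[of _ i])
qed

lemma child_subset: "s > 0 \<Longrightarrow> v \<in> corners \<Longrightarrow> child c s v \<subseteq> cube c s"
  using cube_eq_children[of s c] by blast

lemma sets_cube [measurable, simp]: "cube c s \<in> sets borel"
proof -
  have "cube c s = (\<Inter>i. {x. c $ i \<le> x $ i} \<inter> {x. x $ i < c $ i + s})" by (auto simp: cube_def)
  also have "\<dots> \<in> sets borel"
    by (intro sets.countable_INT'' sets.Int) (auto intro!: borel_closed borel_open closed_Collect_le open_Collect_less continuous_intros)
  finally show ?thesis .
qed

lemma sets_lebesgue_cube [measurable, simp]: "cube c s \<in> sets lebesgue"
  by (intro sets_completionI_sets) simp

lemma cube_bounds: "box c (\<chi> i. c $ i + s) \<subseteq> cube c s" "cube c s \<subseteq> cbox c (\<chi> i. c $ i + s)"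
  by (force simp: cube_def mem_box_cart less_imp_le)+

lemma emeasure_cube:
  fixes c :: "real^'n::finite" assumes "s > 0" shows "emeasure lebesgue (cube c s) = ennreal (s ^ CARD('n))"
proof -
  define d :: "real^'n" where "d = (\<chi> i. c $ i + s)"
  have ne: "\<forall>i\<in>Basis. c \<bullet> i \<le> d \<bullet> i"
    using assms by (auto simp: d_def Basis_vec_def inner_axis)
  have prod: "(\<Prod>i\<in>Basis. (d - c) \<bullet> i) = s ^ CARD('n)"
  proof -
    have "(\<Prod>i\<in>Basis. (d - c) \<bullet> i) = (\<Prod>i\<in>(Basis :: (real^'n) set). s)"
      by (intro prod.cong) (auto simp: d_def Basis_vec_def inner_axis)
    then show ?thesis by simp
  qed
  have "emeasure lebesgue (cube c s) \<le> emeasure lebesgue (cbox c d)"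
    unfolding d_def by (intro emeasure_mono cube_bounds) auto
  moreover have "emeasure lebesgue (box c d) \<le> emeasure lebesgue (cube c s)"
    unfolding d_def by (intro emeasure_mono cube_bounds) auto
  moreover have "emeasure lebesgue (cbox c d) = ennreal (s ^ CARD('n))"
    using emeasure_lborel_cbox[of c d] ne prod by simp
  moreover have "emeasure lebesgue (box c d) = ennreal (s ^ CARD('n))"
    using emeasure_lborel_box[of c d] ne prod by simp
  ultimately show ?thesis by simp
qed

lemma measure_cube:
  fixes c :: "real^'n::finite" assumes "s > 0" shows "measure lebesgue (cube c s) = s ^ CARD('n)"
  using emeasure_cube[OF assms, of c] assms by (simp add: measure_def)

lemma norm_diff_cube:
  fixes x y :: "real^'n::finite"
  assumes "x \<in> cube c s" "y \<in> cube c s" shows "norm (x - y) \<le> real CARD('n) * s"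
proof -
  have "norm (x - y) \<le> (\<Sum>i\<in>UNIV. \<bar>(x - y) $ i\<bar>)" by (rule norm_le_l1_cart)
  also have "\<dots> \<le> (\<Sum>i\<in>(UNIV :: 'n set). s)"
  proof (rule sum_mono)
    fix i
    have "c $ i \<le> x $ i" "x $ i < c $ i + s" "c $ i \<le> y $ i" "y $ i < c $ i + s"
      using assms by (auto simp: cube_def)
    then show "\<bar>(x - y) $ i\<bar> \<le> s" by auto
  qed
  finally show ?thesis by simp
qed

definition cube_mean :: "(real^'n::finite \<Rightarrow> complex) \<Rightarrow> real^'n \<Rightarrow> real \<Rightarrow> complex" where
  "cube_mean b c s = (LINT x:cube c s|lebesgue. b x) /\<^sub>R (s ^ CARD('n))"

fun dyadic_average :: "(real^'n::finite \<Rightarrow> complex) \<Rightarrow> nat \<Rightarrow> real^'n \<Rightarrow> real \<Rightarrow> real^'n \<Rightarrow> complex" where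
  "dyadic_average b 0 c s x = cube_mean b c s"
| "dyadic_average b (Suc N) c s x =
    (\<Sum>v\<in>corners. indicator (child c s v) x *\<^sub>R dyadic_average b N (c + (s / 2) *\<^sub>R v) (s / 2) x)"

text \<open>The union of the maximal dyadic subcubes, down to generation \<open>N\<close>, on which the mean of \<open>b\<close> differs
  from \<open>\<beta>\<close> by more than \<open>l\<close>.\<close>

fun stopping_region :: "(real^'n::finite \<Rightarrow> complex) \<Rightarrow> complex \<Rightarrow> real \<Rightarrow> nat \<Rightarrow> real^'n \<Rightarrow> real \<Rightarrow> (real^'n) set" where
  "stopping_region b \<beta> l 0 c s = (if norm (cube_mean b c s - \<beta>) > l then cube c s else {})"
| "stopping_region b \<beta> l (Suc N) c s = (if norm (cube_mean b c s - \<beta>) > l then cube c s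
     else (\<Union>v\<in>corners. stopping_region b \<beta> l N (c + (s / 2) *\<^sub>R v) (s / 2)))"

lemma dyadic_average_measurable [measurable]: "dyadic_average b N c s \<in> borel_measurable lebesgue"
proof (induction N arbitrary: c s)
  case 0
  have "dyadic_average b 0 c s = (\<lambda>x. cube_mean b c s)" by (simp add: fun_eq_iff)
  then show ?case by simp
next
  case (Suc N)
  note Suc[measurable]
  have "(\<lambda>x. \<Sum>v\<in>corners. indicator (child c s v) x *\<^sub>R dyadic_average b N (c + (s / 2) *\<^sub>R v) (s / 2) x)
    \<in> borel_measurable lebesgue"
    by measurable
  moreover have "dyadic_average b (Suc N) c s =
     (\<lambda>x. \<Sum>v\<in>corners. indicator (child c s v) x *\<^sub>R dyadic_average b N (c + (s / 2) *\<^sub>R v) (s / 2) x)"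
    by (simp add: fun_eq_iff)
  ultimately show ?case by simp
qed

lemma dyadic_average_child:
  assumes "s > 0" "v \<in> corners" "x \<in> child c s v"
  shows "dyadic_average b (Suc N) c s x = dyadic_average b N (c + (s / 2) *\<^sub>R v) (s / 2) x"
proof -
  have "indicator (child c s v') x = (if v' = v then 1 else 0 :: real)" if "v' \<in> corners" for v'
    using disjoint_children[OF assms(1), of c] assms that
    by (auto simp: disjoint_family_on_def indicator_def)
  then have "dyadic_average b (Suc N) c s x =
     (\<Sum>v'\<in>corners. (if v' = v then 1 else 0) *\<^sub>R dyadic_average b N (c + (s / 2) *\<^sub>R v') (s / 2) x)"
    by (simp del: scaleR_one scaleR_zero_left)
  also have "\<dots> = (\<Sum>v'\<in>corners. if v' = v then dyadic_average b N (c + (s / 2) *\<^sub>R v') (s / 2) x else 0)"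
    by (intro sum.cong) auto
  also have "\<dots> = dyadic_average b N (c + (s / 2) *\<^sub>R v) (s / 2) x" using assms by simp
  finally show ?thesis .
qed

lemma stopping_region_sets [measurable]: "stopping_region b \<beta> l N c s \<in> sets borel"
  by (induction N arbitrary: c s) auto

lemma stopping_region_sets_lebesgue [measurable]: "stopping_region b \<beta> l N c s \<in> sets lebesgue"
  by (intro sets_completionI_sets) simp

lemma stopping_region_subset: "s > 0 \<Longrightarrow> stopping_region b \<beta> l N c s \<subseteq> cube c s"
proof (induction N arbitrary: c s)
  case (Suc N)
  have "stopping_region b \<beta> l N (c + (s / 2) *\<^sub>R v) (s / 2) \<subseteq> cube c s" if "v \<in> corners" for v
    using Suc.IH[of "s/2"] child_subset[OF Suc.prems that, of c] Suc.prems by force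
  then show ?case by auto
qed auto

lemma disjoint_stopping:
  assumes "s > 0"
  shows "disjoint_family_on (\<lambda>v. stopping_region b \<beta> l N (c + (s / 2) *\<^sub>R v) (s / 2)) corners"
  using disjoint_children[OF assms, of c] stopping_region_subset[of "s/2" b \<beta> l N] assms
  unfolding disjoint_family_on_def by (meson Int_mono disjoint_iff half_gt_zero subset_empty subset_iff)

lemma nn_integral_UN_disjoint:
  assumes [measurable]: "f \<in> borel_measurable M" and "finite I" "disjoint_family_on B I"
    and "\<And>i. i \<in> I \<Longrightarrow> B i \<in> sets M"
  shows "(\<integral>\<^sup>+x\<in>(\<Union>i\<in>I. B i). f x \<partial>M) = (\<Sum>i\<in>I. \<integral>\<^sup>+x\<in>B i. f x \<partial>M)"
proof -
  have "(\<integral>\<^sup>+x\<in>(\<Union>i\<in>I. B i). f x \<partial>M) = (\<integral>\<^sup>+x. (\<Sum>i\<in>I. f x * indicator (B i) x) \<partial>M)"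
    by (subst indicator_UN_disjoint[OF assms(2,3)]) (simp add: sum_distrib_left)
  also have "\<dots> = (\<Sum>i\<in>I. \<integral>\<^sup>+x\<in>B i. f x \<partial>M)"
    using assms(4) by (intro nn_integral_sum borel_measurable_times_ennreal borel_measurable_indicator assms(1))
  finally show ?thesis .
qed

lemma nn_integral_cube_children:
  assumes "f \<in> borel_measurable M" "s > 0" "sets M = sets lebesgue"
  shows "(\<integral>\<^sup>+x\<in>cube c s. f x \<partial>M) = (\<Sum>v\<in>corners. \<integral>\<^sup>+x\<in>child c s v. f x \<partial>M)"
  unfolding cube_eq_children[OF assms(2), of c]
  by (rule nn_integral_UN_disjoint) (use assms disjoint_children in auto)

lemma cube_mean_diff_le:
  fixes c :: "real^'n::finite"
  assumes s: "0 < s" and sub: "cube c s \<subseteq> S" and b: "set_integrable lebesgue (cube c s) b"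
  shows "ennreal (norm (cube_mean b c s - \<beta>) * s ^ CARD('n)) \<le> (\<integral>\<^sup>+x\<in>S. ennreal (norm (b x - \<beta>)) \<partial>lebesgue)"
proof -
  have const: "set_integrable lebesgue (cube c s) (\<lambda>x. \<beta>)"
    using emeasure_cube[OF s, of c] by (simp add: set_integrable_def)
  have i: "set_integrable lebesgue (cube c s) (\<lambda>x. b x - \<beta>)" using b const by (rule set_integral_diff)
  have "(LINT x:cube c s|lebesgue. b x - \<beta>) = (LINT x:cube c s|lebesgue. b x) - s ^ CARD('n) *\<^sub>R \<beta>"
    by (subst set_integral_diff(2)[OF b const])
       (simp add: set_integral_const emeasure_cube[OF s] measure_cube[OF s] set_lebesgue_integral_def)
  also have "\<dots> = s ^ CARD('n) *\<^sub>R (cube_mean b c s - \<beta>)"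
    using s by (simp add: cube_mean_def scaleR_diff_right)
  finally have eq: "(LINT x:cube c s|lebesgue. b x - \<beta>) = s ^ CARD('n) *\<^sub>R (cube_mean b c s - \<beta>)" .
  have "ennreal (norm (cube_mean b c s - \<beta>) * s ^ CARD('n)) = ennreal (norm (LINT x:cube c s|lebesgue. b x - \<beta>))"
    unfolding eq using s by (simp add: mult.commute)
  also have "\<dots> \<le> (\<integral>\<^sup>+x. ennreal (norm (indicator (cube c s) x *\<^sub>R (b x - \<beta>))) \<partial>lebesgue)"
    unfolding set_lebesgue_integral_def by (rule integral_norm_bound_ennreal) (use i in \<open>simp add: set_integrable_def\<close>)
  also have "\<dots> \<le> (\<integral>\<^sup>+x\<in>S. ennreal (norm (b x - \<beta>)) \<partial>lebesgue)"
    using sub by (intro nn_integral_mono) (auto simp: indicator_def)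
  finally show ?thesis .
qed

text \<open>The selected cubes are disjoint and on each of them the mean of \<open>|b - \<beta>|\<close> exceeds \<open>l\<close>; this is the
  weak type estimate for the dyadic maximal function.\<close>

lemma stopping_region_weak_type:
  assumes int: "set_integrable lebesgue (cube c s) b" and s: "s > 0"
  shows "ennreal l * emeasure lebesgue (stopping_region b \<beta> l N c s) \<le>
    (\<integral>\<^sup>+x\<in>stopping_region b \<beta> l N c s. ennreal (norm (b x - \<beta>)) * indicator (cube c s) x \<partial>lebesgue)"
  using assms
proof (induction N arbitrary: c s)
  have sel: "ennreal l * emeasure lebesgue (cube c s) \<le>
      (\<integral>\<^sup>+x\<in>cube c s. ennreal (norm (b x - \<beta>)) * indicator (cube c s) x \<partial>lebesgue)"
    if b: "set_integrable lebesgue (cube c s) b" and s: "s > 0" and l: "norm (cube_mean b c s - \<beta>) > l" for c s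
  proof -
    have "ennreal l * emeasure lebesgue (cube c s) \<le> ennreal (norm (cube_mean b c s - \<beta>)) * ennreal (s ^ CARD('a))"
      unfolding emeasure_cube[OF s] using l by (intro mult_right_mono ennreal_leI) auto
    also have "\<dots> = ennreal (norm (cube_mean b c s - \<beta>) * s ^ CARD('a))"
      using s by (simp add: ennreal_mult)
    also have "\<dots> \<le> (\<integral>\<^sup>+x\<in>cube c s. ennreal (norm (b x - \<beta>)) \<partial>lebesgue)"
      by (rule cube_mean_diff_le[OF s order_refl b])
    also have "\<dots> = (\<integral>\<^sup>+x\<in>cube c s. ennreal (norm (b x - \<beta>)) * indicator (cube c s) x \<partial>lebesgue)"
      by (intro nn_integral_cong) (auto simp: indicator_def)
    finally show ?thesis .
  qed
  {
    case 0
    then show ?case using sel by auto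
  next
    case (Suc N)
    show ?case
    proof (cases "norm (cube_mean b c s - \<beta>) > l")
      case True then show ?thesis using sel Suc.prems by simp
    next
      case False
      let ?U = "\<lambda>v. stopping_region b \<beta> l N (c + (s / 2) *\<^sub>R v) (s / 2)"
      have [measurable]: "(\<lambda>x. ennreal (norm (b x - \<beta>)) * indicator (cube c s) x) \<in> borel_measurable lebesgue"
      proof -
        have [measurable]: "(\<lambda>x. indicator (cube c s) x *\<^sub>R b x) \<in> borel_measurable lebesgue"
          using Suc.prems(1) by (auto simp: set_integrable_def)
        have "(\<lambda>x. ennreal (norm (b x - \<beta>)) * indicator (cube c s) x) =
          (\<lambda>x. ennreal (norm (indicator (cube c s) x *\<^sub>R b x - \<beta>)) * indicator (cube c s) x)"
          by (auto simp: indicator_def)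
        then show ?thesis by simp
      qed
      have "ennreal l * emeasure lebesgue (\<Union>v\<in>corners. ?U v) = (\<Sum>v\<in>corners. ennreal l * emeasure lebesgue (?U v))"
        using disjoint_stopping[OF Suc.prems(2)]
        by (subst sum_emeasure[symmetric]) (auto simp: sum_distrib_left)
      also have "\<dots> \<le> (\<Sum>v\<in>corners. \<integral>\<^sup>+x\<in>?U v. ennreal (norm (b x - \<beta>)) * indicator (cube c s) x \<partial>lebesgue)"
      proof (rule sum_mono)
        fix v :: "real^'a" assume v: "v \<in> corners"
        have "set_integrable lebesgue (child c s v) b"
          by (rule set_integrable_subset[OF Suc.prems(1)]) (use child_subset[OF Suc.prems(2) v] in auto)
        then have "ennreal l * emeasure lebesgue (?U v) \<le> (\<integral>\<^sup>+x\<in>?U v. ennreal (norm (b x - \<beta>)) * indicator (child c s v) x \<partial>lebesgue)"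
          using Suc.IH Suc.prems by simp
        also have "\<dots> \<le> (\<integral>\<^sup>+x\<in>?U v. ennreal (norm (b x - \<beta>)) * indicator (cube c s) x \<partial>lebesgue)"
          by (intro nn_integral_mono mult_right_mono mult_left_mono)
             (use child_subset[OF Suc.prems(2) v, of c] in \<open>auto simp: indicator_def\<close>)
        finally show "ennreal l * emeasure lebesgue (?U v) \<le> \<dots>" .
      qed
      also have "\<dots> = (\<integral>\<^sup>+x\<in>(\<Union>v\<in>corners. ?U v). ennreal (norm (b x - \<beta>)) * indicator (cube c s) x \<partial>lebesgue)"
        by (rule nn_integral_UN_disjoint[symmetric]) (use disjoint_stopping[OF Suc.prems(2)] in auto)
      finally show ?thesis using False by simp
    qed
  }
qed

text \<open>Convexity of \<open>t\<^sup>P\<close>, applied to \<open>(X + u)/(K + u)\<close> as a convex combination of \<open>X/K\<close> and \<open>1\<close>. If the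
  mean of \<open>X\<^sup>P\<close> is at most \<open>K\<^sup>P\<close>, the right-hand side has mean at most \<open>(K + u)\<^sup>P\<close>; thus moments
  propagate with Minkowski's constant although only an integral of \<open>X\<^sup>P\<close> is at hand.\<close>

lemma powr_add_convex_bound:
  fixes X K u P :: real
  assumes "0 \<le> X" "0 < K" "0 < u" "1 \<le> P"
  shows "(X + u) powr P \<le> (K + u) powr P * (K / (K + u) * (X / K) powr P + u / (K + u))"
proof -
  have key: "(X + u) / (K + u) = K / (K + u) * (X / K) + u / (K + u) * 1"
    using assms by (simp add: add_divide_distrib)
  have "((X + u) / (K + u)) powr P \<le> K / (K + u) * (X / K) powr P + u / (K + u)"
  proof (cases "X = 0")
    case True
    have "(u / (K + u)) powr P \<le> (u / (K + u)) powr 1"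
      using assms by (intro powr_mono') auto
    then show ?thesis using True assms by simp
  next
    case False
    have "convex_on {0<..} (\<lambda>x::real. x powr P)" by (rule powr_convex[OF assms(4)])
    then have "((1 - u / (K + u)) *\<^sub>R (X / K) + (u / (K + u)) *\<^sub>R 1) powr P
        \<le> (1 - u / (K + u)) * (X / K) powr P + u / (K + u) * 1 powr P"
      by (rule convex_onD) (use False assms in auto)
    moreover have "1 - u / (K + u) = K / (K + u)" using assms by (simp add: field_simps)
    ultimately show ?thesis unfolding key by simp
  qed
  then have "(K + u) powr P * ((X + u) / (K + u)) powr P \<le>
     (K + u) powr P * (K / (K + u) * (X / K) powr P + u / (K + u))"
    by (intro mult_left_mono) auto
  then show ?thesis using assms by (simp add: powr_divide)
qed

text \<open>This inequality closes the induction for the \<open>P\<close>-th moment \<open>K\<^sup>P\<close>: off the stopping cubes the function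
  differs from its mean by at most \<open>l\<close>, the stopping cubes have relative mass at most \<open>1 - 1/\<Gamma>\<close>, and on them the moment
  deteriorates only from \<open>K\<close> to \<open>K + u\<close>. Since \<open>(1 + u/K)\<^sup>P\<close> is about \<open>1 + P u/K\<close>, a \<open>K\<close> that is
  large compared with \<open>P \<Gamma> u\<close> makes the loss smaller than the gain \<open>1/\<Gamma>\<close>.\<close>

lemma John_Nirenberg_numeric:
  fixes P \<Gamma> l u :: real
  assumes "1 \<le> P" "1 \<le> \<Gamma>" "0 \<le> l" "l \<le> u" "0 < u"
  defines "K \<equiv> (2 * P + 1) * \<Gamma> * u"
  shows "l powr P + (K + u) powr P * (1 - 1 / \<Gamma>) \<le> K powr P"
proof -
  define \<kappa> where "\<kappa> = (2 * P + 1) * \<Gamma>"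
  have \<kappa>: "\<kappa> \<ge> 2 * P + 1" unfolding \<kappa>_def using assms by (simp add: mult_le_cancel_left1)
  have \<kappa>0: "\<kappa> > 0" "\<kappa> \<ge> 1" "P / \<kappa> \<le> 1" using \<kappa> assms by (auto simp: field_simps)
  have "(1 + 1 / \<kappa>) powr P \<le> exp (1 / \<kappa>) powr P"
    using \<kappa>0 assms by (intro powr_mono2) auto
  also have "\<dots> = exp (P / \<kappa>)" by (simp add: powr_def)
  also have "\<dots> \<le> 1 + P / \<kappa> + (P / \<kappa>)\<^sup>2" using \<kappa>0 assms by (intro exp_bound) auto
  also have "(P / \<kappa>)\<^sup>2 \<le> (P / \<kappa>) ^ 1" using \<kappa>0 assms by (intro power_decreasing) auto
  finally have a: "(1 + 1 / \<kappa>) powr P \<le> 1 + 2 * (P / \<kappa>)" by simp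
  have b: "(1 / \<kappa>) powr P \<le> 1 / \<kappa>"
    using powr_mono'[of 1 P "1 / \<kappa>"] \<kappa>0 assms by simp
  have c: "0 \<le> 1 - 1 / \<Gamma>" "1 - 1 / \<Gamma> \<le> 1" using assms by (auto simp: field_simps)
  have "(1 / \<kappa>) powr P + (1 + 1 / \<kappa>) powr P * (1 - 1 / \<Gamma>) \<le> 1 / \<kappa> + (1 + 2 * (P / \<kappa>)) * (1 - 1 / \<Gamma>)"
    using a b c by (intro add_mono mult_right_mono)
  also have "\<dots> \<le> 1 / \<kappa> + (1 - 1 / \<Gamma>) + 2 * (P / \<kappa>)"
  proof -
    have "2 * (P / \<kappa>) * (1 - 1 / \<Gamma>) \<le> 2 * (P / \<kappa>) * 1"
      using c \<kappa>0 assms by (intro mult_left_mono) auto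
    then show ?thesis by (simp add: algebra_simps)
  qed
  also have "\<dots> = 1 + ((2 * P + 1) / \<kappa> - 1 / \<Gamma>)" by (simp add: add_divide_distrib)
  also have "(2 * P + 1) / \<kappa> = 1 / \<Gamma>" using assms by (simp add: \<kappa>_def)
  finally have d: "(1 / \<kappa>) powr P + (1 + 1 / \<kappa>) powr P * (1 - 1 / \<Gamma>) \<le> 1" by simp
  have K: "K = \<kappa> * u" by (simp add: K_def \<kappa>_def)
  have "l powr P \<le> u powr P" using assms by (intro powr_mono2) auto
  also have "u powr P = K powr P * (1 / \<kappa>) powr P"
    unfolding K using \<kappa>0 \<open>0 < u\<close> by (simp add: powr_divide powr_mult)
  finally have e: "l powr P \<le> K powr P * (1 / \<kappa>) powr P" .
  have "K + u = K * (1 + 1 / \<kappa>)" using \<kappa>0 by (simp add: K field_simps)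
  then have f: "(K + u) powr P = K powr P * (1 + 1 / \<kappa>) powr P"
    using \<kappa>0 \<open>0 < u\<close> by (simp only: powr_mult K)
  have "l powr P + (K + u) powr P * (1 - 1 / \<Gamma>) \<le> K powr P * (1 / \<kappa>) powr P + K powr P * (1 + 1 / \<kappa>) powr P * (1 - 1 / \<Gamma>)"
    using e f by simp
  also have "\<dots> = K powr P * ((1 / \<kappa>) powr P + (1 + 1 / \<kappa>) powr P * (1 - 1 / \<Gamma>))"
    by (simp add: algebra_simps)
  also have "\<dots> \<le> K powr P * 1" using d by (intro mult_left_mono) auto
  finally show ?thesis by simp
qed

text \<open>Estimates on the children add up to one on the parent, since the children are disjoint and the
  stopping regions are contained in their cubes.\<close>

lemma moment_children_bound:
  fixes \<mu> :: "(real^'n::finite) measure" and b :: "real^'n \<Rightarrow> complex"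
  assumes U_def: "U = (\<lambda>v. stopping_region b \<beta> l N (c + (s / 2) *\<^sub>R v) (s / 2))"
    and sets: "sets \<mu> = sets lebesgue" and s: "0 < s"
    and bd: "\<And>v. v \<in> corners \<Longrightarrow>
      (\<integral>\<^sup>+x\<in>child c s v. ennreal (norm (dyadic_average b N (c + (s / 2) *\<^sub>R v) (s / 2) x - \<beta>) powr P) \<partial>\<mu>)
        \<le> L * emeasure \<mu> (child c s v - U v) + R * emeasure \<mu> (U v)"
  shows "(\<integral>\<^sup>+x\<in>cube c s. ennreal (norm (dyadic_average b (Suc N) c s x - \<beta>) powr P) \<partial>\<mu>) \<le>
    L * emeasure \<mu> (cube c s - (\<Union>v\<in>corners. U v)) + R * emeasure \<mu> (\<Union>v\<in>corners. U v)"
proof -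
  note sets[measurable_cong]
  let ?U = U
  have U: "(\<Sum>v\<in>corners. emeasure \<mu> (?U v)) = emeasure \<mu> (\<Union>v\<in>corners. ?U v)"
    using disjoint_stopping[OF s] by (intro sum_emeasure) (auto simp: sets U_def)
  have D: "(\<Sum>v\<in>corners. emeasure \<mu> (child c s v - ?U v)) = emeasure \<mu> (cube c s - (\<Union>v\<in>corners. ?U v))"
  proof -
    have "x \<notin> ?U w" if "x \<in> child c s v" "x \<notin> ?U v" "v \<in> corners" "w \<in> corners" for x v w
      using that disjoint_children[OF s, of c] stopping_region_subset[of "s/2" b \<beta> l N "c + (s / 2) *\<^sub>R w"] s
      unfolding disjoint_family_on_def U_def by (cases "v = w") (auto 0 4)
    note key = this
    have "(\<Union>v\<in>corners. child c s v - ?U v) = (\<Union>v\<in>corners. child c s v) - (\<Union>v\<in>corners. ?U v)"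
    proof (intro equalityI subsetI)
      fix x assume "x \<in> (\<Union>v\<in>corners. child c s v - ?U v)"
      then obtain v where v: "v \<in> corners" "x \<in> child c s v" "x \<notin> ?U v" by (elim UN_E DiffE)
      have 1: "x \<in> (\<Union>v\<in>corners. child c s v)" using v(1,2) by (rule UN_I)
      have 2: "x \<notin> (\<Union>v\<in>corners. ?U v)"
      proof
        assume "x \<in> (\<Union>v\<in>corners. ?U v)"
        then obtain w where "w \<in> corners" "x \<in> ?U w" by (elim UN_E)
        then show False using key[OF v(2,3,1)] by simp
      qed
      show "x \<in> (\<Union>v\<in>corners. child c s v) - (\<Union>v\<in>corners. ?U v)" by (rule DiffI[OF 1 2])
    next
      fix x assume x: "x \<in> (\<Union>v\<in>corners. child c s v) - (\<Union>v\<in>corners. ?U v)"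
      then obtain v where v: "v \<in> corners" "x \<in> child c s v" by (elim DiffE UN_E)
      have "x \<notin> ?U v"
      proof
        assume "x \<in> ?U v"
        with v(1) have "x \<in> (\<Union>v\<in>corners. ?U v)" by (rule UN_I)
        with x show False by simp
      qed
      with v(2) have "x \<in> child c s v - ?U v" by (rule DiffI)
      with v(1) show "x \<in> (\<Union>v\<in>corners. child c s v - ?U v)" by (rule UN_I)
    qed
    then have "(\<Union>v\<in>corners. child c s v - ?U v) = cube c s - (\<Union>v\<in>corners. ?U v)"
      by (simp only: cube_eq_children[OF s, of c])
    moreover have "(\<Sum>v\<in>corners. emeasure \<mu> (child c s v - ?U v)) = emeasure \<mu> (\<Union>v\<in>corners. child c s v - ?U v)"
    proof (intro sum_emeasure)
      show "disjoint_family_on (\<lambda>v. child c s v - ?U v) corners"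
        using disjoint_children[OF s, of c] unfolding disjoint_family_on_def by blast
    qed (auto simp: sets U_def)
    ultimately show ?thesis by simp
  qed
  have "(\<integral>\<^sup>+x\<in>cube c s. ennreal (norm (dyadic_average b (Suc N) c s x - \<beta>) powr P) \<partial>\<mu>) =
    (\<Sum>v\<in>corners. \<integral>\<^sup>+x\<in>child c s v. ennreal (norm (dyadic_average b (Suc N) c s x - \<beta>) powr P) \<partial>\<mu>)"
    by (rule nn_integral_cube_children)
       (use s sets in \<open>auto simp: measurable_cong_sets[OF sets refl] simp del: dyadic_average.simps\<close>)
  also have "\<dots> = (\<Sum>v\<in>corners. \<integral>\<^sup>+x\<in>child c s v. ennreal (norm (dyadic_average b N (c + (s / 2) *\<^sub>R v) (s / 2) x - \<beta>) powr P) \<partial>\<mu>)"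
  proof (intro sum.cong refl nn_integral_cong)
    fix v x :: "real^'n" assume "v \<in> corners"
    then show "ennreal (norm (dyadic_average b (Suc N) c s x - \<beta>) powr P) * indicator (child c s v) x =
      ennreal (norm (dyadic_average b N (c + (s / 2) *\<^sub>R v) (s / 2) x - \<beta>) powr P) * indicator (child c s v) x"
      using s by (cases "x \<in> child c s v") (simp_all add: dyadic_average_child del: dyadic_average.simps)
  qed
  also have "\<dots> \<le> (\<Sum>v\<in>corners. L * emeasure \<mu> (child c s v - ?U v) + R * emeasure \<mu> (?U v))"
    by (intro sum_mono bd)
  also have "\<dots> = L * (\<Sum>v\<in>corners. emeasure \<mu> (child c s v - ?U v)) + R * (\<Sum>v\<in>corners. emeasure \<mu> (?U v))"
    by (simp add: sum.distrib sum_distrib_left)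
  also have "\<dots> = L * emeasure \<mu> (cube c s - (\<Union>v\<in>corners. ?U v)) + R * emeasure \<mu> (\<Union>v\<in>corners. ?U v)"
    by (simp only: U D)
  finally show ?thesis .
qed

text \<open>Bounded mean oscillation on all cubes of side at most \<open>s0\<close>, with one constant. The growth factor of
  \<open>BMO\<^sub>\<theta>\<close> is frozen at the scale \<open>s0\<close>, so that the classical argument applies below that scale.\<close>

locale bounded_oscillation =
  fixes b :: "real^'n::finite \<Rightarrow> complex" and A s0 :: real
  assumes A_pos: "A > 0"
    and integrable_cube: "\<And>c s. 0 < s \<Longrightarrow> s \<le> s0 \<Longrightarrow> set_integrable lebesgue (cube c s) b"
    and oscillation: "\<And>c s. 0 < s \<Longrightarrow> s \<le> s0 \<Longrightarrow>
      (\<integral>\<^sup>+x\<in>cube c s. ennreal (norm (b x - cube_mean b c s)) \<partial>lebesgue) \<le> ennreal (A * s ^ CARD('n))"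
begin

text \<open>A child has \<open>2\<^bsup>-n\<^esup>\<close> of the volume of its parent.\<close>

lemma child_mean_diff_le:
  assumes s: "0 < s" "s \<le> s0" and v: "v \<in> corners"
  shows "norm (cube_mean b (c + (s / 2) *\<^sub>R v) (s / 2) - cube_mean b c s) \<le> 2 ^ CARD('n) * A"
proof -
  have "ennreal (norm (cube_mean b (c + (s / 2) *\<^sub>R v) (s / 2) - cube_mean b c s) * (s / 2) ^ CARD('n))
    \<le> (\<integral>\<^sup>+x\<in>cube c s. ennreal (norm (b x - cube_mean b c s)) \<partial>lebesgue)"
    using s v by (intro cube_mean_diff_le child_subset integrable_cube) auto
  also have "\<dots> \<le> ennreal (A * s ^ CARD('n))" by (rule oscillation[OF s])
  finally have "norm (cube_mean b (c + (s / 2) *\<^sub>R v) (s / 2) - cube_mean b c s) * (s / 2) ^ CARD('n) \<le> A * s ^ CARD('n)"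
    using A_pos s by (simp add: ennreal_le_iff)
  then show ?thesis using s by (simp add: power_divide field_simps)
qed

text \<open>Stopping-time step. On a selected cube the mean differs from \<open>\<beta>\<close> by at most \<open>l + 2\<^sup>n A\<close>, because its
  parent was not selected, and the moment about its own mean is known by hypothesis; off the selected
  cubes the dyadic average is within \<open>l\<close> of \<open>\<beta>\<close>. The hypothesis on \<open>cube_mean b c s - \<beta>\<close> is the part of
  this dichotomy that the induction passes down to children.\<close>

lemma dyadic_moment_bound_off_stopping:
  fixes \<mu> :: "(real^'n) measure"
  assumes sets: "sets \<mu> = sets lebesgue" and P: "1 \<le> P" and K: "0 < K" and l: "0 \<le> l"
    and IH: "\<And>M c s. M \<le> N \<Longrightarrow> 0 < s \<Longrightarrow> s \<le> s0 \<Longrightarrow>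
      (\<integral>\<^sup>+x\<in>cube c s. ennreal (norm (dyadic_average b M c s x - cube_mean b c s) powr P) \<partial>\<mu>)
         \<le> ennreal (K powr P) * emeasure \<mu> (cube c s)"
    and s: "0 < s" "s \<le> s0" and \<beta>: "norm (cube_mean b c s - \<beta>) \<le> l + 2 ^ CARD('n) * A"
  shows "(\<integral>\<^sup>+x\<in>cube c s. ennreal (norm (dyadic_average b N c s x - \<beta>) powr P) \<partial>\<mu>) \<le>
    ennreal (l powr P) * emeasure \<mu> (cube c s - stopping_region b \<beta> l N c s) +
    ennreal ((K + (l + 2 ^ CARD('n) * A)) powr P) * emeasure \<mu> (stopping_region b \<beta> l N c s)"
  using IH s \<beta>
proof (induction N arbitrary: c s)
  note sets[measurable_cong]
  define u where "u = l + 2 ^ CARD('n) * A"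
  have u: "u > 0" unfolding u_def using l A_pos by (intro add_nonneg_pos) auto
  have sel: "(\<integral>\<^sup>+x\<in>cube c s. ennreal (norm (dyadic_average b N c s x - \<beta>) powr P) \<partial>\<mu>) \<le>
     ennreal ((K + u) powr P) * emeasure \<mu> (cube c s)"
    if IH: "(\<integral>\<^sup>+x\<in>cube c s. ennreal (norm (dyadic_average b N c s x - cube_mean b c s) powr P) \<partial>\<mu>)
         \<le> ennreal (K powr P) * emeasure \<mu> (cube c s)"
      and \<beta>: "norm (cube_mean b c s - \<beta>) \<le> u" for N c s
  proof -
    define a0 b0 where a0_def: "a0 = (K + u) powr P * (K / (K + u)) / K powr P"
      and b0_def: "b0 = (K + u) powr P * (u / (K + u))"
    have ab: "0 \<le> a0" "0 \<le> b0" using K u by (auto simp: a0_def b0_def)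
    have pt: "norm (dyadic_average b N c s x - \<beta>) powr P \<le>
      a0 * norm (dyadic_average b N c s x - cube_mean b c s) powr P + b0" for x
    proof -
      have "norm (dyadic_average b N c s x - \<beta>) \<le>
          norm (dyadic_average b N c s x - cube_mean b c s) + norm (cube_mean b c s - \<beta>)"
        by (metis diff_add_cancel diff_add_eq norm_triangle_ineq add_diff_eq)
      also have "\<dots> \<le> norm (dyadic_average b N c s x - cube_mean b c s) + u" using \<beta> by simp
      finally have "norm (dyadic_average b N c s x - \<beta>) powr P \<le> (norm (dyadic_average b N c s x - cube_mean b c s) + u) powr P"
        using P by (intro powr_mono2) auto
      also have "\<dots> \<le> (K + u) powr P * (K / (K + u) * (norm (dyadic_average b N c s x - cube_mean b c s) / K) powr P + u / (K + u))"
        by (rule powr_add_convex_bound) (use K u P in auto)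
      also have "\<dots> = a0 * norm (dyadic_average b N c s x - cube_mean b c s) powr P + b0"
        using K by (simp add: a0_def b0_def powr_divide algebra_simps)
      finally show ?thesis .
    qed
    have "(\<integral>\<^sup>+x\<in>cube c s. ennreal (norm (dyadic_average b N c s x - \<beta>) powr P) \<partial>\<mu>) \<le>
      (\<integral>\<^sup>+x. ennreal a0 * (ennreal (norm (dyadic_average b N c s x - cube_mean b c s) powr P) * indicator (cube c s) x)
          + ennreal b0 * indicator (cube c s) x \<partial>\<mu>)"
    proof (rule nn_integral_mono)
      fix x
      have "ennreal (norm (dyadic_average b N c s x - \<beta>) powr P) \<le>
        ennreal (a0 * norm (dyadic_average b N c s x - cube_mean b c s) powr P + b0)"
        by (rule ennreal_leI[OF pt])
      also have "\<dots> = ennreal a0 * ennreal (norm (dyadic_average b N c s x - cube_mean b c s) powr P) + ennreal b0"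
        using ab by (simp add: ennreal_plus ennreal_mult)
      finally show "ennreal (norm (dyadic_average b N c s x - \<beta>) powr P) * indicator (cube c s) x \<le>
        ennreal a0 * (ennreal (norm (dyadic_average b N c s x - cube_mean b c s) powr P) * indicator (cube c s) x)
          + ennreal b0 * indicator (cube c s) x"
        by (auto simp: indicator_def)
    qed
    also have "\<dots> = ennreal a0 * (\<integral>\<^sup>+x\<in>cube c s. ennreal (norm (dyadic_average b N c s x - cube_mean b c s) powr P) \<partial>\<mu>)
        + ennreal b0 * emeasure \<mu> (cube c s)"
      by (simp add: nn_integral_add nn_integral_cmult sets)
    also have "\<dots> \<le> ennreal a0 * (ennreal (K powr P) * emeasure \<mu> (cube c s)) + ennreal b0 * emeasure \<mu> (cube c s)"
      by (intro add_mono mult_left_mono IH) auto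
    also have "\<dots> = ennreal (a0 * K powr P + b0) * emeasure \<mu> (cube c s)"
      using ab by (simp add: ennreal_mult ennreal_plus distrib_right mult.assoc)
    also have "a0 * K powr P + b0 = (K + u) powr P * (K / (K + u)) + b0"
      using K by (simp add: a0_def)
    also have "\<dots> = (K + u) powr P * (K / (K + u) + u / (K + u))"
      by (simp only: b0_def distrib_left)
    also have "K / (K + u) + u / (K + u) = 1"
      using K u by (simp flip: add_divide_distrib)
    also have "(K + u) powr P * 1 = (K + u) powr P" by simp
    finally show ?thesis .
  qed
  {
    case 0
    show ?case
    proof (cases "norm (cube_mean b c s - \<beta>) > l")
      case True
      then show ?thesis using sel[where N = 0 and c = c and s = s] "0.prems" by (simp add: u_def)
    next
      case False
      have "(\<integral>\<^sup>+x\<in>cube c s. ennreal (norm (cube_mean b c s - \<beta>) powr P) \<partial>\<mu>) \<le>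
         (\<integral>\<^sup>+x\<in>cube c s. ennreal (l powr P) \<partial>\<mu>)"
        using False P by (intro nn_integral_mono mult_right_mono ennreal_leI powr_mono2) auto
      also have "\<dots> = ennreal (l powr P) * emeasure \<mu> (cube c s)"
        by (simp add: nn_integral_cmult_indicator sets)
      finally show ?thesis using False by simp
    qed
  next
    case (Suc N)
    show ?case
    proof (cases "norm (cube_mean b c s - \<beta>) > l")
      case True
      then show ?thesis using sel[where N = "Suc N" and c = c and s = s] Suc.prems by (simp add: u_def del: dyadic_average.simps)
    next
      case False
      let ?U = "\<lambda>v. stopping_region b \<beta> l N (c + (s / 2) *\<^sub>R v) (s / 2)"
      have U: "stopping_region b \<beta> l (Suc N) c s = (\<Union>v\<in>corners. ?U v)" using False by simp
      show ?thesis unfolding U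
      proof (rule moment_children_bound[OF refl sets Suc.prems(2)])
        fix v :: "real^'n" assume v: "v \<in> corners"
        have "norm (cube_mean b (c + (s / 2) *\<^sub>R v) (s / 2) - \<beta>) \<le>
           norm (cube_mean b (c + (s / 2) *\<^sub>R v) (s / 2) - cube_mean b c s) + norm (cube_mean b c s - \<beta>)"
          by (metis diff_add_cancel diff_add_eq norm_triangle_ineq add_diff_eq)
        then have "norm (cube_mean b (c + (s / 2) *\<^sub>R v) (s / 2) - \<beta>) \<le> l + 2 ^ CARD('n) * A"
          using child_mean_diff_le[OF Suc.prems(2,3) v, of c] False by linarith
        then show "(\<integral>\<^sup>+x\<in>child c s v. ennreal (norm (dyadic_average b N (c + (s / 2) *\<^sub>R v) (s / 2) x - \<beta>) powr P) \<partial>\<mu>)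
          \<le> ennreal (l powr P) * emeasure \<mu> (child c s v - ?U v) +
            ennreal ((K + (l + 2 ^ CARD('n) * A)) powr P) * emeasure \<mu> (?U v)"
          using Suc.prems by (intro Suc.IH) auto
      qed
    qed
  }
qed

text \<open>The weak type estimate at height \<open>2 A\<close>, twice the mean oscillation.\<close>

lemma emeasure_stopping_region_le:
  assumes s: "0 < s" "s \<le> s0" and N: "\<beta> = cube_mean b c s"
  shows "measure lebesgue (stopping_region b \<beta> (2 * A) N c s) \<le> s ^ CARD('n) / 2"
proof -
  let ?U = "stopping_region b \<beta> (2 * A) N c s"
  have U: "?U \<subseteq> cube c s" by (rule stopping_region_subset[OF s(1)])
  have fin: "emeasure lebesgue ?U \<noteq> top"
    using emeasure_mono[OF U, of lebesgue] emeasure_cube[OF s(1), of c] by (auto simp: top_unique)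
  have "ennreal (2 * A) * emeasure lebesgue ?U \<le>
    (\<integral>\<^sup>+x\<in>?U. ennreal (norm (b x - \<beta>)) * indicator (cube c s) x \<partial>lebesgue)"
    by (intro stopping_region_weak_type integrable_cube s)
  also have "\<dots> \<le> (\<integral>\<^sup>+x\<in>cube c s. ennreal (norm (b x - \<beta>)) \<partial>lebesgue)"
    by (intro nn_integral_mono) (auto simp: indicator_def)
  also have "\<dots> \<le> ennreal (A * s ^ CARD('n))" unfolding N by (rule oscillation[OF s])
  finally have "ennreal (2 * A * measure lebesgue ?U) \<le> ennreal (A * s ^ CARD('n))"
    using A_pos fin by (simp add: emeasure_eq_ennreal_measure ennreal_mult)
  then show ?thesis using A_pos s by (simp add: ennreal_le_iff)
qed

text \<open>Induction on the number of generations, with a constant that does not depend on it. The stopping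
  region at height \<open>2 A\<close> has at most half of the Lebesgue measure of the cube; by the hypothesis on \<open>\<mu>\<close> the complement has at
  least the fraction \<open>1/\<Gamma>\<close> of the mass, and \<open>1 - 1/\<Gamma>\<close> remains for the stopping region.\<close>

lemma dyadic_moment_bound:
  fixes \<mu> :: "(real^'n) measure"
  assumes sets: "sets \<mu> = sets lebesgue" and P: "1 \<le> P" and \<Gamma>: "1 \<le> \<Gamma>"
    and finite: "\<And>c s. 0 < s \<Longrightarrow> s \<le> s0 \<Longrightarrow> emeasure \<mu> (cube c s) < top"
    and A_inf: "\<And>c s E. 0 < s \<Longrightarrow> s \<le> s0 \<Longrightarrow> E \<in> sets lebesgue \<Longrightarrow> E \<subseteq> cube c s \<Longrightarrow>
      s ^ CARD('n) / 2 \<le> measure lebesgue E \<Longrightarrow> measure \<mu> (cube c s) \<le> \<Gamma> * measure \<mu> E"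
    and K_def: "K = (2 * P + 1) * \<Gamma> * (2 * A + 2 ^ CARD('n) * A)"
    and s: "0 < s" "s \<le> s0"
  shows "(\<integral>\<^sup>+x\<in>cube c s. ennreal (norm (dyadic_average b N c s x - cube_mean b c s) powr P) \<partial>\<mu>)
         \<le> ennreal (K powr P) * emeasure \<mu> (cube c s)"
  using s
proof (induction N arbitrary: c s rule: less_induct)
  case (less N)
  note s = less.prems
  define u where "u = 2 * A + 2 ^ CARD('n) * A"
  have u: "0 < u" "2 * A \<le> u" using A_pos by (auto simp: u_def intro: add_pos_pos)
  have K: "K = (2 * P + 1) * \<Gamma> * u" "K > 0"
    using P \<Gamma> u by (auto simp: K_def u_def[symmetric])
  show ?case
  proof (cases N)
    case 0
    then show ?thesis by simp
  next
    case (Suc M)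
    define \<beta> where "\<beta> = cube_mean b c s"
    let ?U = "stopping_region b \<beta> (2 * A) N c s"
    have U: "?U \<in> sets \<mu>" "cube c s \<in> sets \<mu>" "?U \<subseteq> cube c s"
      using stopping_region_subset[OF s(1), of b \<beta> "2 * A" N c] by (auto simp: sets)
    \<comment> \<open>The top cube is never selected, since \<open>\<beta>\<close> is its mean.\<close>
    have Un: "?U = (\<Union>v\<in>corners. stopping_region b \<beta> (2 * A) M (c + (s / 2) *\<^sub>R v) (s / 2))"
      using A_pos by (simp add: Suc \<beta>_def)
    have bound: "(\<integral>\<^sup>+x\<in>cube c s. ennreal (norm (dyadic_average b N c s x - \<beta>) powr P) \<partial>\<mu>) \<le>
      ennreal ((2 * A) powr P) * emeasure \<mu> (cube c s - ?U) + ennreal ((K + u) powr P) * emeasure \<mu> ?U"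
      unfolding Un unfolding Suc
    proof (rule moment_children_bound[OF refl sets s(1)])
      let ?V = "\<lambda>v. stopping_region b \<beta> (2 * A) M (c + (s / 2) *\<^sub>R v) (s / 2)"
      fix v :: "real^'n" assume v: "v \<in> corners"
      have "norm (cube_mean b (c + (s / 2) *\<^sub>R v) (s / 2) - \<beta>) \<le> 2 * A + 2 ^ CARD('n) * A"
        using child_mean_diff_le[OF s v, of c] A_pos unfolding \<beta>_def by linarith
      then show "(\<integral>\<^sup>+x\<in>child c s v. ennreal (norm (dyadic_average b M (c + (s / 2) *\<^sub>R v) (s / 2) x - \<beta>) powr P) \<partial>\<mu>)
        \<le> ennreal ((2 * A) powr P) * emeasure \<mu> (child c s v - ?V v) + ennreal ((K + u) powr P) * emeasure \<mu> (?V v)"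
        unfolding u_def using s A_pos K
        by (intro dyadic_moment_bound_off_stopping sets P less.IH) (auto simp: Suc)
    qed
    have fin: "emeasure \<mu> (cube c s) = ennreal (measure \<mu> (cube c s))"
      using finite[OF s, of c] by (intro emeasure_eq_ennreal_measure) auto
    have fmeas: "cube c s \<in> fmeasurable \<mu>"
      using finite[OF s, of c] U by (intro fmeasurableI) auto
    have fmU: "?U \<in> fmeasurable \<mu>" by (rule fmeasurableI2[OF fmeas U(3,1)])
    have finU: "emeasure \<mu> ?U = ennreal (measure \<mu> ?U)"
      by (rule emeasure_eq_measure2[OF fmU])
    have finD: "emeasure \<mu> (cube c s - ?U) = ennreal (measure \<mu> (cube c s - ?U))"
      by (rule emeasure_eq_measure2) (rule fmeasurable.Diff[OF fmeas fmU])
    have diff: "measure \<mu> (cube c s - ?U) = measure \<mu> (cube c s) - measure \<mu> ?U"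
      by (rule measurable_measure_Diff[OF fmeas U(1,3)])
    have "measure lebesgue (cube c s - ?U) = s ^ CARD('n) - measure lebesgue ?U"
      using emeasure_cube[OF s(1), of c] U(3)
      by (subst measurable_measure_Diff) (auto intro!: fmeasurableI simp: measure_cube[OF s(1)])
    then have "s ^ CARD('n) / 2 \<le> measure lebesgue (cube c s - ?U)"
      using emeasure_stopping_region_le[OF s \<beta>_def, of N] by simp
    then have "measure \<mu> (cube c s) \<le> \<Gamma> * (measure \<mu> (cube c s) - measure \<mu> ?U)"
      unfolding diff[symmetric] by (intro A_inf s) (auto simp: sets)
    then have mU: "measure \<mu> ?U \<le> (1 - 1 / \<Gamma>) * measure \<mu> (cube c s)"
      using \<Gamma> by (simp add: field_simps)
    have "(2 * A) powr P * measure \<mu> (cube c s - ?U) + (K + u) powr P * measure \<mu> ?U \<le>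
        (2 * A) powr P * measure \<mu> (cube c s) + (K + u) powr P * ((1 - 1 / \<Gamma>) * measure \<mu> (cube c s))"
      using mU by (intro add_mono mult_left_mono) (auto simp: diff)
    also have "\<dots> = ((2 * A) powr P + (K + u) powr P * (1 - 1 / \<Gamma>)) * measure \<mu> (cube c s)"
      by (simp add: algebra_simps)
    also have "\<dots> \<le> K powr P * measure \<mu> (cube c s)"
      unfolding K(1) using P \<Gamma> A_pos u
      by (intro mult_right_mono John_Nirenberg_numeric) auto
    finally have fin_le: "(2 * A) powr P * measure \<mu> (cube c s - ?U) + (K + u) powr P * measure \<mu> ?U \<le> K powr P * measure \<mu> (cube c s)" .
    have "ennreal ((2 * A) powr P) * emeasure \<mu> (cube c s - ?U) + ennreal ((K + u) powr P) * emeasure \<mu> ?U \<le>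
        ennreal (K powr P) * emeasure \<mu> (cube c s)"
    proof -
      have e1: "ennreal ((2 * A) powr P) * ennreal (measure \<mu> (cube c s - ?U)) + ennreal ((K + u) powr P) * ennreal (measure \<mu> ?U) =
          ennreal ((2 * A) powr P * measure \<mu> (cube c s - ?U) + (K + u) powr P * measure \<mu> ?U)"
        by (rule ennreal_lincomb) auto
      have e2: "ennreal (K powr P) * ennreal (measure \<mu> (cube c s)) = ennreal (K powr P * measure \<mu> (cube c s))"
        by (simp add: ennreal_mult)
      show ?thesis unfolding fin finU finD e1 e2 by (rule ennreal_leI[OF fin_le])
    qed
    with bound show ?thesis unfolding \<beta>_def by (rule order_trans)
  qed
qed

text \<open>Dyadic averaging is a contraction in \<open>L\<^sup>1\<close> of a cube and moves a function by no more than its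
  oscillation on cubes of generation \<open>N\<close>; compare \<open>b\<close> with \<open>g\<close> before and after averaging.\<close>

lemma dyadic_average_L1_approx:
  assumes g: "continuous_on UNIV g" and \<eta>: "0 \<le> \<eta>" and s: "0 < s" "s \<le> s0"
    and osc: "\<And>x y. x \<in> cube c s \<Longrightarrow> y \<in> cube c s \<Longrightarrow> norm (x - y) \<le> real CARD('n) * s / 2 ^ N \<Longrightarrow> norm (g x - g y :: complex) \<le> \<eta>"
  shows "(\<integral>\<^sup>+x\<in>cube c s. ennreal (norm (dyadic_average b N c s x - b x)) \<partial>lebesgue) \<le>
     2 * (\<integral>\<^sup>+x\<in>cube c s. ennreal (norm (b x - g x)) \<partial>lebesgue) + ennreal (\<eta> * s ^ CARD('n))"
  using s osc
proof (induction N arbitrary: c s)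
  have [measurable]: "g \<in> borel_measurable borel" by (rule borel_measurable_continuous_onI[OF g])
  have [measurable]: "g \<in> borel_measurable lebesgue" by (rule measurable_completion) simp
  {
    case (0 c s)
    have [measurable]: "(\<lambda>x. ennreal (norm (b x - g x)) * indicator (cube c s) x) \<in> borel_measurable lebesgue"
    proof -
      have [measurable]: "(\<lambda>x. indicator (cube c s) x *\<^sub>R b x) \<in> borel_measurable lebesgue"
        using integrable_cube[OF 0(1,2)] by (auto simp: set_integrable_def)
      have "(\<lambda>x. ennreal (norm (b x - g x)) * indicator (cube c s) x) =
        (\<lambda>x. ennreal (norm (indicator (cube c s) x *\<^sub>R b x - g x)) * indicator (cube c s) x)"
        by (auto simp: indicator_def)
      then show ?thesis by simp
    qed
    let ?I = "\<integral>\<^sup>+x\<in>cube c s. ennreal (norm (b x - g x)) \<partial>lebesgue"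
    have sn: "ennreal (s ^ CARD('n)) > 0" using 0(1) by simp
    have mean: "ennreal (norm (cube_mean b c s - g x) * s ^ CARD('n)) \<le> ?I + ennreal (\<eta> * s ^ CARD('n))" if x: "x \<in> cube c s" for x
    proof -
      have "ennreal (norm (cube_mean b c s - g x) * s ^ CARD('n)) \<le> (\<integral>\<^sup>+y\<in>cube c s. ennreal (norm (b y - g x)) \<partial>lebesgue)"
        by (rule cube_mean_diff_le) (use 0 integrable_cube in auto)
      also have "\<dots> \<le> (\<integral>\<^sup>+y. ennreal (norm (b y - g y)) * indicator (cube c s) y + ennreal \<eta> * indicator (cube c s) y \<partial>lebesgue)"
      proof (rule nn_integral_mono)
        fix y
        have "norm (b y - g x) \<le> norm (b y - g y) + \<eta>" if "y \<in> cube c s"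
        proof -
          have "norm (g y - g x) \<le> \<eta>" using 0(3)[OF that x] norm_diff_cube[OF that x] by simp
          then show ?thesis using norm_triangle_ineq[of "b y - g y" "g y - g x"] by simp
        qed
        then show "ennreal (norm (b y - g x)) * indicator (cube c s) y \<le> ennreal (norm (b y - g y)) * indicator (cube c s) y + ennreal \<eta> * indicator (cube c s) y"
          using \<eta> by (auto simp: indicator_def simp flip: ennreal_plus intro!: ennreal_leI)
      qed
      also have "\<dots> = ?I + ennreal \<eta> * emeasure lebesgue (cube c s)"
        by (subst nn_integral_add) (auto simp: nn_integral_cmult_indicator)
      also have "\<dots> = ?I + ennreal (\<eta> * s ^ CARD('n))"
        unfolding emeasure_cube[OF 0(1)] using \<eta> 0(1) by (simp add: ennreal_mult)
      finally show ?thesis .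
    qed
    have "(\<integral>\<^sup>+x\<in>cube c s. ennreal (norm (cube_mean b c s - b x)) \<partial>lebesgue) \<le>
      (\<integral>\<^sup>+x. (?I + ennreal (\<eta> * s ^ CARD('n))) / ennreal (s ^ CARD('n)) * indicator (cube c s) x + ennreal (norm (b x - g x)) * indicator (cube c s) x \<partial>lebesgue)"
    proof (rule nn_integral_mono)
      fix x
      have "ennreal (norm (cube_mean b c s - b x)) \<le> (?I + ennreal (\<eta> * s ^ CARD('n))) / ennreal (s ^ CARD('n)) + ennreal (norm (b x - g x))" if x: "x \<in> cube c s"
      proof -
        have "ennreal (norm (cube_mean b c s - b x)) \<le> ennreal (norm (cube_mean b c s - g x)) + ennreal (norm (b x - g x))"
          using norm_triangle_ineq4[of "cube_mean b c s - g x" "b x - g x"] by (simp flip: ennreal_plus)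
        also have "ennreal (norm (cube_mean b c s - g x)) \<le> (?I + ennreal (\<eta> * s ^ CARD('n))) / ennreal (s ^ CARD('n))"
        proof -
          have "ennreal (norm (cube_mean b c s - g x)) = ennreal (norm (cube_mean b c s - g x) * s ^ CARD('n)) / ennreal (s ^ CARD('n))"
            using 0(1) by (simp add: divide_ennreal)
          also have "\<dots> \<le> (?I + ennreal (\<eta> * s ^ CARD('n))) / ennreal (s ^ CARD('n))"
            by (intro divide_right_mono_ennreal mean x)
          finally show ?thesis .
        qed
        finally show ?thesis by simp
      qed
      then show "ennreal (norm (cube_mean b c s - b x)) * indicator (cube c s) x \<le> (?I + ennreal (\<eta> * s ^ CARD('n))) / ennreal (s ^ CARD('n)) * indicator (cube c s) x + ennreal (norm (b x - g x)) * indicator (cube c s) x"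
        by (auto simp: indicator_def)
    qed
    also have "\<dots> = (?I + ennreal (\<eta> * s ^ CARD('n))) / ennreal (s ^ CARD('n)) * ennreal (s ^ CARD('n)) + ?I"
      unfolding emeasure_cube[OF 0(1), of c, symmetric]
      by (subst nn_integral_add) (auto simp: nn_integral_cmult_indicator)
    also have "\<dots> = (?I + ennreal (\<eta> * s ^ CARD('n))) + ?I"
    proof -
      have one: "ennreal (s ^ CARD('n)) / ennreal (s ^ CARD('n)) = 1" using 0(1) by (simp add: divide_ennreal)
      show ?thesis by (simp only: ennreal_divide_times one mult_1_right)
    qed
    finally show ?case by (simp add: ac_simps mult_2)
  next
    case (Suc N c s)
    have meas: "(\<lambda>x. ennreal (norm (b x - g x)) * indicator (cube c s) x) \<in> borel_measurable lebesgue"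
      "(\<lambda>x. ennreal (norm (dyadic_average b (Suc N) c s x - b x)) * indicator (cube c s) x) \<in> borel_measurable lebesgue"
    proof -
      have [measurable]: "(\<lambda>x. indicator (cube c s) x *\<^sub>R b x) \<in> borel_measurable lebesgue"
        using integrable_cube[OF Suc.prems(1,2)] by (auto simp: set_integrable_def)
      have "(\<lambda>x. ennreal (norm (b x - g x)) * indicator (cube c s) x) =
        (\<lambda>x. ennreal (norm (indicator (cube c s) x *\<^sub>R b x - g x)) * indicator (cube c s) x)"
        by (auto simp: indicator_def)
      then show "(\<lambda>x. ennreal (norm (b x - g x)) * indicator (cube c s) x) \<in> borel_measurable lebesgue" by simp
      have "(\<lambda>x. ennreal (norm (dyadic_average b (Suc N) c s x - b x)) * indicator (cube c s) x) =
        (\<lambda>x. ennreal (norm (dyadic_average b (Suc N) c s x - indicator (cube c s) x *\<^sub>R b x)) * indicator (cube c s) x)"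
        by (auto simp: indicator_def)
      then show "(\<lambda>x. ennreal (norm (dyadic_average b (Suc N) c s x - b x)) * indicator (cube c s) x) \<in> borel_measurable lebesgue"
        by (simp del: dyadic_average.simps)
    qed
    have ind: "indicator (child c s v) x = indicator (cube c s) x * (indicator (child c s v) x :: ennreal)" if "v \<in> corners" for v x
      using child_subset[OF Suc.prems(1) that, of c] by (auto simp: indicator_def)
    have split: "(\<integral>\<^sup>+x\<in>cube c s. f x \<partial>lebesgue) = (\<Sum>v\<in>corners. \<integral>\<^sup>+x\<in>child c s v. f x \<partial>lebesgue)"
      if m: "(\<lambda>x. f x * indicator (cube c s) x) \<in> borel_measurable lebesgue" for f :: "real^'n \<Rightarrow> ennreal"
    proof -
      have "(\<integral>\<^sup>+x\<in>cube c s. f x \<partial>lebesgue) = (\<integral>\<^sup>+x\<in>cube c s. f x * indicator (cube c s) x \<partial>lebesgue)"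
        by (intro nn_integral_cong) (auto simp: indicator_def)
      also have "\<dots> = (\<Sum>v\<in>corners. \<integral>\<^sup>+x\<in>child c s v. f x * indicator (cube c s) x \<partial>lebesgue)"
        by (rule nn_integral_cube_children[OF m Suc.prems(1) refl])
      also have "\<dots> = (\<Sum>v\<in>corners. \<integral>\<^sup>+x\<in>child c s v. f x \<partial>lebesgue)"
        by (intro sum.cong refl nn_integral_cong, subst (2) ind) (auto simp: mult.assoc)
      finally show ?thesis .
    qed
    have "(\<integral>\<^sup>+x\<in>cube c s. ennreal (norm (dyadic_average b (Suc N) c s x - b x)) \<partial>lebesgue) =
      (\<Sum>v\<in>corners. \<integral>\<^sup>+x\<in>child c s v. ennreal (norm (dyadic_average b (Suc N) c s x - b x)) \<partial>lebesgue)"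
      by (rule split[OF meas(2)])
    also have "\<dots> = (\<Sum>v\<in>corners. \<integral>\<^sup>+x\<in>child c s v. ennreal (norm (dyadic_average b N (c + (s / 2) *\<^sub>R v) (s / 2) x - b x)) \<partial>lebesgue)"
    proof (intro sum.cong refl nn_integral_cong)
      fix v x :: "real^'n" assume "v \<in> corners"
      then show "ennreal (norm (dyadic_average b (Suc N) c s x - b x)) * indicator (child c s v) x =
        ennreal (norm (dyadic_average b N (c + (s / 2) *\<^sub>R v) (s / 2) x - b x)) * indicator (child c s v) x"
        using Suc.prems(1) by (cases "x \<in> child c s v") (simp_all add: dyadic_average_child del: dyadic_average.simps)
    qed
    also have "\<dots> \<le> (\<Sum>v\<in>corners. 2 * (\<integral>\<^sup>+x\<in>child c s v. ennreal (norm (b x - g x)) \<partial>lebesgue) + ennreal \<eta> * emeasure lebesgue (child c s v))"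
    proof (rule sum_mono)
      fix v :: "real^'n" assume v: "v \<in> corners"
      have "(\<integral>\<^sup>+x\<in>child c s v. ennreal (norm (dyadic_average b N (c + (s / 2) *\<^sub>R v) (s / 2) x - b x)) \<partial>lebesgue)
        \<le> 2 * (\<integral>\<^sup>+x\<in>child c s v. ennreal (norm (b x - g x)) \<partial>lebesgue) + ennreal (\<eta> * (s / 2) ^ CARD('n))"
      proof (rule Suc.IH)
        fix x y assume "x \<in> child c s v" "y \<in> child c s v" "norm (x - y) \<le> real CARD('n) * (s / 2) / 2 ^ N"
        then show "norm (g x - g y) \<le> \<eta>"
          using child_subset[OF Suc.prems(1) v, of c] by (intro Suc.prems(3)) auto
      qed (use Suc.prems in auto)
      then show "(\<integral>\<^sup>+x\<in>child c s v. ennreal (norm (dyadic_average b N (c + (s / 2) *\<^sub>R v) (s / 2) x - b x)) \<partial>lebesgue)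
        \<le> 2 * (\<integral>\<^sup>+x\<in>child c s v. ennreal (norm (b x - g x)) \<partial>lebesgue) + ennreal \<eta> * emeasure lebesgue (child c s v)"
        using Suc.prems(1) \<eta> by (subst emeasure_cube) (simp_all add: ennreal_mult)
    qed
    also have "\<dots> = 2 * (\<Sum>v\<in>corners. \<integral>\<^sup>+x\<in>child c s v. ennreal (norm (b x - g x)) \<partial>lebesgue) + ennreal \<eta> * (\<Sum>v\<in>corners. emeasure lebesgue (child c s v))"
      by (simp add: sum.distrib sum_distrib_left)
    also have "\<dots> = 2 * (\<integral>\<^sup>+x\<in>cube c s. ennreal (norm (b x - g x)) \<partial>lebesgue) + ennreal \<eta> * emeasure lebesgue (cube c s)"
    proof -
      have "(\<Sum>v\<in>corners. emeasure lebesgue (child c s v)) = emeasure lebesgue (cube c s)"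
        unfolding cube_eq_children[OF Suc.prems(1), of c]
        by (rule sum_emeasure) (use disjoint_children[OF Suc.prems(1)] in auto)
      then show ?thesis by (simp only: split[OF meas(1)])
    qed
    finally show ?case
      unfolding emeasure_cube[OF Suc.prems(1)] using Suc.prems(1) \<eta> by (simp add: ennreal_mult del: dyadic_average.simps)
  }
qed

end

text \<open>The projection of the complex plane onto the disc of radius \<open>M\<close>.\<close>

definition clip :: "real \<Rightarrow> complex \<Rightarrow> complex" where
  "clip M z = (M / max M (norm z)) *\<^sub>R z"

lemma norm_clip_le: "M > 0 \<Longrightarrow> norm (clip M z) \<le> M" "M > 0 \<Longrightarrow> norm (clip M z) \<le> norm z"
  by (auto simp: clip_def max_def field_simps)

lemma clip_eq: "M > 0 \<Longrightarrow> norm z \<le> M \<Longrightarrow> clip M z = z"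
  by (simp add: clip_def)

lemma continuous_clip: "M > 0 \<Longrightarrow> continuous_on UNIV (clip M)"
  unfolding clip_def by (intro continuous_intros) auto

text \<open>Lebesgue measurable functions are almost everywhere limits of continuous ones. Clipping both the
  function and the approximants at a large height makes dominated convergence applicable on the set
  \<open>S\<close> of finite measure.\<close>

lemma continuous_approx_L1:
  fixes f :: "'a::euclidean_space \<Rightarrow> complex"
  assumes int: "integrable lebesgue f" and S: "S \<in> lmeasurable" and e: "0 < e"
  obtains g where "continuous_on UNIV g" "(\<integral>\<^sup>+x\<in>S. ennreal (norm (f x - g x)) \<partial>lebesgue) \<le> ennreal e"
proof -
  have [measurable]: "f \<in> borel_measurable lebesgue" "S \<in> sets lebesgue" using int S by auto
  have clip_meas [measurable]: "clip M \<in> borel_measurable borel" if "M > 0" for M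
    by (rule borel_measurable_continuous_onI[OF continuous_clip[OF that]])
  have "(\<lambda>M. \<integral>x. norm (f x - clip (real (Suc M)) (f x)) \<partial>lebesgue) \<longlonglongrightarrow> (\<integral>x. 0 \<partial>(lebesgue :: 'a measure))"
  proof (rule integral_dominated_convergence)
    show "integrable lebesgue (\<lambda>x. 2 * norm (f x))" using int by simp
    show "AE x in lebesgue. (\<lambda>M. norm (f x - clip (real (Suc M)) (f x))) \<longlonglongrightarrow> 0"
    proof (intro AE_I2 tendsto_eventually)
      fix x
      obtain k where "norm (f x) \<le> real k" using real_arch_simple by blast
      then show "\<forall>\<^sub>F M in sequentially. norm (f x - clip (real (Suc M)) (f x)) = 0"
        by (intro eventually_sequentiallyI[of k]) (simp add: clip_eq)
    qed
    show "AE x in lebesgue. norm (norm (f x - clip (real (Suc M)) (f x))) \<le> 2 * norm (f x)" for M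
    proof (intro AE_I2)
      fix x
      show "norm (norm (f x - clip (real (Suc M)) (f x))) \<le> 2 * norm (f x)"
        using norm_triangle_ineq4[of "f x" "clip (real (Suc M)) (f x)"] norm_clip_le(2)[of "real (Suc M)" "f x"] by simp
    qed
    show "(\<lambda>x. norm (f x - clip (real (Suc M)) (f x))) \<in> borel_measurable lebesgue" for M
      using measurable_compose[OF \<open>f \<in> borel_measurable lebesgue\<close> clip_meas[of "real (Suc M)"]] by measurable
  qed auto
  then have "\<forall>\<^sub>F M in sequentially. (\<integral>x. norm (f x - clip (real (Suc M)) (f x)) \<partial>lebesgue) < e / 2"
    using e by (intro order_tendstoD) auto
  then obtain M0 where M0: "(\<integral>x. norm (f x - clip (real (Suc M0)) (f x)) \<partial>lebesgue) < e / 2"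
    by (auto simp: eventually_sequentially)
  define M where "M = real (Suc M0)"
  have M: "M > 0" "(\<integral>x. norm (f x - clip M (f x)) \<partial>lebesgue) < e / 2" using M0 by (auto simp: M_def)
  have [measurable]: "(\<lambda>x. clip M (f x)) \<in> borel_measurable lebesgue"
    using measurable_compose[OF \<open>f \<in> borel_measurable lebesgue\<close> clip_meas[OF M(1)]] .
  have intd: "integrable lebesgue (\<lambda>x. norm (f x - clip M (f x)))"
    by (rule Bochner_Integration.integrable_bound[of _ "\<lambda>x. 2 * norm (f x)"])
       (use int norm_triangle_ineq4[of "f _" "clip M (f _)"] norm_clip_le(2)[OF M(1), of "f _"] in \<open>auto intro!: AE_I2 order_trans[OF norm_triangle_ineq4]\<close>)
  have "f measurable_on UNIV" by (simp add: measurable_on_iff_borel_measurable lebesgue_on_UNIV_eq)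
  then obtain N g where N: "negligible N" and g: "\<And>n. continuous_on UNIV (g n)" and lim: "\<And>x. x \<notin> N \<Longrightarrow> (\<lambda>n. g n x) \<longlonglongrightarrow> f x"
    unfolding measurable_on_def by auto
  have cg: "continuous_on UNIV (\<lambda>x. clip M (g n x))" for n
    using continuous_on_compose2[OF continuous_clip[OF M(1)] g[of n]] by auto
  have cgm [measurable]: "(\<lambda>x. clip M (g n x)) \<in> borel_measurable lebesgue" for n
    by (rule measurable_completion) (simp add: borel_measurable_continuous_onI[OF cg])
  have "(\<lambda>n. \<integral>x. indicator S x * norm (clip M (f x) - clip M (g n x)) \<partial>lebesgue) \<longlonglongrightarrow> (\<integral>x. 0 \<partial>(lebesgue :: 'a measure))"
  proof (rule integral_dominated_convergence)
    show "integrable lebesgue (\<lambda>x. 2 * M * indicator S x :: real)"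
      using S by (intro integrable_mult_right integrable_real_indicator) (auto simp: fmeasurable_def)
    have "AE x in lebesgue. x \<notin> N"
      using N by (simp add: negligible_iff_null_sets AE_not_in)
    then show "AE x in lebesgue. (\<lambda>n. indicator S x * norm (clip M (f x) - clip M (g n x))) \<longlonglongrightarrow> 0"
    proof eventually_elim
      case (elim x)
      have "isCont (clip M) (f x)" using continuous_clip[OF M(1)] by (simp add: continuous_on_eq_continuous_at)
      from isCont_tendsto_compose[OF this lim[OF elim]]
      have "(\<lambda>n. clip M (g n x)) \<longlonglongrightarrow> clip M (f x)" .
      then have "(\<lambda>n. indicator S x * norm (clip M (f x) - clip M (g n x))) \<longlonglongrightarrow> indicator S x * norm (clip M (f x) - clip M (f x))"
        by (intro tendsto_intros)
      then show ?case by simp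
    qed
    show "AE x in lebesgue. norm (indicator S x * norm (clip M (f x) - clip M (g n x))) \<le> 2 * M * indicator S x" for n
    proof (intro AE_I2)
      fix x
      show "norm (indicator S x * norm (clip M (f x) - clip M (g n x))) \<le> 2 * M * indicator S x"
        using norm_triangle_ineq4[of "clip M (f x)" "clip M (g n x)"] norm_clip_le(1)[OF M(1), of "f x"] norm_clip_le(1)[OF M(1), of "g n x"]
        by (auto simp: indicator_def)
    qed
  qed auto
  then have "\<forall>\<^sub>F n in sequentially. (\<integral>x. indicator S x * norm (clip M (f x) - clip M (g n x)) \<partial>lebesgue) < e / 2"
    using e by (intro order_tendstoD) auto
  then obtain n where n: "(\<integral>x. indicator S x * norm (clip M (f x) - clip M (g n x)) \<partial>lebesgue) < e / 2"
    by (auto simp: eventually_sequentially)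
  have intd2: "integrable lebesgue (\<lambda>x. indicator S x * norm (clip M (f x) - clip M (g n x)))"
  proof (rule Bochner_Integration.integrable_bound[of _ "\<lambda>x. 2 * M * indicator S x :: real"])
    show "integrable lebesgue (\<lambda>x. 2 * M * indicator S x :: real)"
      using S by (intro integrable_mult_right integrable_real_indicator) (auto simp: fmeasurable_def)
    show "AE x in lebesgue. norm (indicator S x * norm (clip M (f x) - clip M (g n x))) \<le> norm (2 * M * indicator S x)"
    proof (intro AE_I2)
      fix x
      show "norm (indicator S x * norm (clip M (f x) - clip M (g n x))) \<le> norm (2 * M * indicator S x)"
        using norm_triangle_ineq4[of "clip M (f x)" "clip M (g n x)"] norm_clip_le(1)[OF M(1), of "f x"] norm_clip_le(1)[OF M(1), of "g n x"]
        by (auto simp: indicator_def)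
    qed
  qed auto
  have "(\<integral>\<^sup>+x\<in>S. ennreal (norm (f x - clip M (g n x))) \<partial>lebesgue) \<le>
    (\<integral>\<^sup>+x. ennreal (norm (f x - clip M (f x))) + ennreal (indicator S x * norm (clip M (f x) - clip M (g n x))) \<partial>lebesgue)"
  proof (rule nn_integral_mono)
    fix x
    show "ennreal (norm (f x - clip M (g n x))) * indicator S x \<le> ennreal (norm (f x - clip M (f x))) + ennreal (indicator S x * norm (clip M (f x) - clip M (g n x)))"
      using norm_triangle_ineq[of "f x - clip M (f x)" "clip M (f x) - clip M (g n x)"]
      by (auto simp: indicator_def simp flip: ennreal_plus intro!: ennreal_leI)
  qed
  also have "\<dots> = ennreal (\<integral>x. norm (f x - clip M (f x)) \<partial>lebesgue) + ennreal (\<integral>x. indicator S x * norm (clip M (f x) - clip M (g n x)) \<partial>lebesgue)"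
    using intd intd2 by (subst nn_integral_add) (auto simp: nn_integral_eq_integral)
  also have "\<dots> \<le> ennreal (e / 2) + ennreal (e / 2)"
    using M n by (intro add_mono ennreal_leI) auto
  also have "\<dots> = ennreal e" using e by (simp flip: ennreal_plus)
  finally show ?thesis using that[OF cg] by blast
qed

context bounded_oscillation
begin

text \<open>A weak form of the Lebesgue differentiation theorem, obtained from uniform continuity of a
  continuous approximant on the closed cube.\<close>

lemma dyadic_average_tendsto_L1:
  assumes s: "0 < s" "s \<le> s0" and e: "0 < e"
  shows "\<forall>\<^sub>F N in sequentially. (\<integral>\<^sup>+x\<in>cube c s. ennreal (norm (dyadic_average b N c s x - b x)) \<partial>lebesgue) \<le> ennreal e"
proof -
  have b: "integrable lebesgue (\<lambda>x. indicator (cube c s) x *\<^sub>R b x)"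
    using integrable_cube[OF s] by (simp add: set_integrable_def)
  have S: "cube c s \<in> lmeasurable"
    using emeasure_cube[OF s(1), of c] by (intro fmeasurableI) auto
  obtain g where g: "continuous_on UNIV g" and
     ge: "(\<integral>\<^sup>+x\<in>cube c s. ennreal (norm (indicator (cube c s) x *\<^sub>R b x - g x)) \<partial>lebesgue) \<le> ennreal (e / 4)"
    using continuous_approx_L1[OF b S, of "e / 4"] e by auto
  have ge: "(\<integral>\<^sup>+x\<in>cube c s. ennreal (norm (b x - g x)) \<partial>lebesgue) \<le> ennreal (e / 4)"
  proof -
    have "(\<integral>\<^sup>+x\<in>cube c s. ennreal (norm (b x - g x)) \<partial>lebesgue) =
      (\<integral>\<^sup>+x\<in>cube c s. ennreal (norm (indicator (cube c s) x *\<^sub>R b x - g x)) \<partial>lebesgue)"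
      by (intro nn_integral_cong) (auto simp: indicator_def)
    with ge show ?thesis by simp
  qed
  define \<eta> where "\<eta> = e / (2 * s ^ CARD('n))"
  have \<eta>: "\<eta> > 0" using e s by (simp add: \<eta>_def)
  let ?Q = "cbox c (\<chi> i. c $ i + s)"
  have "uniformly_continuous_on ?Q g"
    by (intro compact_uniformly_continuous continuous_on_subset[OF g]) auto
  then obtain d where d: "d > 0" "\<And>x y. x \<in> ?Q \<Longrightarrow> y \<in> ?Q \<Longrightarrow> dist y x < d \<Longrightarrow> dist (g y) (g x) < \<eta>"
    unfolding uniformly_continuous_on_def using \<eta> by metis
  have "(\<lambda>N. real CARD('n) * s * (1 / 2) ^ N) \<longlonglongrightarrow> real CARD('n) * s * 0"
    by (intro tendsto_intros LIMSEQ_power_zero) auto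
  then have "\<forall>\<^sub>F N in sequentially. real CARD('n) * s * (1 / 2) ^ N < d"
    using d by (intro order_tendstoD) auto
  then show ?thesis
  proof eventually_elim
    case (elim N)
    have "(\<integral>\<^sup>+x\<in>cube c s. ennreal (norm (dyadic_average b N c s x - b x)) \<partial>lebesgue) \<le>
       2 * (\<integral>\<^sup>+x\<in>cube c s. ennreal (norm (b x - g x)) \<partial>lebesgue) + ennreal (\<eta> * s ^ CARD('n))"
    proof (rule dyadic_average_L1_approx[OF g])
      fix x y assume xy: "x \<in> cube c s" "y \<in> cube c s" "norm (x - y) \<le> real CARD('n) * s / 2 ^ N"
      then have "dist x y < d" using elim by (simp add: dist_norm power_divide)
      then show "norm (g x - g y) \<le> \<eta>"
        using d(2)[of y x] xy cube_bounds(2)[of c s] by (auto simp: dist_norm intro: less_imp_le)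
    qed (use \<eta> s in auto)
    also have "\<dots> \<le> 2 * ennreal (e / 4) + ennreal (\<eta> * s ^ CARD('n))"
      by (intro add_mono mult_left_mono ge) auto
    also have "2 * ennreal (e / 4) = ennreal (e / 2)"
      using e by (simp add: mult_2 flip: ennreal_plus)
    also have "\<eta> * s ^ CARD('n) = e / 2" using s by (simp add: \<eta>_def)
    also have "ennreal (e / 2) + ennreal (e / 2) = ennreal e" using e by (simp flip: ennreal_plus)
    finally show ?case .
  qed
qed

text \<open>Fatou's lemma along a subsequence on which the dyadic averages converge almost everywhere. Absolute
  continuity of \<open>\<mu>\<close> turns convergence almost everywhere for Lebesgue measure into convergence almost
  everywhere for \<open>\<mu>\<close>.\<close>

theorem weighted_John_Nirenberg:
  fixes \<mu> :: "(real^'n) measure"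
  assumes sets: "sets \<mu> = sets lebesgue" and ac: "absolutely_continuous lebesgue \<mu>"
    and P: "1 \<le> P" and \<Gamma>: "1 \<le> \<Gamma>"
    and finite: "\<And>c s. 0 < s \<Longrightarrow> s \<le> s0 \<Longrightarrow> emeasure \<mu> (cube c s) < top"
    and A_inf: "\<And>c s E. 0 < s \<Longrightarrow> s \<le> s0 \<Longrightarrow> E \<in> sets lebesgue \<Longrightarrow> E \<subseteq> cube c s \<Longrightarrow>
      s ^ CARD('n) / 2 \<le> measure lebesgue E \<Longrightarrow> measure \<mu> (cube c s) \<le> \<Gamma> * measure \<mu> E"
    and K_def: "K = (2 * P + 1) * \<Gamma> * (2 * A + 2 ^ CARD('n) * A)"
    and s: "0 < s" "s \<le> s0"
  shows "(\<integral>\<^sup>+x\<in>cube c s. ennreal (norm (b x - cube_mean b c s) powr P) \<partial>\<mu>)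
         \<le> ennreal (K powr P) * emeasure \<mu> (cube c s)"
proof -
  note sets[measurable_cong]
  have [measurable]: "(\<lambda>x. indicator (cube c s) x *\<^sub>R b x) \<in> borel_measurable lebesgue"
    using integrable_cube[OF s] by (auto simp: set_integrable_def)
  define D where "D N x = indicator (cube c s) x *\<^sub>R (dyadic_average b N c s x - indicator (cube c s) x *\<^sub>R b x)" for N x
  have [measurable]: "D N \<in> borel_measurable lebesgue" for N unfolding D_def by measurable
  have nnD: "(\<integral>\<^sup>+x. ennreal (norm (D N x)) \<partial>lebesgue) = (\<integral>\<^sup>+x\<in>cube c s. ennreal (norm (dyadic_average b N c s x - b x)) \<partial>lebesgue)" for N
    by (intro nn_integral_cong) (auto simp: D_def indicator_def)
  have ev: "\<forall>\<^sub>F N in sequentially. (\<integral>\<^sup>+x. ennreal (norm (D N x)) \<partial>lebesgue) \<le> ennreal e" if "e > 0" for e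
    unfolding nnD by (rule dyadic_average_tendsto_L1[OF s that])
  from ev[of 1] obtain N0 where N0: "\<And>N. N \<ge> N0 \<Longrightarrow> (\<integral>\<^sup>+x. ennreal (norm (D N x)) \<partial>lebesgue) \<le> ennreal 1"
    unfolding eventually_sequentially by auto
  have intD: "integrable lebesgue (D (N + N0))" for N
    using N0[of "N + N0"] by (intro integrableI_bounded) (auto simp: less_top[symmetric] top_unique)
  have "(\<lambda>N. \<integral>x. norm (D (N + N0) x) \<partial>lebesgue) \<longlonglongrightarrow> 0"
  proof (rule LIMSEQ_I)
    fix e :: real assume "e > 0"
    then obtain N1 where N1: "\<And>N. N \<ge> N1 \<Longrightarrow> (\<integral>\<^sup>+x. ennreal (norm (D N x)) \<partial>lebesgue) \<le> ennreal (e / 2)"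
      using ev[of "e / 2"] unfolding eventually_sequentially by auto
    show "\<exists>no. \<forall>n\<ge>no. norm ((\<integral>x. norm (D (n + N0) x) \<partial>lebesgue) - 0) < e"
    proof (intro exI[of _ N1] allI impI)
      fix n assume "N1 \<le> n"
      then have "ennreal (\<integral>x. norm (D (n + N0) x) \<partial>lebesgue) \<le> ennreal (e / 2)"
        using N1[of "n + N0"] intD[of n] by (simp add: nn_integral_eq_integral)
      then show "norm ((\<integral>x. norm (D (n + N0) x) \<partial>lebesgue) - 0) < e"
        using \<open>e > 0\<close> by (simp add: ennreal_le_iff)
    qed
  qed
  from tendsto_L1_AE_subseq[OF intD this]
  obtain r :: "nat \<Rightarrow> nat" where AE: "AE x in lebesgue. (\<lambda>n. D (r n + N0) x) \<longlonglongrightarrow> 0" by blast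
  have AE: "AE x in \<mu>. (\<lambda>n. D (r n + N0) x) \<longlonglongrightarrow> 0"
    by (rule absolutely_continuous_AE[OF _ ac AE]) (simp add: sets)
  define Y where "Y n x = ennreal (norm (dyadic_average b (r n + N0) c s x - cube_mean b c s) powr P) * indicator (cube c s) x" for n x
  have [measurable]: "Y n \<in> borel_measurable \<mu>" for n unfolding Y_def by measurable
  have "(\<integral>\<^sup>+x\<in>cube c s. ennreal (norm (b x - cube_mean b c s) powr P) \<partial>\<mu>) = (\<integral>\<^sup>+x. liminf (\<lambda>n. Y n x) \<partial>\<mu>)"
  proof (rule nn_integral_cong_AE)
    show "AE x in \<mu>. ennreal (norm (b x - cube_mean b c s) powr P) * indicator (cube c s) x = liminf (\<lambda>n. Y n x)"
      using AE
    proof eventually_elim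
      case (elim x)
      have "(\<lambda>n. Y n x) \<longlonglongrightarrow> ennreal (norm (b x - cube_mean b c s) powr P) * indicator (cube c s) x"
      proof (cases "x \<in> cube c s")
        case True
        then have "(\<lambda>n. dyadic_average b (r n + N0) c s x - b x) \<longlonglongrightarrow> 0" using elim by (simp add: D_def)
        then have lim: "(\<lambda>n. dyadic_average b (r n + N0) c s x) \<longlonglongrightarrow> b x" by (simp add: LIM_zero_iff)
        have "(\<lambda>n. norm (dyadic_average b (r n + N0) c s x - cube_mean b c s) powr P) \<longlonglongrightarrow> norm (b x - cube_mean b c s) powr P"
          by (rule tendsto_powr'[OF tendsto_norm[OF tendsto_diff[OF lim tendsto_const]] tendsto_const]) (use P in auto)
        then show ?thesis using True by (simp add: Y_def tendsto_ennrealI)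
      qed (simp add: Y_def)
      then show ?case using lim_imp_Liminf[OF sequentially_bot] by metis
    qed
  qed
  also have "\<dots> \<le> liminf (\<lambda>n. integral\<^sup>N \<mu> (Y n))" by (rule nn_integral_liminf) measurable
  also have "\<dots> \<le> ennreal (K powr P) * emeasure \<mu> (cube c s)"
  proof -
    have "integral\<^sup>N \<mu> (Y n) \<le> ennreal (K powr P) * emeasure \<mu> (cube c s)" for n
      unfolding Y_def by (rule dyadic_moment_bound[OF sets P \<Gamma> finite A_inf K_def s])
    then have "liminf (\<lambda>n. integral\<^sup>N \<mu> (Y n)) \<le> liminf (\<lambda>n::nat. ennreal (K powr P) * emeasure \<mu> (cube c s))"
      by (intro Liminf_mono) auto
    then show ?thesis by (simp add: Liminf_const)
  qed
  finally show ?thesis .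
qed

end

section \<open>Weights with polynomially growing constants\<close>

text \<open>The symmetric form of the \<open>A\<^sub>p\<^sup>\<theta>\<close> condition for a weight \<open>W\<close> and its dual weight \<open>V = W\<^bsup>-q/p\<^esup>\<close>, which may take
  the value \<open>\<infinity>\<close> on a null set only. Symmetry gives every statement about \<open>W\<close> and \<open>p\<close> also for \<open>V\<close> and
  \<open>q\<close>.\<close>

definition dual_weights ::
  "real \<Rightarrow> real \<Rightarrow> (real^'n::finite \<Rightarrow> ennreal) \<Rightarrow> (real^'n \<Rightarrow> ennreal) \<Rightarrow> real \<Rightarrow> real \<Rightarrow> bool" where
  "dual_weights p q W V C \<theta> \<longleftrightarrow> p > 1 \<and> q > 1 \<and> 1 / p + 1 / q = 1 \<and> 0 \<le> C \<and> 0 \<le> \<theta> \<and>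
     W \<in> borel_measurable lebesgue \<and> V \<in> borel_measurable lebesgue \<and>
     (AE x in lebesgue. ennpowr (W x) (1 / p) * ennpowr (V x) (1 / q) = 1) \<and>
     (\<forall>x r. r > 0 \<longrightarrow> (\<integral>\<^sup>+y\<in>ball x r. W y \<partial>lebesgue) < top \<and> (\<integral>\<^sup>+y\<in>ball x r. V y \<partial>lebesgue) < top \<and>
       ennpowr (\<integral>\<^sup>+y\<in>ball x r. W y \<partial>lebesgue) (1 / p) * ennpowr (\<integral>\<^sup>+y\<in>ball x r. V y \<partial>lebesgue) (1 / q)
         \<le> ennreal (C * r ^ CARD('n) * (1 + r) powr \<theta>))"

lemma dual_weights_commute: "dual_weights p q W V C \<theta> \<Longrightarrow> dual_weights q p V W C \<theta>"
  unfolding dual_weights_def by (auto simp: mult.commute add.commute)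

lemma measure_lebesgue_ball:
  fixes x :: "real^'n::finite" assumes "r > 0"
  shows "measure lebesgue (ball x r) = unit_ball_vol (real CARD('n)) * r ^ CARD('n)"
  using content_ball[of r x] assms by (simp add: measure_completion)

lemma borel_measurable_locally_integrable:
  assumes "locally_integrable (f :: real^'n::finite \<Rightarrow> 'b::{banach, second_countable_topology})"
  shows "f \<in> borel_measurable lebesgue"
proof (rule borel_measurable_LIMSEQ_metric)
  show "(\<lambda>x. indicator (cball 0 (real k)) x *\<^sub>R f x) \<in> borel_measurable lebesgue" for k
    using assms compact_cball[of "0 :: real^'n" "real k"]
    unfolding locally_integrable_def set_integrable_def by (blast intro: borel_measurable_integrable)
  show "(\<lambda>k. indicator (cball 0 (real k)) x *\<^sub>R f x) \<longlonglongrightarrow> f x" for x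
  proof (rule tendsto_eventually)
    obtain k where "norm x \<le> real k" using real_arch_simple by blast
    then show "\<forall>\<^sub>F k in sequentially. indicator (cball 0 (real k)) x *\<^sub>R f x = f x"
      by (intro eventually_sequentiallyI[of k]) (simp add: indicator_def)
  qed
qed

lemma nn_integral_ball_finite:
  assumes "locally_integrable (w :: real^'n::finite \<Rightarrow> real)" "\<And>x. 0 \<le> w x"
  shows "(\<integral>\<^sup>+y\<in>ball x r. ennreal (w y) \<partial>lebesgue) < top"
proof -
  have "integrable lebesgue (\<lambda>y. indicator (cball x r) y *\<^sub>R w y)"
    using assms(1) by (auto simp: locally_integrable_def set_integrable_def)
  then have "(\<integral>\<^sup>+y. ennreal (norm (indicator (cball x r) y *\<^sub>R w y)) \<partial>lebesgue) < top"
    by (simp add: integrable_iff_bounded)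
  moreover have "(\<integral>\<^sup>+y\<in>ball x r. ennreal (w y) \<partial>lebesgue) \<le> (\<integral>\<^sup>+y. ennreal (norm (indicator (cball x r) y *\<^sub>R w y)) \<partial>lebesgue)"
    using assms(2) by (intro nn_integral_mono) (auto simp: indicator_def)
  ultimately show ?thesis by (rule le_less_trans[rotated])
qed

lemma nn_integral_mono_set:
  "A \<subseteq> B \<Longrightarrow> (\<integral>\<^sup>+y\<in>A. f y \<partial>M) \<le> (\<integral>\<^sup>+y\<in>B. f y \<partial>M)"
  by (intro nn_integral_mono) (auto simp: indicator_def)

text \<open>If \<open>w\<close> does not vanish almost everywhere, then it has positive mass on all large balls. There the \<open>A\<^sub>p\<^sup>\<theta>\<close>
  condition bounds the mass of \<open>w\<^bsup>-1/(p-1)\<^esup>\<close>, which is therefore finite almost everywhere, and so \<open>w\<close> is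
  positive almost everywhere.\<close>

lemma Ap_infty_dual_weights:
  fixes w :: "real^'n::finite \<Rightarrow> real"
  assumes p: "p > 1" and w: "w \<in> Ap_infty p" and nz: "\<not> (AE x in lebesgue. w x = 0)"
  obtains V C \<theta> where "dual_weights p (p / (p - 1)) (\<lambda>x. ennreal (w x)) V C \<theta>"
proof -
  define q where "q = p / (p - 1)"
  have q: "q > 1" "1 / p + 1 / q = 1" "1 - 1 / p = 1 / q" using p by (auto simp: q_def field_simps)
  obtain \<theta> C0 where \<theta>: "\<theta> \<ge> 0" and wt: "weight w" and
    C0: "\<And>x r. r > 0 \<Longrightarrow> ennpowr (\<integral>\<^sup>+y\<in>ball x r. ennreal (w y) \<partial>lebesgue) (1 / p) *
        ennpowr (\<integral>\<^sup>+y\<in>ball x r. ennpowr (ennreal (w y)) (- (1 / (p - 1))) \<partial>lebesgue) (1 - 1 / p)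
        \<le> ennreal (C0 * measure lebesgue (ball x r) * (1 + r) powr \<theta>)"
    using w unfolding Ap_infty_def Ap_theta_def by auto
  define V where "V x = ennpowr (ennreal (w x)) (- (1 / (p - 1)))" for x
  define C where "C = \<bar>C0\<bar> * unit_ball_vol (real CARD('n))"
  have w0: "0 \<le> w x" for x using wt by (simp add: weight_def)
  have li: "locally_integrable w" using wt by (simp add: weight_def)
  have wm [measurable]: "w \<in> borel_measurable lebesgue" by (rule borel_measurable_locally_integrable[OF li])
  have V_eq: "V x = (if w x = 0 then top else ennreal (w x powr (- (1 / (p - 1)))))" for x
    using w0[of x] p by (auto simp: V_def ennpowr_def)
  have Vm [measurable]: "V \<in> borel_measurable lebesgue"
    unfolding V_eq[abs_def] by measurable
  have Wfin: "(\<integral>\<^sup>+y\<in>ball x r. ennreal (w y) \<partial>lebesgue) < top" for x r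
    by (rule nn_integral_ball_finite[OF li w0])
  have A: "ennpowr (\<integral>\<^sup>+y\<in>ball x r. ennreal (w y) \<partial>lebesgue) (1 / p) * ennpowr (\<integral>\<^sup>+y\<in>ball x r. V y \<partial>lebesgue) (1 / q)
         \<le> ennreal (C * r ^ CARD('n) * (1 + r) powr \<theta>)" if "r > 0" for x r
  proof -
    have "ennpowr (\<integral>\<^sup>+y\<in>ball x r. ennreal (w y) \<partial>lebesgue) (1 / p) * ennpowr (\<integral>\<^sup>+y\<in>ball x r. V y \<partial>lebesgue) (1 / q)
       \<le> ennreal (C0 * measure lebesgue (ball x r) * (1 + r) powr \<theta>)"
      using C0[OF that, of x] by (simp add: V_def q)
    also have "\<dots> \<le> ennreal (\<bar>C0\<bar> * measure lebesgue (ball x r) * (1 + r) powr \<theta>)"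
      by (intro ennreal_leI mult_right_mono) auto
    also have "\<bar>C0\<bar> * measure lebesgue (ball x r) * (1 + r) powr \<theta> = C * r ^ CARD('n) * (1 + r) powr \<theta>"
      unfolding measure_lebesgue_ball[OF that] C_def by (simp add: mult_ac)
    finally show ?thesis .
  qed
  \<comment> \<open>Some ball has positive mass, because the balls about the origin exhaust the space.\<close>
  obtain k0 :: nat where k0: "(\<integral>\<^sup>+y\<in>ball 0 (real k0). ennreal (w y) \<partial>lebesgue) \<noteq> 0"
  proof (rule ccontr)
    assume "\<not> thesis"
    with that have "(\<integral>\<^sup>+y\<in>ball 0 (real k). ennreal (w y) \<partial>lebesgue) = 0" for k by blast
    then have "AE y in lebesgue. ennreal (w y) * indicator (ball 0 (real k)) y = 0" for k
      by (subst (asm) nn_integral_0_iff_AE) auto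
    note z = this
    have "AE y in lebesgue. \<forall>k. ennreal (w y) * indicator (ball 0 (real k)) y = 0"
      unfolding AE_all_countable by (rule allI[OF z])
    then have "AE y in lebesgue. w y = 0"
    proof eventually_elim
      case (elim y)
      obtain k where "norm y < real k" using reals_Archimedean2 by blast
      then show ?case using elim[rule_format, of k] w0[of y] by (simp add: ennreal_eq_0_iff)
    qed
    with nz show False by simp
  qed
  have Vfin: "(\<integral>\<^sup>+y\<in>ball x r. V y \<partial>lebesgue) < top" for x r
  proof -
    define R where "R = max (real k0 + 1) (norm x + \<bar>r\<bar> + 1)"
    have R: "R > 0" by (simp add: R_def max_def)
    have sub: "ball x r \<subseteq> ball 0 R"
    proof
      fix y assume "y \<in> ball x r"
      then have "norm (y - x) < r" by (simp add: dist_norm norm_minus_commute)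
      then show "y \<in> ball 0 R" using norm_triangle_ineq[of "y - x" x] by (simp add: R_def)
    qed
    have "0 < (\<integral>\<^sup>+y\<in>ball 0 (real k0). ennreal (w y) \<partial>lebesgue)" using k0 by (simp add: zero_less_iff_neq_zero)
    also have "\<dots> \<le> (\<integral>\<^sup>+y\<in>ball 0 R. ennreal (w y) \<partial>lebesgue)"
      by (rule nn_integral_mono_set) (auto simp: R_def)
    finally have "ennpowr (\<integral>\<^sup>+y\<in>ball 0 R. ennreal (w y) \<partial>lebesgue) (1 / p) \<noteq> 0"
      using p by (simp add: ennpowr_eq_0_iff)
    moreover have "ennpowr (\<integral>\<^sup>+y\<in>ball 0 R. ennreal (w y) \<partial>lebesgue) (1 / p) * ennpowr (\<integral>\<^sup>+y\<in>ball 0 R. V y \<partial>lebesgue) (1 / q) < top"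
      using A[OF R, of 0] by (rule le_less_trans) simp
    ultimately have "ennpowr (\<integral>\<^sup>+y\<in>ball 0 R. V y \<partial>lebesgue) (1 / q) < top"
      by (auto simp: ennreal_mult_less_top)
    then have "(\<integral>\<^sup>+y\<in>ball 0 R. V y \<partial>lebesgue) < top" using q p by (simp add: ennpowr_less_top_iff)
    with nn_integral_mono_set[OF sub] show ?thesis by (rule le_less_trans)
  qed
  have "AE y in lebesgue. \<forall>k. V y * indicator (ball 0 (real k)) y \<noteq> \<infinity>"
    unfolding AE_all_countable using Vfin by (intro allI nn_integral_PInf_AE) (auto simp: less_top[symmetric])
  then have "AE y in lebesgue. ennpowr (ennreal (w y)) (1 / p) * ennpowr (V y) (1 / q) = 1"
  proof eventually_elim
    case (elim y)
    obtain k where "norm y < real k" using reals_Archimedean2 by blast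
    then have "V y \<noteq> top" using elim[rule_format, of k] by simp
    then have wy: "w y > 0" using w0[of y] by (auto simp: V_eq split: if_splits)
    have e: "1 / p + - (1 / (p - 1)) * (1 / q) = 0" using p by (simp add: q_def field_simps)
    have "ennpowr (ennreal (w y)) (1 / p) * ennpowr (V y) (1 / q) =
        ennreal (w y powr (1 / p) * w y powr (- (1 / (p - 1)) * (1 / q)))"
      using wy p q by (simp add: V_eq ennpowr_ennreal powr_powr ennreal_mult)
    also have "w y powr (1 / p) * w y powr (- (1 / (p - 1)) * (1 / q)) = 1"
      unfolding powr_add[symmetric] e using wy by simp
    finally show ?case by simp
  qed
  then have "dual_weights p q (\<lambda>x. ennreal (w x)) V C \<theta>"
    unfolding dual_weights_def using p q \<theta> A Wfin Vfin by (auto simp: C_def)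
  then show ?thesis using that by (simp add: q_def)
qed

lemma dual_weights_mass_product:
  assumes dw: "dual_weights p q W V C \<theta>" and r: "r > 0"
    and A: "A \<subseteq> ball (x :: real^'n::finite) r" and B: "B \<subseteq> ball x r"
  shows "(\<integral>\<^sup>+y\<in>A. W y \<partial>lebesgue) * ennpowr (\<integral>\<^sup>+y\<in>B. V y \<partial>lebesgue) (p - 1) \<le>
    ennreal ((C * r ^ CARD('n) * (1 + r) powr \<theta>) powr p)"
proof -
  have p: "p > 1" "q > 1" "1 / p + 1 / q = 1" "0 \<le> C" using dw by (auto simp: dual_weights_def)
  have pq: "1 / q * p = p - 1" "1 / p * p = 1" using p by (simp_all add: field_simps)
  have "(\<integral>\<^sup>+y\<in>A. W y \<partial>lebesgue) * ennpowr (\<integral>\<^sup>+y\<in>B. V y \<partial>lebesgue) (p - 1) \<le>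
      (\<integral>\<^sup>+y\<in>ball x r. W y \<partial>lebesgue) * ennpowr (\<integral>\<^sup>+y\<in>ball x r. V y \<partial>lebesgue) (p - 1)"
    using p by (intro mult_mono ennpowr_mono nn_integral_mono_set A B) auto
  also have "\<dots> = ennpowr (ennpowr (\<integral>\<^sup>+y\<in>ball x r. W y \<partial>lebesgue) (1 / p) * ennpowr (\<integral>\<^sup>+y\<in>ball x r. V y \<partial>lebesgue) (1 / q)) p"
    using p by (simp add: ennpowr_mult ennpowr_ennpowr pq del: times_divide_eq_left)
  also have "\<dots> \<le> ennpowr (ennreal (C * r ^ CARD('n) * (1 + r) powr \<theta>)) p"
    using dw r p unfolding dual_weights_def by (intro ennpowr_mono) auto
  also have "\<dots> = ennreal ((C * r ^ CARD('n) * (1 + r) powr \<theta>) powr p)"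
    using p r by (intro ennpowr_ennreal) auto
  finally show ?thesis .
qed

lemma cube_subset_ball:
  fixes c :: "real^'n::finite" assumes "s > 0"
  shows "cube c s \<subseteq> ball c ((real CARD('n) + 1) * s)"
proof
  fix x assume x: "x \<in> cube c s"
  have "c \<in> cube c s" using assms by (simp add: cube_def)
  from norm_diff_cube[OF x this] show "x \<in> ball c ((real CARD('n) + 1) * s)"
    using assms by (simp add: dist_norm norm_minus_commute algebra_simps)
qed

text \<open>A set \<open>E\<close> filling half of a cube carries a definite part of its mass: Hoelder's inequality bounds \<open>|E|\<^sup>p\<close> by
  the mass of \<open>W\<close> on \<open>E\<close> times a power of the mass of \<open>V\<close> on the cube, while the \<open>A\<^sub>p\<close> condition bounds the
  mass of \<open>W\<close> on the cube times the same power.\<close>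

lemma dual_weights_A_infinity:
  fixes W :: "real^'n::finite \<Rightarrow> ennreal"
  assumes dw: "dual_weights p q W V C \<theta>"
  defines "\<mu> \<equiv> density lebesgue W"
  obtains G M where "G \<ge> 1" "M \<ge> 0"
    "\<And>s0 c s E. 0 < s \<Longrightarrow> s \<le> s0 \<Longrightarrow> E \<in> sets lebesgue \<Longrightarrow> E \<subseteq> cube c s \<Longrightarrow>
      s ^ CARD('n) / 2 \<le> measure lebesgue E \<Longrightarrow> measure \<mu> (cube c s) \<le> (G * (1 + s0) powr M) * measure \<mu> E"
proof -
  have p: "p > 1" "q > 1" "1 / p + 1 / q = 1" "0 \<le> C" "0 \<le> \<theta>" using dw by (auto simp: dual_weights_def)
  have [measurable]: "W \<in> borel_measurable lebesgue" "V \<in> borel_measurable lebesgue" using dw by (auto simp: dual_weights_def)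
  have pos: "0 < p" "0 < q" "0 < p - 1" "0 < 1 / p" "0 < 1 / q" using p by auto
  note [measurable] = borel_measurable_ennpowr'[OF _ pos(1)] borel_measurable_ennpowr'[OF _ pos(2)]
     borel_measurable_ennpowr'[OF _ pos(4)] borel_measurable_ennpowr'[OF _ pos(5)]
  define N where "N = real CARD('n) + 1"
  have N: "N \<ge> 1" by (simp add: N_def)
  define G0 where "G0 = 1 + 2 * C * N ^ CARD('n) * N powr \<theta>"
  have G0: "G0 \<ge> 1" using p N by (simp add: G0_def)
  show ?thesis
  proof (rule that[of "G0 powr p" "\<theta> * p"])
    show "G0 powr p \<ge> 1" using G0 p by (simp add: ge_one_powr_ge_zero)
    show "\<theta> * p \<ge> 0" using p by simp
    fix s0 s :: real and c :: "real^'n" and E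
    assume s: "0 < s" "s \<le> s0" and E [measurable]: "E \<in> sets lebesgue" and sub: "E \<subseteq> cube c s"
      and big: "s ^ CARD('n) / 2 \<le> measure lebesgue E"
    have r: "N * s > 0" using N s by simp
    have Q: "cube c s \<subseteq> ball c (N * s)" unfolding N_def by (rule cube_subset_ball[OF s(1)])
    have fin: "(\<integral>\<^sup>+y\<in>ball c (N * s). W y \<partial>lebesgue) < top" "(\<integral>\<^sup>+y\<in>ball c (N * s). V y \<partial>lebesgue) < top"
      using dw r by (auto simp: dual_weights_def)
    define m where "m = measure \<mu> (cube c s)"
    define e where "e = measure \<mu> E"
    define v where "v = enn2real (\<integral>\<^sup>+y\<in>cube c s. V y \<partial>lebesgue)"
    have em: "emeasure \<mu> A = (\<integral>\<^sup>+y\<in>A. W y \<partial>lebesgue)" if "A \<in> sets lebesgue" for A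
      unfolding \<mu>_def using that by (simp add: emeasure_density)
    have "emeasure \<mu> (cube c s) < top" "emeasure \<mu> E < top"
      using fin(1) nn_integral_mono_set[OF Q, of lebesgue W] nn_integral_mono_set[OF order_trans[OF sub Q], of lebesgue W]
      by (auto simp: em intro: le_less_trans)
    then have me: "(\<integral>\<^sup>+y\<in>cube c s. W y \<partial>lebesgue) = ennreal m" "(\<integral>\<^sup>+y\<in>E. W y \<partial>lebesgue) = ennreal e"
      by (auto simp: m_def e_def em[symmetric] emeasure_eq_ennreal_measure)
    have ve: "(\<integral>\<^sup>+y\<in>cube c s. V y \<partial>lebesgue) = ennreal v"
    proof -
      have "(\<integral>\<^sup>+y\<in>cube c s. V y \<partial>lebesgue) < top"
        using nn_integral_mono_set[OF Q] fin(2) by (rule le_less_trans)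
      then show ?thesis unfolding v_def by (rule ennreal_enn2real[symmetric])
    qed
    have nn: "m \<ge> 0" "e \<ge> 0" "v \<ge> 0" by (auto simp: m_def e_def v_def)
    define X where "X = C * (N * s) ^ CARD('n) * (1 + N * s) powr \<theta>"
    have "ennreal m * ennpowr (ennreal v) (p - 1) \<le> ennreal (X powr p)"
      unfolding me[symmetric] ve[symmetric] X_def by (rule dual_weights_mass_product[OF dw r Q Q])
    then have 1: "m * v powr (p - 1) \<le> X powr p"
      using nn p by (simp add: ennpowr_ennreal ennreal_le_iff flip: ennreal_mult)
    have "ennreal (s ^ CARD('n) / 2) \<le> emeasure lebesgue E"
    proof -
      have "E \<in> lmeasurable"
        by (rule fmeasurableI2[OF _ sub E]) (use emeasure_cube[OF s(1), of c] in \<open>auto intro: fmeasurableI\<close>)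
      then show ?thesis using big by (simp add: emeasure_eq_measure2 ennreal_leI)
    qed
    also have "emeasure lebesgue E = (\<integral>\<^sup>+y. indicator E y \<partial>lebesgue)" by simp
    also have "\<dots> = (\<integral>\<^sup>+y. (ennpowr (W y) (1 / p) * indicator E y) * (ennpowr (V y) (1 / q) * indicator E y) \<partial>lebesgue)"
    proof (rule nn_integral_cong_AE)
      have "AE x in lebesgue. ennpowr (W x) (1 / p) * ennpowr (V x) (1 / q) = 1"
        using dw by (simp add: dual_weights_def)
      then show "AE y in lebesgue. indicator E y = (ennpowr (W y) (1 / p) * indicator E y) * (ennpowr (V y) (1 / q) * indicator E y)"
        by eventually_elim (simp add: indicator_def)
    qed
    finally have "ennpowr (ennreal (s ^ CARD('n) / 2)) p \<le> ennpowr \<dots> p"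
      by (rule ennpowr_mono[OF pos(1)])
    also have "\<dots> \<le> (\<integral>\<^sup>+y. ennpowr (ennpowr (W y) (1 / p) * indicator E y) p \<partial>lebesgue) *
       ennpowr (\<integral>\<^sup>+y. ennpowr (ennpowr (V y) (1 / q) * indicator E y) q \<partial>lebesgue) (p - 1)"
      by (rule Hoelder_ennpowr[OF _ _ p(1-3)]) measurable
    also have "\<dots> = (\<integral>\<^sup>+y\<in>E. W y \<partial>lebesgue) * ennpowr (\<integral>\<^sup>+y\<in>E. V y \<partial>lebesgue) (p - 1)"
    proof -
      have ind: "ennpowr (indicator A y) s = indicator A y" if "s > 0" for A and y :: "real^'n" and s
        using that ennpowr_ennreal[of 1 s] by (auto simp: indicator_def)
      show ?thesis using pos by (simp add: ennpowr_mult ennpowr_ennpowr ind)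
    qed
    also have "\<dots> \<le> ennreal e * ennpowr (ennreal v) (p - 1)"
      unfolding me[symmetric] ve[symmetric] by (intro mult_left_mono ennpowr_mono nn_integral_mono_set sub pos) auto
    finally have 2: "(s ^ CARD('n) / 2) powr p \<le> e * v powr (p - 1)"
      using nn p s by (simp add: ennpowr_ennreal ennreal_le_iff flip: ennreal_mult)
    have vpos: "v powr (p - 1) > 0"
    proof -
      have "0 < (s ^ CARD('n) / 2) powr p" using s by simp
      with 2 have "e * v powr (p - 1) > 0" by linarith
      then show ?thesis using nn by (simp add: zero_less_mult_iff)
    qed
    have "m * v powr (p - 1) * (s ^ CARD('n) / 2) powr p \<le> X powr p * (e * v powr (p - 1))"
      using 1 2 by (intro mult_mono) auto
    then have "m * (s ^ CARD('n) / 2) powr p \<le> X powr p * e" using vpos by (simp add: mult.commute mult.left_commute)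
    then have "m \<le> (X powr p / (s ^ CARD('n) / 2) powr p) * e" using s by (simp add: field_simps)
    also have "X powr p / (s ^ CARD('n) / 2) powr p = (X / (s ^ CARD('n) / 2)) powr p"
      by (subst powr_divide) (use p N s in \<open>auto simp: X_def\<close>)
    also have "X / (s ^ CARD('n) / 2) = 2 * C * N ^ CARD('n) * (1 + N * s) powr \<theta>"
      using s by (simp add: X_def power_mult_distrib)
    also have "(2 * C * N ^ CARD('n) * (1 + N * s) powr \<theta>) powr p \<le> (2 * C * N ^ CARD('n) * (N * (1 + s0)) powr \<theta>) powr p"
    proof -
      have "1 + N * s \<le> N * (1 + s0)" using N s by (simp add: distrib_left) (metis add_mono mult_left_mono order_trans zero_le_one)
      then show ?thesis using N s p by (intro powr_mono2 mult_left_mono) auto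
    qed
    also have "\<dots> = (2 * C * N ^ CARD('n) * N powr \<theta>) powr p * (1 + s0) powr (\<theta> * p)"
      using N s p by (simp add: powr_mult powr_powr mult.assoc)
    also have "\<dots> \<le> G0 powr p * (1 + s0) powr (\<theta> * p)"
      using N p by (intro mult_right_mono powr_mono2) (auto simp: G0_def)
    finally show "measure \<mu> (cube c s) \<le> (G0 powr p * (1 + s0) powr (\<theta> * p)) * measure \<mu> E"
      using nn by (simp add: m_def e_def mult_right_mono)
  qed
qed

text \<open>The oscillation of \<open>b\<close> about its mean on a cube is at most twice the oscillation about any constant; the
  mean over a ball containing the cube is a suitable constant.\<close>

lemma BMO_bounded_oscillation:
  fixes b :: "real^'n::finite \<Rightarrow> complex"
  assumes b: "b \<in> BMO \<theta>" and \<theta>: "0 < \<theta>"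
  obtains A0 where "A0 > 0" "\<And>s0. s0 > 0 \<Longrightarrow> bounded_oscillation b (A0 * (1 + s0) powr \<theta>) s0"
proof -
  obtain C where li: "locally_integrable b" and
    C: "\<And>x r. r > 0 \<Longrightarrow> (LINT y:ball x r|lebesgue. norm (b y - ball_mean b x r)) / measure lebesgue (ball x r) \<le> C * (1 + r) powr \<theta>"
    using b unfolding BMO_def by auto
  have [measurable]: "b \<in> borel_measurable lebesgue" by (rule borel_measurable_locally_integrable[OF li])
  define N where "N = real CARD('n) + 1"
  have N: "N \<ge> 1" by (simp add: N_def)
  define \<omega> where "\<omega> = unit_ball_vol (real CARD('n))"
  have \<omega>: "\<omega> \<ge> 0" by (simp add: \<omega>_def)
  define A0 where "A0 = 1 + 2 * (\<bar>C\<bar> * \<omega> * N ^ CARD('n) * N powr \<theta>)"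
  have A0: "A0 > 0" using N \<omega> by (simp add: A0_def add_pos_nonneg)
  show ?thesis
  proof (rule that[OF A0], unfold_locales)
    fix s0 :: real assume s0: "s0 > 0"
    show "A0 * (1 + s0) powr \<theta> > 0" using A0 s0 by simp
    fix c :: "real^'n" and s :: real assume s: "0 < s" "s \<le> s0"
    have "set_integrable lebesgue (cball c (N * s)) b" using li by (simp add: locally_integrable_def)
    note cb = this
    have Q: "cube c s \<subseteq> ball c (N * s)" unfolding N_def by (rule cube_subset_ball[OF s(1)])
    show int: "set_integrable lebesgue (cube c s) b"
      by (rule set_integrable_subset[OF cb]) (use Q ball_subset_cball in auto)
    have r: "N * s > 0" using N s by simp
    define \<beta> where "\<beta> = ball_mean b c (N * s)"
    have "set_integrable lebesgue (ball c (N * s)) b"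
      using \<open>set_integrable lebesgue (cball c (N * s)) b\<close> by (rule set_integrable_subset) auto
    moreover have "set_integrable lebesgue (ball c (N * s)) (\<lambda>x. \<beta>)"
      using emeasure_lborel_ball_finite[of c "N * s"] by (simp add: set_integrable_def)
    ultimately have i: "set_integrable lebesgue (ball c (N * s)) (\<lambda>x. b x - \<beta>)" by (rule set_integral_diff)
    have ballb: "(\<integral>\<^sup>+x\<in>ball c (N * s). ennreal (norm (b x - \<beta>)) \<partial>lebesgue) \<le> ennreal (\<bar>C\<bar> * \<omega> * (N * s) ^ CARD('n) * (1 + N * s) powr \<theta>)"
    proof -
      have "(\<integral>\<^sup>+x\<in>ball c (N * s). ennreal (norm (b x - \<beta>)) \<partial>lebesgue) = (\<integral>\<^sup>+x. ennreal (indicator (ball c (N * s)) x *\<^sub>R norm (b x - \<beta>)) \<partial>lebesgue)"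
        by (intro nn_integral_cong) (auto simp: indicator_def)
      also have "\<dots> = ennreal (LINT y:ball c (N * s)|lebesgue. norm (b y - \<beta>))"
        using set_integrable_norm[OF i] unfolding set_lebesgue_integral_def set_integrable_def
        by (intro nn_integral_eq_integral) (auto simp: indicator_def)
      also have "\<dots> \<le> ennreal (\<bar>C\<bar> * \<omega> * (N * s) ^ CARD('n) * (1 + N * s) powr \<theta>)"
      proof (rule ennreal_leI)
        have m: "measure lebesgue (ball c (N * s)) = \<omega> * (N * s) ^ CARD('n)"
          unfolding \<omega>_def by (rule measure_lebesgue_ball[OF r])
        have mp: "measure lebesgue (ball c (N * s)) > 0"
          using content_ball_gt_0_iff[of c "N * s"] r by (simp add: measure_completion)
        have "(LINT y:ball c (N * s)|lebesgue. norm (b y - \<beta>)) \<le> C * (1 + N * s) powr \<theta> * measure lebesgue (ball c (N * s))"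
          using C[OF r, of c] mp by (simp add: \<beta>_def pos_divide_le_eq)
        also have "\<dots> \<le> \<bar>C\<bar> * (1 + N * s) powr \<theta> * measure lebesgue (ball c (N * s))"
          by (intro mult_right_mono) auto
        finally show "(LINT y:ball c (N * s)|lebesgue. norm (b y - \<beta>)) \<le> \<bar>C\<bar> * \<omega> * (N * s) ^ CARD('n) * (1 + N * s) powr \<theta>"
          unfolding m by (simp add: mult_ac)
      qed
      finally show ?thesis .
    qed
    let ?I = "\<integral>\<^sup>+x\<in>cube c s. ennreal (norm (b x - \<beta>)) \<partial>lebesgue"
    have I: "?I \<le> ennreal (\<bar>C\<bar> * \<omega> * (N * s) ^ CARD('n) * (1 + N * s) powr \<theta>)"
      using nn_integral_mono_set[OF Q] ballb by (rule order_trans)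
    have mean: "ennreal (norm (cube_mean b c s - \<beta>) * s ^ CARD('n)) \<le> ?I"
      by (rule cube_mean_diff_le[OF s(1) order_refl int])
    have "(\<integral>\<^sup>+x\<in>cube c s. ennreal (norm (b x - cube_mean b c s)) \<partial>lebesgue) \<le>
      (\<integral>\<^sup>+x. ennreal (norm (b x - \<beta>)) * indicator (cube c s) x + ennreal (norm (cube_mean b c s - \<beta>)) * indicator (cube c s) x \<partial>lebesgue)"
    proof (rule nn_integral_mono)
      fix x
      show "ennreal (norm (b x - cube_mean b c s)) * indicator (cube c s) x \<le>
        ennreal (norm (b x - \<beta>)) * indicator (cube c s) x + ennreal (norm (cube_mean b c s - \<beta>)) * indicator (cube c s) x"
        using norm_triangle_ineq4[of "b x - \<beta>" "cube_mean b c s - \<beta>"]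
        by (auto simp: indicator_def simp flip: ennreal_plus intro!: ennreal_leI)
    qed
    also have "\<dots> = ?I + ennreal (norm (cube_mean b c s - \<beta>)) * emeasure lebesgue (cube c s)"
      by (subst nn_integral_add) (auto simp: nn_integral_cmult_indicator)
    also have "\<dots> = ?I + ennreal (norm (cube_mean b c s - \<beta>) * s ^ CARD('n))"
      unfolding emeasure_cube[OF s(1)] using s by (simp add: ennreal_mult)
    also have "\<dots> \<le> ?I + ?I" by (intro add_left_mono mean)
    also have "\<dots> \<le> ennreal (\<bar>C\<bar> * \<omega> * (N * s) ^ CARD('n) * (1 + N * s) powr \<theta>) + ennreal (\<bar>C\<bar> * \<omega> * (N * s) ^ CARD('n) * (1 + N * s) powr \<theta>)"
      by (intro add_mono I)
    also have "\<dots> = ennreal (2 * (\<bar>C\<bar> * \<omega> * (N * s) ^ CARD('n) * (1 + N * s) powr \<theta>))"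
      using \<omega> r by (subst ennreal_plus[symmetric]) auto
    also have "\<dots> \<le> ennreal (A0 * (1 + s0) powr \<theta> * s ^ CARD('n))"
    proof (rule ennreal_leI)
      have "1 + N * s \<le> N * (1 + s0)" using N s by (simp add: distrib_left) (metis add_mono mult_left_mono order_trans zero_le_one)
      then have "(1 + N * s) powr \<theta> \<le> (N * (1 + s0)) powr \<theta>" using N s \<theta> by (intro powr_mono2) auto
      also have "\<dots> = N powr \<theta> * (1 + s0) powr \<theta>" using N s by (simp add: powr_mult)
      finally have "2 * (\<bar>C\<bar> * \<omega> * (N * s) ^ CARD('n) * (1 + N * s) powr \<theta>) \<le> 2 * (\<bar>C\<bar> * \<omega> * (N * s) ^ CARD('n) * (N powr \<theta> * (1 + s0) powr \<theta>))"
        using \<omega> r by (intro mult_left_mono) auto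
      also have "\<dots> = (2 * (\<bar>C\<bar> * \<omega> * N ^ CARD('n) * N powr \<theta>)) * (1 + s0) powr \<theta> * s ^ CARD('n)"
        by (simp add: power_mult_distrib mult_ac)
      also have "\<dots> \<le> A0 * (1 + s0) powr \<theta> * s ^ CARD('n)"
        using s by (intro mult_right_mono) (auto simp: A0_def)
      finally show "2 * (\<bar>C\<bar> * \<omega> * (N * s) ^ CARD('n) * (1 + N * s) powr \<theta>) \<le> A0 * (1 + s0) powr \<theta> * s ^ CARD('n)" .
    qed
    finally show "(\<integral>\<^sup>+x\<in>cube c s. ennreal (norm (b x - cube_mean b c s)) \<partial>lebesgue) \<le> ennreal (A0 * (1 + s0) powr \<theta> * s ^ CARD('n))" .
  qed
qed

lemma BMO_weighted_moment:
  fixes b :: "real^'n::finite \<Rightarrow> complex"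
  assumes dw: "dual_weights p q W V C \<theta>" and b: "b \<in> BMO \<theta>b" and \<theta>b: "0 < \<theta>b" and P: "1 \<le> P"
  obtains K0 M where "K0 \<ge> 0" "M \<ge> 0"
    "\<And>c s. 0 < s \<Longrightarrow> (\<integral>\<^sup>+x\<in>cube c s. ennreal (norm (b x - cube_mean b c s) powr P) * W x \<partial>lebesgue)
       \<le> ennreal (K0 * (1 + s) powr M) * (\<integral>\<^sup>+x\<in>cube c s. W x \<partial>lebesgue)"
proof -
  have [measurable]: "W \<in> borel_measurable lebesgue" using dw by (auto simp: dual_weights_def)
  have "locally_integrable b" using b by (auto simp: BMO_def)
  then have [measurable]: "b \<in> borel_measurable lebesgue" by (rule borel_measurable_locally_integrable)
  define \<mu> where "\<mu> = density lebesgue W"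
  obtain A0 where A0: "A0 > 0" and osc: "\<And>s0. s0 > 0 \<Longrightarrow> bounded_oscillation b (A0 * (1 + s0) powr \<theta>b) s0"
    using BMO_bounded_oscillation[OF b \<theta>b] by blast
  obtain G M where G: "G \<ge> 1" and M: "M \<ge> 0" and A_inf:
    "\<And>s0 c s E. 0 < s \<Longrightarrow> s \<le> s0 \<Longrightarrow> E \<in> sets lebesgue \<Longrightarrow> E \<subseteq> cube c s \<Longrightarrow>
      s ^ CARD('n) / 2 \<le> measure lebesgue E \<Longrightarrow> measure \<mu> (cube c s) \<le> (G * (1 + s0) powr M) * measure \<mu> E"
    using dual_weights_A_infinity[OF dw] unfolding \<mu>_def by metis
  define K1 where "K1 = (2 * P + 1) * G * (2 + 2 ^ CARD('n)) * A0"
  have K1: "K1 \<ge> 0" using P G A0 by (simp add: K1_def)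
  show ?thesis
  proof (rule that[of "K1 powr P" "(M + \<theta>b) * P"])
    show "K1 powr P \<ge> 0" "(M + \<theta>b) * P \<ge> 0" using P M \<theta>b by auto
    fix c :: "real^'n" and s :: real assume s: "0 < s"
    interpret bounded_oscillation b "A0 * (1 + s) powr \<theta>b" s by (rule osc[OF s])
    define K where "K = (2 * P + 1) * (G * (1 + s) powr M) * (2 * (A0 * (1 + s) powr \<theta>b) + 2 ^ CARD('n) * (A0 * (1 + s) powr \<theta>b))"
    have "(1 + s) powr M \<ge> 1" using s M by (simp add: ge_one_powr_ge_zero)
    then have G1: "1 \<le> G * (1 + s) powr M" using G mult_mono[of 1 G 1 "(1 + s) powr M"] by simp
    have K: "K = K1 * (1 + s) powr (M + \<theta>b)"
      using s by (simp add: K_def K1_def powr_add algebra_simps)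
    have "(\<integral>\<^sup>+x\<in>cube c s. ennreal (norm (b x - cube_mean b c s) powr P) \<partial>\<mu>) \<le> ennreal (K powr P) * emeasure \<mu> (cube c s)"
    proof (rule weighted_John_Nirenberg[OF _ _ P G1 _ _ K_def s order_refl])
      show "sets \<mu> = sets lebesgue" by (simp add: \<mu>_def)
      show "absolutely_continuous lebesgue \<mu>" unfolding \<mu>_def by (rule absolutely_continuousI_density) simp
      show "emeasure \<mu> (cube c' s') < top" if "0 < s'" for c' s'
      proof -
        have "emeasure \<mu> (cube c' s') = (\<integral>\<^sup>+y\<in>cube c' s'. W y \<partial>lebesgue)"
          unfolding \<mu>_def by (simp add: emeasure_density)
        also have "\<dots> \<le> (\<integral>\<^sup>+y\<in>ball c' ((real CARD('n) + 1) * s'). W y \<partial>lebesgue)"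
          by (rule nn_integral_mono_set[OF cube_subset_ball[OF that]])
        also have "\<dots> < top" using dw that by (auto simp: dual_weights_def)
        finally show ?thesis .
      qed
      show "measure \<mu> (cube c' s') \<le> G * (1 + s) powr M * measure \<mu> E"
        if "0 < s'" "s' \<le> s" "E \<in> sets lebesgue" "E \<subseteq> cube c' s'" "s' ^ CARD('n) / 2 \<le> measure lebesgue E" for c' s' E
        by (rule A_inf[OF that])
    qed
    also have "emeasure \<mu> (cube c s) = (\<integral>\<^sup>+x\<in>cube c s. W x \<partial>lebesgue)"
      unfolding \<mu>_def by (simp add: emeasure_density)
    also have "(\<integral>\<^sup>+x\<in>cube c s. ennreal (norm (b x - cube_mean b c s) powr P) \<partial>\<mu>) =
        (\<integral>\<^sup>+x\<in>cube c s. ennreal (norm (b x - cube_mean b c s) powr P) * W x \<partial>lebesgue)"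
      unfolding \<mu>_def by (subst nn_integral_density) (auto simp: mult_ac)
    also have "K powr P = K1 powr P * (1 + s) powr ((M + \<theta>b) * P)"
      unfolding K using K1 s by (simp add: powr_mult powr_powr)
    finally show "(\<integral>\<^sup>+x\<in>cube c s. ennreal (norm (b x - cube_mean b c s) powr P) * W x \<partial>lebesgue)
       \<le> ennreal (K1 powr P * (1 + s) powr ((M + \<theta>b) * P)) * (\<integral>\<^sup>+x\<in>cube c s. W x \<partial>lebesgue)" .
  qed
qed

section \<open>Kernels tested scale by scale\<close>

text \<open>The quantity appearing in \<open>one_scale_bound\<close>, with at most polynomial growth relative to \<open>r\<^bsup>np\<^esup>\<close>, which is its
  order of magnitude if \<open>W\<close>, \<open>V\<close> and \<open>D\<close> are constant.\<close>

definition scale_test ::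
  "real \<Rightarrow> real \<Rightarrow> (real^'n::finite \<Rightarrow> ennreal) \<Rightarrow> (real^'n \<Rightarrow> ennreal) \<Rightarrow> (real^'n \<Rightarrow> real^'n \<Rightarrow> ennreal) \<Rightarrow> bool" where
  "scale_test p q W V D \<longleftrightarrow> (\<exists>\<kappa> M. 0 \<le> \<kappa> \<and> 0 \<le> M \<and> (\<forall>r y. r > 0 \<longrightarrow>
     (\<integral>\<^sup>+x\<in>ball y r. W x * ennpowr (\<integral>\<^sup>+z\<in>ball x r. ennpowr (D x z) q * V z \<partial>lebesgue) (p - 1) \<partial>lebesgue)
       \<le> ennreal (\<kappa> * (1 + r) powr M * (r ^ CARD('n)) powr p)))"

lemma mass_product_real:
  fixes C r \<theta> p a :: real
  assumes "0 \<le> C" "0 < r" "1 < p" "1 \<le> a" "0 \<le> \<theta>"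
  shows "(C * (a * r) ^ n * (1 + a * r) powr \<theta>) powr p \<le> (C * a ^ n * a powr \<theta>) powr p * (1 + r) powr (\<theta> * p) * (r ^ n) powr p"
proof -
  have "1 + a * r \<le> a * (1 + r)" using assms by (simp add: distrib_left)
  then have "(1 + a * r) powr \<theta> \<le> (a * (1 + r)) powr \<theta>" using assms by (intro powr_mono2) auto
  also have "\<dots> = a powr \<theta> * (1 + r) powr \<theta>" using assms by (simp add: powr_mult)
  finally have "C * (a * r) ^ n * (1 + a * r) powr \<theta> \<le> C * (a * r) ^ n * (a powr \<theta> * (1 + r) powr \<theta>)"
    using assms by (intro mult_left_mono) auto
  then have "(C * (a * r) ^ n * (1 + a * r) powr \<theta>) powr p \<le> (C * (a * r) ^ n * (a powr \<theta> * (1 + r) powr \<theta>)) powr p"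
    using assms by (intro powr_mono2) auto
  also have "\<dots> = (C * a ^ n * a powr \<theta>) powr p * (1 + r) powr (\<theta> * p) * (r ^ n) powr p"
    using assms by (simp add: powr_mult powr_powr power_mult_distrib mult_ac)
  finally show ?thesis .
qed

lemma ball_ball_subset: "x \<in> ball y r \<Longrightarrow> ball x r \<subseteq> ball y (2 * r)" for x :: "'a::metric_space"
  by (auto simp: subset_iff) (smt (verit) dist_triangle)

text \<open>Both balls lie in the ball of radius \<open>2 r\<close> about \<open>y\<close>.\<close>

lemma scale_test_one:
  fixes W :: "real^'n::finite \<Rightarrow> ennreal"
  assumes dw: "dual_weights p q W V C \<theta>"
  shows "scale_test p q W V (\<lambda>x y. 1)"
proof -
  have p: "p > 1" "q > 1" "0 \<le> C" "0 \<le> \<theta>" using dw by (auto simp: dual_weights_def)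
  have [measurable]: "W \<in> borel_measurable lebesgue" "V \<in> borel_measurable lebesgue" using dw by (auto simp: dual_weights_def)
  have one: "ennpowr 1 q = 1" using ennpowr_ennreal[of 1 q] p by simp
  show ?thesis unfolding scale_test_def
  proof (intro exI conjI allI impI)
    show "0 \<le> (C * 2 ^ CARD('n) * 2 powr \<theta>) powr p" "0 \<le> \<theta> * p" using p by auto
    fix r :: real and y :: "real^'n" assume r: "r > 0"
    let ?B = "ball y (2 * r)"
    have "(\<integral>\<^sup>+x\<in>ball y r. W x * ennpowr (\<integral>\<^sup>+z\<in>ball x r. ennpowr 1 q * V z \<partial>lebesgue) (p - 1) \<partial>lebesgue)
      \<le> (\<integral>\<^sup>+x. W x * indicator ?B x * ennpowr (\<integral>\<^sup>+z\<in>?B. V z \<partial>lebesgue) (p - 1) \<partial>lebesgue)"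
    proof (rule nn_integral_mono)
      fix x
      show "W x * ennpowr (\<integral>\<^sup>+z\<in>ball x r. ennpowr 1 q * V z \<partial>lebesgue) (p - 1) * indicator (ball y r) x
        \<le> W x * indicator ?B x * ennpowr (\<integral>\<^sup>+z\<in>?B. V z \<partial>lebesgue) (p - 1)"
      proof (cases "x \<in> ball y r")
        case True
        then have "x \<in> ?B" using r by auto
        moreover have "ennpowr (\<integral>\<^sup>+z\<in>ball x r. V z \<partial>lebesgue) (p - 1) \<le> ennpowr (\<integral>\<^sup>+z\<in>?B. V z \<partial>lebesgue) (p - 1)"
          using p by (intro ennpowr_mono nn_integral_mono_set ball_ball_subset True) auto
        ultimately show ?thesis using True by (simp add: one mult_left_mono)
      qed simp
    qed
    also have "\<dots> = (\<integral>\<^sup>+x\<in>?B. W x \<partial>lebesgue) * ennpowr (\<integral>\<^sup>+z\<in>?B. V z \<partial>lebesgue) (p - 1)"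
      by (rule nn_integral_multc) measurable
    also have "\<dots> \<le> ennreal ((C * (2 * r) ^ CARD('n) * (1 + 2 * r) powr \<theta>) powr p)"
      using r by (intro dual_weights_mass_product[OF dw]) auto
    also have "\<dots> \<le> ennreal ((C * 2 ^ CARD('n) * 2 powr \<theta>) powr p * (1 + r) powr (\<theta> * p) * (r ^ CARD('n)) powr p)"
      using p r by (intro ennreal_leI mass_product_real) auto
    finally show "(\<integral>\<^sup>+x\<in>ball y r. W x * ennpowr (\<integral>\<^sup>+z\<in>ball x r. ennpowr 1 q * V z \<partial>lebesgue) (p - 1) \<partial>lebesgue)
      \<le> \<dots>" .
  qed
qed

text \<open>Compare \<open>b x\<close> and \<open>b z\<close> with the mean \<open>\<beta>\<close> of \<open>b\<close> on a cube \<open>Q\<close> containing both points. The moment in \<open>z\<close> is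
  of order \<open>q\<close> against \<open>V\<close>, the one in \<open>x\<close> of order \<open>q (p - 1) = p\<close> against \<open>W\<close>.\<close>

lemma scale_test_oscillation:
  fixes W :: "real^'n::finite \<Rightarrow> ennreal" and b :: "real^'n \<Rightarrow> complex"
  assumes dw: "dual_weights p q W V C \<theta>" and b: "b \<in> BMO \<theta>b" and \<theta>b: "0 < \<theta>b"
  shows "scale_test p q W V (\<lambda>x y. ennreal (norm (b x - b y)))"
proof -
  have p: "p > 1" "q > 1" "0 \<le> C" "0 \<le> \<theta>" "1 / p + 1 / q = 1" using dw by (auto simp: dual_weights_def)
  have pos: "0 < p" "0 < q" "0 < p - 1" using p by auto
  have qp: "q * (p - 1) = p" using p by (simp add: field_simps)
  have [measurable]: "W \<in> borel_measurable lebesgue" "V \<in> borel_measurable lebesgue" using dw by (auto simp: dual_weights_def)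
  have "locally_integrable b" using b by (auto simp: BMO_def)
  then have [measurable]: "b \<in> borel_measurable lebesgue" by (rule borel_measurable_locally_integrable)
  obtain K1 M1 where K1: "K1 \<ge> 0" "M1 \<ge> 0" and mW:
    "\<And>c s. 0 < s \<Longrightarrow> (\<integral>\<^sup>+x\<in>cube c s. ennreal (norm (b x - cube_mean b c s) powr p) * W x \<partial>lebesgue)
       \<le> ennreal (K1 * (1 + s) powr M1) * (\<integral>\<^sup>+x\<in>cube c s. W x \<partial>lebesgue)"
    using BMO_weighted_moment[OF dw b \<theta>b, of p] p by auto
  obtain K2 M2 where K2: "K2 \<ge> 0" "M2 \<ge> 0" and mV:
    "\<And>c s. 0 < s \<Longrightarrow> (\<integral>\<^sup>+x\<in>cube c s. ennreal (norm (b x - cube_mean b c s) powr q) * V x \<partial>lebesgue)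
       \<le> ennreal (K2 * (1 + s) powr M2) * (\<integral>\<^sup>+x\<in>cube c s. V x \<partial>lebesgue)"
    using BMO_weighted_moment[OF dual_weights_commute[OF dw] b \<theta>b, of q] p by auto
  define N where "N = (real CARD('n) + 1) * 4"
  have N: "N \<ge> 1" by (simp add: N_def)
  define E where "E = 2 powr (p - 1) * 2 powr p"
  define H where "H = (K1 * 4 powr M1 + (K2 * 4 powr M2) powr (p - 1))"
  define M where "M = M1 + M2 * (p - 1)"
  have EH: "E \<ge> 0" "H \<ge> 0" "M \<ge> 0" using K1 K2 p by (auto simp: E_def H_def M_def)
  show ?thesis unfolding scale_test_def
  proof (intro exI conjI allI impI)
    show "0 \<le> E * H * (C * N ^ CARD('n) * N powr \<theta>) powr p" "0 \<le> M + \<theta> * p" using p EH by auto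
    fix r :: real and y :: "real^'n" assume r: "r > 0"
    \<comment> \<open>The cube of side \<open>4 r\<close> centred at \<open>y\<close>, which contains \<open>ball x r\<close> for each \<open>x\<close> in \<open>ball y r\<close>.\<close>
    define c where "c = y - (2 * r) *\<^sub>R (\<chi> i. 1)"
    define Q where "Q = cube c (4 * r)"
    define \<beta> where "\<beta> = cube_mean b c (4 * r)"
    have s: "0 < 4 * r" using r by simp
    have BQ: "ball y (2 * r) \<subseteq> Q"
    proof
      fix x assume "x \<in> ball y (2 * r)"
      then have "norm (x - y) < 2 * r" by (simp add: dist_norm norm_minus_commute)
      then have "\<bar>x $ i - y $ i\<bar> < 2 * r" for i
        using component_le_norm_cart[of "x - y" i] by simp
      then show "x \<in> Q" unfolding Q_def cube_def c_def by (auto simp: abs_less_iff algebra_simps) (smt (verit))+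
    qed
    have Nr: "N * r = (real CARD('n) + 1) * (4 * r)" by (simp add: N_def)
    have QB: "Q \<subseteq> ball c (N * r)" unfolding Q_def Nr by (rule cube_subset_ball[OF s])
    have Qm [measurable]: "Q \<in> sets lebesgue" by (simp add: Q_def)
    define X where "X x = ennreal (norm (b x - \<beta>))" for x
    have [measurable]: "X \<in> borel_measurable lebesgue" unfolding X_def by measurable
    note [measurable] = borel_measurable_ennpowr'[OF _ pos(1)] borel_measurable_ennpowr'[OF _ pos(2)]
    define k1 where "k1 = K1 * (1 + 4 * r) powr M1"
    define k2 where "k2 = K2 * (1 + 4 * r) powr M2"
    have k: "k1 \<ge> 0" "k2 \<ge> 0" using K1 K2 by (auto simp: k1_def k2_def)
    let ?W = "\<integral>\<^sup>+x\<in>Q. W x \<partial>lebesgue" and ?V = "\<integral>\<^sup>+x\<in>Q. V x \<partial>lebesgue"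
    have mX: "(\<integral>\<^sup>+x\<in>Q. ennpowr (X x) p * W x \<partial>lebesgue) \<le> ennreal k1 * ?W"
      "(\<integral>\<^sup>+x\<in>Q. ennpowr (X x) q * V x \<partial>lebesgue) \<le> ennreal k2 * ?V"
      using mW[OF s, of c] mV[OF s, of c] pos by (simp_all add: X_def ennpowr_ennreal Q_def k1_def k2_def \<beta>_def)
    have inner: "ennpowr (\<integral>\<^sup>+z\<in>ball x r. ennpowr (ennreal (norm (b x - b z))) q * V z \<partial>lebesgue) (p - 1) \<le>
       ennreal E * (ennpowr (X x) p + ennreal (k2 powr (p - 1))) * ennpowr ?V (p - 1)" if x: "x \<in> ball y r" for x
    proof -
      have "(\<integral>\<^sup>+z\<in>ball x r. ennpowr (ennreal (norm (b x - b z))) q * V z \<partial>lebesgue) \<le>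
        (\<integral>\<^sup>+z. ennreal (2 powr q) * (ennpowr (X x) q * (V z * indicator Q z) + ennpowr (X z) q * V z * indicator Q z) \<partial>lebesgue)"
      proof (rule nn_integral_mono)
        fix z
        have "ennreal (norm (b x - b z)) \<le> X x + X z"
          unfolding X_def using norm_triangle_ineq4[of "b x - \<beta>" "b z - \<beta>"] by (simp flip: ennreal_plus)
        then have "ennpowr (ennreal (norm (b x - b z))) q \<le> ennpowr (X x + X z) q" by (rule ennpowr_mono[OF pos(2)])
        also have "\<dots> \<le> ennreal (2 powr q) * (ennpowr (X x) q + ennpowr (X z) q)" by (rule ennpowr_add_le[OF pos(2)])
        finally have "ennpowr (ennreal (norm (b x - b z))) q * (V z * indicator (ball x r) z) \<le>
          ennreal (2 powr q) * (ennpowr (X x) q + ennpowr (X z) q) * (V z * indicator Q z)"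
          using ball_ball_subset[OF x] BQ by (intro mult_mono) (auto simp: indicator_def)
        then show "ennpowr (ennreal (norm (b x - b z))) q * V z * indicator (ball x r) z \<le>
          ennreal (2 powr q) * (ennpowr (X x) q * (V z * indicator Q z) + ennpowr (X z) q * V z * indicator Q z)"
          by (simp add: algebra_simps)
      qed
      also have "\<dots> = ennreal (2 powr q) * (ennpowr (X x) q * ?V + (\<integral>\<^sup>+x\<in>Q. ennpowr (X x) q * V x \<partial>lebesgue))"
        by (simp add: nn_integral_cmult nn_integral_add)
      also have "\<dots> \<le> ennreal (2 powr q) * (ennpowr (X x) q * ?V + ennreal k2 * ?V)"
        by (intro mult_left_mono add_left_mono mX) auto
      also have "\<dots> = ennreal (2 powr q) * (ennpowr (X x) q + ennreal k2) * ?V"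
        by (simp add: algebra_simps)
      finally have "ennpowr (\<integral>\<^sup>+z\<in>ball x r. ennpowr (ennreal (norm (b x - b z))) q * V z \<partial>lebesgue) (p - 1) \<le>
        ennpowr (ennreal (2 powr q) * (ennpowr (X x) q + ennreal k2) * ?V) (p - 1)"
        by (rule ennpowr_mono[OF pos(3)])
      also have "\<dots> = ennreal (2 powr p) * ennpowr (ennpowr (X x) q + ennreal k2) (p - 1) * ennpowr ?V (p - 1)"
        using pos by (simp add: ennpowr_mult ennpowr_ennreal powr_powr qp)
      also have "\<dots> \<le> ennreal (2 powr p) * (ennreal (2 powr (p - 1)) * (ennpowr (ennpowr (X x) q) (p - 1) + ennpowr (ennreal k2) (p - 1))) * ennpowr ?V (p - 1)"
        by (intro mult_left_mono mult_right_mono ennpowr_add_le pos) auto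
      also have "\<dots> = ennreal E * (ennpowr (X x) p + ennreal (k2 powr (p - 1))) * ennpowr ?V (p - 1)"
        using pos k by (simp add: E_def ennpowr_ennpowr qp ennpowr_ennreal ennreal_mult mult_ac)
      finally show ?thesis .
    qed
    have "(\<integral>\<^sup>+x\<in>ball y r. W x * ennpowr (\<integral>\<^sup>+z\<in>ball x r. ennpowr (ennreal (norm (b x - b z))) q * V z \<partial>lebesgue) (p - 1) \<partial>lebesgue) \<le>
      (\<integral>\<^sup>+x. ennreal E * ennpowr ?V (p - 1) * (ennpowr (X x) p * W x * indicator Q x + ennreal (k2 powr (p - 1)) * (W x * indicator Q x)) \<partial>lebesgue)"
    proof (rule nn_integral_mono)
      fix x
      show "W x * ennpowr (\<integral>\<^sup>+z\<in>ball x r. ennpowr (ennreal (norm (b x - b z))) q * V z \<partial>lebesgue) (p - 1) * indicator (ball y r) x \<le>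
        ennreal E * ennpowr ?V (p - 1) * (ennpowr (X x) p * W x * indicator Q x + ennreal (k2 powr (p - 1)) * (W x * indicator Q x))"
      proof (cases "x \<in> ball y r")
        case True
        then have "x \<in> Q" using BQ r by auto
        have "W x * ennpowr (\<integral>\<^sup>+z\<in>ball x r. ennpowr (ennreal (norm (b x - b z))) q * V z \<partial>lebesgue) (p - 1) \<le>
          W x * (ennreal E * (ennpowr (X x) p + ennreal (k2 powr (p - 1))) * ennpowr ?V (p - 1))"
          by (intro mult_left_mono inner True) auto
        then show ?thesis using True \<open>x \<in> Q\<close> by (simp add: algebra_simps)
      qed simp
    qed
    also have "\<dots> = ennreal E * ennpowr ?V (p - 1) * ((\<integral>\<^sup>+x\<in>Q. ennpowr (X x) p * W x \<partial>lebesgue) + ennreal (k2 powr (p - 1)) * ?W)"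
      by (simp add: nn_integral_cmult nn_integral_add)
    also have "\<dots> \<le> ennreal E * ennpowr ?V (p - 1) * (ennreal k1 * ?W + ennreal (k2 powr (p - 1)) * ?W)"
      by (intro mult_left_mono add_right_mono mX) auto
    also have "\<dots> = ennreal (E * (k1 + k2 powr (p - 1))) * (?W * ennpowr ?V (p - 1))"
      using EH k by (simp add: ennreal_mult ennreal_plus algebra_simps)
    also have "\<dots> \<le> ennreal (E * (k1 + k2 powr (p - 1))) * ennreal ((C * (N * r) ^ CARD('n) * (1 + N * r) powr \<theta>) powr p)"
      using N r by (intro mult_left_mono dual_weights_mass_product[OF dw _ QB QB]) auto
    also have "\<dots> \<le> ennreal (E * (H * (1 + r) powr M)) * ennreal ((C * N ^ CARD('n) * N powr \<theta>) powr p * (1 + r) powr (\<theta> * p) * (r ^ CARD('n)) powr p)"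
    proof (intro mult_mono ennreal_leI mult_left_mono)
      have r4: "(1 + 4 * r) powr e \<le> 4 powr e * (1 + r) powr e" if "e \<ge> 0" for e
        using r that powr_mono2[of e "1 + 4 * r" "4 * (1 + r)"] by (subst powr_mult[symmetric]) auto
      have "k1 \<le> K1 * (4 powr M1 * (1 + r) powr M1)" unfolding k1_def by (intro mult_left_mono r4 K1)
      also have "\<dots> \<le> K1 * 4 powr M1 * (1 + r) powr M"
        using K1 K2 r p by (simp add: mult.assoc M_def) (intro mult_left_mono powr_mono, auto)
      finally have a: "k1 \<le> K1 * 4 powr M1 * (1 + r) powr M" .
      have "k2 \<le> K2 * (4 powr M2 * (1 + r) powr M2)" unfolding k2_def by (intro mult_left_mono r4 K2)
      then have "k2 powr (p - 1) \<le> (K2 * (4 powr M2 * (1 + r) powr M2)) powr (p - 1)"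
        using k p by (intro powr_mono2) auto
      also have "\<dots> = (K2 * 4 powr M2) powr (p - 1) * (1 + r) powr (M2 * (p - 1))"
        using K2 r by (simp add: powr_mult powr_powr)
      also have "\<dots> \<le> (K2 * 4 powr M2) powr (p - 1) * (1 + r) powr M"
        using K1 K2 r p by (intro mult_left_mono powr_mono) (auto simp: M_def)
      finally show "k1 + k2 powr (p - 1) \<le> H * (1 + r) powr M" using a by (simp add: H_def algebra_simps)
      show "(C * (N * r) ^ CARD('n) * (1 + N * r) powr \<theta>) powr p \<le> (C * N ^ CARD('n) * N powr \<theta>) powr p * (1 + r) powr (\<theta> * p) * (r ^ CARD('n)) powr p"
        using p r N by (intro mass_product_real) auto
    qed (use EH k in auto)
    also have "\<dots> = ennreal (E * H * (C * N ^ CARD('n) * N powr \<theta>) powr p * (1 + r) powr (M + \<theta> * p) * (r ^ CARD('n)) powr p)"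
      using EH r by (simp add: powr_add mult_ac flip: ennreal_mult)
    finally show "(\<integral>\<^sup>+x\<in>ball y r. W x * ennpowr (\<integral>\<^sup>+z\<in>ball x r. ennpowr (ennreal (norm (b x - b z))) q * V z \<partial>lebesgue) (p - 1) \<partial>lebesgue) \<le> \<dots>" .
  qed
qed

lemma dyadic_scale_above_1:
  fixes d :: real assumes "1 \<le> d"
  obtains l where "2 ^ l \<le> d" "d < 2 ^ Suc l"
proof -
  obtain m where m: "d < 2 ^ m" using real_arch_pow[of 2 d] by auto
  define m0 where "m0 = (LEAST m. d < 2 ^ m)"
  have 1: "d < 2 ^ m0" unfolding m0_def by (rule LeastI[of _ m]) (use m in simp)
  then have "m0 \<noteq> 0" using assms by (intro notI) simp
  then obtain l where l: "m0 = Suc l" by (cases m0) auto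
  have "\<not> d < 2 ^ l" using not_less_Least[of l "\<lambda>m. d < 2 ^ m"] l unfolding m0_def by simp
  then show ?thesis using that[of l] 1 l by simp
qed

lemma dyadic_scale_below_1:
  fixes d :: real assumes d: "0 < d" "d < 1"
  obtains l where "(1/2) ^ Suc l \<le> d" "d < (1/2) ^ l"
proof -
  obtain m where m: "(1/2) ^ m < d" using real_arch_pow_inv[of d "1/2"] d by auto
  define m0 where "m0 = (LEAST m. (1/2) ^ m \<le> d)"
  have 1: "(1/2) ^ m0 \<le> d" unfolding m0_def by (rule LeastI[of _ m]) (use m in simp)
  then have "m0 \<noteq> 0" using d by (intro notI) simp
  then obtain l where l: "m0 = Suc l" by (cases m0) auto
  have "\<not> (1/2) ^ l \<le> d" using not_less_Least[of l "\<lambda>m. (1/2) ^ m \<le> d"] l unfolding m0_def by simp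
  then show ?thesis using that[of l] 1 l by simp
qed

lemma suminf_geometric_finite:
  fixes c t :: real assumes "0 \<le> c" "0 \<le> t" "t < 1"
  shows "(\<Sum>l. ennreal (c * t ^ l)) < top"
proof -
  have "summable (\<lambda>l. c * t ^ l)" using assms by (intro summable_mult summable_geometric) auto
  then have "(\<Sum>l. ennreal (c * t ^ l)) \<noteq> top"
    using assms by (intro ennreal_suminf_neq_top) auto
  then show ?thesis by (simp add: less_top)
qed

text \<open>Near the diagonal the kernel is at most a multiple of the sum over \<open>l\<close> of \<open>2\<^bsup>l(n-\<epsilon>)\<^esup>\<close> times the indicator of
  \<open>|x - y| < 2\<^bsup>-l\<^esup>\<close>, and away from it of the sum of \<open>2\<^bsup>-lL\<^esup>\<close> times the indicator of \<open>|x - y| < 2\<^bsup>l+1\<^esup>\<close>. The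
  single-scale bounds \<open>\<kappa> (1 + r)\<^sup>M r\<^bsup>np\<^esup>\<close> lead to convergent geometric series: half of \<open>\<epsilon>\<close> is spent on each
  of the two sums in \<open>sum_of_scales_bound\<close>, and \<open>L\<close> is chosen large depending on \<open>M\<close>.\<close>

lemma decaying_kernel_bound:
  fixes W :: "real^'n::finite \<Rightarrow> ennreal" and k D :: "real^'n \<Rightarrow> real^'n \<Rightarrow> ennreal"
  assumes dw: "dual_weights p q W V C \<theta>" and test: "scale_test p q W V D"
    and [measurable]: "(\<lambda>(x, y). D x y) \<in> borel_measurable (lebesgue \<Otimes>\<^sub>M lebesgue)"
    and \<epsilon>: "\<epsilon> > 0"
    and near: "\<And>x y. 0 < norm (x - y) \<Longrightarrow> norm (x - y) \<le> 1 \<Longrightarrow> k x y \<le> ennreal (A * norm (x - y) powr (\<epsilon> - real CARD('n))) * D x y"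
    and far: "\<And>L. \<exists>B. \<forall>x y. 1 \<le> norm (x - y) \<longrightarrow> k x y \<le> ennreal (B * norm (x - y) powr (- L)) * D x y"
  obtains C' :: real where "\<And>F. F \<in> borel_measurable lebesgue \<Longrightarrow>
       (\<integral>\<^sup>+x. ennpowr (\<integral>\<^sup>+y. k x y * F y \<partial>lebesgue) p * W x \<partial>lebesgue)
         \<le> ennreal C' * (\<integral>\<^sup>+y. ennpowr (F y) p * W y \<partial>lebesgue)"
proof -
  define n where "n = real CARD('n)"
  have n: "n \<ge> 1" by (simp add: n_def)
  have p: "p > 1" "q > 1" "1 / p + 1 / q = 1" using dw by (auto simp: dual_weights_def)
  have [measurable]: "W \<in> borel_measurable lebesgue" "V \<in> borel_measurable lebesgue" using dw by (auto simp: dual_weights_def)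
  have dual: "AE x in lebesgue. ennpowr (W x) (1 / p) * ennpowr (V x) (1 / q) = 1" using dw by (auto simp: dual_weights_def)
  have pos: "0 < p" using p by auto
  note [measurable] = borel_measurable_ennpowr'[OF _ pos(1)]
  obtain \<kappa> M where \<kappa>: "0 \<le> \<kappa>" "0 \<le> M" and t: "\<And>r y. r > 0 \<Longrightarrow>
     (\<integral>\<^sup>+x\<in>ball y r. W x * ennpowr (\<integral>\<^sup>+z\<in>ball x r. ennpowr (D x z) q * V z \<partial>lebesgue) (p - 1) \<partial>lebesgue)
       \<le> ennreal (\<kappa> * (1 + r) powr M * (r ^ CARD('n)) powr p)"
    using test unfolding scale_test_def by blast
  \<comment> \<open>This makes \<open>M + n p - (L - 1) p = -1\<close>, so the far scales contribute the series of \<open>2\<^bsup>-l\<^esup>\<close>.\<close>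
  define L where "L = n + 1 + (M + 1) / p"
  obtain B where far': "\<And>x y. 1 \<le> norm (x - y) \<Longrightarrow> k x y \<le> ennreal (B * norm (x - y) powr (- L)) * D x y"
    using far[of L] by blast
  define A1 where "A1 = \<bar>A\<bar> * 2 powr n"
  define h where "h F r x = (\<integral>\<^sup>+y\<in>ball x r. D x y * F y \<partial>lebesgue)" for F :: "real^'n \<Rightarrow> ennreal" and r x
  define u1 where "u1 = (2::real) powr (- \<epsilon> / 2)"
  define v1 where "v1 = (2::real) powr (n - \<epsilon> / 2)"
  define u2 where "u2 = (1 / 2 :: real)"
  define v2 where "v2 = (2::real) powr (- (L - 1))"
  have uv: "0 < u1" "u1 < 1" "0 < v1" "0 < u2" "u2 < 1" "0 < v2"
    using \<epsilon> by (auto simp: u1_def v1_def u2_def v2_def powr_less_one)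
  define S1 where "S1 F x = (\<Sum>l. ennreal (u1 ^ l) * ennreal (v1 ^ l) * h F ((1 / 2) ^ l) x)" for F x
  define S2 where "S2 F x = (\<Sum>l. ennreal (u2 ^ l) * ennreal (v2 ^ l) * h F (2 ^ (Suc l)) x)" for F x
  define \<kappa>1 where "\<kappa>1 l = ennreal (\<kappa> * (1 + (1/2) ^ l) powr M * (((1/2) ^ l) ^ CARD('n)) powr p)" for l :: nat
  define \<kappa>2 where "\<kappa>2 l = ennreal (\<kappa> * (1 + 2 ^ Suc l) powr M * ((2 ^ Suc l) ^ CARD('n)) powr p)" for l :: nat
  define Z1 where "Z1 = ennpowr (\<Sum>l. ennreal (u1 ^ l)) p * (\<Sum>l. ennpowr (ennreal (v1 ^ l)) p * \<kappa>1 l)"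
  define Z2 where "Z2 = ennpowr (\<Sum>l. ennreal (u2 ^ l)) p * (\<Sum>l. ennpowr (ennreal (v2 ^ l)) p * \<kappa>2 l)"
  have Z1: "Z1 < top"
  proof -
    have "ennpowr (ennreal (v1 ^ l)) p * \<kappa>1 l \<le> ennreal (\<kappa> * 2 powr M * (2 powr (- (\<epsilon> / 2 * p))) ^ l)" for l
    proof -
      have "(v1 ^ l) powr p * (((1/2) ^ l) ^ CARD('n)) powr p = (v1 ^ l * ((1/2) ^ l) ^ CARD('n)) powr p"
        using uv by (simp add: powr_mult)
      also have "v1 ^ l * ((1/2) ^ l) ^ CARD('n) = (v1 * (1 / 2) ^ CARD('n)) ^ l"
        by (simp add: power_mult_distrib power_mult[symmetric] mult.commute)
      also have "v1 * (1 / 2) ^ CARD('n) = 2 powr (n - \<epsilon> / 2) * 2 powr (- n)"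
        unfolding v1_def by (simp add: n_def powr_minus powr_realpow inverse_eq_divide power_one_over)
      also have "\<dots> = 2 powr (- \<epsilon> / 2)" by (simp flip: powr_add)
      also have "((2 powr (- \<epsilon> / 2)) ^ l) powr p = (2 powr (- (\<epsilon> / 2 * p))) ^ l"
        by (simp add: powr_realpow[symmetric] powr_powr mult_ac)
      finally have e: "(v1 ^ l) powr p * (((1/2) ^ l) ^ CARD('n)) powr p = (2 powr (- (\<epsilon> / 2 * p))) ^ l" .
      have "(1 + (1/2) ^ l) powr M \<le> 2 powr M"
        using \<kappa> power_le_one[of "1/2::real" l] by (intro powr_mono2) auto
      then have "\<kappa> * (1 + (1/2) ^ l) powr M * ((v1 ^ l) powr p * (((1/2) ^ l) ^ CARD('n)) powr p) \<le>
         \<kappa> * 2 powr M * (2 powr (- (\<epsilon> / 2 * p))) ^ l"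
        unfolding e using \<kappa> by (intro mult_right_mono mult_left_mono) auto
      then have "ennreal ((v1 ^ l) powr p * (\<kappa> * (1 + (1/2) ^ l) powr M * (((1/2) ^ l) ^ CARD('n)) powr p)) \<le>
         ennreal (\<kappa> * 2 powr M * (2 powr (- (\<epsilon> / 2 * p))) ^ l)"
        by (intro ennreal_leI) (simp add: mult_ac)
      then show ?thesis using uv p \<kappa> unfolding \<kappa>1_def by (simp add: ennpowr_ennreal ennreal_mult)
    qed
    then have "(\<Sum>l. ennpowr (ennreal (v1 ^ l)) p * \<kappa>1 l) \<le> (\<Sum>l. ennreal (\<kappa> * 2 powr M * (2 powr (- (\<epsilon> / 2 * p))) ^ l))"
      by (intro suminf_le) auto
    also have "\<dots> < top" using \<kappa> \<epsilon> p by (intro suminf_geometric_finite) (auto simp: powr_less_one)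
    finally have "(\<Sum>l. ennpowr (ennreal (v1 ^ l)) p * \<kappa>1 l) < top" .
    moreover have "(\<Sum>l. ennreal (u1 ^ l)) < top" by (rule suminf_geometric_finite[of 1 u1, unfolded mult_1_left]) (use uv in auto)
    ultimately show ?thesis unfolding Z1_def using pos by (simp add: ennreal_mult_less_top ennpowr_less_top_iff)
  qed
  have Z2: "Z2 < top"
  proof -
    have "ennpowr (ennreal (v2 ^ l)) p * \<kappa>2 l \<le> ennreal (\<kappa> * 4 powr M * 2 powr (n * p) * (1 / 2) ^ l)" for l
    proof -
      have "(1 + 2 ^ Suc l) powr M \<le> (4 * 2 ^ l) powr M"
      proof (rule powr_mono2)
        have "1 \<le> (2::real) ^ l" by simp
        then show "1 + 2 ^ Suc l \<le> 4 * (2::real) ^ l" unfolding power_Suc by linarith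
      qed (use \<kappa> in auto)
      also have "\<dots> = 4 powr M * (2 powr M) ^ l" by (simp add: powr_mult powr_realpow[symmetric] powr_powr mult_ac)
      finally have a: "(1 + 2 ^ Suc l) powr M \<le> 4 powr M * (2 powr M) ^ l" .
      have b: "((2 ^ Suc l) ^ CARD('n)) powr p = 2 powr (n * p) * (2 powr (n * p)) ^ l"
        by (simp add: power_mult_distrib powr_mult n_def powr_realpow[symmetric] powr_powr mult_ac)
      have c: "(v2 ^ l) powr p = (2 powr (- (L - 1) * p)) ^ l"
        unfolding v2_def by (simp add: powr_realpow[symmetric] powr_powr mult_ac)
      have ex: "M + n * p + - (L - 1) * p = - 1" using p by (simp add: L_def field_simps)
      have "(v2 ^ l) powr p * (\<kappa> * (1 + 2 ^ Suc l) powr M * ((2 ^ Suc l) ^ CARD('n)) powr p) \<le>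
         (v2 ^ l) powr p * (\<kappa> * (4 powr M * (2 powr M) ^ l) * ((2 ^ Suc l) ^ CARD('n)) powr p)"
        using \<kappa> a by (intro mult_left_mono mult_right_mono) auto
      also have "\<dots> = \<kappa> * 4 powr M * 2 powr (n * p) * ((2 powr M) * (2 powr (n * p)) * (2 powr (- (L - 1) * p))) ^ l"
        unfolding b c by (simp add: power_mult_distrib mult_ac)
      also have "(2 powr M) * (2 powr (n * p)) * (2 powr (- (L - 1) * p)) = (1 / 2 :: real)"
        unfolding powr_add[symmetric] ex by (simp add: powr_minus)
      finally have "ennreal ((v2 ^ l) powr p * (\<kappa> * (1 + 2 ^ Suc l) powr M * ((2 ^ Suc l) ^ CARD('n)) powr p)) \<le>
         ennreal (\<kappa> * 4 powr M * 2 powr (n * p) * (1 / 2) ^ l)" by (rule ennreal_leI)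
      then show ?thesis using uv p \<kappa> unfolding \<kappa>2_def by (simp add: ennpowr_ennreal ennreal_mult)
    qed
    then have "(\<Sum>l. ennpowr (ennreal (v2 ^ l)) p * \<kappa>2 l) \<le> (\<Sum>l. ennreal (\<kappa> * 4 powr M * 2 powr (n * p) * (1 / 2) ^ l))"
      by (intro suminf_le) auto
    also have "\<dots> < top" using \<kappa> by (intro suminf_geometric_finite) auto
    finally have "(\<Sum>l. ennpowr (ennreal (v2 ^ l)) p * \<kappa>2 l) < top" .
    moreover have "(\<Sum>l. ennreal (u2 ^ l)) < top" by (rule suminf_geometric_finite[of 1 u2, unfolded mult_1_left]) (use uv in auto)
    ultimately show ?thesis unfolding Z2_def using pos by (simp add: ennreal_mult_less_top ennpowr_less_top_iff)
  qed
  define T where "T = ennreal (2 powr p) * (ennpowr (ennreal A1) p * Z1 + ennpowr (ennreal \<bar>B\<bar>) p * Z2)"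
  have T: "T < top" using Z1 Z2 pos by (simp add: T_def ennreal_mult_less_top ennpowr_less_top_iff)
  show ?thesis
  proof (rule that[of "enn2real T"])
    fix F :: "real^'n \<Rightarrow> ennreal" assume [measurable]: "F \<in> borel_measurable lebesgue"
    have hm [measurable]: "h F r \<in> borel_measurable lebesgue" for r unfolding h_def by measurable
    have Dm [measurable]: "(\<lambda>y. D x y) \<in> borel_measurable lebesgue" for x
      using measurable_compose[OF measurable_Pair1'[of x lebesgue lebesgue] assms(3)] by simp
    define I where "I = (\<integral>\<^sup>+y. ennpowr (F y) p * W y \<partial>lebesgue)"
    have h: "(\<integral>\<^sup>+x. ennpowr (h F r x) p * W x \<partial>lebesgue) \<le> ennreal (\<kappa> * (1 + r) powr M * (r ^ CARD('n)) powr p) * I"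
      if "r > 0" for r
      unfolding h_def I_def by (rule one_scale_bound[OF _ _ _ _ p dual t[OF that]]) measurable
    have B1: "(\<integral>\<^sup>+x. ennpowr (S1 F x) p * W x \<partial>lebesgue) \<le> Z1 * I"
      unfolding S1_def Z1_def \<kappa>1_def by (rule sum_of_scales_bound[OF _ _ pos h]) auto
    have B2: "(\<integral>\<^sup>+x. ennpowr (S2 F x) p * W x \<partial>lebesgue) \<le> Z2 * I"
      unfolding S2_def Z2_def \<kappa>2_def by (rule sum_of_scales_bound[OF _ _ pos h]) auto
    have pt: "(\<integral>\<^sup>+y. k x y * F y \<partial>lebesgue) \<le> ennreal A1 * S1 F x + ennreal \<bar>B\<bar> * S2 F x" for x
    proof -
      let ?s1 = "\<lambda>y. \<Sum>l. ennreal (u1 ^ l) * ennreal (v1 ^ l) * (D x y * F y * indicator (ball x ((1 / 2) ^ l)) y)"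
      let ?s2 = "\<lambda>y. \<Sum>l. ennreal (u2 ^ l) * ennreal (v2 ^ l) * (D x y * F y * indicator (ball x (2 ^ Suc l)) y)"
      have AE: "AE y in lebesgue. y \<noteq> x" using AE_completion[OF AE_lborel_singleton[of x]] .
      have "(\<integral>\<^sup>+y. k x y * F y \<partial>lebesgue) \<le> (\<integral>\<^sup>+y. ennreal A1 * ?s1 y + ennreal \<bar>B\<bar> * ?s2 y \<partial>lebesgue)"
      proof (rule nn_integral_mono_AE)
        show "AE y in lebesgue. k x y * F y \<le> ennreal A1 * ?s1 y + ennreal \<bar>B\<bar> * ?s2 y"
          using AE
        proof eventually_elim
          case (elim y)
          define d where "d = norm (x - y)"
          have d: "d > 0" using elim by (simp add: d_def)
          have dd: "dist x y = d" by (simp add: d_def dist_norm)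
          show ?case
          proof (cases "d < 1")
            case True
            obtain l where l: "(1/2) ^ Suc l \<le> d" "d < (1/2) ^ l"
              by (rule dyadic_scale_below_1[OF d True])
            have "A * d powr (\<epsilon> - n) \<le> A1 * (u1 ^ l * v1 ^ l)"
            proof (cases "\<epsilon> \<le> n")
              case True
              have "d powr (\<epsilon> - n) \<le> ((1/2) ^ Suc l) powr (\<epsilon> - n)"
                using l True by (intro powr_mono2') auto
              also have "\<dots> = 2 powr (n - \<epsilon>) * (2 powr (n - \<epsilon>)) ^ l"
                by (simp add: powr_mult power_one_over powr_divide powr_realpow[symmetric] powr_powr powr_minus[symmetric] powr_diff field_simps)
              also have "\<dots> \<le> 2 powr n * (2 powr (n - \<epsilon>)) ^ l"
                using \<epsilon> by (intro mult_right_mono powr_mono) auto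
              also have "2 powr (n - \<epsilon>) = u1 * v1" by (simp add: u1_def v1_def flip: powr_add)
              finally have "\<bar>A\<bar> * d powr (\<epsilon> - n) \<le> A1 * (u1 ^ l * v1 ^ l)"
                unfolding A1_def by (simp add: mult.assoc power_mult_distrib mult_left_mono)
              moreover have "A * d powr (\<epsilon> - n) \<le> \<bar>A\<bar> * d powr (\<epsilon> - n)" by (intro mult_right_mono) auto
              ultimately show ?thesis by linarith
            next
              case False
              have "d powr (\<epsilon> - n) \<le> ((1/2) ^ l) powr (\<epsilon> - n)"
                using l d False by (intro powr_mono2) auto
              also have "\<dots> = (2 powr (n - \<epsilon>)) ^ l"
                by (simp add: power_one_over powr_divide powr_realpow[symmetric] powr_powr powr_minus[symmetric] powr_diff field_simps)
              also have "\<dots> \<le> 2 powr n * (2 powr (n - \<epsilon>)) ^ l"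
                using n ge_one_powr_ge_zero[of 2 n] by (simp add: mult_le_cancel_right1)
              also have "2 powr (n - \<epsilon>) = u1 * v1" by (simp add: u1_def v1_def flip: powr_add)
              finally have "\<bar>A\<bar> * d powr (\<epsilon> - n) \<le> A1 * (u1 ^ l * v1 ^ l)"
                unfolding A1_def by (simp add: mult.assoc power_mult_distrib mult_left_mono)
              moreover have "A * d powr (\<epsilon> - n) \<le> \<bar>A\<bar> * d powr (\<epsilon> - n)" by (intro mult_right_mono) auto
              ultimately show ?thesis by linarith
            qed
            then have "k x y * F y \<le> ennreal (A1 * (u1 ^ l * v1 ^ l)) * D x y * F y"
              using near[of x y] d True
              by (intro mult_right_mono order_trans[OF near] ennreal_leI) (auto simp: d_def n_def)
            also have "\<dots> = ennreal A1 * (ennreal (u1 ^ l) * ennreal (v1 ^ l) * (D x y * F y * indicator (ball x ((1 / 2) ^ l)) y))"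
              using uv l dd by (simp add: A1_def ennreal_mult mult_ac)
            also have "\<dots> \<le> ennreal A1 * ?s1 y"
              using sum_le_suminf[of "\<lambda>l. ennreal (u1 ^ l) * ennreal (v1 ^ l) * (D x y * F y * indicator (ball x ((1 / 2) ^ l)) y)" "{l}"]
              by (intro mult_left_mono) auto
            also have "\<dots> \<le> ennreal A1 * ?s1 y + ennreal \<bar>B\<bar> * ?s2 y" by simp
            finally show ?thesis .
          next
            case False
            obtain l where l: "2 ^ l \<le> d" "d < 2 ^ Suc l"
              by (rule dyadic_scale_above_1[of d]) (use False in auto)
            have L0: "L > 0" using n p \<kappa> by (simp add: L_def add_pos_nonneg)
            have "d powr (- L) \<le> (2 ^ l) powr (- L)"
              using l L0 by (intro powr_mono2') auto
            also have "\<dots> = (2 powr (- L)) ^ l" by (simp add: powr_realpow[symmetric] powr_powr mult_ac)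
            also have "2 powr (- L) = u2 * v2"
            proof -
              have "u2 * v2 = 2 powr (- 1) * (2::real) powr (- (L - 1))" by (simp add: u2_def v2_def powr_minus)
              also have "\<dots> = 2 powr (- 1 + - (L - 1))" by (rule powr_add[symmetric])
              also have "- 1 + - (L - 1) = - L" by simp
              finally show ?thesis by simp
            qed
            finally have "\<bar>B\<bar> * d powr (- L) \<le> \<bar>B\<bar> * (u2 ^ l * v2 ^ l)"
              by (simp add: power_mult_distrib mult_left_mono)
            moreover have "B * d powr (- L) \<le> \<bar>B\<bar> * d powr (- L)" by (intro mult_right_mono) auto
            ultimately have "B * d powr (- L) \<le> \<bar>B\<bar> * (u2 ^ l * v2 ^ l)" by linarith
            then have "k x y * F y \<le> ennreal (\<bar>B\<bar> * (u2 ^ l * v2 ^ l)) * D x y * F y"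
              using False by (intro mult_right_mono order_trans[OF far'] ennreal_leI) (auto simp: d_def)
            also have "\<dots> = ennreal \<bar>B\<bar> * (ennreal (u2 ^ l) * ennreal (v2 ^ l) * (D x y * F y * indicator (ball x (2 ^ Suc l)) y))"
              using uv l dd by (simp add: ennreal_mult mult_ac)
            also have "\<dots> \<le> ennreal \<bar>B\<bar> * ?s2 y"
              using sum_le_suminf[of "\<lambda>l. ennreal (u2 ^ l) * ennreal (v2 ^ l) * (D x y * F y * indicator (ball x (2 ^ Suc l)) y)" "{l}"]
              by (intro mult_left_mono) auto
            also have "\<dots> \<le> ennreal A1 * ?s1 y + ennreal \<bar>B\<bar> * ?s2 y" by simp
            finally show ?thesis .
          qed
        qed
      qed
      also have "\<dots> = ennreal A1 * S1 F x + ennreal \<bar>B\<bar> * S2 F x"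
        unfolding S1_def S2_def h_def by (simp add: nn_integral_add nn_integral_cmult nn_integral_suminf)
      finally show ?thesis .
    qed
    have [measurable]: "S1 F \<in> borel_measurable lebesgue" "S2 F \<in> borel_measurable lebesgue"
      unfolding S1_def S2_def by measurable
    have "(\<integral>\<^sup>+x. ennpowr (\<integral>\<^sup>+y. k x y * F y \<partial>lebesgue) p * W x \<partial>lebesgue) \<le>
      (\<integral>\<^sup>+x. ennreal (2 powr p) * (ennpowr (ennreal A1) p * (ennpowr (S1 F x) p * W x) + ennpowr (ennreal \<bar>B\<bar>) p * (ennpowr (S2 F x) p * W x)) \<partial>lebesgue)"
    proof (rule nn_integral_mono)
      fix x
      have "ennpowr (\<integral>\<^sup>+y. k x y * F y \<partial>lebesgue) p \<le> ennpowr (ennreal A1 * S1 F x + ennreal \<bar>B\<bar> * S2 F x) p"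
        by (rule ennpowr_mono[OF pos pt])
      also have "\<dots> \<le> ennreal (2 powr p) * (ennpowr (ennreal A1 * S1 F x) p + ennpowr (ennreal \<bar>B\<bar> * S2 F x) p)"
        by (rule ennpowr_add_le[OF pos])
      finally have "ennpowr (\<integral>\<^sup>+y. k x y * F y \<partial>lebesgue) p * W x \<le> ennreal (2 powr p) * (ennpowr (ennreal A1 * S1 F x) p + ennpowr (ennreal \<bar>B\<bar> * S2 F x) p) * W x"
        by (rule mult_right_mono) simp
      then show "ennpowr (\<integral>\<^sup>+y. k x y * F y \<partial>lebesgue) p * W x \<le> ennreal (2 powr p) * (ennpowr (ennreal A1) p * (ennpowr (S1 F x) p * W x) + ennpowr (ennreal \<bar>B\<bar>) p * (ennpowr (S2 F x) p * W x))"
        by (simp only: ennpowr_mult[OF pos] distrib_right mult.assoc)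
    qed
    also have "\<dots> = ennreal (2 powr p) * (ennpowr (ennreal A1) p * (\<integral>\<^sup>+x. ennpowr (S1 F x) p * W x \<partial>lebesgue) + ennpowr (ennreal \<bar>B\<bar>) p * (\<integral>\<^sup>+x. ennpowr (S2 F x) p * W x \<partial>lebesgue))"
      by (simp add: nn_integral_cmult nn_integral_add)
    also have "\<dots> \<le> ennreal (2 powr p) * (ennpowr (ennreal A1) p * (Z1 * I) + ennpowr (ennreal \<bar>B\<bar>) p * (Z2 * I))"
      by (intro mult_left_mono add_mono B1 B2) auto
    also have "\<dots> = T * I" unfolding T_def by (simp only: distrib_right distrib_left mult.assoc)
    also have "\<dots> = ennreal (enn2real T) * I" using T by simp
    finally show "(\<integral>\<^sup>+x. ennpowr (\<integral>\<^sup>+y. k x y * F y \<partial>lebesgue) p * W x \<partial>lebesgue)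
         \<le> ennreal (enn2real T) * (\<integral>\<^sup>+y. ennpowr (F y) p * W y \<partial>lebesgue)" by (simp add: I_def)
  qed
qed

section \<open>Fourier integrals and integration by parts\<close>

text \<open>From here on functions are mostly Borel measurable, for which this rule misdirects the measurability prover.\<close>

declare measurable_ident_lebesgue [measurable del]

lemma jap_ge: "1 \<le> jap \<xi>" "norm \<xi> \<le> jap \<xi>" "0 < jap \<xi>" "jap \<xi> \<le> 1 + norm \<xi>" "(jap \<xi>)\<^sup>2 = 1 + (norm \<xi>)\<^sup>2"
proof -
  have e: "jap \<xi> = sqrt (1 + (norm \<xi>)\<^sup>2)" by (simp add: jap_def powr_half_sqrt)
  show "1 \<le> jap \<xi>" "norm \<xi> \<le> jap \<xi>" by (auto simp: e intro: real_le_rsqrt)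
  then show "0 < jap \<xi>" by simp
  show "jap \<xi> \<le> 1 + norm \<xi>" unfolding e by (rule real_le_lsqrt) (auto simp: power2_eq_square algebra_simps)
  show "(jap \<xi>)\<^sup>2 = 1 + (norm \<xi>)\<^sup>2" unfolding e by simp
qed

lemma continuous_on_jap [continuous_intros]: "continuous_on UNIV jap"
  unfolding jap_def by (intro continuous_intros) (auto intro: add_pos_nonneg simp: add_nonneg_eq_0_iff)

lemma borel_measurable_jap [measurable]: "jap \<in> borel_measurable borel"
  by (rule borel_measurable_continuous_onI[OF continuous_on_jap])

lemma jap_translate: "norm h \<le> 1 \<Longrightarrow> jap \<xi> \<le> 3 * jap (\<xi> + h)"
  using jap_ge(1,2)[of "\<xi> + h"] jap_ge(4)[of \<xi>] norm_triangle_ineq4[of "\<xi> + h" h] by simp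

lemma jap_powr_translate:
  assumes "norm h \<le> 1" "0 \<le> q" shows "jap (\<xi> + h) powr (- q) \<le> 3 powr q * jap \<xi> powr (- q)"
proof -
  have "(3 * jap (\<xi> + h)) powr (- q) \<le> jap \<xi> powr (- q)"
    using jap_translate[OF assms(1), of \<xi>] jap_ge(3)[of \<xi>] assms by (intro powr_mono2') auto
  moreover have "(3 * jap (\<xi> + h)) powr (- q) = 3 powr (- q) * jap (\<xi> + h) powr (- q)"
    using jap_ge(3)[of "\<xi> + h"] by (intro powr_mult)
  ultimately have "3 powr q * (3 powr (- q) * jap (\<xi> + h) powr (- q)) \<le> 3 powr q * jap \<xi> powr (- q)"
    by (intro mult_left_mono) auto
  moreover have "3 powr q * 3 powr (- q) = (1::real)" by (simp flip: powr_add)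
  ultimately show ?thesis by (simp add: mult.assoc[symmetric])
qed

text \<open>Summation over dyadic shells.\<close>

lemma integrable_jap_powr:
  assumes q: "q > real CARD('n)"
  shows "integrable lborel (\<lambda>\<xi> :: real^'n::finite. jap \<xi> powr (- q))"
proof (rule integrableI_nonneg)
  define n where "n = real CARD('n)"
  define \<omega> where "\<omega> = unit_ball_vol n"
  have \<omega>: "\<omega> \<ge> 0" by (simp add: \<omega>_def n_def)
  define t where "t = (2::real) powr (- q)"
  have q0: "q > 0" using q by (smt (verit) of_nat_0_le_iff)
  have "(\<integral>\<^sup>+\<xi>. ennreal (jap (\<xi> :: real^'n) powr (- q)) \<partial>lborel) \<le>
    (\<integral>\<^sup>+\<xi>. (\<Sum>l. ennreal (t ^ l) * indicator (ball (0 :: real^'n) (2 ^ Suc l)) \<xi>) \<partial>lborel)"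
  proof (rule nn_integral_mono)
    fix \<xi> :: "real^'n"
    obtain l where l: "norm \<xi> < 2 ^ Suc l" "jap \<xi> powr (- q) \<le> t ^ l"
    proof (cases "norm \<xi> < 1")
      case True
      have "jap \<xi> powr (- q) \<le> 1 powr (- q)" using jap_ge(1)[of \<xi>] q0 by (intro powr_mono2') auto
      then show ?thesis using that[of 0] True by simp
    next
      case False
      obtain l where l: "2 ^ l \<le> norm \<xi>" "norm \<xi> < 2 ^ Suc l"
        by (rule dyadic_scale_above_1[of "norm \<xi>"]) (use False in auto)
      have "jap \<xi> powr (- q) \<le> (2 ^ l) powr (- q)"
        using l jap_ge(2)[of \<xi>] q0 by (intro powr_mono2') auto
      also have "\<dots> = t ^ l" by (simp add: t_def powr_realpow[symmetric] powr_powr mult_ac)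
      finally show ?thesis using that l by blast
    qed
    then have "ennreal (jap \<xi> powr (- q)) \<le> ennreal (t ^ l) * indicator (ball 0 (2 ^ Suc l)) \<xi>"
      by (simp add: ennreal_leI)
    also have "\<dots> \<le> (\<Sum>l. ennreal (t ^ l) * indicator (ball 0 (2 ^ Suc l)) \<xi>)"
    proof -
      define f :: "nat \<Rightarrow> ennreal" where "f l = ennreal (t ^ l) * indicator (ball 0 (2 ^ Suc l)) \<xi>" for l
      have "f l = sum f {l}" by simp
      also have "\<dots> \<le> suminf f" by (rule sum_le_suminf) auto
      finally show ?thesis by (simp only: f_def[abs_def])
    qed
    finally show "ennreal (jap \<xi> powr (- q)) \<le> (\<Sum>l. ennreal (t ^ l) * indicator (ball 0 (2 ^ Suc l)) \<xi>)" .
  qed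
  also have "\<dots> = (\<Sum>l. ennreal (t ^ l) * emeasure lborel (ball (0 :: real^'n) (2 ^ Suc l)))"
    by (subst nn_integral_suminf) (auto simp: nn_integral_cmult_indicator simp del: power_Suc
        intro!: borel_measurable_times_ennreal borel_measurable_indicator)
  also have "\<dots> = (\<Sum>l. ennreal (\<omega> * 2 powr n * (2 powr (n - q)) ^ l))"
  proof (intro suminf_cong)
    fix l
    have "emeasure lborel (ball (0 :: real^'n) (2 ^ Suc l)) = ennreal (\<omega> * (2 ^ Suc l) ^ CARD('n))"
      unfolding \<omega>_def n_def by (subst emeasure_ball) auto
    then have "ennreal (t ^ l) * emeasure lborel (ball (0 :: real^'n) (2 ^ Suc l)) = ennreal (t ^ l * (\<omega> * (2 ^ Suc l) ^ CARD('n)))"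
      using \<omega> by (simp add: t_def ennreal_mult)
    also have "(2 ^ Suc l) ^ CARD('n) = 2 powr n * (2 powr n) ^ l"
      by (simp add: n_def powr_realpow power_mult_distrib power_mult[symmetric] mult.commute)
    also have "t ^ l * (\<omega> * (2 powr n * (2 powr n) ^ l)) = \<omega> * 2 powr n * (t * 2 powr n) ^ l"
      by (simp add: power_mult_distrib)
    also have "t * 2 powr n = 2 powr (n - q)" by (simp add: t_def flip: powr_add)
    finally show "ennreal (t ^ l) * emeasure lborel (ball (0 :: real^'n) (2 ^ Suc l)) = ennreal (\<omega> * 2 powr n * (2 powr (n - q)) ^ l)" .
  qed
  also have "\<dots> < \<infinity>"
  proof -
    have "summable (\<lambda>l. \<omega> * 2 powr n * (2 powr (n - q)) ^ l)"
      using q by (intro summable_mult summable_geometric) (auto simp: n_def powr_less_one)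
    then have "(\<Sum>l. ennreal (\<omega> * 2 powr n * (2 powr (n - q)) ^ l)) \<noteq> top"
      using \<omega> by (intro ennreal_suminf_neq_top) auto
    then show ?thesis by (simp add: less_top)
  qed
  finally show "(\<integral>\<^sup>+\<xi>. ennreal (jap (\<xi> :: real^'n) powr (- q)) \<partial>lborel) < \<infinity>" .
qed auto

lemma line_derivative_shift:
  fixes g :: "'a::real_normed_vector \<Rightarrow> complex"
  assumes "\<And>\<xi>. ((\<lambda>s. g (\<xi> + s *\<^sub>R e)) has_vector_derivative g' \<xi>) (at 0)"
  shows "((\<lambda>s. g (\<xi> + s *\<^sub>R e)) has_vector_derivative g' (\<xi> + s *\<^sub>R e)) (at s)"
proof -
  have "((\<lambda>t. t - s) has_vector_derivative 1) (at s)"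
    by (auto intro!: derivative_eq_intros)
  moreover have "((\<lambda>u. g (\<xi> + s *\<^sub>R e + u *\<^sub>R e)) has_vector_derivative g' (\<xi> + s *\<^sub>R e)) (at (s - s))"
    using assms[of "\<xi> + s *\<^sub>R e"] by simp
  ultimately have "((\<lambda>u. g (\<xi> + s *\<^sub>R e + u *\<^sub>R e)) \<circ> (\<lambda>t. t - s) has_vector_derivative 1 *\<^sub>R g' (\<xi> + s *\<^sub>R e)) (at s)"
    by (rule vector_diff_chain_at)
  moreover have "(\<lambda>u. g (\<xi> + s *\<^sub>R e + u *\<^sub>R e)) \<circ> (\<lambda>t. t - s) = (\<lambda>t. g (\<xi> + t *\<^sub>R e))"
    by (auto simp: fun_eq_iff algebra_simps)
  ultimately show ?thesis by simp
qed

text \<open>The integral of a difference quotient vanishes by translation invariance; dominated convergence passes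
  to the derivative. Applied to products, this is integration by parts for functions that
  decay together with one directional derivative.\<close>

lemma integral_line_derivative_eq_0:
  fixes g g' :: "'a::euclidean_space \<Rightarrow> complex"
  assumes der: "\<And>\<xi>. ((\<lambda>s. g (\<xi> + s *\<^sub>R e)) has_vector_derivative g' \<xi>) (at 0)"
    and [measurable]: "g \<in> borel_measurable borel" "g' \<in> borel_measurable borel"
    and H: "integrable lborel H" "\<And>\<xi>. norm (g \<xi>) \<le> H \<xi>"
    and H': "\<And>\<xi> s. 0 \<le> s \<Longrightarrow> s \<le> 1 \<Longrightarrow> norm (g' (\<xi> + s *\<^sub>R e)) \<le> H \<xi>"
  shows "(LINT \<xi>|lborel. g' \<xi>) = 0"
proof -
  define h where "h k = 1 / real (Suc k)" for k
  have h: "0 < h k" "h k \<le> 1" for k by (auto simp: h_def)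
  have h0: "h \<longlonglongrightarrow> 0" unfolding h_def using LIMSEQ_inverse_real_of_nat by (simp add: inverse_eq_divide)
  have ig: "integrable lborel g"
    by (rule Bochner_Integration.integrable_bound[OF H(1)]) (use H(2) in \<open>auto intro!: AE_I2 order_trans[OF _ abs_ge_self]\<close>)
  have shift: "(\<lambda>x. g (t + x)) = g \<circ> (+) t" for t by auto
  have igt: "integrable lborel (\<lambda>\<xi>. g (t + \<xi>))" and it: "(LINT \<xi>|lborel. g (t + \<xi>)) = (LINT \<xi>|lborel. g \<xi>)" for t
  proof -
    have "integrable (distr lborel borel ((+) t)) g" using ig by (simp add: lborel_distr_plus)
    then show "integrable lborel (\<lambda>\<xi>. g (t + \<xi>))" by (simp add: integrable_distr_eq)
    have "(LINT \<xi>|lborel. g (t + \<xi>)) = (LINT \<xi>|distr lborel borel ((+) t). g \<xi>)"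
      by (subst integral_distr) auto
    then show "(LINT \<xi>|lborel. g (t + \<xi>)) = (LINT \<xi>|lborel. g \<xi>)" by (simp add: lborel_distr_plus)
  qed
  define D where "D k \<xi> = (g (h k *\<^sub>R e + \<xi>) - g \<xi>) /\<^sub>R h k" for k \<xi>
  have "(\<lambda>k. LINT \<xi>|lborel. D k \<xi>) \<longlonglongrightarrow> (LINT \<xi>|lborel. g' \<xi>)"
  proof (rule integral_dominated_convergence)
    show "integrable lborel H" by (rule H)
    show "D k \<in> borel_measurable lborel" for k unfolding D_def by measurable
    show "AE \<xi> in lborel. (\<lambda>k. D k \<xi>) \<longlonglongrightarrow> g' \<xi>"
    proof (intro AE_I2)
      fix \<xi>
      have lim: "((\<lambda>s. norm (g (\<xi> + s *\<^sub>R e) - g \<xi> - s *\<^sub>R g' \<xi>) / \<bar>s\<bar>) \<longlongrightarrow> 0) (at 0)"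
        using der[of \<xi>] unfolding has_vector_derivative_def by (subst (asm) has_derivative_at) simp
      have "((\<lambda>s. (g (\<xi> + s *\<^sub>R e) - g \<xi>) /\<^sub>R s - g' \<xi>) \<longlongrightarrow> 0) (at 0)"
      proof (rule tendsto_norm_zero_cancel, rule Lim_transform_eventually[OF lim])
        have "\<forall>\<^sub>F s :: real in at 0. s \<noteq> 0" by (simp add: eventually_at_filter)
        then show "\<forall>\<^sub>F s in at 0. norm (g (\<xi> + s *\<^sub>R e) - g \<xi> - s *\<^sub>R g' \<xi>) / \<bar>s\<bar> = norm ((g (\<xi> + s *\<^sub>R e) - g \<xi>) /\<^sub>R s - g' \<xi>)"
        proof eventually_elim
          case (elim s)
          have "(g (\<xi> + s *\<^sub>R e) - g \<xi>) /\<^sub>R s - g' \<xi> = (g (\<xi> + s *\<^sub>R e) - g \<xi> - s *\<^sub>R g' \<xi>) /\<^sub>R s"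
            using elim by (simp add: scaleR_diff_right)
          then show ?case by (simp add: divide_inverse mult.commute)
        qed
      qed
      then have "((\<lambda>s. (g (\<xi> + (0 + s) *\<^sub>R e) - g (\<xi> + 0 *\<^sub>R e)) /\<^sub>R s) \<longlongrightarrow> g' \<xi>) (at 0)"
        by (simp add: LIM_zero_iff)
      moreover have "filterlim h (at 0) sequentially"
        using h0 h by (auto simp: filterlim_at intro!: always_eventually less_imp_neq[symmetric])
      ultimately have "((\<lambda>k. (g (\<xi> + (0 + h k) *\<^sub>R e) - g (\<xi> + 0 *\<^sub>R e)) /\<^sub>R h k) \<longlonglongrightarrow> g' \<xi>)"
        by (rule filterlim_compose)
      then show "(\<lambda>k. D k \<xi>) \<longlonglongrightarrow> g' \<xi>" by (simp add: D_def add.commute)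
    qed
    show "AE \<xi> in lborel. norm (D k \<xi>) \<le> H \<xi>" for k
    proof (intro AE_I2)
      fix \<xi>
      have "norm (g (\<xi> + h k *\<^sub>R e) - g (\<xi> + 0 *\<^sub>R e)) \<le> H \<xi> * norm (h k - 0)"
      proof (rule differentiable_bound[where S = "{0..1}" and f = "\<lambda>s. g (\<xi> + s *\<^sub>R e)" and f' = "\<lambda>s u. u *\<^sub>R g' (\<xi> + s *\<^sub>R e)"])
        fix s :: real assume s: "s \<in> {0..1}"
        show "((\<lambda>s. g (\<xi> + s *\<^sub>R e)) has_derivative (\<lambda>u. u *\<^sub>R g' (\<xi> + s *\<^sub>R e))) (at s within {0..1})"
          using line_derivative_shift[of g e g' \<xi> s, OF der] unfolding has_vector_derivative_def by (rule has_derivative_at_withinI)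
        show "onorm (\<lambda>u. u *\<^sub>R g' (\<xi> + s *\<^sub>R e)) \<le> H \<xi>"
          using H'[of s \<xi>] s by (intro onorm_le) (auto simp: mult.commute intro: mult_left_mono)
      qed (use h[of k] in auto)
      moreover have "norm (D k \<xi>) = norm (g (\<xi> + h k *\<^sub>R e) - g (\<xi> + 0 *\<^sub>R e)) / h k"
        using h[of k] by (simp add: D_def add.commute divide_inverse mult.commute)
      ultimately show "norm (D k \<xi>) \<le> H \<xi>" using h[of k] by (simp add: pos_divide_le_eq)
    qed
  qed auto
  moreover have "(LINT \<xi>|lborel. D k \<xi>) = 0" for k
    unfolding D_def using ig igt it by simp
  ultimately show ?thesis using LIMSEQ_unique[OF _ tendsto_const] by fastforce
qed

definition ft :: "(real^'n::finite \<Rightarrow> complex) \<Rightarrow> real^'n \<Rightarrow> complex" where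
  "ft g z = (LINT \<xi>|lborel. g \<xi> * exp (\<i> * complex_of_real (z \<bullet> \<xi>)))"

lemma norm_exp_i [simp]: "norm (exp (\<i> * complex_of_real t)) = 1"
  by (simp add: norm_exp_eq_Re)

lemma borel_measurable_exp_inner [measurable]:
  "(\<lambda>\<xi> :: real^'n::finite. exp (\<i> * complex_of_real (z \<bullet> \<xi>))) \<in> borel_measurable borel"
  by (intro borel_measurable_continuous_onI continuous_intros)

lemma integrable_jap_bound:
  fixes g :: "real^'n::finite \<Rightarrow> 'b::{banach,second_countable_topology}"
  assumes "g \<in> borel_measurable borel" "\<And>\<xi>. norm (g \<xi>) \<le> C * jap \<xi> powr (- q)" "q > real CARD('n)"
  shows "integrable lborel g"
  by (rule Bochner_Integration.integrable_bound[of _ "\<lambda>\<xi>. C * jap \<xi> powr (- q)"])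
     (use assms integrable_jap_powr in \<open>auto intro!: AE_I2 order_trans[OF _ abs_ge_self]\<close>)

lemma ft_integrable:
  assumes "g \<in> borel_measurable borel" "integrable lborel g"
  shows "integrable lborel (\<lambda>\<xi>. g \<xi> * exp (\<i> * complex_of_real (z \<bullet> \<xi>)))"
  by (rule Bochner_Integration.integrable_bound[OF assms(2)]) (use assms in \<open>auto simp: norm_mult\<close>)

lemma norm_ft_le: "g \<in> borel_measurable borel \<Longrightarrow> norm (ft g z) \<le> (LINT \<xi>|lborel. norm (g \<xi>))"
  unfolding ft_def by (rule order_trans[OF integral_norm_bound]) (simp add: norm_mult)

text \<open>A sequence of successive derivatives in the \<open>i\<close>-th coordinate direction. Pure derivatives are enough to
  bound the decay of a Fourier integral, because \<open>|z|\<close> is comparable to the largest \<open>|z\<^sub>i|\<close>.\<close>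

definition line_derivs :: "'n::finite \<Rightarrow> (nat \<Rightarrow> real^'n \<Rightarrow> complex) \<Rightarrow> bool" where
  "line_derivs i D \<longleftrightarrow> (\<forall>k. D k \<in> borel_measurable borel) \<and>
     (\<forall>k \<xi>. ((\<lambda>s. D k (\<xi> + s *\<^sub>R axis i 1)) has_vector_derivative D (Suc k) \<xi>) (at 0))"

text \<open>The function \<open>D k \<xi> * exp (i z \<xi>)\<close> and its derivative are integrable, so the integral of that derivative
  vanishes.\<close>

lemma ft_line_deriv:
  fixes D :: "nat \<Rightarrow> real^'n::finite \<Rightarrow> complex"
  assumes D: "line_derivs i D" and bd: "\<And>k \<xi>. norm (D k \<xi>) \<le> C k * jap \<xi> powr (- q)" and q: "q > real CARD('n)"
  shows "ft (D (Suc k)) z = - \<i> * complex_of_real (z $ i) * ft (D k) z"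
proof -
  let ?E = "\<lambda>\<xi>. exp (\<i> * complex_of_real (z \<bullet> \<xi>))"
  have [measurable]: "D k \<in> borel_measurable borel" for k using D by (simp add: line_derivs_def)
  have q0: "0 \<le> q" using q by (smt (verit) of_nat_0_le_iff)
  define g' where "g' \<xi> = D (Suc k) \<xi> * ?E \<xi> + D k \<xi> * (\<i> * complex_of_real (z $ i) * ?E \<xi>)" for \<xi>
  define B where "B = 3 powr q * (C (Suc k) + C k * \<bar>z $ i\<bar>) + \<bar>C k\<bar>"
  have C: "0 \<le> C k" for k using order_trans[OF norm_ge_zero bd[of k 0]] jap_ge(3)[of "0 :: real^'n"] by (simp add: zero_le_mult_iff)
  have "(LINT \<xi>|lborel. g' \<xi>) = 0"
  proof (rule integral_line_derivative_eq_0[where g = "\<lambda>\<xi>. D k \<xi> * ?E \<xi>" and e = "axis i 1" and H = "\<lambda>\<xi>. B * jap \<xi> powr (- q)"])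
    show "integrable lborel (\<lambda>\<xi> :: real^'n. B * jap \<xi> powr (- q))" using integrable_jap_powr[OF q] by simp
    show "norm (D k \<xi> * ?E \<xi>) \<le> B * jap \<xi> powr (- q)" for \<xi>
    proof -
      have "norm (D k \<xi> * ?E \<xi>) \<le> C k * jap \<xi> powr (- q)" using bd[of k \<xi>] by (simp add: norm_mult)
      also have "\<dots> \<le> B * jap \<xi> powr (- q)" using C[of k] C[of "Suc k"] by (intro mult_right_mono) (auto simp: B_def)
      finally show ?thesis .
    qed
    show "norm (g' (\<xi> + s *\<^sub>R axis i 1)) \<le> B * jap \<xi> powr (- q)" if "0 \<le> s" "s \<le> 1" for \<xi> s
    proof -
      let ?\<eta> = "\<xi> + s *\<^sub>R axis i 1"
      have "norm (g' ?\<eta>) \<le> norm (D (Suc k) ?\<eta>) + norm (D k ?\<eta>) * \<bar>z $ i\<bar>"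
        unfolding g'_def by (rule order_trans[OF norm_triangle_ineq]) (simp add: norm_mult)
      also have "\<dots> \<le> C (Suc k) * jap ?\<eta> powr (- q) + C k * jap ?\<eta> powr (- q) * \<bar>z $ i\<bar>"
        by (intro add_mono mult_right_mono bd) auto
      also have "\<dots> = (C (Suc k) + C k * \<bar>z $ i\<bar>) * jap ?\<eta> powr (- q)" by (simp add: algebra_simps)
      also have "\<dots> \<le> (C (Suc k) + C k * \<bar>z $ i\<bar>) * (3 powr q * jap \<xi> powr (- q))"
        using that C q0 by (intro mult_left_mono jap_powr_translate) (auto simp: norm_axis_1)
      also have "\<dots> \<le> B * jap \<xi> powr (- q)"
        unfolding mult.assoc[symmetric] by (intro mult_right_mono) (auto simp: B_def mult.commute)
      finally show ?thesis .
    qed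
    show "((\<lambda>s. D k (\<xi> + s *\<^sub>R axis i 1) * ?E (\<xi> + s *\<^sub>R axis i 1)) has_vector_derivative g' \<xi>) (at 0)" for \<xi>
    proof -
      have "((\<lambda>s. D k (\<xi> + s *\<^sub>R axis i 1)) has_vector_derivative D (Suc k) \<xi>) (at 0)"
        using D by (simp add: line_derivs_def)
      moreover have "((\<lambda>s. ?E (\<xi> + s *\<^sub>R axis i 1)) has_vector_derivative \<i> * complex_of_real (z $ i) * ?E \<xi>) (at 0)"
      proof -
        have "((\<lambda>s. exp (\<i> * complex_of_real (z \<bullet> \<xi> + s * z $ i))) has_vector_derivative \<i> * complex_of_real (z $ i) * exp (\<i> * complex_of_real (z \<bullet> \<xi> + 0 * z $ i))) (at 0)"
        proof -
          have "((\<lambda>s. z \<bullet> \<xi> + s * z $ i) has_field_derivative z $ i) (at 0)"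
            by (auto intro!: derivative_eq_intros)
          from has_vector_derivative_mult_right[OF has_vector_derivative_of_real[OF this], of \<i>]
          have "((\<lambda>s. \<i> * complex_of_real (z \<bullet> \<xi> + s * z $ i)) has_vector_derivative \<i> * complex_of_real (z $ i)) (at 0)" .
          from field_vector_diff_chain_at[OF this DERIV_exp] show ?thesis by (simp add: o_def)
        qed
        then show ?thesis by (simp add: inner_add_right inner_axis)
      qed
      ultimately have "((\<lambda>s. D k (\<xi> + s *\<^sub>R axis i 1) * ?E (\<xi> + s *\<^sub>R axis i 1)) has_vector_derivative
          D k (\<xi> + 0 *\<^sub>R axis i 1) * (\<i> * complex_of_real (z $ i) * ?E \<xi>) + D (Suc k) \<xi> * ?E (\<xi> + 0 *\<^sub>R axis i 1)) (at 0)"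
        by (rule has_vector_derivative_mult)
      then show ?thesis by (simp add: g'_def add.commute)
    qed
  qed (auto simp: g'_def)
  moreover have i: "integrable lborel (\<lambda>\<xi>. D k \<xi> * ?E \<xi>)" for k
    by (rule ft_integrable[OF _ integrable_jap_bound[OF _ bd q]]) auto
  have "(LINT \<xi>|lborel. g' \<xi>) = ft (D (Suc k)) z + \<i> * complex_of_real (z $ i) * ft (D k) z"
  proof -
    have eq: "D k \<xi> * (\<i> * complex_of_real (z $ i) * ?E \<xi>) = \<i> * complex_of_real (z $ i) * (D k \<xi> * ?E \<xi>)" for \<xi>
      by simp
    have "(LINT \<xi>|lborel. g' \<xi>) = (LINT \<xi>|lborel. D (Suc k) \<xi> * ?E \<xi>) + (LINT \<xi>|lborel. \<i> * complex_of_real (z $ i) * (D k \<xi> * ?E \<xi>))"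
      unfolding g'_def eq by (rule Bochner_Integration.integral_add[OF i integrable_mult_right[OF i]])
    then show ?thesis unfolding ft_def by simp
  qed
  ultimately show ?thesis by (simp add: eq_neg_iff_add_eq_0)
qed

lemma ft_decay:
  fixes D :: "nat \<Rightarrow> real^'n::finite \<Rightarrow> complex"
  assumes D: "line_derivs i D" and bd: "\<And>k \<xi>. norm (D k \<xi>) \<le> C k * jap \<xi> powr (- q)" and q: "q > real CARD('n)"
  shows "\<bar>z $ i\<bar> ^ k * norm (ft (D 0) z) \<le> (LINT \<xi>|lborel. norm (D k \<xi>))"
proof -
  have "norm (ft (D k) z) = \<bar>z $ i\<bar> ^ k * norm (ft (D 0) z)"
    by (induction k) (simp_all add: ft_line_deriv[OF D bd q] norm_mult)
  then show ?thesis using norm_ft_le[of "D k" z] D by (simp add: line_derivs_def)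
qed

lemma Leibniz_sum:
  fixes A B :: "nat \<Rightarrow> complex"
  shows "(\<Sum>l\<le>k. of_nat (k choose l) * (A (Suc l) * B (k - l) + A l * B (Suc (k - l)))) =
    (\<Sum>l\<le>Suc k. of_nat (Suc k choose l) * (A l * B (Suc k - l)))"
proof -
  have "(\<Sum>l\<le>Suc k. of_nat (Suc k choose l) * (A l * B (Suc k - l))) =
    A 0 * B (Suc k) + (\<Sum>l\<le>k. of_nat ((k choose l) + (k choose Suc l)) * (A (Suc l) * B (k - l)))"
    by (subst sum.atMost_Suc_shift) simp
  also have "\<dots> = (\<Sum>l\<le>k. of_nat (k choose l) * (A (Suc l) * B (k - l))) +
     (A 0 * B (Suc k) + (\<Sum>l\<le>k. of_nat (k choose Suc l) * (A (Suc l) * B (k - l))))"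
    by (simp add: sum.distrib algebra_simps)
  also have "A 0 * B (Suc k) + (\<Sum>l\<le>k. of_nat (k choose Suc l) * (A (Suc l) * B (k - l))) =
     (\<Sum>l\<le>Suc k. of_nat (k choose l) * (A l * B (Suc k - l)))"
    by (subst sum.atMost_Suc_shift) simp
  also have "\<dots> = (\<Sum>l\<le>k. of_nat (k choose l) * (A l * B (Suc (k - l))))"
    by (simp add: Suc_diff_le)
  finally show ?thesis by (simp add: sum.distrib distrib_left)
qed

lemma line_derivs_mult:
  fixes i :: "'n::finite"
  assumes A: "line_derivs i A" and B: "line_derivs i B"
  shows "line_derivs i (\<lambda>k \<xi>. \<Sum>l\<le>k. of_nat (k choose l) * (A l \<xi> * B (k - l) \<xi>))"
  unfolding line_derivs_def
proof (intro conjI allI)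
  have [measurable]: "A k \<in> borel_measurable borel" "B k \<in> borel_measurable borel" for k
    using A B by (auto simp: line_derivs_def)
  show "(\<lambda>\<xi>. \<Sum>l\<le>k. of_nat (k choose l) * (A l \<xi> * B (k - l) \<xi>)) \<in> borel_measurable borel" for k
    by measurable
  fix k and \<xi> :: "real^'n"
  let ?x = "\<lambda>s::real. \<xi> + s *\<^sub>R axis i 1"
  have "((\<lambda>s. \<Sum>l\<le>k. of_nat (k choose l) * (A l (?x s) * B (k - l) (?x s))) has_vector_derivative
     (\<Sum>l\<le>k. of_nat (k choose l) * (A l (?x 0) * B (Suc (k - l)) \<xi> + A (Suc l) \<xi> * B (k - l) (?x 0)))) (at 0)"
    using A B by (intro has_vector_derivative_sum has_vector_derivative_mult_right has_vector_derivative_mult)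
      (auto simp: line_derivs_def)
  also have "(\<Sum>l\<le>k. of_nat (k choose l) * (A l (?x 0) * B (Suc (k - l)) \<xi> + A (Suc l) \<xi> * B (k - l) (?x 0))) =
     (\<Sum>l\<le>Suc k. of_nat (Suc k choose l) * (A l \<xi> * B (Suc k - l) \<xi>))"
    by (subst Leibniz_sum[symmetric]) (simp add: add.commute)
  finally show "((\<lambda>s. \<Sum>l\<le>k. of_nat (k choose l) * (A l (?x s) * B (k - l) (?x s))) has_vector_derivative
     (\<Sum>l\<le>Suc k. of_nat (Suc k choose l) * (A l \<xi> * B (Suc k - l) \<xi>))) (at 0)" .
qed

lemma line_derivs_diff:
  assumes A: "line_derivs i A" and B: "line_derivs i B"
  shows "line_derivs i (\<lambda>k \<xi>. A k \<xi> - B k \<xi>)"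
  using A B unfolding line_derivs_def by (auto intro!: has_vector_derivative_diff borel_measurable_diff)

lemma line_derivs_iter_partial:
  assumes "\<And>k. \<forall>x. iter_partial (replicate k i) f differentiable (at x)"
  shows "line_derivs i (\<lambda>k. iter_partial (replicate k i) f)"
  unfolding line_derivs_def
proof (intro conjI allI)
  fix k
  show "iter_partial (replicate k i) f \<in> borel_measurable borel"
    using assms by (intro borel_measurable_continuous_onI)
      (auto simp: continuous_on_eq_continuous_at intro: differentiable_imp_continuous_within)
  fix \<xi>
  let ?g = "iter_partial (replicate k i) f"
  have "(?g has_derivative frechet_derivative ?g (at \<xi>)) (at \<xi>)"
    using assms frechet_derivative_works by blast
  then have g: "(?g has_derivative frechet_derivative ?g (at \<xi>)) (at (\<xi> + 0 *\<^sub>R axis i 1))" by simp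
  have "((\<lambda>s. \<xi> + s *\<^sub>R axis i 1) has_derivative (\<lambda>s. s *\<^sub>R axis i 1)) (at 0)"
    by (auto intro!: derivative_eq_intros)
  from has_derivative_compose[OF this g]
  have "((\<lambda>s. ?g (\<xi> + s *\<^sub>R axis i 1)) has_derivative (\<lambda>s. frechet_derivative ?g (at \<xi>) (s *\<^sub>R axis i 1))) (at 0)" .
  moreover have "linear (frechet_derivative ?g (at \<xi>))"
    using assms by (intro linear_frechet_derivative) auto
  ultimately show "((\<lambda>s. ?g (\<xi> + s *\<^sub>R axis i 1)) has_vector_derivative iter_partial (replicate (Suc k) i) f \<xi>) (at 0)"
    by (simp add: has_vector_derivative_def linear_scale partial_deriv_def)
qed

section \<open>Gaussian decomposition of the frequency space\<close>

text \<open>The polynomials with \<open>(d/dt)\<^sup>l exp(-t\<^sup>2) = H\<^sub>l(t) exp(-t\<^sup>2)\<close>.\<close>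

fun hermite :: "nat \<Rightarrow> real poly" where
  "hermite 0 = 1"
| "hermite (Suc l) = pderiv (hermite l) - [:0, 2:] * hermite l"

text \<open>The \<open>l\<close>-th derivative of \<open>exp(-\<epsilon>\<^sup>2|\<xi>|\<^sup>2)\<close> in the direction \<open>i\<close>. Gaussians serve as frequency cutoffs because
  their derivatives are explicit; they have no compact support, but their decay does the same job.\<close>

definition gauss_deriv :: "'n::finite \<Rightarrow> real \<Rightarrow> nat \<Rightarrow> real^'n \<Rightarrow> complex" where
  "gauss_deriv i \<epsilon> l \<xi> = complex_of_real (\<epsilon> ^ l * poly (hermite l) (\<epsilon> * \<xi> $ i) * exp (- (\<epsilon>\<^sup>2 * (norm \<xi>)\<^sup>2)))"

lemma gauss_deriv_0: "gauss_deriv i \<epsilon> 0 \<xi> = complex_of_real (exp (- (\<epsilon>\<^sup>2 * (norm \<xi>)\<^sup>2)))"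
  by (simp add: gauss_deriv_def)

lemma line_derivs_gauss: "line_derivs i (gauss_deriv i \<epsilon>)"
  unfolding line_derivs_def
proof (intro conjI allI)
  fix k
  show "gauss_deriv i \<epsilon> k \<in> borel_measurable borel"
    unfolding gauss_deriv_def[abs_def] by (intro borel_measurable_continuous_onI continuous_intros)
  fix \<xi> :: "real^'a"
  let ?P = "hermite k"
  define a where "a = \<xi> $ i"
  define N where "N = (norm \<xi>)\<^sup>2"
  have nrm: "(norm (\<xi> + s *\<^sub>R axis i 1))\<^sup>2 = N + 2 * s * a + s\<^sup>2" for s :: real
    unfolding power2_norm_eq_inner N_def a_def
    by (simp add: inner_add_left inner_add_right inner_axis inner_commute[of "axis i 1"] power2_eq_square algebra_simps)
  have "((\<lambda>s. \<epsilon> ^ k * poly ?P (\<epsilon> * (a + s)) * exp (- (\<epsilon>\<^sup>2 * (N + 2 * s * a + s\<^sup>2)))) has_field_derivative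
     \<epsilon> ^ Suc k * poly (hermite (Suc k)) (\<epsilon> * a) * exp (- (\<epsilon>\<^sup>2 * N))) (at 0)"
  proof -
    have "((\<lambda>s. \<epsilon> ^ k * poly ?P (\<epsilon> * (a + s)) * exp (- (\<epsilon>\<^sup>2 * (N + 2 * s * a + s\<^sup>2)))) has_field_derivative
      \<epsilon> ^ k * (poly (pderiv ?P) (\<epsilon> * (a + 0)) * \<epsilon>) * exp (- (\<epsilon>\<^sup>2 * (N + 2 * 0 * a + 0\<^sup>2))) +
      \<epsilon> ^ k * poly ?P (\<epsilon> * (a + 0)) * (exp (- (\<epsilon>\<^sup>2 * (N + 2 * 0 * a + 0\<^sup>2))) * - (\<epsilon>\<^sup>2 * (2 * a)))) (at 0)"
      by (auto intro!: derivative_eq_intros DERIV_chain2[OF poly_DERIV])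
    also have "\<epsilon> ^ k * (poly (pderiv ?P) (\<epsilon> * (a + 0)) * \<epsilon>) * exp (- (\<epsilon>\<^sup>2 * (N + 2 * 0 * a + 0\<^sup>2))) +
      \<epsilon> ^ k * poly ?P (\<epsilon> * (a + 0)) * (exp (- (\<epsilon>\<^sup>2 * (N + 2 * 0 * a + 0\<^sup>2))) * - (\<epsilon>\<^sup>2 * (2 * a))) =
      \<epsilon> ^ Suc k * poly (hermite (Suc k)) (\<epsilon> * a) * exp (- (\<epsilon>\<^sup>2 * N))"
      by (simp add: power2_eq_square algebra_simps)
    finally show ?thesis .
  qed
  from has_vector_derivative_of_real[OF this]
  show "((\<lambda>s. gauss_deriv i \<epsilon> k (\<xi> + s *\<^sub>R axis i 1)) has_vector_derivative gauss_deriv i \<epsilon> (Suc k) \<xi>) (at 0)"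
    unfolding gauss_deriv_def nrm by (simp add: a_def N_def)
qed

lemma poly_times_exp_bound:
  "\<exists>c\<ge>0. \<forall>t u. \<bar>t\<bar> \<le> u \<longrightarrow> \<bar>poly (P :: real poly) t\<bar> * exp (- u\<^sup>2) \<le> c / (1 + u\<^sup>2) ^ N"
proof (induction P arbitrary: N)
  case 0
  show ?case by (intro exI[of _ 0]) auto
next
  case (pCons a P)
  obtain c where c: "c \<ge> 0" "\<And>t u. \<bar>t\<bar> \<le> u \<Longrightarrow> \<bar>poly P t\<bar> * exp (- u\<^sup>2) \<le> c / (1 + u\<^sup>2) ^ Suc N"
    using pCons.IH[of "Suc N"] by blast
  define M where "M = Suc N"
  have base: "exp (- u\<^sup>2) \<le> real M ^ M * exp 1 / (1 + u\<^sup>2) ^ N" for u :: real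
  proof -
    have "(1 + u\<^sup>2) ^ N \<le> (1 + u\<^sup>2) ^ M" by (intro power_increasing) (auto simp: M_def)
    also have "\<dots> \<le> (real M * (1 + (1 + u\<^sup>2) / real M)) ^ M"
      by (intro power_mono) (auto simp: M_def field_simps)
    also have "\<dots> = real M ^ M * (1 + (1 + u\<^sup>2) / real M) ^ M" by (rule power_mult_distrib)
    also have "\<dots> \<le> real M ^ M * exp (1 + u\<^sup>2)"
      by (intro mult_left_mono exp_ge_one_plus_x_over_n_power_n) (auto simp: M_def intro: order_trans[of _ 0])
    finally have "(1 + u\<^sup>2) ^ N * exp (- u\<^sup>2) \<le> real M ^ M * exp (1 + u\<^sup>2) * exp (- u\<^sup>2)"
      by (intro mult_right_mono) auto
    also have "\<dots> = real M ^ M * exp 1" by (simp add: mult.assoc flip: exp_add)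
    finally show ?thesis by (simp add: field_simps add_pos_nonneg)
  qed
  show ?case
  proof (intro exI[of _ "\<bar>a\<bar> * (real M ^ M * exp 1) + c"] conjI allI impI)
    show "0 \<le> \<bar>a\<bar> * (real M ^ M * exp 1) + c" using c by (intro add_nonneg_nonneg) auto
    fix t u :: real assume tu: "\<bar>t\<bar> \<le> u"
    have u0: "0 \<le> u" using tu by linarith
    have "u \<le> 1 + u\<^sup>2" using sum_power2_ge_zero[of "u - 1" 0] by (simp add: power2_eq_square algebra_simps) (smt (verit) mult_nonneg_nonneg u0)
    have p: "(1 + u\<^sup>2) ^ N > 0" by (simp add: add_pos_nonneg)
    have "\<bar>poly (pCons a P) t\<bar> * exp (- u\<^sup>2) \<le> (\<bar>a\<bar> + \<bar>t\<bar> * \<bar>poly P t\<bar>) * exp (- u\<^sup>2)"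
      by (intro mult_right_mono) (auto simp: abs_mult[symmetric])
    also have "\<dots> = \<bar>a\<bar> * exp (- u\<^sup>2) + \<bar>t\<bar> * (\<bar>poly P t\<bar> * exp (- u\<^sup>2))" by (simp add: algebra_simps)
    also have "\<dots> \<le> \<bar>a\<bar> * (real M ^ M * exp 1 / (1 + u\<^sup>2) ^ N) + (1 + u\<^sup>2) * (c / (1 + u\<^sup>2) ^ Suc N)"
      using c(2)[OF tu] tu \<open>u \<le> 1 + u\<^sup>2\<close> by (intro add_mono mult_left_mono mult_mono base) auto
    also have "(1 + u\<^sup>2) * (c / (1 + u\<^sup>2) ^ Suc N) = c / (1 + u\<^sup>2) ^ N" by (simp add: add_nonneg_eq_0_iff)
    also have "\<bar>a\<bar> * (real M ^ M * exp 1 / (1 + u\<^sup>2) ^ N) + c / (1 + u\<^sup>2) ^ N = (\<bar>a\<bar> * (real M ^ M * exp 1) + c) / (1 + u\<^sup>2) ^ N"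
      by (simp add: add_divide_distrib)
    finally show "\<bar>poly (pCons a P) t\<bar> * exp (- u\<^sup>2) \<le> (\<bar>a\<bar> * (real M ^ M * exp 1) + c) / (1 + u\<^sup>2) ^ N" .
  qed
qed

text \<open>The exponent \<open>t\<close> is left free: \<open>t = q\<close> large gives integrability, while \<open>t = l - \<delta>\<close> turns \<open>\<epsilon>\<^sup>l\<close> into a gain
  of \<open>\<epsilon>\<^sup>\<delta>\<close>.\<close>

lemma gauss_deriv_bound:
  obtains c where "c \<ge> 0" "\<And>(i::'n::finite) \<epsilon> \<xi> t. 0 < \<epsilon> \<Longrightarrow> \<epsilon> \<le> 1 \<Longrightarrow> 0 \<le> t \<Longrightarrow> t \<le> 2 * real N \<Longrightarrow>
    norm (gauss_deriv i \<epsilon> l \<xi>) \<le> c * \<epsilon> ^ l * (\<epsilon> * jap \<xi>) powr (- t)"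
proof -
  obtain c where c: "c \<ge> 0" "\<And>t u. \<bar>t\<bar> \<le> u \<Longrightarrow> \<bar>poly (hermite l) t\<bar> * exp (- u\<^sup>2) \<le> c / (1 + u\<^sup>2) ^ N"
    using poly_times_exp_bound[of "hermite l" N] by blast
  show ?thesis
  proof (rule that[OF c(1)])
    fix i :: 'n and \<epsilon> t :: real and \<xi> :: "real^'n" assume \<epsilon>: "0 < \<epsilon>" "\<epsilon> \<le> 1" and t: "0 \<le> t" "t \<le> 2 * real N"
    define u where "u = \<epsilon> * norm \<xi>"
    have j: "0 < \<epsilon> * jap \<xi>" using \<epsilon> jap_ge(3)[of \<xi>] by simp
    have "(\<epsilon> * jap \<xi>) powr t \<le> (1 + u\<^sup>2) powr (t / 2)"
    proof -
      have "(\<epsilon> * jap \<xi>)\<^sup>2 = \<epsilon>\<^sup>2 + u\<^sup>2" by (simp add: power_mult_distrib jap_ge(5) u_def algebra_simps)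
      also have "\<dots> \<le> 1 + u\<^sup>2" using \<epsilon> by (simp add: power_le_one)
      finally have "((\<epsilon> * jap \<xi>)\<^sup>2) powr (t / 2) \<le> (1 + u\<^sup>2) powr (t / 2)" using t by (intro powr_mono2) auto
      moreover have "((\<epsilon> * jap \<xi>)\<^sup>2) powr (t / 2) = (\<epsilon> * jap \<xi>) powr t"
      proof -
        have y2: "(\<epsilon> * jap \<xi>)\<^sup>2 = (\<epsilon> * jap \<xi>) powr 2" using j by simp
        show ?thesis unfolding y2 by (simp only: powr_powr) simp
      qed
      ultimately show ?thesis by simp
    qed
    also have "\<dots> \<le> (1 + u\<^sup>2) powr (real N)" using t by (intro powr_mono) auto
    also have "\<dots> = (1 + u\<^sup>2) ^ N" by (intro powr_realpow) (simp add: add_pos_nonneg)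
    finally have "(\<epsilon> * jap \<xi>) powr t \<le> (1 + u\<^sup>2) ^ N" .
    have a: "1 / (1 + u\<^sup>2) ^ N \<le> (\<epsilon> * jap \<xi>) powr (- t)"
    proof -
      have "0 < (\<epsilon> * jap \<xi>) powr t" using j by (metis powr_gt_zero less_irrefl)
      from le_imp_inverse_le[OF \<open>(\<epsilon> * jap \<xi>) powr t \<le> (1 + u\<^sup>2) ^ N\<close> this]
      show ?thesis by (simp add: powr_minus divide_inverse)
    qed
    have "\<bar>\<epsilon> * \<xi> $ i\<bar> \<le> u" using \<epsilon> component_le_norm_cart[of \<xi> i] by (simp add: u_def abs_mult)
    from c(2)[OF this] have "\<bar>poly (hermite l) (\<epsilon> * \<xi> $ i)\<bar> * exp (- u\<^sup>2) \<le> c * (1 / (1 + u\<^sup>2) ^ N)" by simp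
    also have "\<dots> \<le> c * (\<epsilon> * jap \<xi>) powr (- t)" by (intro mult_left_mono a c)
    finally have "\<epsilon> ^ l * (\<bar>poly (hermite l) (\<epsilon> * \<xi> $ i)\<bar> * exp (- u\<^sup>2)) \<le> \<epsilon> ^ l * (c * (\<epsilon> * jap \<xi>) powr (- t))"
      using \<epsilon> by (intro mult_left_mono) auto
    then show "norm (gauss_deriv i \<epsilon> l \<xi>) \<le> c * \<epsilon> ^ l * (\<epsilon> * jap \<xi>) powr (- t)"
      using \<epsilon> by (simp add: gauss_deriv_def norm_mult norm_power abs_mult u_def power_mult_distrib mult_ac)
  qed
qed

text \<open>The \<open>l\<close>-th derivative of the dyadic piece with index \<open>j\<close> below. The pieces telescope: those up to \<open>j\<close> add up to
  \<open>exp(-4\<^bsup>-j\<^esup>|\<xi>|\<^sup>2)\<close>, which tends to \<open>1\<close>.\<close>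

definition dyadic_deriv :: "'n::finite \<Rightarrow> nat \<Rightarrow> nat \<Rightarrow> real^'n \<Rightarrow> complex" where
  "dyadic_deriv i j l \<xi> = (case j of 0 \<Rightarrow> gauss_deriv i 1 l \<xi>
     | Suc j' \<Rightarrow> gauss_deriv i ((1 / 2) ^ j) l \<xi> - gauss_deriv i ((1 / 2) ^ j') l \<xi>)"

definition dyadic_piece :: "nat \<Rightarrow> real^'n::finite \<Rightarrow> real" where
  "dyadic_piece j \<xi> = (case j of 0 \<Rightarrow> exp (- (norm \<xi>)\<^sup>2)
     | Suc j' \<Rightarrow> exp (- (((1 / 2) ^ j)\<^sup>2 * (norm \<xi>)\<^sup>2)) - exp (- (((1 / 2) ^ j')\<^sup>2 * (norm \<xi>)\<^sup>2)))"

lemma dyadic_deriv_0: "dyadic_deriv i j 0 \<xi> = complex_of_real (dyadic_piece j \<xi>)"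
  by (cases j) (simp_all add: dyadic_deriv_def dyadic_piece_def gauss_deriv_0)

lemma line_derivs_dyadic: "line_derivs i (dyadic_deriv i j)"
proof (cases j)
  case 0
  then have "dyadic_deriv i j = gauss_deriv i 1" by (auto simp: fun_eq_iff dyadic_deriv_def)
  then show ?thesis by (simp add: line_derivs_gauss)
next
  case (Suc j')
  then have "dyadic_deriv i j = (\<lambda>l \<xi>. gauss_deriv i ((1 / 2) ^ j) l \<xi> - gauss_deriv i ((1 / 2) ^ j') l \<xi>)"
    by (auto simp: fun_eq_iff dyadic_deriv_def)
  then show ?thesis by (simp add: line_derivs_gauss line_derivs_diff)
qed

lemma sum_dyadic_piece: "(\<Sum>j\<le>J. dyadic_piece j \<xi>) = exp (- (((1 / 2) ^ J)\<^sup>2 * (norm \<xi>)\<^sup>2))"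
  by (induction J) (auto simp: dyadic_piece_def)

lemma dyadic_piece_nonneg: "0 \<le> dyadic_piece j \<xi>"
proof (cases j)
  case (Suc j')
  have "((1 / 2) ^ j)\<^sup>2 * (norm \<xi>)\<^sup>2 \<le> ((1 / 2 :: real) ^ j')\<^sup>2 * (norm \<xi>)\<^sup>2"
    unfolding Suc by (intro mult_right_mono power_mono power_decreasing) auto
  then show ?thesis by (simp add: dyadic_piece_def Suc del: power_Suc)
qed (simp add: dyadic_piece_def)

lemma dyadic_deriv_rapid:
  assumes q: "0 \<le> q"
  obtains c where "c \<ge> 0" "\<And>(i::'n::finite) j \<xi>. norm (dyadic_deriv i j l \<xi>) \<le> c * (2 ^ j) powr q * jap \<xi> powr (- q)"
proof -
  define N where "N = nat \<lceil>q\<rceil>"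
  have N: "q \<le> 2 * real N" using q by (simp add: N_def) linarith
  obtain c where c: "c \<ge> 0" "\<And>(i::'n) \<epsilon> \<xi> t. 0 < \<epsilon> \<Longrightarrow> \<epsilon> \<le> 1 \<Longrightarrow> 0 \<le> t \<Longrightarrow> t \<le> 2 * real N \<Longrightarrow>
    norm (gauss_deriv i \<epsilon> l \<xi>) \<le> c * \<epsilon> ^ l * (\<epsilon> * jap \<xi>) powr (- t)"
    using gauss_deriv_bound[where 'n='n, of N l] by blast
  have g: "norm (gauss_deriv i ((1 / 2) ^ j') l \<xi>) \<le> c * (2 ^ j) powr q * jap \<xi> powr (- q)" if "j' \<le> j" for i :: 'n and j j' and \<xi> :: "real^'n"
  proof -
    have "norm (gauss_deriv i ((1 / 2) ^ j') l \<xi>) \<le> c * ((1 / 2) ^ j') ^ l * ((1 / 2) ^ j' * jap \<xi>) powr (- q)"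
      using q N by (intro c(2)) (auto simp: power_le_one)
    also have "\<dots> \<le> c * 1 * ((1 / 2) ^ j' * jap \<xi>) powr (- q)"
      using c by (intro mult_right_mono mult_left_mono) (auto simp: power_le_one)
    also have "((1 / 2) ^ j' * jap \<xi>) powr (- q) = (2 ^ j') powr q * jap \<xi> powr (- q)"
      using jap_ge(3)[of \<xi>] by (simp add: powr_mult power_one_over powr_divide powr_minus inverse_eq_divide)
    also have "c * 1 * ((2 ^ j') powr q * jap \<xi> powr (- q)) \<le> c * 1 * ((2 ^ j) powr q * jap \<xi> powr (- q))"
      using c q that by (intro mult_left_mono mult_right_mono powr_mono2 power_increasing) auto
    finally show ?thesis by simp
  qed
  show ?thesis
  proof (rule that[of "2 * c"])
    show "2 * c \<ge> 0" using c by simp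
    fix i :: 'n and j and \<xi> :: "real^'n"
    define S where "S = c * (2 ^ j) powr q * jap \<xi> powr (- q)"
    have S: "0 \<le> S" using c by (simp add: S_def)
    have g: "norm (gauss_deriv i ((1 / 2) ^ j') l \<xi>) \<le> S" if "j' \<le> j" for j'
      unfolding S_def by (rule g[OF that])
    have "norm (dyadic_deriv i j l \<xi>) \<le> 2 * S"
    proof (cases j)
      case 0
      then have e: "dyadic_deriv i j l \<xi> = gauss_deriv i ((1 / 2) ^ 0) l \<xi>" by (simp add: dyadic_deriv_def)
      show ?thesis unfolding e using g[OF le0] S by linarith
    next
      case (Suc j')
      then have e: "dyadic_deriv i j l \<xi> = gauss_deriv i ((1 / 2) ^ j) l \<xi> - gauss_deriv i ((1 / 2) ^ j') l \<xi>"
        and "j' \<le> j" by (simp_all add: dyadic_deriv_def)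
      show ?thesis unfolding e using g[OF order_refl] g[OF \<open>j' \<le> j\<close>]
        norm_triangle_ineq4[of "gauss_deriv i ((1 / 2) ^ j) l \<xi>" "gauss_deriv i ((1 / 2) ^ j') l \<xi>"]
        by linarith
    qed
    then show "norm (dyadic_deriv i j l \<xi>) \<le> 2 * c * (2 ^ j) powr q * jap \<xi> powr (- q)"
      by (simp add: S_def mult.assoc)
  qed
qed

text \<open>A frequency far below \<open>2\<^sup>j\<close> contributes little to the piece with index \<open>j\<close>: for \<open>l = 0\<close> and \<open>j > 0\<close> because
  the piece vanishes to second order at the origin, and for \<open>l > 0\<close> because every derivative of a Gaussian of
  width \<open>2\<^sup>j\<close> gains \<open>2\<^bsup>-j\<^esup>\<close>. A part \<open>\<delta>\<close> of this gain is kept, the rest is traded for decay in \<open>\<langle>\<xi>\<rangle>\<close>.\<close>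

lemma dyadic_deriv_bound:
  assumes \<delta>: "0 < \<delta>" "\<delta> \<le> 1"
  obtains c where "c \<ge> 0" "\<And>(i::'n::finite) j \<xi>. norm (dyadic_deriv i j l \<xi>) \<le> c * ((1 / 2) ^ j) powr \<delta> * jap \<xi> powr (\<delta> - real l)"
proof (cases l)
  case 0
  show ?thesis
  proof (rule that[of 3])
    fix i :: 'n and j and \<xi> :: "real^'n"
    define \<epsilon> :: real where "\<epsilon> = (1 / 2) ^ j"
    have \<epsilon>: "0 < \<epsilon>" "\<epsilon> \<le> 1" by (auto simp: \<epsilon>_def power_le_one)
    have j: "0 < \<epsilon> * jap \<xi>" using \<epsilon> jap_ge(3)[of \<xi>] by simp
    have "dyadic_piece j \<xi> \<le> 3 * (\<epsilon> * jap \<xi>) powr \<delta>"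
    proof (cases "j = 0 \<or> 1 \<le> \<epsilon> * jap \<xi>")
      case True
      then have "1 \<le> \<epsilon> * jap \<xi>" using jap_ge(1)[of \<xi>] by (auto simp: \<epsilon>_def)
      then have "1 \<le> (\<epsilon> * jap \<xi>) powr \<delta>" using \<delta> by (simp add: ge_one_powr_ge_zero)
      moreover have "dyadic_piece j \<xi> \<le> 1"
      proof -
        have "dyadic_piece j \<xi> \<le> (\<Sum>j\<le>j. dyadic_piece j \<xi>)"
          by (intro member_le_sum) (auto simp: dyadic_piece_nonneg)
        also have "\<dots> \<le> 1" unfolding sum_dyadic_piece by simp
        finally show ?thesis .
      qed
      ultimately show ?thesis by linarith
    next
      case False
      then obtain j' where j': "j = Suc j'" by (cases j) auto
      define v where "v = \<epsilon>\<^sup>2 * (norm \<xi>)\<^sup>2"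
      have e2: "((1 / 2) ^ j')\<^sup>2 * (norm \<xi>)\<^sup>2 = 4 * v" by (simp add: v_def \<epsilon>_def j' power2_eq_square)
      have "dyadic_piece j \<xi> = exp (- v) - exp (- (4 * v))"
        using e2 by (simp add: dyadic_piece_def j' v_def \<epsilon>_def del: power_Suc)
      also have "exp (- (4 * v)) = exp (- v) * exp (- (3 * v))" by (simp flip: exp_add)
      also have "exp (- v) - exp (- v) * exp (- (3 * v)) = exp (- v) * (1 - exp (- (3 * v)))" by (simp add: algebra_simps)
      also have "\<dots> \<le> 1 * (3 * v)"
        using exp_ge_add_one_self[of "- (3 * v)"] by (intro mult_mono) (auto simp: v_def)
      also have "\<dots> \<le> 3 * (\<epsilon> * jap \<xi>)\<^sup>2" by (simp add: v_def power_mult_distrib jap_ge(5) algebra_simps)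
      also have "(\<epsilon> * jap \<xi>)\<^sup>2 = (\<epsilon> * jap \<xi>) powr 2" using j by simp
      also have "\<dots> \<le> (\<epsilon> * jap \<xi>) powr \<delta>" using False \<delta> j by (intro powr_mono') auto
      finally show ?thesis by simp
    qed
    then show "norm (dyadic_deriv i j l \<xi>) \<le> 3 * ((1 / 2) ^ j) powr \<delta> * jap \<xi> powr (\<delta> - real l)"
      using dyadic_piece_nonneg[of j \<xi>] \<epsilon> jap_ge(3)[of \<xi>] by (simp add: 0 dyadic_deriv_0 powr_mult \<epsilon>_def)
  qed simp
next
  case (Suc l')
  define t where "t = real l - \<delta>"
  have t: "0 \<le> t" "t \<le> 2 * real l" using \<delta> Suc by (auto simp: t_def)
  obtain c where c: "c \<ge> 0" "\<And>(i::'n) \<epsilon> \<xi> t. 0 < \<epsilon> \<Longrightarrow> \<epsilon> \<le> 1 \<Longrightarrow> 0 \<le> t \<Longrightarrow> t \<le> 2 * real l \<Longrightarrow>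
    norm (gauss_deriv i \<epsilon> l \<xi>) \<le> c * \<epsilon> ^ l * (\<epsilon> * jap \<xi>) powr (- t)"
    using gauss_deriv_bound[where 'n='n, of l l] by blast
  have g: "norm (gauss_deriv i \<epsilon> l \<xi>) \<le> c * \<epsilon> powr \<delta> * jap \<xi> powr (\<delta> - real l)" if \<epsilon>: "0 < \<epsilon>" "\<epsilon> \<le> 1" for i :: 'n and \<epsilon> and \<xi> :: "real^'n"
  proof -
    have "norm (gauss_deriv i \<epsilon> l \<xi>) \<le> c * \<epsilon> ^ l * (\<epsilon> * jap \<xi>) powr (- t)" by (rule c(2)[OF \<epsilon> t])
    also have "\<dots> = c * (\<epsilon> powr real l * \<epsilon> powr (- t)) * jap \<xi> powr (- t)"
      using \<epsilon> jap_ge(3)[of \<xi>] by (simp add: powr_mult powr_realpow)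
    also have "\<epsilon> powr real l * \<epsilon> powr (- t) = \<epsilon> powr \<delta>" unfolding powr_add[symmetric] by (simp add: t_def)
    finally show ?thesis by (simp add: t_def)
  qed
  show ?thesis
  proof (rule that[of "3 * c"])
    show "3 * c \<ge> 0" using c by simp
    fix i :: 'n and j and \<xi> :: "real^'n"
    define S where "S = c * ((1 / 2) ^ j) powr \<delta> * jap \<xi> powr (\<delta> - real l)"
    have S: "0 \<le> S" using c by (simp add: S_def)
    have gj: "norm (gauss_deriv i ((1 / 2) ^ j) l \<xi>) \<le> S"
      unfolding S_def by (rule g) (auto simp: power_le_one)
    have "norm (dyadic_deriv i j l \<xi>) \<le> 3 * S"
    proof (cases j)
      case 0
      then have e: "dyadic_deriv i j l \<xi> = gauss_deriv i ((1 / 2) ^ j) l \<xi>" by (simp add: dyadic_deriv_def)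
      show ?thesis unfolding e using gj S by linarith
    next
      case (Suc j')
      have "(1 / 2) ^ j' = 2 * (1 / 2 :: real) ^ j" by (simp add: Suc)
      then have "((1 / 2) ^ j') powr \<delta> = 2 powr \<delta> * ((1 / 2 :: real) ^ j) powr \<delta>"
        by (simp only: powr_mult)
      also have "\<dots> \<le> 2 * ((1 / 2) ^ j) powr \<delta>"
        using \<delta> powr_mono[of \<delta> 1 2] by (intro mult_right_mono) auto
      finally have "c * ((1 / 2) ^ j') powr \<delta> * jap \<xi> powr (\<delta> - real l) \<le> c * (2 * ((1 / 2) ^ j) powr \<delta>) * jap \<xi> powr (\<delta> - real l)"
        using c by (intro mult_right_mono mult_left_mono) auto
      moreover have "norm (gauss_deriv i ((1 / 2) ^ j') l \<xi>) \<le> c * ((1 / 2) ^ j') powr \<delta> * jap \<xi> powr (\<delta> - real l)"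
        by (rule g) (auto simp: power_le_one)
      ultimately have gj': "norm (gauss_deriv i ((1 / 2) ^ j') l \<xi>) \<le> 2 * S" by (simp add: S_def mult_ac)
      from Suc have e: "dyadic_deriv i j l \<xi> = gauss_deriv i ((1 / 2) ^ j) l \<xi> - gauss_deriv i ((1 / 2) ^ j') l \<xi>"
        by (simp add: dyadic_deriv_def)
      show ?thesis unfolding e using gj gj'
        norm_triangle_ineq4[of "gauss_deriv i ((1 / 2) ^ j) l \<xi>" "gauss_deriv i ((1 / 2) ^ j') l \<xi>"]
        by linarith
    qed
    then show "norm (dyadic_deriv i j l \<xi>) \<le> 3 * c * ((1 / 2) ^ j) powr \<delta> * jap \<xi> powr (\<delta> - real l)"
      by (simp add: S_def mult.assoc)
  qed
qed

section \<open>Kernel estimates for symbols\<close>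

text \<open>The symbol estimates for a fixed \<open>x\<close>, restricted to pure derivatives and with prescribed constants, so that
  the kernel bounds below are uniform in \<open>x\<close>.\<close>

definition symbol_bound :: "real \<Rightarrow> real \<Rightarrow> (nat \<Rightarrow> real) \<Rightarrow> (real^'n::finite \<Rightarrow> complex) \<Rightarrow> bool" where
  "symbol_bound m \<rho> C a \<longleftrightarrow> (\<forall>i k. (\<forall>\<xi>. iter_partial (replicate k i) a differentiable (at \<xi>)) \<and>
     (\<forall>\<xi>. norm (iter_partial (replicate k i) a \<xi>) \<le> C k * jap \<xi> powr (m - \<rho> * real k)))"

definition kernel_piece :: "(real^'n::finite \<Rightarrow> complex) \<Rightarrow> nat \<Rightarrow> real^'n \<Rightarrow> complex" where
  "kernel_piece a j z = ft (\<lambda>\<xi>. a \<xi> * complex_of_real (dyadic_piece j \<xi>)) z"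

lemma symbol_bound_measurable:
  assumes "symbol_bound m \<rho> C a" shows "a \<in> borel_measurable borel"
proof -
  have "\<forall>\<xi>. a differentiable (at \<xi>)" using assms unfolding symbol_bound_def by (metis iter_partial.simps(1) replicate_0)
  then show ?thesis
    by (intro borel_measurable_continuous_onI) (auto simp: continuous_on_eq_continuous_at intro: differentiable_imp_continuous_within)
qed

lemma symbol_bound_nonneg:
  assumes "symbol_bound m \<rho> C (a :: real^'n::finite \<Rightarrow> complex)" shows "0 \<le> C k"
proof -
  have "0 \<le> C k * jap (0 :: real^'n) powr (m - \<rho> * real k)"
    using assms order_trans[OF norm_ge_zero] unfolding symbol_bound_def by blast
  then show ?thesis using jap_ge(3)[of "0 :: real^'n"] by (simp add: zero_le_mult_iff)
qed

lemma symbol_bound_0: "symbol_bound m \<rho> C a \<Longrightarrow> norm (a \<xi>) \<le> C 0 * jap \<xi> powr m"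
  unfolding symbol_bound_def by (metis diff_zero iter_partial.simps(1) mult_zero_right of_nat_0 replicate_0)

lemma jap_powr_mono: "s \<le> t \<Longrightarrow> jap \<xi> powr s \<le> jap \<xi> powr t"
  using jap_ge(1) by (intro powr_mono) auto

lemma norm_le_max_component:
  fixes z :: "real^'n::finite"
  obtains i where "norm z \<le> real CARD('n) * \<bar>z $ i\<bar>"
proof -
  have "Max (range (\<lambda>i. \<bar>z $ i\<bar>)) \<in> range (\<lambda>i. \<bar>z $ i\<bar>)" by (intro Max_in) auto
  then obtain i where "Max (range (\<lambda>i. \<bar>z $ i\<bar>)) = \<bar>z $ i\<bar>" by (rule rangeE)
  then have i: "\<bar>z $ i'\<bar> \<le> \<bar>z $ i\<bar>" for i' by (metis Max_ge finite finite_imageI rangeI)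
  have "norm z \<le> (\<Sum>i'\<in>UNIV. \<bar>z $ i'\<bar>)" by (rule norm_le_l1_cart)
  also have "\<dots> \<le> (\<Sum>i'\<in>(UNIV :: 'n set). \<bar>z $ i\<bar>)" by (intro sum_mono i)
  finally show ?thesis using that[of i] by simp
qed

text \<open>The first bound is the trivial one for a symbol of size \<open>O(1)\<close> cut off at frequency \<open>2\<^sup>j\<close>. For the second, the
  \<open>k\<close>-th derivative of the cut-off symbol is \<open>O(2\<^bsup>-j\<delta>\<^esup> \<langle>\<xi>\<rangle>\<^bsup>m-\<rho>k+\<delta>\<^esup>)\<close> by Leibniz' rule, and for \<open>k \<ge> n\<close> the exponent is
  below \<open>-n\<close>; this is where the condition on \<open>m\<close> enters.\<close>

lemma kernel_piece_bounds:
  fixes m \<rho> \<delta> :: real and C :: "nat \<Rightarrow> real"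
  assumes \<rho>: "0 \<le> \<rho>" "\<rho> \<le> 1" and m: "m \<le> 0" and \<delta>: "0 < \<delta>" "\<delta> \<le> 1" "m + \<delta> < real CARD('n) * (\<rho> - 1)"
  obtains B1 B2 where "B1 \<ge> 0" "\<And>k. B2 k \<ge> 0"
    "\<And>(a :: real^'n::finite \<Rightarrow> complex) j z. symbol_bound m \<rho> C a \<Longrightarrow> norm (kernel_piece a j z) \<le> B1 * (2 ^ j) powr (real CARD('n) + 1)"
    "\<And>(a :: real^'n::finite \<Rightarrow> complex) j z k. symbol_bound m \<rho> C a \<Longrightarrow> CARD('n) \<le> k \<Longrightarrow>
        norm z ^ k * norm (kernel_piece a j z) \<le> B2 k * ((1 / 2) ^ j) powr \<delta>"
proof -
  define n where "n = real CARD('n)"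
  define q where "q = n + 1"
  have q: "q > real CARD('n)" "0 \<le> q" by (auto simp: q_def n_def)
  define R where "R l = (SOME c. c \<ge> 0 \<and> (\<forall>(i::'n) j \<xi>. norm (dyadic_deriv i j l \<xi>) \<le> c * (2 ^ j) powr q * jap \<xi> powr (- q)))" for l
  have R: "R l \<ge> 0 \<and> (\<forall>(i::'n) j \<xi>. norm (dyadic_deriv i j l \<xi>) \<le> R l * (2 ^ j) powr q * jap \<xi> powr (- q))" for l
    unfolding R_def
  proof (rule someI_ex)
    obtain c where "c \<ge> 0" "\<And>(i::'n) j \<xi>. norm (dyadic_deriv i j l \<xi>) \<le> c * (2 ^ j) powr q * jap \<xi> powr (- q)"
      by (rule dyadic_deriv_rapid[where 'n='n, OF q(2), of l]) (rule that)
    then show "\<exists>c. c \<ge> 0 \<and> (\<forall>(i::'n) j \<xi>. norm (dyadic_deriv i j l \<xi>) \<le> c * (2 ^ j) powr q * jap \<xi> powr (- q))"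
      by (intro exI[of _ c] conjI allI)
  qed
  define G where "G l = (SOME c. c \<ge> 0 \<and> (\<forall>(i::'n) j \<xi>. norm (dyadic_deriv i j l \<xi>) \<le> c * ((1 / 2) ^ j) powr \<delta> * jap \<xi> powr (\<delta> - real l)))" for l
  have G: "G l \<ge> 0 \<and> (\<forall>(i::'n) j \<xi>. norm (dyadic_deriv i j l \<xi>) \<le> G l * ((1 / 2) ^ j) powr \<delta> * jap \<xi> powr (\<delta> - real l))" for l
    unfolding G_def
  proof (rule someI_ex)
    obtain c where "c \<ge> 0" "\<And>(i::'n) j \<xi>. norm (dyadic_deriv i j l \<xi>) \<le> c * ((1 / 2) ^ j) powr \<delta> * jap \<xi> powr (\<delta> - real l)"
      by (rule dyadic_deriv_bound[where 'n='n, OF \<delta>(1,2), of l]) (rule that)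
    then show "\<exists>c. c \<ge> 0 \<and> (\<forall>(i::'n) j \<xi>. norm (dyadic_deriv i j l \<xi>) \<le> c * ((1 / 2) ^ j) powr \<delta> * jap \<xi> powr (\<delta> - real l))"
      by (intro exI[of _ c] conjI allI)
  qed
  define E where "E k = (\<Sum>l\<le>k. real (k choose l) * (\<bar>C l\<bar> * G (k - l)))" for k
  have E: "E k \<ge> 0" for k unfolding E_def using G by (intro sum_nonneg mult_nonneg_nonneg) auto
  define I where "I e = (LINT \<xi>|lborel. jap (\<xi> :: real^'n) powr e)" for e
  have I: "I e \<ge> 0" for e unfolding I_def by (intro integral_nonneg_AE) auto
  show ?thesis
  proof (rule that[of "\<bar>C 0\<bar> * R 0 * I (- q)" "\<lambda>k. n ^ k * (E k * I (m - \<rho> * real k + \<delta>))"])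
    show "0 \<le> \<bar>C 0\<bar> * R 0 * I (- q)" using R I by simp
    show "0 \<le> n ^ k * (E k * I (m - \<rho> * real k + \<delta>))" for k using E I by (simp add: n_def)
    fix a :: "real^'n \<Rightarrow> complex" and j z assume a: "symbol_bound m \<rho> C a"
    have [measurable]: "a \<in> borel_measurable borel" by (rule symbol_bound_measurable[OF a])
    have C: "C k \<ge> 0" for k by (rule symbol_bound_nonneg[OF a])
    define A where "A i k = iter_partial (replicate k i) a" for i k
    have Abd: "norm (A i k \<xi>) \<le> C k * jap \<xi> powr (m - \<rho> * real k)" for i k \<xi>
      using a unfolding symbol_bound_def A_def by blast
    have Ald: "line_derivs i (A i)" for i
      unfolding A_def by (rule line_derivs_iter_partial) (use a in \<open>auto simp: symbol_bound_def\<close>)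
    define D where "D i k \<xi> = (\<Sum>l\<le>k. of_nat (k choose l) * (A i l \<xi> * dyadic_deriv i j (k - l) \<xi>))" for i k \<xi>
    have Dld: "line_derivs i (D i)" for i
      unfolding D_def[abs_def] by (rule line_derivs_mult[OF Ald line_derivs_dyadic])
    have Dm [measurable]: "D i k \<in> borel_measurable borel" for i k using Dld by (simp add: line_derivs_def)
    have D0: "D i 0 = (\<lambda>\<xi>. a \<xi> * complex_of_real (dyadic_piece j \<xi>))" for i
      by (simp add: D_def A_def dyadic_deriv_0 fun_eq_iff)
    have norm_D: "norm (D i k \<xi>) \<le> (\<Sum>l\<le>k. real (k choose l) * (norm (A i l \<xi>) * norm (dyadic_deriv i j (k - l) \<xi>)))" for i k \<xi>
      unfolding D_def by (rule order_trans[OF norm_sum]) (simp add: norm_mult)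
    define Q where "Q k = (\<Sum>l\<le>k. real (k choose l) * (C l * (R (k - l) * (2 ^ j) powr q)))" for k
    have D1: "norm (D i k \<xi>) \<le> Q k * jap \<xi> powr (- q)" for i k \<xi>
    proof -
      have "norm (D i k \<xi>) \<le> (\<Sum>l\<le>k. real (k choose l) * (C l * (R (k - l) * (2 ^ j) powr q * jap \<xi> powr (- q))))"
      proof (rule order_trans[OF norm_D], intro sum_mono mult_left_mono)
        fix l
        have "0 \<le> \<rho> * real l" using \<rho> by simp
        then have e: "m - \<rho> * real l \<le> 0" using m by linarith
        have "norm (A i l \<xi>) \<le> C l * jap \<xi> powr (m - \<rho> * real l)" by (rule Abd)
        also have "\<dots> \<le> C l * 1"
          using jap_powr_mono[OF e, of \<xi>] jap_ge(3)[of \<xi>] C[of l] by (intro mult_left_mono) auto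
        finally show "norm (A i l \<xi>) * norm (dyadic_deriv i j (k - l) \<xi>) \<le> C l * (R (k - l) * (2 ^ j) powr q * jap \<xi> powr (- q))"
          using R[of "k - l"] C[of l] by (intro mult_mono) auto
      qed auto
      also have "\<dots> = Q k * jap \<xi> powr (- q)" unfolding Q_def sum_distrib_right by (rule sum.cong) (simp_all add: mult_ac)
      finally show ?thesis .
    qed
    have D2: "norm (D i k \<xi>) \<le> E k * ((1 / 2) ^ j) powr \<delta> * jap \<xi> powr (m - \<rho> * real k + \<delta>)" for i k \<xi>
    proof -
      have "norm (D i k \<xi>) \<le> (\<Sum>l\<le>k. real (k choose l) * (\<bar>C l\<bar> * G (k - l) * (((1 / 2) ^ j) powr \<delta> * jap \<xi> powr (m - \<rho> * real k + \<delta>))))"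
      proof (rule order_trans[OF norm_D], intro sum_mono mult_left_mono)
        fix l assume "l \<in> {..k}"
        then have l: "l \<le> k" by simp
        have "norm (A i l \<xi>) * norm (dyadic_deriv i j (k - l) \<xi>) \<le>
           (C l * jap \<xi> powr (m - \<rho> * real l)) * (G (k - l) * ((1 / 2) ^ j) powr \<delta> * jap \<xi> powr (\<delta> - real (k - l)))"
          using Abd G C[of l] by (intro mult_mono) auto
        also have "\<dots> = C l * G (k - l) * (((1 / 2) ^ j) powr \<delta> * jap \<xi> powr (m - \<rho> * real l + (\<delta> - real (k - l))))"
          by (simp add: powr_add mult_ac)
        also have "\<dots> \<le> C l * G (k - l) * (((1 / 2) ^ j) powr \<delta> * jap \<xi> powr (m - \<rho> * real k + \<delta>))"
        proof (intro mult_left_mono jap_powr_mono)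
          have "\<rho> * (real k - real l) \<le> 1 * (real k - real l)" using \<rho> l by (intro mult_right_mono) auto
          then show "m - \<rho> * real l + (\<delta> - real (k - l)) \<le> m - \<rho> * real k + \<delta>"
            using l by (simp add: of_nat_diff algebra_simps)
        qed (use C[of l] G[of "k - l"] in auto)
        finally show "norm (A i l \<xi>) * norm (dyadic_deriv i j (k - l) \<xi>) \<le> \<bar>C l\<bar> * G (k - l) * (((1 / 2) ^ j) powr \<delta> * jap \<xi> powr (m - \<rho> * real k + \<delta>))"
          using C[of l] by simp
      qed auto
      also have "\<dots> = E k * ((1 / 2) ^ j) powr \<delta> * jap \<xi> powr (m - \<rho> * real k + \<delta>)"
        unfolding E_def sum_distrib_right by (rule sum.cong) (simp_all add: mult_ac)
      finally show ?thesis .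
    qed
    have piece: "kernel_piece a j z = ft (D i 0) z" for i by (simp add: kernel_piece_def D0)
    fix i0 :: 'n
    have "norm (kernel_piece a j z) \<le> (LINT \<xi>|lborel. norm (D i0 0 \<xi>))"
      unfolding piece[of i0] by (rule norm_ft_le) simp
    also have "\<dots> \<le> (LINT \<xi>|lborel. (C 0 * R 0 * (2 ^ j) powr q) * jap (\<xi> :: real^'n) powr (- q))"
    proof (rule integral_mono)
      show "integrable lborel (\<lambda>\<xi>. norm (D i0 0 \<xi>))"
        by (intro integrable_norm integrable_jap_bound[OF _ D1 q(1)]) auto
      show "integrable lborel (\<lambda>\<xi> :: real^'n. (C 0 * R 0 * (2 ^ j) powr q) * jap \<xi> powr (- q))"
        using integrable_jap_powr[OF q(1)] by simp
      show "norm (D i0 0 \<xi>) \<le> (C 0 * R 0 * (2 ^ j) powr q) * jap \<xi> powr (- q)" for \<xi>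
        using D1[of i0 0 \<xi>] by (simp add: Q_def mult_ac)
    qed
    also have "\<dots> = C 0 * R 0 * (2 ^ j) powr q * I (- q)" by (simp add: I_def)
    finally show "norm (kernel_piece a j z) \<le> \<bar>C 0\<bar> * R 0 * I (- q) * (2 ^ j) powr (real CARD('n) + 1)"
      using C[of 0] by (simp add: q_def n_def mult_ac)
    fix k assume k: "CARD('n) \<le> k"
    obtain i where "norm z \<le> n * \<bar>z $ i\<bar>" unfolding n_def by (rule norm_le_max_component)
    then have "norm z ^ k \<le> (n * \<bar>z $ i\<bar>) ^ k" by (intro power_mono) auto
    then have "norm z ^ k * norm (kernel_piece a j z) \<le> n ^ k * (\<bar>z $ i\<bar> ^ k * norm (ft (D i 0) z))"
      unfolding piece[of i] by (simp add: power_mult_distrib mult.assoc[symmetric] mult_right_mono)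
    also have "\<dots> \<le> n ^ k * (LINT \<xi>|lborel. norm (D i k \<xi>))"
      by (intro mult_left_mono ft_decay[OF Dld D1 q(1)]) (simp add: n_def)
    also have "\<dots> \<le> n ^ k * (LINT \<xi>|lborel. (E k * ((1 / 2) ^ j) powr \<delta>) * jap (\<xi> :: real^'n) powr (m - \<rho> * real k + \<delta>))"
    proof (intro mult_left_mono integral_mono)
      show "integrable lborel (\<lambda>\<xi>. norm (D i k \<xi>))"
        by (intro integrable_norm integrable_jap_bound[OF _ D1 q(1)]) auto
      have "real CARD('n) * \<rho> \<le> real k * \<rho>" using k \<rho> by (intro mult_right_mono) auto
      then have "- (m - \<rho> * real k + \<delta>) > real CARD('n)" using \<delta>(3) by (simp add: algebra_simps)
      from integrable_jap_powr[OF this, unfolded minus_minus]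
      show "integrable lborel (\<lambda>\<xi> :: real^'n. (E k * ((1 / 2) ^ j) powr \<delta>) * jap \<xi> powr (m - \<rho> * real k + \<delta>))"
        by (intro integrable_mult_right)
    qed (use D2 in \<open>auto simp: n_def\<close>)
    also have "\<dots> = n ^ k * (E k * I (m - \<rho> * real k + \<delta>)) * ((1 / 2) ^ j) powr \<delta>" by (simp add: I_def mult_ac)
    finally show "norm z ^ k * norm (kernel_piece a j z) \<le> n ^ k * (E k * I (m - \<rho> * real k + \<delta>)) * ((1 / 2) ^ j) powr \<delta>" .
  qed
qed

text \<open>The first bound of \<open>kernel_piece_bounds\<close> to the power \<open>s\<close> times the second to the power \<open>1 - s\<close>. For \<open>s\<close> small,
  the growth \<open>2\<^bsup>j(n+1)s\<^esup>\<close> is beaten by the decay \<open>2\<^bsup>-j\<delta>(1-s)\<^esup>\<close>, and \<open>k = n\<close> leaves \<open>|z|\<^bsup>-n+ns\<^esup>\<close>, which is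
  locally integrable with room to spare.\<close>

lemma kernel_pieces_sum_bound:
  fixes m \<rho> :: real and C :: "nat \<Rightarrow> real"
  assumes \<rho>: "0 \<le> \<rho>" "\<rho> \<le> 1" and m: "m < real CARD('n) * (\<rho> - 1)"
  obtains \<epsilon> A B where "0 < \<epsilon>"
    "\<And>(a :: real^'n::finite \<Rightarrow> complex) z. symbol_bound m \<rho> C a \<Longrightarrow> 0 < norm z \<Longrightarrow>
       (\<Sum>j. ennreal (norm (kernel_piece a j z))) \<le> ennreal (A * norm z powr (\<epsilon> - real CARD('n)))"
    "\<And>L (a :: real^'n::finite \<Rightarrow> complex) z. symbol_bound m \<rho> C a \<Longrightarrow> 1 \<le> norm z \<Longrightarrow>
       (\<Sum>j. ennreal (norm (kernel_piece a j z))) \<le> ennreal (B L * norm z powr (- L))"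
proof -
  define n where "n = real CARD('n)"
  have n: "n \<ge> 1" by (simp add: n_def)
  \<comment> \<open>Half of the gap in the condition on \<open>m\<close>, so that the condition survives for \<open>m + \<delta>\<close>.\<close>
  define \<delta> where "\<delta> = min 1 ((n * (\<rho> - 1) - m) / 2)"
  have \<delta>: "0 < \<delta>" "\<delta> \<le> 1" "m + \<delta> < real CARD('n) * (\<rho> - 1)"
    using m by (auto simp: \<delta>_def n_def min_def field_simps)
  have "real CARD('n) * (\<rho> - 1) \<le> 0" using \<rho> by (simp add: mult_nonneg_nonpos)
  then have m0: "m \<le> 0" using m by linarith
  obtain B1 B2 where B: "B1 \<ge> 0" "\<And>k. B2 k \<ge> 0" and
    b1: "\<And>(a :: real^'n \<Rightarrow> complex) j z. symbol_bound m \<rho> C a \<Longrightarrow> norm (kernel_piece a j z) \<le> B1 * (2 ^ j) powr (n + 1)" and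
    b2: "\<And>(a :: real^'n \<Rightarrow> complex) j z k. symbol_bound m \<rho> C a \<Longrightarrow> CARD('n) \<le> k \<Longrightarrow>
        norm z ^ k * norm (kernel_piece a j z) \<le> B2 k * ((1 / 2) ^ j) powr \<delta>"
    using kernel_piece_bounds[where 'n='n, OF \<rho> m0 \<delta>, of C] unfolding n_def by metis
  \<comment> \<open>With this \<open>s\<close> the growth \<open>(n + 1) s\<close> is exactly half of the decay \<open>\<delta> (1 - s)\<close>.\<close>
  define s where "s = \<delta> / (2 * (n + 1) + \<delta>)"
  have s: "0 < s" "s < 1" using \<delta> n by (auto simp: s_def)
  have s_eq: "(n + 1) * s - \<delta> * (1 - s) = - (\<delta> / 2 * (1 - s))"
  proof -
    have "s * (2 * (n + 1) + \<delta>) = \<delta>" using \<delta> n by (simp add: s_def)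
    then have "2 * ((n + 1) * s) = \<delta> * (1 - s)" by (simp add: algebra_simps)
    then show ?thesis by (simp add: field_simps)
  qed
  define t where "t = (2::real) powr (- (\<delta> / 2 * (1 - s)))"
  have t: "0 < t" "t < 1" using \<delta> s by (auto simp: t_def powr_less_one)
  define H where "H k = B1 powr s * B2 k powr (1 - s)" for k
  define S where "S = (\<Sum>j. t ^ j)"
  have bd: "(\<Sum>j. ennreal (norm (kernel_piece a j z))) \<le> ennreal (H k * S * norm z powr (- (real k * (1 - s))))"
    if a: "symbol_bound m \<rho> C a" and z: "0 < norm z" and k: "CARD('n) \<le> k" for a :: "real^'n \<Rightarrow> complex" and z k
  proof -
    have pc: "norm (kernel_piece a j z) \<le> (H k * norm z powr (- (real k * (1 - s)))) * t ^ j" for j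
    proof -
      define X where "X = norm (kernel_piece a j z)"
      have X: "X \<ge> 0" by (simp add: X_def)
      have "X = X powr s * X powr (1 - s)" using X by (cases "X = 0") (simp_all flip: powr_add)
      also have "\<dots> \<le> (B1 * (2 ^ j) powr (n + 1)) powr s * (B2 k * ((1 / 2) ^ j) powr \<delta> / norm z ^ k) powr (1 - s)"
        using b1[OF a, of j z] b2[OF a k, of z j] z X s unfolding X_def[symmetric]
        by (intro mult_mono powr_mono2) (auto simp: field_simps)
      also have "\<dots> = H k * ((2 powr ((n + 1) * s)) ^ j * (2 powr (- (\<delta> * (1 - s)))) ^ j) * norm z powr (- (real k * (1 - s)))"
      proof -
        have e1: "(B1 * (2 ^ j) powr (n + 1)) powr s = B1 powr s * (2 powr ((n + 1) * s)) ^ j"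
          by (simp add: powr_mult powr_realpow[symmetric] powr_powr mult_ac)
        have "((1 / 2 :: real) ^ j) powr \<delta> = (2 powr (- \<delta>)) ^ j"
          by (simp add: power_one_over powr_divide powr_realpow[symmetric] powr_powr powr_minus inverse_eq_divide mult_ac)
        then have E1: "(((1 / 2) ^ j) powr \<delta>) powr (1 - s) = (2 powr (- (\<delta> * (1 - s)))) ^ j"
          by (simp add: powr_realpow[symmetric] powr_powr mult_ac)
        have E2: "(norm z ^ k) powr (1 - s) = norm z powr (real k * (1 - s))"
          using z by (simp add: powr_realpow[symmetric] powr_powr)
        have "(B2 k * ((1 / 2) ^ j) powr \<delta> / norm z ^ k) powr (1 - s) = B2 k powr (1 - s) * (((1 / 2) ^ j) powr \<delta>) powr (1 - s) / (norm z ^ k) powr (1 - s)"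
          by (simp only: powr_mult powr_divide)
        also have "\<dots> = B2 k powr (1 - s) * (2 powr (- (\<delta> * (1 - s)))) ^ j * norm z powr (- (real k * (1 - s)))"
          unfolding E1 E2 by (simp add: powr_minus_divide[of "norm z"])
        finally have e2: "(B2 k * ((1 / 2) ^ j) powr \<delta> / norm z ^ k) powr (1 - s) = B2 k powr (1 - s) * (2 powr (- (\<delta> * (1 - s)))) ^ j * norm z powr (- (real k * (1 - s)))" .
        show ?thesis unfolding e1 e2 by (simp add: H_def mult_ac)
      qed
      also have "(2 powr ((n + 1) * s)) ^ j * (2 powr (- (\<delta> * (1 - s)))) ^ j = t ^ j"
        unfolding t_def s_eq[symmetric] by (simp add: power_mult_distrib[symmetric] flip: powr_add)
      finally show ?thesis by (simp add: X_def mult_ac)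
    qed
    have c: "0 \<le> H k * norm z powr (- (real k * (1 - s)))" by (simp add: H_def)
    have "(\<Sum>j. ennreal (norm (kernel_piece a j z))) \<le> (\<Sum>j. ennreal ((H k * norm z powr (- (real k * (1 - s)))) * t ^ j))"
      by (intro suminf_le ennreal_leI pc) auto
    also have "\<dots> = ennreal (\<Sum>j. (H k * norm z powr (- (real k * (1 - s)))) * t ^ j)"
      by (rule suminf_ennreal2) (use c t in \<open>auto intro!: summable_mult summable_geometric mult_nonneg_nonneg\<close>)
    also have "(\<Sum>j. (H k * norm z powr (- (real k * (1 - s)))) * t ^ j) = (H k * norm z powr (- (real k * (1 - s)))) * S"
      unfolding S_def by (rule suminf_mult) (use t in \<open>auto intro: summable_geometric\<close>)
    finally show ?thesis by (simp add: mult_ac)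
  qed
  have S0: "0 \<le> S" unfolding S_def using t by (intro suminf_nonneg summable_geometric) auto
  define kL where "kL L = CARD('n) + nat \<lceil>L / (1 - s)\<rceil>" for L
  show ?thesis
  proof (rule that[of "n * s" "H CARD('n) * S" "\<lambda>L. H (kL L) * S"])
    show "0 < n * s" using n s by simp
    fix a :: "real^'n \<Rightarrow> complex" and z :: "real^'n" assume a: "symbol_bound m \<rho> C a"
    show "(\<Sum>j. ennreal (norm (kernel_piece a j z))) \<le> ennreal (H CARD('n) * S * norm z powr (n * s - real CARD('n)))" if "0 < norm z"
      using bd[OF a that order_refl] by (simp add: n_def algebra_simps)
    fix L assume z: "1 \<le> norm z"
    have "L / (1 - s) \<le> real (nat \<lceil>L / (1 - s)\<rceil>)" by (rule real_nat_ceiling_ge)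
    also have "\<dots> \<le> real (kL L)" by (simp add: kL_def)
    finally have "L \<le> real (kL L) * (1 - s)" using s by (simp add: field_simps)
    then have "norm z powr (- (real (kL L) * (1 - s))) \<le> norm z powr (- L)" using z by (intro powr_mono) auto
    then have "H (kL L) * S * norm z powr (- (real (kL L) * (1 - s))) \<le> H (kL L) * S * norm z powr (- L)"
      using S0 by (intro mult_left_mono) (auto simp: H_def)
    moreover have "(\<Sum>j. ennreal (norm (kernel_piece a j z))) \<le> ennreal (H (kL L) * S * norm z powr (- (real (kL L) * (1 - s))))"
      using z by (intro bd a) (auto simp: kL_def)
    ultimately show "(\<Sum>j. ennreal (norm (kernel_piece a j z))) \<le> ennreal (H (kL L) * S * norm z powr (- L))"
      using ennreal_leI order_trans by blast
  qed
qed

section \<open>The integral kernel of a pseudo-differential operator\<close>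

definition full_kernel :: "(real^'n::finite \<Rightarrow> complex) \<Rightarrow> real^'n \<Rightarrow> complex" where
  "full_kernel a z = (\<Sum>j. kernel_piece a j z)"

lemma norm_full_kernel_le: "ennreal (norm (full_kernel a z)) \<le> (\<Sum>j. ennreal (norm (kernel_piece a j z)))"
proof (cases "(\<Sum>j. ennreal (norm (kernel_piece a j z))) = top")
  case False
  then have s: "summable (\<lambda>j. norm (kernel_piece a j z))" by (intro summable_suminf_not_top) auto
  then have "norm (full_kernel a z) \<le> (\<Sum>j. norm (kernel_piece a j z))"
    unfolding full_kernel_def by (rule summable_norm)
  then show ?thesis using s by (subst suminf_ennreal2) (auto intro: ennreal_leI)
qed simp

text \<open>The complement of the support is open, so derivatives vanish there as well.\<close>

lemma test_function_vanishes:
  assumes "f \<in> test_functions" "x \<notin> closure {x. f x \<noteq> 0}"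
  shows "iter_partial is f x = 0"
  using assms(2)
proof (induction "is" arbitrary: x)
  case Nil
  then have "x \<notin> {x. f x \<noteq> 0}" using subsetD[OF closure_subset, of x "{x. f x \<noteq> 0}"] by (rule contrapos_nn)
  then show ?case by simp
next
  case (Cons i "is")
  let ?K = "closure {x. f x \<noteq> 0}"
  have "((\<lambda>x. 0) has_derivative (\<lambda>x. 0)) (at x)" by simp
  moreover have "open (- ?K)" "x \<in> - ?K" using Cons.prems by auto
  ultimately have "(iter_partial is f has_derivative (\<lambda>x. 0)) (at x)"
    by (rule has_derivative_transform_within_open) (use Cons.IH in auto)
  then have "frechet_derivative (iter_partial is f) (at x) = (\<lambda>x. 0)"
    by (rule frechet_derivative_at[symmetric])
  then show ?case by (simp add: partial_deriv_def)
qed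

lemma test_function_differentiable:
  "f \<in> test_functions \<Longrightarrow> iter_partial is f differentiable (at x)"
  by (simp add: test_functions_def smooth_def)

lemma test_function_continuous: "f \<in> test_functions \<Longrightarrow> continuous_on UNIV f"
  using test_function_differentiable[of f "[]"]
  by (auto simp: continuous_on_eq_continuous_at intro: differentiable_imp_continuous_within)

lemma test_function_measurable: "f \<in> test_functions \<Longrightarrow> f \<in> borel_measurable borel"
  by (intro borel_measurable_continuous_onI test_function_continuous)

lemma test_function_deriv_bound:
  fixes f :: "real^'n::finite \<Rightarrow> complex"
  assumes f: "f \<in> test_functions" and q: "q \<ge> 0"
  shows "\<exists>C. \<forall>x. norm (iter_partial is f x) \<le> C * jap x powr (- q)"
proof -
  let ?g = "iter_partial is f" and ?K = "closure {x. f x \<noteq> 0}"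
  have K: "compact ?K" using f by (simp add: test_functions_def)
  have "continuous_on UNIV ?g"
    using test_function_differentiable[OF f]
    by (auto simp: continuous_on_eq_continuous_at intro: differentiable_imp_continuous_within)
  then have g: "continuous_on ?K ?g" by (rule continuous_on_subset) simp
  have j: "continuous_on ?K jap" by (rule continuous_on_subset[OF continuous_on_jap]) simp
  have j0: "\<forall>x\<in>?K. jap x \<noteq> 0" using jap_ge(3) by (metis less_irrefl)
  have "continuous_on ?K (\<lambda>x. norm (?g x) * jap x powr q)"
    by (rule continuous_on_mult[OF continuous_on_norm[OF g] continuous_on_powr[OF j continuous_on_const j0]])
  then have "bounded ((\<lambda>x. norm (?g x) * jap x powr q) ` ?K)"
    by (intro compact_imp_bounded compact_continuous_image K)
  then obtain B where B: "\<And>x. x \<in> ?K \<Longrightarrow> norm (norm (?g x) * jap x powr q) \<le> B"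
    unfolding bounded_iff by auto
  have "norm (?g x) \<le> max B 0 * jap x powr (- q)" for x
  proof (cases "x \<in> ?K")
    case True
    then have "norm (?g x) * jap x powr q \<le> max B 0" using B[of x] by simp
    then have "norm (?g x) * jap x powr q * jap x powr (- q) \<le> max B 0 * jap x powr (- q)"
      by (intro mult_right_mono) auto
    moreover have "jap x powr q * jap x powr (- q) = 1" using jap_ge(3)[of x] by (simp flip: powr_add)
    ultimately show ?thesis by (simp add: mult.assoc)
  next
    case False
    then show ?thesis using test_function_vanishes[OF f False] by simp
  qed
  then show ?thesis by blast
qed

text \<open>The estimate \<open>ft_decay\<close> in the direction of the largest coordinate of \<open>\<xi>\<close>, combined with the trivial bound
  for small \<open>\<xi>\<close>.\<close>

lemma ft_test_function_decay:
  fixes f :: "real^'n::finite \<Rightarrow> complex"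
  assumes f: "f \<in> test_functions"
  obtains C where "C \<ge> 0" "\<And>\<xi>. norm (ft f \<xi>) \<le> C * jap \<xi> powr (- (real CARD('n) + 1))"
proof -
  define q where "q = real CARD('n) + 1"
  define N where "N = CARD('n) + 1"
  have q: "q > real CARD('n)" "q \<ge> 0" "real N = q" by (auto simp: q_def N_def)
  have "\<exists>C. \<forall>k x. norm (iter_partial (replicate k i) f x) \<le> C k * jap x powr (- q)" for i
  proof -
    have "\<forall>k. \<exists>C. \<forall>x. norm (iter_partial (replicate k i) f x) \<le> C * jap x powr (- q)"
      by (intro allI test_function_deriv_bound[OF f q(2)])
    from choice[OF this] show ?thesis .
  qed
  then have "\<forall>i. \<exists>C. \<forall>k x. norm (iter_partial (replicate k i) f x) \<le> C k * jap x powr (- q)" by (rule allI)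
  from choice[OF this]
  obtain Cf where Cf: "\<And>i k x. norm (iter_partial (replicate k i) f x) \<le> Cf i k * jap x powr (- q)" by blast
  have ld: "line_derivs i (\<lambda>k. iter_partial (replicate k i) f)" for i
    by (rule line_derivs_iter_partial) (use test_function_differentiable[OF f] in auto)
  define M where "M i = (LINT \<xi>|lborel. norm (iter_partial (replicate N i) f \<xi>))" for i
  define M0 where "M0 = (LINT \<xi>|lborel. norm (f \<xi>))"
  have M: "0 \<le> M i" "0 \<le> M0" for i unfolding M_def M0_def by auto
  have dec: "\<bar>\<xi> $ i\<bar> ^ N * norm (ft f \<xi>) \<le> M i" for i \<xi>
    using ft_decay[OF ld Cf q(1), of \<xi> i N] by (simp add: M_def)
  have dec0: "norm (ft f \<xi>) \<le> M0" for \<xi>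
    unfolding M0_def by (rule norm_ft_le[OF test_function_measurable[OF f]])
  define C where "C = 2 ^ N * (M0 + real CARD('n) ^ N * (\<Sum>i\<in>UNIV. M i))"
  show ?thesis
  proof (rule that[of C])
    show "C \<ge> 0" unfolding C_def using M by (intro mult_nonneg_nonneg add_nonneg_nonneg sum_nonneg) auto
    fix \<xi> :: "real^'n"
    obtain i where n\<xi>: "norm \<xi> \<le> real CARD('n) * \<bar>\<xi> $ i\<bar>" by (rule norm_le_max_component)
    have "jap \<xi> ^ N \<le> 2 ^ N * (1 + (real CARD('n) * \<bar>\<xi> $ i\<bar>) ^ N)"
    proof -
      have "jap \<xi> \<le> 2 * max 1 (norm \<xi>)" using jap_ge(4)[of \<xi>] by (simp add: max_def)
      then have "jap \<xi> ^ N \<le> (2 * max 1 (norm \<xi>)) ^ N" using jap_ge(3)[of \<xi>] by (intro power_mono) auto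
      also have "\<dots> = 2 ^ N * max 1 (norm \<xi>) ^ N" by (rule power_mult_distrib)
      also have "max 1 (norm \<xi>) ^ N \<le> 1 + norm \<xi> ^ N" by (simp add: max_def)
      also have "norm \<xi> ^ N \<le> (real CARD('n) * \<bar>\<xi> $ i\<bar>) ^ N" using n\<xi> by (intro power_mono) auto
      finally show ?thesis by simp
    qed
    then have "jap \<xi> ^ N * norm (ft f \<xi>) \<le> 2 ^ N * (1 + (real CARD('n) * \<bar>\<xi> $ i\<bar>) ^ N) * norm (ft f \<xi>)"
      by (intro mult_right_mono) auto
    also have "\<dots> = 2 ^ N * (norm (ft f \<xi>) + real CARD('n) ^ N * (\<bar>\<xi> $ i\<bar> ^ N * norm (ft f \<xi>)))"
      by (simp add: power_mult_distrib algebra_simps)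
    also have "\<dots> \<le> 2 ^ N * (M0 + real CARD('n) ^ N * (\<Sum>i\<in>UNIV. M i))"
    proof (intro mult_left_mono add_mono dec0)
      have "M i \<le> (\<Sum>i\<in>UNIV. M i)" by (rule member_le_sum) (use M in auto)
      with dec show "\<bar>\<xi> $ i\<bar> ^ N * norm (ft f \<xi>) \<le> (\<Sum>i\<in>UNIV. M i)" by (rule order_trans)
    qed auto
    finally have "jap \<xi> powr q * norm (ft f \<xi>) \<le> C"
      using jap_ge(3)[of \<xi>] by (simp add: C_def powr_realpow[symmetric] q(3))
    then have "jap \<xi> powr (- q) * (jap \<xi> powr q * norm (ft f \<xi>)) \<le> jap \<xi> powr (- q) * C"
      by (intro mult_left_mono) auto
    moreover have "jap \<xi> powr (- q) * (jap \<xi> powr q * norm (ft f \<xi>)) = norm (ft f \<xi>)"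
    proof -
      have "jap \<xi> powr (- q) * jap \<xi> powr q = 1" using jap_ge(3)[of \<xi>] by (simp flip: powr_add)
      then show ?thesis by (simp only: mult.assoc[symmetric] mult_1_left)
    qed
    ultimately have "norm (ft f \<xi>) \<le> C * jap \<xi> powr (- q)" by (simp only: mult.commute[of C])
    then show "norm (ft f \<xi>) \<le> C * jap \<xi> powr (- (real CARD('n) + 1))" by (simp only: q_def)
  qed
qed

text \<open>Stated for a composition with maps \<open>X\<close> and \<open>z\<close>, in order to apply both to \<open>(x, y)\<close> jointly and to \<open>y\<close> alone.\<close>

lemma borel_measurable_kernel_piece:
  fixes a :: "'x \<Rightarrow> real^'n::finite \<Rightarrow> complex"
  assumes a: "(\<lambda>(x, \<xi>). a x \<xi>) \<in> borel_measurable (M \<Otimes>\<^sub>M borel)" and z [measurable]: "z \<in> borel_measurable N" and X [measurable]: "X \<in> measurable N M"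
  shows "(\<lambda>u. kernel_piece (a (X u)) j (z u)) \<in> borel_measurable N"
proof -
  have [measurable]: "dyadic_piece j \<in> borel_measurable (borel :: (real^'n) measure)"
    unfolding dyadic_piece_def[abs_def] by (cases j) simp_all
  have "(\<lambda>w. (X (fst w), snd w)) \<in> measurable (N \<Otimes>\<^sub>M (lborel :: (real^'n) measure)) (M \<Otimes>\<^sub>M borel)" by measurable
  from measurable_compose[OF this a]
  have [measurable]: "(\<lambda>w. a (X (fst w)) (snd w)) \<in> borel_measurable (N \<Otimes>\<^sub>M lborel)" by simp
  have "(\<lambda>w. (z (fst w) \<bullet> snd w)) \<in> borel_measurable (N \<Otimes>\<^sub>M (lborel :: (real^'n) measure))" by measurable
  then have [measurable]: "(\<lambda>w. exp (\<i> * complex_of_real (z (fst w) \<bullet> snd w))) \<in> borel_measurable (N \<Otimes>\<^sub>M (lborel :: (real^'n) measure))"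
  proof (rule measurable_compose[where g = "\<lambda>t. exp (\<i> * complex_of_real t)"])
    show "(\<lambda>t. exp (\<i> * complex_of_real t)) \<in> borel_measurable borel"
      by (intro borel_measurable_continuous_onI continuous_intros)
  qed
  have "(\<lambda>(u, \<xi>). a (X u) \<xi> * complex_of_real (dyadic_piece j \<xi>) * exp (\<i> * complex_of_real (z u \<bullet> \<xi>)))
     \<in> borel_measurable (N \<Otimes>\<^sub>M lborel)"
    unfolding case_prod_beta by measurable
  from lborel.borel_measurable_lebesgue_integral[OF this]
  show ?thesis unfolding kernel_piece_def ft_def by simp
qed

text \<open>Fubini's theorem; the cut-off makes the double integral absolutely convergent.\<close>

lemma kernel_piece_integral:
  fixes a f :: "real^'n::finite \<Rightarrow> complex"
  assumes [measurable]: "a \<in> borel_measurable borel" "f \<in> borel_measurable borel" and f: "integrable lborel f"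
    and aj: "integrable lborel (\<lambda>\<xi>. a \<xi> * complex_of_real (dyadic_piece j \<xi>))"
  shows "integrable lborel (\<lambda>y. kernel_piece a j (x - y) * f y)"
    and "(LINT y|lborel. kernel_piece a j (x - y) * f y) =
      (LINT \<xi>|lborel. a \<xi> * complex_of_real (dyadic_piece j \<xi>) * exp (\<i> * complex_of_real (x \<bullet> \<xi>)) * ft f (- \<xi>))"
proof -
  let ?c = "\<lambda>\<xi>. a \<xi> * complex_of_real (dyadic_piece j \<xi>)"
  let ?h = "\<lambda>y \<xi>. ?c \<xi> * exp (\<i> * complex_of_real ((x - y) \<bullet> \<xi>)) * f y"
  have [measurable]: "dyadic_piece j \<in> borel_measurable (borel :: (real^'n) measure)"
    unfolding dyadic_piece_def[abs_def] by (cases j) simp_all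
  have [measurable]: "(\<lambda>w. exp (\<i> * complex_of_real ((x - fst w) \<bullet> snd w))) \<in> borel_measurable ((lborel :: (real^'n) measure) \<Otimes>\<^sub>M (lborel :: (real^'n) measure))"
  proof (rule measurable_compose[where g = "\<lambda>t. exp (\<i> * complex_of_real t)" and N = borel])
    show "(\<lambda>t. exp (\<i> * complex_of_real t)) \<in> borel_measurable borel"
      by (intro borel_measurable_continuous_onI continuous_intros)
  qed measurable
  have hm: "(\<lambda>(y, \<xi>). ?h y \<xi>) \<in> borel_measurable (lborel \<Otimes>\<^sub>M lborel)" unfolding case_prod_beta by measurable
  have hi: "integrable lborel (\<lambda>\<xi>. ?h y \<xi>)" for y
    by (intro integrable_mult_left ft_integrable[OF _ aj]) measurable
  have int: "integrable (lborel \<Otimes>\<^sub>M lborel) (\<lambda>(y, \<xi>). ?h y \<xi>)"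
  proof (rule lborel_pair.Fubini_integrable[OF hm])
    have "(\<lambda>y. LINT \<xi>|lborel. norm (?h y \<xi>)) = (\<lambda>y. (LINT \<xi>|lborel. norm (?c \<xi>)) * norm (f y))"
      by (simp add: norm_mult)
    then show "integrable lborel (\<lambda>y. LINT \<xi>|lborel. norm ((\<lambda>(y, \<xi>). ?h y \<xi>) (y, \<xi>)))" using f by simp
    show "AE y in lborel. integrable lborel (\<lambda>\<xi>. (\<lambda>(y, \<xi>). ?h y \<xi>) (y, \<xi>))" using hi by simp
  qed
  have 1: "(LINT \<xi>|lborel. ?h y \<xi>) = kernel_piece a j (x - y) * f y" for y
    unfolding kernel_piece_def ft_def by simp
  have 2: "(LINT y|lborel. ?h y \<xi>) = ?c \<xi> * exp (\<i> * complex_of_real (x \<bullet> \<xi>)) * ft f (- \<xi>)" for \<xi>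
  proof -
    have eq: "?h y \<xi> = ?c \<xi> * exp (\<i> * complex_of_real (x \<bullet> \<xi>)) * (f y * exp (\<i> * complex_of_real (- \<xi> \<bullet> y)))" for y
    proof -
      have "\<i> * complex_of_real ((x - y) \<bullet> \<xi>) = \<i> * complex_of_real (x \<bullet> \<xi>) + \<i> * complex_of_real (- \<xi> \<bullet> y)"
        by (simp add: inner_diff_left inner_commute algebra_simps)
      then show ?thesis by (simp only: exp_add) (simp add: mult_ac)
    qed
    show ?thesis unfolding ft_def eq by (rule integral_mult_right_zero)
  qed
  show "integrable lborel (\<lambda>y. kernel_piece a j (x - y) * f y)"
    using lborel_pair.integrable_fst'[OF int] by (simp only: prod.case 1)
  show "(LINT y|lborel. kernel_piece a j (x - y) * f y) =
      (LINT \<xi>|lborel. a \<xi> * complex_of_real (dyadic_piece j \<xi>) * exp (\<i> * complex_of_real (x \<bullet> \<xi>)) * ft f (- \<xi>))"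
    using lborel_pair.Fubini_integral[OF int] by (simp only: 1 2)
qed

text \<open>Sum the identity \<open>kernel_piece_integral\<close> over \<open>j \<le> J\<close>. On the frequency side the cutoffs add up to
  \<open>exp(-4\<^bsup>-J\<^esup>|\<xi>|\<^sup>2)\<close> and dominated convergence applies because the Fourier transform of \<open>f\<close> decays rapidly; on
  the space side it applies by the assumption \<open>fin\<close>.\<close>

lemma psido_eq_kernel:
  fixes a :: "real^'n::finite \<Rightarrow> real^'n \<Rightarrow> complex"
  assumes a: "symbol_bound m \<rho> C (a x)" and m: "m \<le> 0" and f: "f \<in> test_functions"
    and fin: "(\<integral>\<^sup>+y. (\<Sum>j. ennreal (norm (kernel_piece (a x) j (x - y)))) * ennreal (norm (f y)) \<partial>lebesgue) < top"
  shows "psido a f x = (LINT y|lebesgue. complex_of_real (1 / (2 * pi) ^ CARD('n)) * full_kernel (a x) (x - y) * f y)"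
proof -
  define q where "q = real CARD('n) + 1"
  have q: "q > real CARD('n)" "q \<ge> 0" by (auto simp: q_def)
  have am [measurable]: "a x \<in> borel_measurable borel" by (rule symbol_bound_measurable[OF a])
  have fm [measurable]: "f \<in> borel_measurable borel" by (rule test_function_measurable[OF f])
  have C0: "0 \<le> C 0" by (rule symbol_bound_nonneg[OF a])
  have abd: "norm (a x \<xi>) \<le> C 0" for \<xi>
  proof -
    have "norm (a x \<xi>) \<le> C 0 * jap \<xi> powr m" by (rule symbol_bound_0[OF a])
    also have "\<dots> \<le> C 0 * 1" using jap_powr_mono[OF m, of \<xi>] jap_ge(3)[of \<xi>] C0 by (intro mult_left_mono) auto
    finally show ?thesis by simp
  qed
  obtain Cf where "\<And>y. norm (f y) \<le> Cf * jap y powr (- q)" using test_function_deriv_bound[OF f q(2), of "[]"] by auto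
  from integrable_jap_bound[OF fm this q(1)] have fi: "integrable lborel f" .
  obtain F where F: "F \<ge> 0" "\<And>\<xi>. norm (ft f \<xi>) \<le> F * jap \<xi> powr (- q)"
    using ft_test_function_decay[OF f] unfolding q_def by blast
  have [measurable]: "(\<lambda>\<xi>. ft f (- \<xi>)) \<in> borel_measurable borel"
  proof -
    have "(\<lambda>w. exp (\<i> * complex_of_real (- fst w \<bullet> snd w))) \<in> borel_measurable (borel \<Otimes>\<^sub>M (lborel :: (real^'n) measure))"
    proof (rule measurable_compose[where g = "\<lambda>t. exp (\<i> * complex_of_real t)" and N = borel])
      show "(\<lambda>t. exp (\<i> * complex_of_real t)) \<in> borel_measurable borel"
        by (intro borel_measurable_continuous_onI continuous_intros)
    qed measurable
    then have "(\<lambda>(\<xi>, y). f y * exp (\<i> * complex_of_real (- \<xi> \<bullet> y))) \<in> borel_measurable (borel \<Otimes>\<^sub>M (lborel :: (real^'n) measure))"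
      unfolding case_prod_beta by (intro borel_measurable_times) auto
    from lborel.borel_measurable_lebesgue_integral[OF this] show ?thesis unfolding ft_def by simp
  qed
  define \<Phi> where "\<Phi> \<xi> = a x \<xi> * exp (\<i> * complex_of_real (x \<bullet> \<xi>)) * ft f (- \<xi>)" for \<xi>
  have [measurable]: "\<Phi> \<in> borel_measurable borel" unfolding \<Phi>_def by measurable
  have jm: "jap (- \<xi>) = jap \<xi>" for \<xi> :: "real^'n" by (simp add: jap_def)
  have \<Phi>bd: "norm (\<Phi> \<xi>) \<le> (C 0 * F) * jap \<xi> powr (- q)" for \<xi>
    using mult_mono[OF abd[of \<xi>] F(2)[of "- \<xi>"]] C0 by (simp add: \<Phi>_def norm_mult jm mult_ac)
  have \<Phi>i: "integrable lborel \<Phi>" by (rule integrable_jap_bound[OF _ \<Phi>bd q(1)]) measurable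
  have aj: "integrable lborel (\<lambda>\<xi>. a x \<xi> * complex_of_real (dyadic_piece j \<xi>))" for j
  proof -
    obtain R where R: "R \<ge> 0" "\<And>(i::'n) j \<xi>. norm (dyadic_deriv i j 0 \<xi>) \<le> R * (2 ^ j) powr q * jap \<xi> powr (- q)"
      by (rule dyadic_deriv_rapid[where 'n='n, OF q(2), of 0]) (rule that)
    have [measurable]: "dyadic_piece j \<in> borel_measurable (borel :: (real^'n) measure)"
      unfolding dyadic_piece_def[abs_def] by (cases j) simp_all
    show ?thesis
    proof (rule integrable_jap_bound[OF _ _ q(1)])
      fix \<xi> :: "real^'n"
      have "norm (complex_of_real (dyadic_piece j \<xi>)) \<le> R * (2 ^ j) powr q * jap \<xi> powr (- q)"
        using R(2)[of undefined j \<xi>] by (simp only: dyadic_deriv_0)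
      from mult_mono[OF abd[of \<xi>] this]
      show "norm (a x \<xi> * complex_of_real (dyadic_piece j \<xi>)) \<le> (C 0 * (R * (2 ^ j) powr q)) * jap \<xi> powr (- q)"
        using C0 by (simp add: norm_mult mult_ac)
    qed measurable
  qed
  have inner: "(LINT y|lebesgue. a x \<xi> * exp (\<i> * complex_of_real ((x - y) \<bullet> \<xi>)) * f y) = \<Phi> \<xi>" for \<xi>
  proof -
    have eq: "a x \<xi> * exp (\<i> * complex_of_real ((x - y) \<bullet> \<xi>)) * f y = a x \<xi> * exp (\<i> * complex_of_real (x \<bullet> \<xi>)) * (f y * exp (\<i> * complex_of_real (- \<xi> \<bullet> y)))" for y
    proof -
      have "\<i> * complex_of_real ((x - y) \<bullet> \<xi>) = \<i> * complex_of_real (x \<bullet> \<xi>) + \<i> * complex_of_real (- \<xi> \<bullet> y)"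
        by (simp add: inner_diff_left inner_commute algebra_simps)
      then show ?thesis by (simp only: exp_add) (simp add: mult_ac)
    qed
    have "(LINT y|lebesgue. f y * exp (\<i> * complex_of_real (- \<xi> \<bullet> y))) = ft f (- \<xi>)"
      unfolding ft_def by (rule integral_completion) measurable
    then show ?thesis unfolding \<Phi>_def eq by (simp only: integral_mult_right_zero)
  qed
  have outer: "(LINT \<xi>|lebesgue. \<Phi> \<xi>) = (LINT \<xi>|lborel. \<Phi> \<xi>)"
    by (rule integral_completion) measurable
  define S where "S J = (\<Sum>j\<le>J. LINT y|lborel. kernel_piece (a x) j (x - y) * f y)" for J
  have S1: "S J = (LINT \<xi>|lborel. \<Phi> \<xi> * complex_of_real (exp (- (((1 / 2) ^ J)\<^sup>2 * (norm \<xi>)\<^sup>2))))" for J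
  proof -
    have e: "a x \<xi> * complex_of_real (dyadic_piece j \<xi>) * exp (\<i> * complex_of_real (x \<bullet> \<xi>)) * ft f (- \<xi>) = \<Phi> \<xi> * complex_of_real (dyadic_piece j \<xi>)" for j \<xi>
      by (simp add: \<Phi>_def mult_ac)
    have [measurable]: "dyadic_piece j \<in> borel_measurable (borel :: (real^'n) measure)" for j
      unfolding dyadic_piece_def[abs_def] by (cases j) simp_all
    have le1: "dyadic_piece j \<xi> \<le> 1" for j and \<xi> :: "real^'n"
    proof -
      have "dyadic_piece j \<xi> \<le> (\<Sum>j\<le>j. dyadic_piece j \<xi>)"
        by (intro member_le_sum) (auto simp: dyadic_piece_nonneg)
      also have "\<dots> \<le> 1" unfolding sum_dyadic_piece by simp
      finally show ?thesis .
    qed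
    have "integrable lborel (\<lambda>\<xi>. \<Phi> \<xi> * complex_of_real (dyadic_piece j \<xi>))" for j
      by (rule Bochner_Integration.integrable_bound[OF \<Phi>i])
         (auto simp: norm_mult dyadic_piece_nonneg le1 intro!: mult_left_le)
    then have "(LINT \<xi>|lborel. (\<Sum>j\<le>J. \<Phi> \<xi> * complex_of_real (dyadic_piece j \<xi>))) = (\<Sum>j\<le>J. LINT \<xi>|lborel. \<Phi> \<xi> * complex_of_real (dyadic_piece j \<xi>))"
      by (intro Bochner_Integration.integral_sum)
    moreover have "(\<Sum>j\<le>J. \<Phi> \<xi> * complex_of_real (dyadic_piece j \<xi>)) = \<Phi> \<xi> * complex_of_real (exp (- (((1 / 2) ^ J)\<^sup>2 * (norm \<xi>)\<^sup>2)))" for \<xi>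
      unfolding sum_distrib_left[symmetric] of_real_sum[symmetric] sum_dyadic_piece ..
    ultimately show ?thesis
      unfolding S_def using kernel_piece_integral(2)[OF am fm fi aj] by (simp only: e)
  qed
  have lim1: "S \<longlonglongrightarrow> (LINT \<xi>|lborel. \<Phi> \<xi>)"
    unfolding S1
  proof (rule integral_dominated_convergence[where w = "\<lambda>\<xi>. norm (\<Phi> \<xi>)"])
    show "AE \<xi> in lborel. (\<lambda>J. \<Phi> \<xi> * complex_of_real (exp (- (((1 / 2) ^ J)\<^sup>2 * (norm \<xi>)\<^sup>2)))) \<longlonglongrightarrow> \<Phi> \<xi>"
    proof (intro AE_I2)
      fix \<xi> :: "real^'n"
      have "(\<lambda>J. \<Phi> \<xi> * complex_of_real (exp (- (((1 / 2) ^ J)\<^sup>2 * (norm \<xi>)\<^sup>2)))) \<longlonglongrightarrow> \<Phi> \<xi> * complex_of_real (exp (- (0\<^sup>2 * (norm \<xi>)\<^sup>2)))"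
        by (intro tendsto_intros LIMSEQ_power_zero) auto
      then show "(\<lambda>J. \<Phi> \<xi> * complex_of_real (exp (- (((1 / 2) ^ J)\<^sup>2 * (norm \<xi>)\<^sup>2)))) \<longlonglongrightarrow> \<Phi> \<xi>" by simp
    qed
    show "AE \<xi> in lborel. norm (\<Phi> \<xi> * complex_of_real (exp (- (((1 / 2) ^ J)\<^sup>2 * (norm \<xi>)\<^sup>2)))) \<le> norm (\<Phi> \<xi>)" for J
      by (intro AE_I2) (simp add: norm_mult mult_left_le)
    show "integrable lborel (\<lambda>\<xi>. norm (\<Phi> \<xi>))" using \<Phi>i by simp
  qed measurable
  have pm [measurable]: "(\<lambda>y. kernel_piece (a x) j (x - y)) \<in> borel_measurable borel" for j
    by (rule borel_measurable_kernel_piece[where a = "\<lambda>_::unit. a x" and X = "\<lambda>_. ()" and M = "count_space UNIV"])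
       (auto simp: case_prod_beta)
  define G where "G y = (\<Sum>j. ennreal (norm (kernel_piece (a x) j (x - y))))" for y
  have [measurable]: "G \<in> borel_measurable borel" unfolding G_def by measurable
  have finG: "(\<integral>\<^sup>+y. G y * ennreal (norm (f y)) \<partial>lborel) < top"
    using fin unfolding G_def[symmetric] by (simp add: nn_integral_completion)
  then have AEG: "AE y in lborel. G y * ennreal (norm (f y)) \<noteq> \<infinity>"
    by (intro nn_integral_PInf_AE) (auto simp: less_top)
  define w where "w y = enn2real (G y * ennreal (norm (f y)))" for y
  have [measurable]: "w \<in> borel_measurable borel" unfolding w_def[abs_def] by measurable
  have wi: "integrable lborel w"
  proof (rule integrableI_nonneg)
    have "(\<integral>\<^sup>+y. ennreal (w y) \<partial>lborel) \<le> (\<integral>\<^sup>+y. G y * ennreal (norm (f y)) \<partial>lborel)"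
      unfolding w_def by (intro nn_integral_mono) (auto simp: ennreal_enn2real_if)
    then show "(\<integral>\<^sup>+y. ennreal (w y) \<partial>lborel) < \<infinity>" using finG by (auto intro: le_less_trans)
  qed (auto simp: w_def)
  have pw: "norm ((\<Sum>j\<le>J. kernel_piece (a x) j (x - y)) * f y) \<le> w y \<and>
     (\<lambda>J. (\<Sum>j\<le>J. kernel_piece (a x) j (x - y)) * f y) \<longlonglongrightarrow> full_kernel (a x) (x - y) * f y"
    if "G y * ennreal (norm (f y)) \<noteq> \<infinity>" for J y
  proof (cases "f y = 0")
    case True
    then show ?thesis by (simp add: w_def)
  next
    case False
    then have Gy: "G y \<noteq> top" using that by (auto simp: ennreal_mult_eq_top_iff)
    then have s: "summable (\<lambda>j. norm (kernel_piece (a x) j (x - y)))"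
      unfolding G_def by (intro summable_suminf_not_top) auto
    have Ge: "G y = ennreal (\<Sum>j. norm (kernel_piece (a x) j (x - y)))"
      unfolding G_def by (rule suminf_ennreal2[OF _ s]) auto
    have "norm (\<Sum>j\<le>J. kernel_piece (a x) j (x - y)) \<le> (\<Sum>j\<le>J. norm (kernel_piece (a x) j (x - y)))" by (rule norm_sum)
    also have "\<dots> \<le> (\<Sum>j. norm (kernel_piece (a x) j (x - y)))" by (rule sum_le_suminf[OF s]) auto
    finally have "norm ((\<Sum>j\<le>J. kernel_piece (a x) j (x - y)) * f y) \<le> w y"
      unfolding w_def Ge using suminf_nonneg[OF s] by (simp add: norm_mult mult_right_mono flip: ennreal_mult)
    moreover have "(\<lambda>J. \<Sum>j\<le>J. kernel_piece (a x) j (x - y)) \<longlonglongrightarrow> full_kernel (a x) (x - y)"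
      unfolding full_kernel_def by (rule summable_LIMSEQ'[OF summable_norm_cancel[OF s]])
    ultimately show ?thesis by (intro conjI tendsto_mult tendsto_const)
  qed
  have fkm [measurable]: "(\<lambda>y. full_kernel (a x) (x - y)) \<in> borel_measurable borel"
    unfolding full_kernel_def by measurable
  have S2: "S J = (LINT y|lborel. (\<Sum>j\<le>J. kernel_piece (a x) j (x - y)) * f y)" for J
    unfolding S_def sum_distrib_right
    by (rule Bochner_Integration.integral_sum[symmetric]) (rule kernel_piece_integral(1)[OF am fm fi aj])
  have lim2: "S \<longlonglongrightarrow> (LINT y|lborel. full_kernel (a x) (x - y) * f y)"
    unfolding S2
  proof (rule integral_dominated_convergence[OF _ _ wi])
    show "AE y in lborel. (\<lambda>J. (\<Sum>j\<le>J. kernel_piece (a x) j (x - y)) * f y) \<longlonglongrightarrow> full_kernel (a x) (x - y) * f y"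
      using AEG by eventually_elim (use pw in blast)
    show "AE y in lborel. norm ((\<Sum>j\<le>J. kernel_piece (a x) j (x - y)) * f y) \<le> w y" for J
      using AEG by eventually_elim (use pw in blast)
  qed measurable
  have eq: "(LINT \<xi>|lborel. \<Phi> \<xi>) = (LINT y|lborel. full_kernel (a x) (x - y) * f y)"
    by (rule LIMSEQ_unique[OF lim1 lim2])
  have "(LINT y|lebesgue. complex_of_real (1 / (2 * pi) ^ CARD('n)) * full_kernel (a x) (x - y) * f y) =
     complex_of_real (1 / (2 * pi) ^ CARD('n)) * (LINT y|lborel. full_kernel (a x) (x - y) * f y)"
    by (subst integral_completion) (simp_all add: mult.assoc)
  then show ?thesis unfolding psido_def inner outer eq by simp
qed

text \<open>The identity is a limit of simple functions \<open>F\<^sub>i\<close>; each \<open>f x (F\<^sub>i \<xi>)\<close> is measurable by countable case distinction,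
  and continuity in the second argument gives the limit.\<close>

lemma caratheodory_measurable:
  fixes f :: "'a \<Rightarrow> real^'n::finite \<Rightarrow> complex"
  assumes c: "\<And>x. continuous_on UNIV (f x)" and m: "\<And>\<xi>. (\<lambda>x. f x \<xi>) \<in> borel_measurable M"
  shows "(\<lambda>(x, \<xi>). f x \<xi>) \<in> borel_measurable (M \<Otimes>\<^sub>M borel)"
proof -
  obtain F :: "nat \<Rightarrow> real^'n \<Rightarrow> real^'n" where F: "\<And>i. simple_function borel (F i)" "\<And>x. (\<lambda>i. F i x) \<longlonglongrightarrow> x"
    using borel_measurable_implies_sequence_metric[of "\<lambda>x::real^'n. x" borel 0] by auto
  show ?thesis
  proof (rule borel_measurable_LIMSEQ_metric)
    fix i
    have fin: "finite (range (F i))" using F(1)[of i] by (simp add: simple_function_def)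
    have "F i \<in> measurable borel (count_space (range (F i)))"
      unfolding measurable_count_space_eq_countable[OF countable_finite[OF fin]]
      using F(1)[of i] by (auto simp: simple_function_def)
    then have g: "(\<lambda>z. F i (snd z)) \<in> measurable (M \<Otimes>\<^sub>M borel) (count_space (range (F i)))"
      by measurable
    have "(\<lambda>z. f (fst z) \<xi>) \<in> borel_measurable (M \<Otimes>\<^sub>M borel)" for \<xi>
      using measurable_compose[OF measurable_fst m] .
    from measurable_compose_countable'[where f = "\<lambda>\<xi> z. f (fst z) \<xi>", OF this g countable_finite[OF fin]]
    show "(\<lambda>z. f (fst z) (F i (snd z))) \<in> borel_measurable (M \<Otimes>\<^sub>M borel)" by simp
  next
    fix z :: "'a \<times> (real^'n)"
    obtain x \<xi> where z: "z = (x, \<xi>)" by (cases z)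
    have "isCont (f x) \<xi>" using c[of x] by (simp add: continuous_on_eq_continuous_at)
    from isCont_tendsto_compose[OF this F(2)[of \<xi>]]
    show "(\<lambda>i. f (fst z) (F i (snd z))) \<longlonglongrightarrow> (case z of (x, \<xi>) \<Rightarrow> f x \<xi>)" by (simp add: z)
  qed
qed

text \<open>For a pure derivative there is only one order of differentiation to choose.\<close>

lemma multi_deriv_pure: "multi_deriv (\<lambda>j. if j = i then k else 0) = iter_partial (replicate k i)"
proof -
  have c: "count_list (replicate k i) j = (if j = i then k else 0)" for k j
    by (induction k) auto
  have "is = replicate k i" if "\<forall>j. count_list is j = (if j = i then k else 0)" for "is"
  proof -
    have "set is \<subseteq> {i}"
    proof
      fix j assume "j \<in> set is"
      then have "count_list is j \<noteq> 0" by (simp add: count_list_0_iff)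
      with that show "j \<in> {i}" by (auto split: if_splits)
    qed
    then have r: "is = replicate (length is) i" by (intro replicate_eqI) auto
    then have "count_list is i = length is" using c[of "length is" i] by metis
    with that have "length is = k" by simp
    with r show ?thesis by simp
  qed
  then have "(SOME is. \<forall>j. count_list is j = (if j = i then k else 0)) = replicate k i"
    using c by (intro some_equality) auto
  then show ?thesis by (simp add: multi_deriv_def)
qed

lemma iter_partial_zero: "iter_partial is (\<lambda>_. 0) = (\<lambda>_. 0)"
  by (induction "is") (simp_all add: partial_deriv_def[abs_def] frechet_derivative_const)

text \<open>The symbol estimates hold for almost every \<open>x\<close>, with an exceptional set that may depend on \<open>\<xi>\<close>. Over a
  countable dense set of \<open>\<xi>\<close> these sets have a null union, and continuity in \<open>\<xi>\<close> extends the estimates to all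
  \<open>\<xi>\<close> for \<open>x\<close> outside of this union. For the remaining \<open>x\<close> the symbol is replaced by \<open>0\<close>.\<close>

lemma symbol_class_representative:
  fixes a :: "real^'n::finite \<Rightarrow> real^'n \<Rightarrow> complex"
  assumes a: "a \<in> symbol_class m \<rho>"
  obtains a' C where "AE x in lebesgue. a' x = a x" "\<And>x. symbol_bound m \<rho> C (a' x)"
    "(\<lambda>(x, \<xi>). a' x \<xi>) \<in> borel_measurable (lebesgue \<Otimes>\<^sub>M borel)"
proof -
  have sm: "smooth (a x)" for x using a by (simp add: symbol_class_def)
  have diff: "iter_partial is (a x) differentiable (at \<xi>)" for "is" x \<xi>
    using sm[of x] by (simp add: smooth_def)
  have cont: "continuous_on UNIV (iter_partial is (a x))" for "is" x
    using diff by (auto simp: continuous_on_eq_continuous_at intro: differentiable_imp_continuous_within)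
  have meas: "(\<lambda>x. iter_partial (replicate k i) (a x) \<xi>) \<in> borel_measurable lebesgue" for k i \<xi>
    using a unfolding symbol_class_def multi_deriv_pure[symmetric] by blast
  have bd: "\<exists>C::real. \<forall>\<xi>. Linf_norm (\<lambda>x. iter_partial (replicate k i) (a x) \<xi>) \<le> ennreal (C * jap \<xi> powr (m - \<rho> * real k))" for i k
  proof -
    have "\<exists>C::real. \<forall>\<xi>. Linf_norm (\<lambda>x. multi_deriv (\<lambda>j. if j = i then k else 0) (a x) \<xi>)
             \<le> ennreal (C * jap \<xi> powr (m - \<rho> * real (\<Sum>j\<in>UNIV. if j = i then k else 0)))"
      using a unfolding symbol_class_def by blast
    then show ?thesis by (simp add: multi_deriv_pure)
  qed
  then have "\<forall>i. \<exists>C. \<forall>k \<xi>. Linf_norm (\<lambda>x. iter_partial (replicate k i) (a x) \<xi>) \<le> ennreal (C k * jap \<xi> powr (m - \<rho> * real k))"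
  proof -
    have "\<exists>C. \<forall>k \<xi>. Linf_norm (\<lambda>x. iter_partial (replicate k i) (a x) \<xi>) \<le> ennreal (C k * jap \<xi> powr (m - \<rho> * real k))" for i
    proof -
      have "\<forall>k. \<exists>C. \<forall>\<xi>. Linf_norm (\<lambda>x. iter_partial (replicate k i) (a x) \<xi>) \<le> ennreal (C * jap \<xi> powr (m - \<rho> * real k))"
        by (rule allI[OF bd])
      from choice[OF this] show ?thesis .
    qed
    then show ?thesis by (rule allI)
  qed
  from choice[OF this] obtain C0 where C0:
    "\<And>i k \<xi>. Linf_norm (\<lambda>x. iter_partial (replicate k i) (a x) \<xi>) \<le> ennreal (C0 i k * jap \<xi> powr (m - \<rho> * real k))" by blast
  define C where "C k = (\<Sum>i\<in>UNIV. \<bar>C0 i k\<bar>)" for k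
  have C: "0 \<le> C k" for k by (simp add: C_def sum_nonneg)
  have AE1: "AE x in lebesgue. norm (iter_partial (replicate k i) (a x) \<xi>) \<le> C k * jap \<xi> powr (m - \<rho> * real k)" for i k \<xi>
  proof -
    have "AE x in lebesgue. ennreal (norm (iter_partial (replicate k i) (a x) \<xi>)) \<le> Linf_norm (\<lambda>x. iter_partial (replicate k i) (a x) \<xi>)"
      unfolding Linf_norm_def by (rule esssup_AE)
    then show ?thesis
    proof eventually_elim
      case (elim x)
      have "\<bar>C0 i k\<bar> \<le> C k" unfolding C_def by (rule member_le_sum) auto
      then have "C0 i k \<le> C k" by linarith
      then have "C0 i k * jap \<xi> powr (m - \<rho> * real k) \<le> C k * jap \<xi> powr (m - \<rho> * real k)" by (intro mult_right_mono) auto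
      with order_trans[OF elim C0] have "ennreal (norm (iter_partial (replicate k i) (a x) \<xi>)) \<le> ennreal (C k * jap \<xi> powr (m - \<rho> * real k))"
        by (meson ennreal_leI order_trans)
      then show ?case using C[of k] by (subst (asm) ennreal_le_iff) auto
    qed
  qed
  obtain D :: "(real^'n) set" where D: "countable D" "\<And>X. open X \<Longrightarrow> X \<noteq> {} \<Longrightarrow> \<exists>d\<in>D. d \<in> X"
    using countable_dense_setE by blast
  have "AE x in lebesgue. \<forall>i k. \<forall>\<xi>\<in>D. norm (iter_partial (replicate k i) (a x) \<xi>) \<le> C k * jap \<xi> powr (m - \<rho> * real k)"
    unfolding AE_all_countable by (intro allI AE_ball_countable[THEN iffD2] D(1) ballI AE1)
  then obtain N where N: "N \<in> null_sets lebesgue" and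
    good: "\<And>x i k \<xi>. x \<notin> N \<Longrightarrow> \<xi> \<in> D \<Longrightarrow> norm (iter_partial (replicate k i) (a x) \<xi>) \<le> C k * jap \<xi> powr (m - \<rho> * real k)"
    by (rule AE_E3) auto
  have [measurable]: "N \<in> sets lebesgue" using N by auto
  define a' where "a' x = (if x \<in> N then (\<lambda>_. 0) else a x)" for x
  show ?thesis
  proof (rule that[of a' C])
    have "AE x in lebesgue. x \<notin> N" using N by (rule AE_not_in)
    then show "AE x in lebesgue. a' x = a x" by eventually_elim (simp add: a'_def)
    show "symbol_bound m \<rho> C (a' x)" for x
    proof (cases "x \<in> N")
      case True
      then show ?thesis using C by (simp add: symbol_bound_def a'_def iter_partial_zero)
    next
      case False
      have "norm (iter_partial (replicate k i) (a x) \<xi>) \<le> C k * jap \<xi> powr (m - \<rho> * real k)" for i k \<xi>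
      proof -
        let ?S = "{\<xi>. norm (iter_partial (replicate k i) (a x) \<xi>) \<le> C k * jap \<xi> powr (m - \<rho> * real k)}"
        have "\<forall>\<xi>\<in>UNIV. jap (\<xi> :: real^'n) \<noteq> 0" using jap_ge(3) by (metis less_irrefl)
        then have "continuous_on UNIV (\<lambda>\<xi> :: real^'n. C k * jap \<xi> powr (m - \<rho> * real k))"
          by (intro continuous_on_mult continuous_on_const continuous_on_powr continuous_on_jap)
        then have cl: "closed ?S" by (intro closed_Collect_le continuous_on_norm cont)
        have "- ?S = {}"
        proof (rule ccontr)
          assume "- ?S \<noteq> {}"
          then obtain d where "d \<in> D" "d \<in> - ?S" using D(2)[of "- ?S"] cl by auto
          then show False using good[OF False, of d k i] by simp
        qed
        then show ?thesis by blast
      qed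
      then show ?thesis using False diff by (simp add: symbol_bound_def a'_def)
    qed
    have "(\<lambda>(x, \<xi>). a x \<xi>) \<in> borel_measurable (lebesgue \<Otimes>\<^sub>M borel)"
      using cont[of "[]"] meas[of 0 undefined] by (intro caratheodory_measurable) auto
    then have am: "(\<lambda>z. a (fst z) (snd z)) \<in> borel_measurable (lebesgue \<Otimes>\<^sub>M borel)"
      by (simp only: case_prod_unfold)
    have "N \<times> UNIV \<in> sets (lebesgue \<Otimes>\<^sub>M (borel :: (real^'n) measure))" by (rule pair_measureI) auto
    moreover have "{z \<in> space (lebesgue \<Otimes>\<^sub>M (borel :: (real^'n) measure)). fst z \<in> N} = N \<times> UNIV"
      by (auto simp: space_pair_measure)
    ultimately have "{z \<in> space (lebesgue \<Otimes>\<^sub>M (borel :: (real^'n) measure)). fst z \<in> N} \<in> sets (lebesgue \<Otimes>\<^sub>M borel)" by simp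
    then have "(\<lambda>z. if fst z \<in> N then 0 else a (fst z) (snd z)) \<in> borel_measurable (lebesgue \<Otimes>\<^sub>M borel)"
      by (intro measurable_If am) simp_all
    also have "(\<lambda>z. if fst z \<in> N then 0 else a (fst z) (snd z)) = (\<lambda>(x, \<xi>). a' x \<xi>)"
      by (auto simp: fun_eq_iff a'_def)
    finally show "(\<lambda>(x, \<xi>). a' x \<xi>) \<in> borel_measurable (lebesgue \<Otimes>\<^sub>M borel)" .
  qed
qed

section \<open>Smooth bump functions\<close>

text \<open>Smooth functions of one real variable, presented by the sequence of their derivatives.\<close>

definition deriv_seq :: "(nat \<Rightarrow> real \<Rightarrow> complex) \<Rightarrow> bool" where
  "deriv_seq d \<longleftrightarrow> (\<forall>k t. (d k has_vector_derivative d (Suc k) t) (at t))"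

text \<open>The polynomials with \<open>(d/dt)\<^sup>k exp(-1/t) = P\<^sub>k(1/t) exp(-1/t)\<close> for \<open>t > 0\<close>.\<close>

fun exp_inv_poly :: "nat \<Rightarrow> real poly" where
  "exp_inv_poly 0 = 1"
| "exp_inv_poly (Suc k) = [:0, 0, 1:] * (exp_inv_poly k - pderiv (exp_inv_poly k))"

definition exp_inv_deriv :: "nat \<Rightarrow> real \<Rightarrow> real" where
  "exp_inv_deriv k t = (if t > 0 then poly (exp_inv_poly k) (1 / t) * exp (- (1 / t)) else 0)"

text \<open>A bound by \<open>t\<^sup>2\<close> is what differentiability at the origin, with derivative \<open>0\<close>, requires.\<close>

lemma exp_inv_deriv_quadratic: "\<exists>c\<ge>0. \<forall>t. \<bar>exp_inv_deriv k t\<bar> \<le> c * t\<^sup>2"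
proof -
  define Q where "Q = [:0, 0, 1:] * exp_inv_poly k"
  obtain c where c: "c \<ge> 0" "\<And>u t. \<bar>t\<bar> \<le> u \<Longrightarrow> \<bar>poly (pcompose Q [:0, 0, 1:]) t\<bar> * exp (- u\<^sup>2) \<le> c / (1 + u\<^sup>2) ^ 0"
    using poly_times_exp_bound[of "pcompose Q [:0, 0, 1:]" 0] by blast
  have "\<bar>exp_inv_deriv k t\<bar> \<le> c * t\<^sup>2" for t
  proof (cases "t > 0")
    case True
    define u where "u = sqrt (1 / t)"
    have u: "u\<^sup>2 = 1 / t" "u \<ge> 0" using True by (auto simp: u_def)
    have "\<bar>poly (pcompose Q [:0, 0, 1:]) u\<bar> * exp (- u\<^sup>2) \<le> c" using c(2)[of u u] u by simp
    moreover have "poly (pcompose Q [:0, 0, 1:]) u = (1 / t)\<^sup>2 * poly (exp_inv_poly k) (1 / t)"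
      using u(1) by (simp add: poly_pcompose Q_def power2_eq_square)
    ultimately have "(1 / t)\<^sup>2 * \<bar>exp_inv_deriv k t\<bar> \<le> c"
      using True u by (simp add: exp_inv_deriv_def abs_mult mult.assoc)
    then show ?thesis using True by (simp add: field_simps)
  qed (use c in \<open>simp add: exp_inv_deriv_def\<close>)
  with c(1) show ?thesis by blast
qed

lemma exp_inv_deriv_has_derivative:
  "(exp_inv_deriv k has_field_derivative exp_inv_deriv (Suc k) t) (at t)"
proof -
  consider "t > 0" | "t < 0" | "t = 0" by linarith
  then show ?thesis
  proof cases
    case 1
    let ?P = "exp_inv_poly k"
    have "((\<lambda>t. poly ?P (1 / t) * exp (- (1 / t))) has_field_derivative
       poly (pderiv ?P) (1 / t) * (- (1 / t\<^sup>2)) * exp (- (1 / t)) + poly ?P (1 / t) * (exp (- (1 / t)) * (1 / t\<^sup>2))) (at t)"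
      using 1 by (auto intro!: derivative_eq_intros DERIV_chain2[OF poly_DERIV] simp: power2_eq_square)
    also have "poly (pderiv ?P) (1 / t) * (- (1 / t\<^sup>2)) * exp (- (1 / t)) + poly ?P (1 / t) * (exp (- (1 / t)) * (1 / t\<^sup>2)) = exp_inv_deriv (Suc k) t"
      using 1 by (simp add: exp_inv_deriv_def power2_eq_square algebra_simps)
    finally have "((\<lambda>t. poly ?P (1 / t) * exp (- (1 / t))) has_field_derivative exp_inv_deriv (Suc k) t) (at t)" .
    then show ?thesis
      by (rule has_field_derivative_transform_within_open[of _ _ _ "{0<..}"]) (use 1 in \<open>auto simp: exp_inv_deriv_def\<close>)
  next
    case 2
    have "((\<lambda>t. 0) has_field_derivative exp_inv_deriv (Suc k) t) (at t)" using 2 by (simp add: exp_inv_deriv_def)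
    then show ?thesis
      by (rule has_field_derivative_transform_within_open[of _ _ _ "{..<0}"]) (use 2 in \<open>auto simp: exp_inv_deriv_def\<close>)
  next
    case 3
    obtain c where c: "c \<ge> 0" "\<And>t. \<bar>exp_inv_deriv k t\<bar> \<le> c * t\<^sup>2" using exp_inv_deriv_quadratic by blast
    have "((\<lambda>h. exp_inv_deriv k h / h) \<longlongrightarrow> 0) (at 0)"
    proof (rule Lim_null_comparison)
      show "\<forall>\<^sub>F h in at 0. norm (exp_inv_deriv k h / h) \<le> c * \<bar>h\<bar>"
      proof (intro always_eventually allI)
        fix h :: real
        show "norm (exp_inv_deriv k h / h) \<le> c * \<bar>h\<bar>"
          using c(2)[of h] by (cases "h = 0") (auto simp: abs_divide divide_le_eq power2_eq_square mult.assoc)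
      qed
      have "((\<lambda>h::real. c * \<bar>h\<bar>) \<longlongrightarrow> c * \<bar>0\<bar>) (at 0)" by (intro tendsto_intros)
      then show "((\<lambda>h::real. c * \<bar>h\<bar>) \<longlongrightarrow> 0) (at 0)" by simp
    qed
    then show ?thesis by (simp add: 3 DERIV_def exp_inv_deriv_def[of _ 0])
  qed
qed

lemma deriv_seq_exp_inv: "deriv_seq (\<lambda>k t. complex_of_real (c ^ k * exp_inv_deriv k (c * t + b)))"
  unfolding deriv_seq_def
proof (intro allI has_vector_derivative_of_real)
  fix k t
  have "((\<lambda>t. c * t + b) has_field_derivative c) (at t)" by (auto intro!: derivative_eq_intros)
  note D = DERIV_cmult[OF DERIV_chain2[OF exp_inv_deriv_has_derivative this], where c = "c ^ k"]
  show "((\<lambda>t. c ^ k * exp_inv_deriv k (c * t + b)) has_field_derivative c ^ Suc k * exp_inv_deriv (Suc k) (c * t + b)) (at t)"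
    by (rule DERIV_cong[OF D]) simp
qed

lemma deriv_seq_mult:
  assumes "deriv_seq A" "deriv_seq B"
  shows "deriv_seq (\<lambda>k t. \<Sum>l\<le>k. of_nat (k choose l) * (A l t * B (k - l) t))"
  unfolding deriv_seq_def
proof (intro allI)
  fix k t
  have "((\<lambda>t. \<Sum>l\<le>k. of_nat (k choose l) * (A l t * B (k - l) t)) has_vector_derivative
     (\<Sum>l\<le>k. of_nat (k choose l) * (A l t * B (Suc (k - l)) t + A (Suc l) t * B (k - l) t))) (at t)"
    using assms by (intro has_vector_derivative_sum has_vector_derivative_mult_right has_vector_derivative_mult)
      (auto simp: deriv_seq_def)
  also have "(\<Sum>l\<le>k. of_nat (k choose l) * (A l t * B (Suc (k - l)) t + A (Suc l) t * B (k - l) t)) =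
     (\<Sum>l\<le>Suc k. of_nat (Suc k choose l) * (A l t * B (Suc k - l) t))"
    by (subst Leibniz_sum[symmetric]) (simp add: add.commute)
  finally show "((\<lambda>t. \<Sum>l\<le>k. of_nat (k choose l) * (A l t * B (k - l) t)) has_vector_derivative
     (\<Sum>l\<le>Suc k. of_nat (Suc k choose l) * (A l t * B (Suc k - l) t))) (at t)" .
qed

text \<open>Each partial derivative only advances the derivative index of one factor, so all iterated partial
  derivatives are again products of the same form.\<close>

lemma smooth_tensor_product:
  fixes d :: "'n::finite \<Rightarrow> nat \<Rightarrow> real \<Rightarrow> complex"
  assumes d: "\<And>i. deriv_seq (d i)"
  shows "smooth (\<lambda>x :: real^'n. \<Prod>i\<in>UNIV. d i 0 (x $ i))"
proof -
  define P where "P c x = (\<Prod>i\<in>UNIV. d i (c i) (x $ i))" for c and x :: "real^'n"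
  have der: "(P c has_derivative (\<lambda>h. \<Sum>i\<in>UNIV. h $ i *\<^sub>R d i (Suc (c i)) (x $ i) * (\<Prod>j\<in>UNIV - {i}. d j (c j) (x $ j)))) (at x)" for c x
    unfolding P_def[abs_def]
  proof (rule has_derivative_prod)
    fix i :: 'n
    have "(d i (c i) has_derivative (\<lambda>h. h *\<^sub>R d i (Suc (c i)) (x $ i))) (at (x $ i))"
      using d[of i] by (simp add: deriv_seq_def has_vector_derivative_def)
    moreover have "((\<lambda>x. x $ i) has_derivative (\<lambda>h. h $ i)) (at x)"
      by (rule bounded_linear_imp_has_derivative[OF bounded_linear_vec_nth])
    ultimately show "((\<lambda>x. d i (c i) (x $ i)) has_derivative (\<lambda>h. h $ i *\<^sub>R d i (Suc (c i)) (x $ i))) (at x)"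
      using has_derivative_compose[of "\<lambda>x. x $ i" "\<lambda>h. h $ i" x UNIV "d i (c i)"] by simp
  qed
  have it: "iter_partial is (P (\<lambda>_. 0)) = P (count_list is)" for "is"
  proof (induction "is")
    case (Cons j "is")
    have "partial_deriv j (P (count_list is)) x = P (count_list (j # is)) x" for x
    proof -
      have "partial_deriv j (P (count_list is)) x = (\<Sum>i\<in>UNIV. axis j 1 $ i *\<^sub>R d i (Suc (count_list is i)) (x $ i) * (\<Prod>j\<in>UNIV - {i}. d j (count_list is j) (x $ j)))"
        unfolding partial_deriv_def frechet_derivative_at[OF der, symmetric] ..
      also have "\<dots> = (\<Sum>i\<in>UNIV. if i = j then d j (Suc (count_list is j)) (x $ j) * (\<Prod>i\<in>UNIV - {j}. d i (count_list is i) (x $ i)) else 0)"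
        by (intro sum.cong) (auto simp: axis_def)
      also have "\<dots> = d j (Suc (count_list is j)) (x $ j) * (\<Prod>i\<in>UNIV - {j}. d i (count_list is i) (x $ i))" by simp
      also have "(\<Prod>i\<in>UNIV - {j}. d i (count_list is i) (x $ i)) = (\<Prod>i\<in>UNIV - {j}. d i (count_list (j # is) i) (x $ i))"
        by (intro prod.cong) auto
      also have "d j (Suc (count_list is j)) (x $ j) * \<dots> = P (count_list (j # is)) x"
        unfolding P_def by (subst (2) prod.remove[of _ j]) auto
      finally show ?thesis .
    qed
    then have "partial_deriv j (P (count_list is)) = P (count_list (j # is))" by (rule ext)
    then show ?case by (simp only: iter_partial.simps Cons.IH)
  qed (simp add: P_def)
  have "smooth (P (\<lambda>_. 0))"
    unfolding smooth_def it using der differentiable_def by blast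
  then show ?thesis by (simp add: P_def[abs_def])
qed

text \<open>Positive exactly on \<open>box a b\<close>, and tending to \<open>1\<close> there as \<open>k\<close> grows.\<close>

definition box_bump :: "real^'n::finite \<Rightarrow> real^'n \<Rightarrow> nat \<Rightarrow> real^'n \<Rightarrow> real" where
  "box_bump a b k x = (\<Prod>i\<in>UNIV. exp_inv_deriv 0 (real (Suc k) * (x $ i - a $ i)) * exp_inv_deriv 0 (real (Suc k) * (b $ i - x $ i)))"

lemma exp_inv_range: "0 \<le> exp_inv_deriv 0 t" "exp_inv_deriv 0 t \<le> 1"
  by (auto simp: exp_inv_deriv_def)

lemma box_bump_range: "0 \<le> box_bump a b k x" "box_bump a b k x \<le> indicator (box a b) x"
proof -
  show "0 \<le> box_bump a b k x" unfolding box_bump_def by (intro prod_nonneg mult_nonneg_nonneg ballI exp_inv_range)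
  show "box_bump a b k x \<le> indicator (box a b) x"
  proof (cases "x \<in> box a b")
    case True
    have "box_bump a b k x \<le> (\<Prod>i\<in>(UNIV :: 'a set). 1)"
      unfolding box_bump_def by (intro prod_mono conjI mult_nonneg_nonneg exp_inv_range mult_le_one)
    then show ?thesis using True by simp
  next
    case False
    then obtain i where "\<not> (a $ i < x $ i \<and> x $ i < b $ i)" by (auto simp: mem_box_cart)
    then have "exp_inv_deriv 0 (real (Suc k) * (x $ i - a $ i)) * exp_inv_deriv 0 (real (Suc k) * (b $ i - x $ i)) = 0"
      by (auto simp: exp_inv_deriv_def zero_less_mult_iff)
    then have "box_bump a b k x = 0" unfolding box_bump_def by (intro prod_zero) auto
    then show ?thesis by simp
  qed
qed

lemma box_bump_test_function: "(\<lambda>x. complex_of_real (box_bump a b k x)) \<in> test_functions"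
proof -
  let ?A = "\<lambda>i l t. complex_of_real (real (Suc k) ^ l * exp_inv_deriv l (real (Suc k) * t + - real (Suc k) * a $ i))"
  let ?B = "\<lambda>i l t. complex_of_real ((- real (Suc k)) ^ l * exp_inv_deriv l (- real (Suc k) * t + real (Suc k) * b $ i))"
  define d where "d i l t = (\<Sum>j\<le>l. of_nat (l choose j) * (?A i j t * ?B i (l - j) t))" for i l t
  have "deriv_seq (d i)" for i
    unfolding d_def[abs_def] by (rule deriv_seq_mult[OF deriv_seq_exp_inv deriv_seq_exp_inv])
  from smooth_tensor_product[of d, OF this]
  have "smooth (\<lambda>x. \<Prod>i\<in>UNIV. d i 0 (x $ i))" .
  moreover have "(\<lambda>x. \<Prod>i\<in>UNIV. d i 0 (x $ i)) = (\<lambda>x. complex_of_real (box_bump a b k x))"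
    by (auto simp: fun_eq_iff d_def box_bump_def algebra_simps)
  ultimately have "smooth (\<lambda>x. complex_of_real (box_bump a b k x))" by simp
  moreover have "compact (closure {x. complex_of_real (box_bump a b k x) \<noteq> 0})"
  proof -
    have "{x. complex_of_real (box_bump a b k x) \<noteq> 0} \<subseteq> box a b"
    proof
      fix x assume "x \<in> {x. complex_of_real (box_bump a b k x) \<noteq> 0}"
      then have "0 < (indicator (box a b) x :: real)" using box_bump_range[of a b k x] by auto
      then show "x \<in> box a b" by (simp add: indicator_def split: if_splits)
    qed
    then have "bounded {x. complex_of_real (box_bump a b k x) \<noteq> 0}" using bounded_box bounded_subset by blast
    then show ?thesis by (simp add: compact_closure)
  qed
  ultimately show ?thesis by (simp add: test_functions_def)
qed

lemma box_bump_tendsto: "(\<lambda>k. box_bump a b k x) \<longlonglongrightarrow> indicator (box a b) x"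
proof (cases "x \<in> box a b")
  case False
  then have "box_bump a b k x = 0" for k using box_bump_range[of a b k x] by simp
  then show ?thesis using False by simp
next
  case True
  have e: "(\<lambda>k. exp_inv_deriv 0 (real (Suc k) * t)) \<longlonglongrightarrow> 1" if t: "t > 0" for t
  proof -
    have "(\<lambda>k. exp (- (1 / real (Suc k) * (1 / t)))) \<longlonglongrightarrow> exp (- (0 * (1 / t)))"
      using LIMSEQ_inverse_real_of_nat by (intro tendsto_intros) (simp add: inverse_eq_divide)
    moreover have "exp_inv_deriv 0 (real (Suc k) * t) = exp (- (1 / real (Suc k) * (1 / t)))" for k
      using t by (simp add: exp_inv_deriv_def zero_less_mult_iff)
    ultimately show ?thesis by simp
  qed
  have "(\<lambda>k. box_bump a b k x) \<longlonglongrightarrow> (\<Prod>i\<in>(UNIV :: 'a set). 1 * 1)"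
    unfolding box_bump_def using True by (intro tendsto_prod tendsto_mult e) (auto simp: mem_box_cart)
  then show ?thesis using True by simp
qed

section \<open>Uniqueness of bounded extensions\<close>

definition weighted_mass :: "(real^'n::finite \<Rightarrow> real) \<Rightarrow> real \<Rightarrow> (real^'n \<Rightarrow> complex) \<Rightarrow> ennreal" where
  "weighted_mass w p f = (\<integral>\<^sup>+x. ennpowr (ennreal (norm (f x))) p * ennreal (w x) \<partial>lebesgue)"

locale weighted_Lp =
  fixes w :: "real^'n::finite \<Rightarrow> real" and p :: real
  assumes p: "p > 1" and w0: "\<And>x. 0 \<le> w x" and wm [measurable]: "w \<in> borel_measurable lebesgue"
    and fin: "\<And>x r. (\<integral>\<^sup>+y\<in>ball x r. ennreal (w y) \<partial>lebesgue) < top"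
begin

lemma p0: "p > 0" "1 / p > 0" using p by auto

lemmas [measurable] = borel_measurable_ennpowr'[OF _ p0(1)] borel_measurable_ennpowr'[OF _ p0(2)]

lemma Lp_iff: "f \<in> Lp w p \<longleftrightarrow> f \<in> borel_measurable lebesgue \<and> weighted_mass w p f < top"
  using p0 by (simp add: Lp_def Lp_norm_eq[OF p w0] weighted_mass_def ennpowr_less_top_iff)

lemma mass_add_le:
  assumes [measurable]: "f \<in> borel_measurable lebesgue" "g \<in> borel_measurable lebesgue"
  shows "weighted_mass w p (\<lambda>x. f x + g x) \<le> ennreal (2 powr p) * (weighted_mass w p f + weighted_mass w p g)"
proof -
  have "weighted_mass w p (\<lambda>x. f x + g x) \<le>
    (\<integral>\<^sup>+x. ennreal (2 powr p) * (ennpowr (ennreal (norm (f x))) p * ennreal (w x) + ennpowr (ennreal (norm (g x))) p * ennreal (w x)) \<partial>lebesgue)"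
    unfolding weighted_mass_def
  proof (rule nn_integral_mono)
    fix x
    have "ennreal (norm (f x + g x)) \<le> ennreal (norm (f x)) + ennreal (norm (g x))"
      using norm_triangle_ineq[of "f x" "g x"] by (simp flip: ennreal_plus)
    then have "ennpowr (ennreal (norm (f x + g x))) p \<le> ennpowr (ennreal (norm (f x)) + ennreal (norm (g x))) p"
      by (rule ennpowr_mono[OF p0(1)])
    also have "\<dots> \<le> ennreal (2 powr p) * (ennpowr (ennreal (norm (f x))) p + ennpowr (ennreal (norm (g x))) p)"
      by (rule ennpowr_add_le[OF p0(1)])
    finally have "ennpowr (ennreal (norm (f x + g x))) p * ennreal (w x) \<le>
      ennreal (2 powr p) * (ennpowr (ennreal (norm (f x))) p + ennpowr (ennreal (norm (g x))) p) * ennreal (w x)"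
      by (rule mult_right_mono) simp
    then show "ennpowr (ennreal (norm (f x + g x))) p * ennreal (w x) \<le>
      ennreal (2 powr p) * (ennpowr (ennreal (norm (f x))) p * ennreal (w x) + ennpowr (ennreal (norm (g x))) p * ennreal (w x))"
      by (simp only: distrib_right mult.assoc)
  qed
  also have "\<dots> = ennreal (2 powr p) * (weighted_mass w p f + weighted_mass w p g)"
    unfolding weighted_mass_def by (simp add: nn_integral_cmult nn_integral_add)
  finally show ?thesis .
qed

lemma mass_scale: "f \<in> borel_measurable lebesgue \<Longrightarrow> weighted_mass w p (\<lambda>x. c * f x) = ennreal (norm c powr p) * weighted_mass w p f"
  unfolding weighted_mass_def using p0
  by (simp add: norm_mult ennreal_mult ennpowr_mult ennpowr_ennreal mult.assoc nn_integral_cmult)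

lemma Lp_add: "f \<in> Lp w p \<Longrightarrow> g \<in> Lp w p \<Longrightarrow> (\<lambda>x. f x + g x) \<in> Lp w p"
  unfolding Lp_iff by (auto intro!: le_less_trans[OF mass_add_le] simp: ennreal_mult_less_top)

lemma Lp_scale: "f \<in> Lp w p \<Longrightarrow> (\<lambda>x. c * f x) \<in> Lp w p"
  unfolding Lp_iff by (auto simp: mass_scale ennreal_mult_less_top)

lemma Lp_dominated:
  assumes "g \<in> Lp w p" "f \<in> borel_measurable lebesgue" "\<And>x. norm (f x) \<le> c * norm (g x)"
  shows "f \<in> Lp w p"
proof -
  have "weighted_mass w p f \<le> weighted_mass w p (\<lambda>x. complex_of_real c * g x)"
    unfolding weighted_mass_def
  proof (intro nn_integral_mono mult_right_mono ennpowr_mono p0 ennreal_leI)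
    fix x
    have "c * norm (g x) \<le> \<bar>c\<bar> * norm (g x)" by (intro mult_right_mono) auto
    then show "norm (f x) \<le> norm (complex_of_real c * g x)" using assms(3)[of x] by (simp add: norm_mult)
  qed simp
  also have "\<dots> < top" using Lp_scale[OF assms(1)] by (simp add: Lp_iff)
  finally show ?thesis using assms(2) by (simp add: Lp_iff)
qed

lemma Lp_indicator:
  assumes [measurable]: "A \<in> sets lebesgue" and "A \<subseteq> ball x r"
  shows "indicator A \<in> Lp w p"
proof -
  have "weighted_mass w p (indicator A) \<le> (\<integral>\<^sup>+y\<in>ball x r. ennreal (w y) \<partial>lebesgue)"
    unfolding weighted_mass_def using assms(2) p0 ennpowr_ennreal[of 1 p]
    by (intro nn_integral_mono) (auto simp: indicator_def)
  also have "\<dots> < top" by (rule fin)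
  finally show ?thesis by (simp add: Lp_iff)
qed

text \<open>Dominated convergence, with the dominating function \<open>H\<^sup>p w\<close>.\<close>

lemma mass_tendsto_0:
  assumes f: "f \<in> borel_measurable lebesgue" and g: "\<And>k::nat. g k \<in> borel_measurable lebesgue" and H: "H \<in> Lp w p"
    and lim: "AE x in lebesgue. (\<lambda>k. g k x) \<longlonglongrightarrow> f x"
    and bd: "\<And>k x. norm (f x - g k x) \<le> norm (H x)"
  shows "(\<lambda>k. weighted_mass w p (\<lambda>x. f x - g k x)) \<longlonglongrightarrow> 0"
proof -
  note [measurable] = f g
  have [measurable]: "H \<in> borel_measurable lebesgue" using H by (simp add: Lp_iff)
  have "(\<lambda>k. \<integral>\<^sup>+x. ennpowr (ennreal (norm (f x - g k x))) p * ennreal (w x) \<partial>lebesgue) \<longlonglongrightarrow> (\<integral>\<^sup>+x. 0 \<partial>(lebesgue :: (real^'n) measure))"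
  proof (rule nn_integral_dominated_convergence[where w = "\<lambda>x. ennpowr (ennreal (norm (H x))) p * ennreal (w x)"])
    show "(\<integral>\<^sup>+x. ennpowr (ennreal (norm (H x))) p * ennreal (w x) \<partial>lebesgue) < \<infinity>"
      using H by (simp add: Lp_iff weighted_mass_def)
    show "AE x in lebesgue. ennpowr (ennreal (norm (f x - g k x))) p * ennreal (w x) \<le> ennpowr (ennreal (norm (H x))) p * ennreal (w x)" for k
      using bd by (intro AE_I2 mult_right_mono ennpowr_mono p0 ennreal_leI) auto
    show "AE x in lebesgue. (\<lambda>k. ennpowr (ennreal (norm (f x - g k x))) p * ennreal (w x)) \<longlonglongrightarrow> 0"
      using lim
    proof eventually_elim
      case (elim x)
      then have "(\<lambda>k. norm (f x - g k x)) \<longlonglongrightarrow> norm (f x - f x)" by (intro tendsto_intros)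
      then have "(\<lambda>k. norm (f x - g k x) powr p * w x) \<longlonglongrightarrow> norm (f x - f x) powr p * w x"
        by (intro tendsto_mult tendsto_powr' tendsto_const) (use p0 in auto)
      then have "(\<lambda>k. ennreal (norm (f x - g k x) powr p * w x)) \<longlonglongrightarrow> ennreal 0"
        using p0 by (intro tendsto_ennrealI) simp
      then show ?case using p0 w0 by (simp add: ennpowr_ennreal ennreal_mult)
    qed
  qed measurable
  then show ?thesis by (simp add: weighted_mass_def)
qed

lemma extension_measurable:
  assumes "bounded_extension w p T S" "f \<in> Lp w p" shows "S f \<in> borel_measurable lebesgue"
proof -
  have "S f \<in> Lp w p" using assms unfolding bounded_extension_def by blast
  then show ?thesis by (simp add: Lp_iff)
qed

lemma extension_add:
  assumes "bounded_extension w p T S" "f \<in> Lp w p" "g \<in> Lp w p"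
  shows "AE x in density lebesgue w. S (\<lambda>y. f y + g y) x = S f x + S g x"
  using assms unfolding bounded_extension_def by blast

lemma extension_mass_le:
  assumes "bounded_extension w p T S"
  obtains C where "0 \<le> C" "\<And>f. f \<in> Lp w p \<Longrightarrow> weighted_mass w p (S f) \<le> ennreal C * weighted_mass w p f"
proof -
  obtain C where C: "\<And>f. f \<in> Lp w p \<Longrightarrow> Lp_norm w p (S f) \<le> ennreal C * Lp_norm w p f"
    using assms unfolding bounded_extension_def by blast
  show ?thesis
  proof (rule that[of "max C 0 powr p"])
    show "0 \<le> max C 0 powr p" by simp
    fix f assume f: "f \<in> Lp w p"
    have "Lp_norm w p (S f) \<le> ennreal (max C 0) * Lp_norm w p f"
    proof -
      have "ennreal C = ennreal (max C 0)" by (cases "0 \<le> C") (auto simp: ennreal_neg)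
      then show ?thesis using C[OF f] by simp
    qed
    then have "ennpowr (Lp_norm w p (S f)) p \<le> ennpowr (ennreal (max C 0) * Lp_norm w p f) p"
      by (rule ennpowr_mono[OF p0(1)])
    then show "weighted_mass w p (S f) \<le> ennreal (max C 0 powr p) * weighted_mass w p f"
      using p0 by (simp add: Lp_norm_eq[OF p w0] weighted_mass_def ennpowr_mult ennpowr_ennpowr ennpowr_ennreal)
  qed
qed

context
  fixes T S S'
  assumes S: "bounded_extension w p T S" and S': "bounded_extension w p T S'"
begin

definition agree where "agree f \<longleftrightarrow> (AE x in density lebesgue w. S f x = S' f x)"

lemma agree_test: "f \<in> test_functions \<Longrightarrow> agree f"
proof -
  assume f: "f \<in> test_functions"
  have "AE x in density lebesgue w. S f x = T f x" "AE x in density lebesgue w. S' f x = T f x"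
    using S S' f unfolding bounded_extension_def by blast+
  then show ?thesis unfolding agree_def by eventually_elim simp
qed

lemma agree_add: "f \<in> Lp w p \<Longrightarrow> g \<in> Lp w p \<Longrightarrow> agree f \<Longrightarrow> agree g \<Longrightarrow> agree (\<lambda>x. f x + g x)"
proof -
  assume f: "f \<in> Lp w p" and g: "g \<in> Lp w p" and a: "agree f" "agree g"
  have "AE x in density lebesgue w. S (\<lambda>y. f y + g y) x = S f x + S g x"
    "AE x in density lebesgue w. S' (\<lambda>y. f y + g y) x = S' f x + S' g x"
    using S S' f g unfolding bounded_extension_def by blast+
  with a show ?thesis unfolding agree_def by eventually_elim simp
qed

lemma agree_scale: "f \<in> Lp w p \<Longrightarrow> agree f \<Longrightarrow> agree (\<lambda>x. c * f x)"
proof -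
  assume f: "f \<in> Lp w p" and a: "agree f"
  have "AE x in density lebesgue w. S (\<lambda>y. c * f y) x = c * S f x"
    "AE x in density lebesgue w. S' (\<lambda>y. c * f y) x = c * S' f x"
    using S S' f unfolding bounded_extension_def by blast+
  with a show ?thesis unfolding agree_def by eventually_elim simp
qed

lemma agree_diff: "f \<in> Lp w p \<Longrightarrow> g \<in> Lp w p \<Longrightarrow> agree f \<Longrightarrow> agree g \<Longrightarrow> agree (\<lambda>x. f x - g x)"
  using agree_add[of f "\<lambda>x. (- 1) * g x"] agree_scale[of g "- 1"] Lp_scale[of g "- 1"] by simp

text \<open>\<open>S f - S' f = S (f - g) - S' (f - g)\<close> if \<open>S\<close> and \<open>S'\<close> agree on \<open>g\<close>.\<close>

lemma extensions_mass_diff: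
  obtains K where "\<And>f g. f \<in> Lp w p \<Longrightarrow> g \<in> Lp w p \<Longrightarrow> agree g \<Longrightarrow>
    weighted_mass w p (\<lambda>x. S f x - S' f x) \<le> ennreal K * weighted_mass w p (\<lambda>x. f x - g x)"
proof -
  obtain C C' where C0: "0 \<le> C" "0 \<le> C'" and C: "\<And>f. f \<in> Lp w p \<Longrightarrow> weighted_mass w p (S f) \<le> ennreal C * weighted_mass w p f"
    and C': "\<And>f. f \<in> Lp w p \<Longrightarrow> weighted_mass w p (S' f) \<le> ennreal C' * weighted_mass w p f"
    using extension_mass_le[OF S] extension_mass_le[OF S'] by metis
  have meas: "S f \<in> borel_measurable lebesgue" "S' f \<in> borel_measurable lebesgue" if "f \<in> Lp w p" for f
    by (rule extension_measurable[OF S that] extension_measurable[OF S' that])+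
  show ?thesis
  proof (rule that[of "2 powr p * (C + C')"])
    fix f g assume f: "f \<in> Lp w p" and g: "g \<in> Lp w p" and a: "agree g"
    define h where "h x = f x + (- 1) * g x" for x
    have h: "h \<in> Lp w p" unfolding h_def using Lp_add[OF f Lp_scale[OF g]] .
    have g': "(\<lambda>x. (- 1) * g x) \<in> Lp w p" by (rule Lp_scale[OF g])
    have "AE x in density lebesgue w. S h x = S f x + S (\<lambda>x. (- 1) * g x) x"
      "AE x in density lebesgue w. S' h x = S' f x + S' (\<lambda>x. (- 1) * g x) x"
      unfolding h_def by (rule extension_add[OF S f g'] extension_add[OF S' f g'])+
    with agree_scale[OF g a, of "- 1"]
    have "AE x in density lebesgue w. S f x - S' f x = S h x - S' h x"
      unfolding agree_def by eventually_elim simp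
    then have "AE x in lebesgue. 0 < ennreal (w x) \<longrightarrow> S f x - S' f x = S h x - S' h x"
      by (subst (asm) AE_density) auto
    then have "weighted_mass w p (\<lambda>x. S f x - S' f x) = weighted_mass w p (\<lambda>x. S h x + (- 1) * S' h x)"
      unfolding weighted_mass_def
    proof (intro nn_integral_cong_AE, eventually_elim)
      case (elim x)
      then show ?case using w0[of x] by (cases "w x = 0") (auto simp: less_le)
    qed
    also have "\<dots> \<le> ennreal (2 powr p) * (weighted_mass w p (S h) + weighted_mass w p (\<lambda>x. (- 1) * S' h x))"
      by (rule mass_add_le) (use meas[OF h] in measurable)
    also have "\<dots> = ennreal (2 powr p) * (weighted_mass w p (S h) + weighted_mass w p (S' h))"
      using mass_scale[OF meas(2)[OF h], of "- 1"] by simp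
    also have "\<dots> \<le> ennreal (2 powr p) * (ennreal C * weighted_mass w p h + ennreal C' * weighted_mass w p h)"
      by (intro mult_left_mono add_mono C[OF h] C'[OF h]) auto
    also have "\<dots> = ennreal (2 powr p * (C + C')) * weighted_mass w p h"
      using C0 by (simp add: ennreal_mult ennreal_plus distrib_right mult.assoc)
    finally show "weighted_mass w p (\<lambda>x. S f x - S' f x) \<le> ennreal (2 powr p * (C + C')) * weighted_mass w p (\<lambda>x. f x - g x)"
      by (simp add: h_def[abs_def])
  qed
qed

text \<open>The set on which two bounded extensions agree is closed in \<open>L\<^sup>p(w)\<close>.\<close>

lemma agree_limit:
  assumes f: "f \<in> Lp w p" and g: "\<And>k::nat. g k \<in> Lp w p" "\<And>k. agree (g k)"
    and lim: "(\<lambda>k. weighted_mass w p (\<lambda>x. f x - g k x)) \<longlonglongrightarrow> 0"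
  shows "agree f"
proof -
  obtain K where K: "\<And>f g. f \<in> Lp w p \<Longrightarrow> g \<in> Lp w p \<Longrightarrow> agree g \<Longrightarrow>
    weighted_mass w p (\<lambda>x. S f x - S' f x) \<le> ennreal K * weighted_mass w p (\<lambda>x. f x - g x)"
    by (rule extensions_mass_diff) (rule that)
  have [measurable]: "S f \<in> borel_measurable lebesgue" "S' f \<in> borel_measurable lebesgue"
    by (rule extension_measurable[OF S f] extension_measurable[OF S' f])+
  have "(\<lambda>k. ennreal K * weighted_mass w p (\<lambda>x. f x - g k x)) \<longlonglongrightarrow> ennreal K * 0"
    by (intro ennreal_tendsto_cmult lim) simp
  then have "weighted_mass w p (\<lambda>x. S f x - S' f x) \<le> ennreal K * 0"
    by (rule LIMSEQ_le_const) (use K[OF f g(1) g(2)] in blast)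
  then have "(\<integral>\<^sup>+x. ennpowr (ennreal (norm (S f x - S' f x))) p * ennreal (w x) \<partial>lebesgue) = 0"
    by (simp add: weighted_mass_def)
  then have "AE x in lebesgue. ennpowr (ennreal (norm (S f x - S' f x))) p * ennreal (w x) = 0"
    by (subst (asm) nn_integral_0_iff_AE) auto
  then show ?thesis unfolding agree_def
    by (subst AE_density) (auto elim!: eventually_mono simp: ennpowr_eq_0_iff[OF p0(1)] ennreal_eq_0_iff)
qed

lemma agree_box: "agree (indicator (box a b))"
proof -
  obtain r where r: "box a b \<subseteq> ball 0 r"
    using bounded_subset_ballD[OF bounded_box] by blast
  have L: "indicator (box a b) \<in> Lp w p" by (rule Lp_indicator[OF _ r]) simp
  have "(\<lambda>x. complex_of_real (box_bump a b k x)) \<in> borel_measurable lebesgue" for k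
    by (rule measurable_completion) (simp add: test_function_measurable[OF box_bump_test_function])
  note m = this
  have bound: "norm (complex_of_real (box_bump a b k x)) \<le> 1 * norm (indicator (box a b) x :: complex)" for k x
    using box_bump_range[of a b k x] by (cases "x \<in> box a b") auto
  have mi: "(indicator (box a b) :: real^'n \<Rightarrow> complex) \<in> borel_measurable lebesgue" using L by (simp add: Lp_iff)
  show ?thesis
  proof (rule agree_limit[OF L])
    show "(\<lambda>x. complex_of_real (box_bump a b k x)) \<in> Lp w p" for k
      by (rule Lp_dominated[OF L m bound])
    show "agree (\<lambda>x. complex_of_real (box_bump a b k x))" for k
      by (rule agree_test[OF box_bump_test_function])
    show "(\<lambda>k. weighted_mass w p (\<lambda>x. indicator (box a b) x - complex_of_real (box_bump a b k x))) \<longlonglongrightarrow> 0"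
    proof (rule mass_tendsto_0[OF mi m L])
      have "(\<lambda>k. complex_of_real (box_bump a b k x)) \<longlonglongrightarrow> complex_of_real (indicator (box a b) x)" for x
        by (intro tendsto_of_real box_bump_tendsto)
      note t = this
      show "AE x in lebesgue. (\<lambda>k. complex_of_real (box_bump a b k x)) \<longlonglongrightarrow> indicator (box a b) x"
      proof (intro AE_I2)
        fix x
        show "(\<lambda>k. complex_of_real (box_bump a b k x)) \<longlonglongrightarrow> indicator (box a b) x"
          using t[of x] by (cases "x \<in> box a b") simp_all
      qed
      show "norm (indicator (box a b) x - complex_of_real (box_bump a b k x)) \<le> norm (indicator (box a b) x :: complex)" for k x
      proof -
        have "indicator (box a b) x - complex_of_real (box_bump a b k x) = complex_of_real (indicator (box a b) x - box_bump a b k x)"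
          by (simp add: indicator_def)
        then show ?thesis using box_bump_range[of a b k x] by (simp only: norm_of_real) (auto simp: indicator_def split: if_splits)
      qed
    qed
  qed
qed

text \<open>Boxes are stable under intersection and generate the Borel sets; the sets \<open>A\<close> with the stated property form
  a Dynkin class. Intersecting with a bounded box keeps all indicators in \<open>L\<^sup>p(w)\<close>.\<close>

lemma agree_borel_Int_box:
  assumes "A \<in> sets borel"
  shows "agree (indicator (A \<inter> box c d))"
proof -
  let ?B = "box c d"
  obtain r where r: "?B \<subseteq> ball 0 r" using bounded_subset_ballD[OF bounded_box] by blast
  have L: "indicator (A \<inter> ?B) \<in> Lp w p" if "A \<in> sets borel" for A
    by (rule Lp_indicator[of _ 0 r]) (use that r in \<open>auto intro!: sets_completionI_sets\<close>)
  have gen: "sets borel = sigma_sets UNIV (range (\<lambda>(a, b). box a b :: (real^'n) set))"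
    by (subst borel_eq_box) (simp add: sets_measure_of)
  have A: "A \<in> sigma_sets UNIV (range (\<lambda>(a, b). box a b :: (real^'n) set))" using assms gen by simp
  have stable: "Int_stable (range (\<lambda>(a, b). box a b :: (real^'n) set))"
    unfolding Int_stable_def
  proof (intro ballI)
    fix X Y assume "X \<in> range (\<lambda>(a, b). box a b :: (real^'n) set)" "Y \<in> range (\<lambda>(a, b). box a b :: (real^'n) set)"
    then obtain a b a' b' where XY: "X = box a b" "Y = box a' b'" by auto
    obtain u v where "X \<inter> Y = box u v" unfolding XY box_Int_box by blast
    then show "X \<inter> Y \<in> range (\<lambda>(a, b). box a b :: (real^'n) set)" by (intro image_eqI[where x = "(u, v)"]) auto
  qed
  have sub: "range (\<lambda>(a, b). box a b :: (real^'n) set) \<subseteq> Pow UNIV" by simp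
  from stable sub A show ?thesis
  proof (induction rule: sigma_sets_induct_disjoint)
    case (basic A)
    then obtain a b where "A = box a b" by auto
    then show ?case by (simp only: box_Int_box agree_box)
  next
    case empty
    have "agree (\<lambda>x. 0 * indicator (box c d) x)"
      by (rule agree_scale) (use L[of UNIV] agree_box in auto)
    then show ?case by simp
  next
    case (compl A)
    have A: "A \<in> sets borel" using compl gen by simp
    have "agree (\<lambda>x. indicator ?B x - indicator (A \<inter> ?B) x)"
      using agree_diff[OF L[of UNIV] L[OF A]] agree_box compl by simp
    also have "(\<lambda>x. indicator ?B x - indicator (A \<inter> ?B) x) = (indicator ((UNIV - A) \<inter> ?B) :: real^'n \<Rightarrow> complex)"
      by (auto simp: indicator_def fun_eq_iff)
    finally show ?case .
  next
    case (union A)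
    have A: "A i \<in> sets borel" for i using union gen by auto
    have UA: "(\<Union>i. A i) \<in> sets borel" using A by auto
    define s where "s k x = (\<Sum>i<k. indicator (A i \<inter> ?B) x :: complex)" for k x
    have s: "s k \<in> Lp w p \<and> agree (s k)" for k
    proof (induction k)
      case 0
      have "s 0 = (\<lambda>x. 0 * indicator (UNIV \<inter> ?B) x)" by (simp add: s_def fun_eq_iff)
      then show ?case using Lp_scale[OF L[of UNIV], of 0] agree_scale[OF L[of UNIV], of 0] agree_box by simp
    next
      case (Suc k)
      have "s (Suc k) = (\<lambda>x. s k x + indicator (A k \<inter> ?B) x)" by (simp add: s_def fun_eq_iff)
      then show ?case using Suc Lp_add[of "s k"] agree_add[of "s k"] L[OF A] union by simp
    qed
    have s_eq: "s k x = indicator ((\<Union>i<k. A i) \<inter> ?B) x" for k x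
    proof -
      have "indicator (\<Union>i\<in>{..<k}. A i \<inter> ?B) x = (\<Sum>i\<in>{..<k}. indicator (A i \<inter> ?B) x :: complex)"
        using union by (intro indicator_UN_disjoint) (auto simp: disjoint_family_on_def)
      moreover have "(\<Union>i\<in>{..<k}. A i \<inter> ?B) = (\<Union>i<k. A i) \<inter> ?B" by auto
      ultimately show ?thesis by (simp add: s_def)
    qed
    show ?case
    proof (rule agree_limit[OF L[OF UA]])
      show "s k \<in> Lp w p" "agree (s k)" for k using s by auto
      show "(\<lambda>k. weighted_mass w p (\<lambda>x. indicator ((\<Union>i. A i) \<inter> ?B) x - s k x)) \<longlonglongrightarrow> 0"
      proof (rule mass_tendsto_0[OF _ _ L[of UNIV]])
        show "(indicator ((\<Union>i. A i) \<inter> ?B) :: real^'n \<Rightarrow> complex) \<in> borel_measurable lebesgue" using L[OF UA] by (simp add: Lp_iff)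
        show "s k \<in> borel_measurable lebesgue" for k using s by (simp add: Lp_iff)
        show "norm (indicator ((\<Union>i. A i) \<inter> ?B) x - s k x) \<le> norm (indicator (UNIV \<inter> ?B) x :: complex)" for k x
          unfolding s_eq by (auto simp: indicator_def)
        show "AE x in lebesgue. (\<lambda>k. s k x) \<longlonglongrightarrow> indicator ((\<Union>i. A i) \<inter> ?B) x"
        proof (intro AE_I2)
          fix x
          show "(\<lambda>k. s k x) \<longlonglongrightarrow> indicator ((\<Union>i. A i) \<inter> ?B) x"
          proof (cases "x \<in> (\<Union>i. A i)")
            case True
            then obtain i where i: "x \<in> A i" by auto
            have "\<forall>\<^sub>F k in sequentially. s k x = indicator ((\<Union>i. A i) \<inter> ?B) x"
              using i by (intro eventually_sequentiallyI[of "Suc i"]) (auto simp: s_eq indicator_def)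
            then show ?thesis by (rule tendsto_eventually)
          next
            case False
            then have "s k x = indicator ((\<Union>i. A i) \<inter> ?B) x" for k by (auto simp: s_eq indicator_def)
            then show ?thesis by simp
          qed
        qed
      qed simp
    qed
  qed
qed

lemma agree_lebesgue_Int_box:
  assumes A: "A \<in> sets lebesgue"
  shows "agree (indicator (A \<inter> box c d)) \<and> indicator (A \<inter> box c d) \<in> Lp w p"
proof -
  let ?B = "box c d"
  obtain r where r: "?B \<subseteq> ball 0 r" using bounded_subset_ballD[OF bounded_box] by blast
  have L: "indicator (A \<inter> ?B) \<in> Lp w p" if "A \<in> sets lebesgue" for A
    by (rule Lp_indicator[of _ 0 r]) (use that r in auto)
  obtain X N N' where X: "A = X \<union> N" "N \<subseteq> N'" "N' \<in> null_sets lborel" "X \<in> sets lborel"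
    by (rule sets_completionE[OF A])
  have Xl: "X \<in> sets lebesgue" using X by (intro sets_completionI_sets)
  have "AE x in lebesgue. x \<notin> N'" using AE_completion[OF AE_not_in[OF X(3)]] .
  then have "AE x in lebesgue. ennpowr (ennreal (norm (indicator (A \<inter> ?B) x - indicator (X \<inter> ?B) x :: complex))) p * ennreal (w x) = 0"
    by eventually_elim (use X p0 in \<open>auto simp: indicator_def\<close>)
  then have "weighted_mass w p (\<lambda>x. indicator (A \<inter> ?B) x - indicator (X \<inter> ?B) x) = 0"
    unfolding weighted_mass_def by (subst nn_integral_cong_AE[where v = "\<lambda>_. 0"]) auto
  then have "(\<lambda>k::nat. weighted_mass w p (\<lambda>x. indicator (A \<inter> ?B) x - indicator (X \<inter> ?B) x)) \<longlonglongrightarrow> 0" by simp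
  from agree_limit[OF L[OF A] L[OF Xl] agree_borel_Int_box this] show ?thesis using X L[OF A] by simp
qed

text \<open>Simple functions with bounded support are linear combinations of the indicators treated above, and they
  approximate \<open>f\<close> with the integrable majorant \<open>3 |f|\<close>.\<close>

theorem extensions_agree:
  assumes f: "f \<in> Lp w p"
  shows "AE x in density lebesgue w. S f x = S' f x"
proof -
  have [measurable]: "f \<in> borel_measurable lebesgue" using f by (simp add: Lp_iff)
  obtain F where F: "\<And>i. simple_function lebesgue (F i)" "\<And>x. (\<lambda>i. F i x) \<longlonglongrightarrow> f x" "\<And>i x. dist (F i x) 0 \<le> 2 * dist (f x) 0"
    using borel_measurable_implies_sequence_metric[of f lebesgue 0] by auto
  define B where "B k = box ((\<chi> i. - real k) :: real^'n) (\<chi> i. real k)" for k :: nat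
  define g where "g k x = F k x * indicator (B k) x" for k x
  have Fm: "F k \<in> borel_measurable lebesgue" for k by (rule borel_measurable_simple_function[OF F(1)])
  have Bm: "B k \<in> sets lebesgue" for k by (simp add: B_def)
  have gm: "g k \<in> borel_measurable lebesgue" for k unfolding g_def[abs_def] using Fm Bm by simp
  have g: "g k \<in> Lp w p \<and> agree (g k)" for k
  proof -
    have fin: "finite (range (F k))" using F(1)[of k] by (simp add: simple_function_def)
    have e: "g k = (\<lambda>x. \<Sum>y\<in>range (F k). y * indicator (F k -` {y} \<inter> B k) x)"
    proof
      fix x
      have "(\<Sum>y\<in>range (F k). y * indicator (F k -` {y} \<inter> B k) x) = (\<Sum>y\<in>range (F k). if y = F k x then F k x * indicator (B k) x else 0)"
        by (intro sum.cong) (auto simp: indicator_def)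
      also have "\<dots> = g k x" using fin by (simp add: g_def)
      finally show "g k x = (\<Sum>y\<in>range (F k). y * indicator (F k -` {y} \<inter> B k) x)" by simp
    qed
    have one: "(\<lambda>x. y * indicator (F k -` {y} \<inter> B k) x) \<in> Lp w p \<and> agree (\<lambda>x. y * indicator (F k -` {y} \<inter> B k) x)" for y
    proof -
      have "F k -` {y} \<in> sets lebesgue" using simple_functionD(2)[OF F(1), of k "{y}"] by simp
      from agree_lebesgue_Int_box[OF this, of "\<chi> i. - real k" "\<chi> i. real k"]
      show ?thesis unfolding B_def using Lp_scale agree_scale by simp
    qed
    define q where "q y x = y * indicator (F k -` {y} \<inter> B k) x" for y x
    have q: "q y \<in> Lp w p" "agree (q y)" for y using one[of y] by (auto simp: q_def[abs_def])
    have "(\<lambda>x. \<Sum>y\<in>Y. q y x) \<in> Lp w p \<and> agree (\<lambda>x. \<Sum>y\<in>Y. q y x)" if "finite Y" for Y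
      using that
    proof (induction Y rule: finite_induct)
      case empty
      show ?case using Lp_scale[OF q(1), of 0] agree_scale[OF q, of 0] by simp
    next
      case (insert y Y)
      then have "(\<lambda>x. \<Sum>y\<in>insert y Y. q y x) = (\<lambda>x. q y x + (\<Sum>y\<in>Y. q y x))" by (simp add: fun_eq_iff)
      then show ?case
        using Lp_add[OF q(1) conjunct1[OF insert.IH]] agree_add[OF q(1) conjunct1[OF insert.IH] q(2) conjunct2[OF insert.IH]] by simp
    qed
    from this[OF fin] show ?thesis unfolding e q_def .
  qed
  have "agree f"
  proof (rule agree_limit[OF f])
    show "g k \<in> Lp w p" "agree (g k)" for k using g by auto
    show "(\<lambda>k. weighted_mass w p (\<lambda>x. f x - g k x)) \<longlonglongrightarrow> 0"
    proof (rule mass_tendsto_0[OF _ gm Lp_scale[OF f, of 3]])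
      show "AE x in lebesgue. (\<lambda>k. g k x) \<longlonglongrightarrow> f x"
      proof (intro AE_I2)
        fix x :: "real^'n"
        obtain k0 where k0: "norm x < real k0" using reals_Archimedean2 by blast
        have "x \<in> B k" if "k \<ge> k0" for k
        proof -
          have "\<bar>x $ i\<bar> < real k" for i using component_le_norm_cart[of x i] k0 that by (meson le_less_trans less_le_trans of_nat_le_iff)
          then show ?thesis by (auto simp: B_def mem_box_cart abs_less_iff) (metis minus_less_iff)
        qed
        then have "\<forall>\<^sub>F k in sequentially. F k x = g k x"
          by (intro eventually_sequentiallyI[of k0]) (simp add: g_def)
        with F(2) show "(\<lambda>k. g k x) \<longlonglongrightarrow> f x" by (rule Lim_transform_eventually)
      qed
      show "norm (f x - g k x) \<le> norm (3 * f x)" for k x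
        using norm_triangle_ineq4[of "f x" "g k x"] F(3)[of k x] by (auto simp: g_def indicator_def norm_mult)
    qed simp
  qed
  then show ?thesis by (simp add: agree_def)
qed

end

end

section \<open>Boundedness of the operator and of its commutators\<close>

text \<open>A test function is bounded and supported in some ball.\<close>

lemma (in weighted_Lp) Lp_bounded_support:
  assumes f: "f \<in> test_functions" and g: "g \<in> borel_measurable lebesgue"
    and Q: "\<And>r. (\<lambda>x. indicator (ball 0 r) x * g x) \<in> Lp w p"
  shows "(\<lambda>x. g x * f x) \<in> Lp w p"
proof -
  have fm: "f \<in> borel_measurable lebesgue" by (rule measurable_completion) (simp add: test_function_measurable[OF f])
  have K: "compact (closure {x. f x \<noteq> 0})" using f by (simp add: test_functions_def)
  obtain r where r: "closure {x. f x \<noteq> 0} \<subseteq> ball 0 r" using bounded_subset_ballD[OF compact_imp_bounded[OF K]] by blast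
  have "bounded (f ` closure {x. f x \<noteq> 0})"
    by (intro compact_imp_bounded compact_continuous_image K continuous_on_subset[OF test_function_continuous[OF f]]) simp
  then obtain B where B: "\<And>x. x \<in> closure {x. f x \<noteq> 0} \<Longrightarrow> norm (f x) \<le> B" unfolding bounded_iff by auto
  show ?thesis
  proof (rule Lp_dominated[OF Q[of r]])
    show "(\<lambda>x. g x * f x) \<in> borel_measurable lebesgue" using fm g by simp
    fix x
    show "norm (g x * f x) \<le> max B 0 * norm (indicator (ball 0 r) x * g x)"
    proof (cases "f x = 0")
      case False
      then have x: "x \<in> closure {x. f x \<noteq> 0}" using subsetD[OF closure_subset, of x "{x. f x \<noteq> 0}"] by simp
      then have "norm (f x) \<le> max B 0" "x \<in> ball 0 r" using B[OF x] r by auto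
      then show ?thesis by (simp add: norm_mult mult.commute mult_right_mono)
    qed simp
  qed
qed

lemma (in weighted_Lp) test_functions_Lp: "f \<in> test_functions \<Longrightarrow> f \<in> Lp w p"
proof -
  assume f: "f \<in> test_functions"
  have m: "(\<lambda>_. 1 :: complex) \<in> borel_measurable lebesgue" by simp
  have "(\<lambda>x. indicator (ball 0 r) x * (1 :: complex)) \<in> Lp w p" for r
    using Lp_indicator[of "ball 0 r" 0 r] by simp
  from Lp_bounded_support[OF f m this] show ?thesis by simp
qed

lemma dual_weights_weighted_Lp:
  fixes w :: "real^'n::finite \<Rightarrow> real"
  assumes dw: "dual_weights p q (\<lambda>x. ennreal (w x)) V C \<theta>" and w0: "\<And>x. 0 \<le> w x" and wm: "w \<in> borel_measurable lebesgue"
  shows "weighted_Lp w p"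
proof
  show "p > 1" using dw by (simp add: dual_weights_def)
  show "(\<integral>\<^sup>+y\<in>ball x r. ennreal (w y) \<partial>lebesgue) < top" for x r
  proof (cases "r > 0")
    case True
    then show ?thesis using dw by (auto simp: dual_weights_def)
  next
    case False
    then have "ball x r = {}" by simp
    then have "(\<integral>\<^sup>+y\<in>ball x r. ennreal (w y) \<partial>lebesgue) = 0" by (simp only: indicator_def empty_iff if_False mult_zero_right) simp
    then show ?thesis by (simp only:) simp
  qed
qed (use w0 wm in auto)

text \<open>On a cube containing the support of \<open>f\<close>, the function \<open>b\<close> is the sum of its mean and of a function whose
  \<open>p\<close>-th moment against \<open>w\<close> is finite.\<close>

lemma BMO_times_test_function:
  fixes w :: "real^'n::finite \<Rightarrow> real"
  assumes dw: "dual_weights p q (\<lambda>x. ennreal (w x)) V C \<theta>" and w0: "\<And>x. 0 \<le> w x" and wm: "w \<in> borel_measurable lebesgue"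
    and b: "b \<in> BMO \<theta>b" and \<theta>b: "0 < \<theta>b" and f: "f \<in> test_functions"
  shows "(\<lambda>x. b x * f x) \<in> Lp w p"
proof -
  interpret weighted_Lp w p by (rule dual_weights_weighted_Lp[OF dw w0 wm])
  have "locally_integrable b" using b by (auto simp: BMO_def)
  then have bm [measurable]: "b \<in> borel_measurable lebesgue" by (rule borel_measurable_locally_integrable)
  obtain K0 M where K0: "K0 \<ge> 0" "M \<ge> 0"
    "\<And>c s. 0 < s \<Longrightarrow> (\<integral>\<^sup>+x\<in>cube c s. ennreal (norm (b x - cube_mean b c s) powr p) * ennreal (w x) \<partial>lebesgue)
       \<le> ennreal (K0 * (1 + s) powr M) * (\<integral>\<^sup>+x\<in>cube c s. ennreal (w x) \<partial>lebesgue)"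
    using BMO_weighted_moment[OF dw b \<theta>b, of p] p by auto
  show ?thesis
  proof (rule Lp_bounded_support[OF f bm])
    fix r :: real
    define R where "R = \<bar>r\<bar> + 1"
    define c :: "real^'n" where "c = (\<chi> i. - R)"
    define Q where "Q = cube c (2 * R)"
    define m where "m = cube_mean b c (2 * R)"
    have s: "0 < 2 * R" by (simp add: R_def)
    have [measurable]: "Q \<in> sets lebesgue" by (simp add: Q_def)
    have sub: "ball 0 r \<subseteq> Q"
    proof
      fix x :: "real^'n" assume "x \<in> ball 0 r"
      then have "norm x < R" by (simp add: R_def)
      then have "\<bar>x $ i\<bar> < R" for i using component_le_norm_cart[of x i] by simp
      then show "x \<in> Q" unfolding Q_def cube_def c_def by (auto simp: abs_less_iff) (smt (verit))+
    qed
    have QB: "Q \<subseteq> ball c ((real CARD('n) + 1) * (2 * R))" unfolding Q_def by (rule cube_subset_ball[OF s])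
    have WQ: "(\<integral>\<^sup>+x\<in>Q. ennreal (w x) \<partial>lebesgue) < top"
      by (rule le_less_trans[OF nn_integral_mono_set[OF QB] fin])
    have "weighted_mass w p (\<lambda>x. indicator Q x * (b x - m)) = (\<integral>\<^sup>+x\<in>Q. ennreal (norm (b x - m) powr p) * ennreal (w x) \<partial>lebesgue)"
      unfolding weighted_mass_def using p0 by (intro nn_integral_cong) (auto simp: indicator_def ennpowr_ennreal)
    also have "\<dots> \<le> ennreal (K0 * (1 + 2 * R) powr M) * (\<integral>\<^sup>+x\<in>Q. ennreal (w x) \<partial>lebesgue)"
      unfolding Q_def m_def by (rule K0(3)[OF s])
    also have "\<dots> < top" using WQ by (simp add: ennreal_mult_less_top)
    finally have "(\<lambda>x. indicator Q x * (b x - m)) \<in> Lp w p" by (simp add: Lp_iff)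
    moreover have "(\<lambda>x. m * indicator Q x) \<in> Lp w p" by (intro Lp_scale Lp_indicator[OF _ QB]) simp
    ultimately have "(\<lambda>x. indicator Q x * (b x - m) + m * indicator Q x) \<in> Lp w p" by (rule Lp_add)
    then show "(\<lambda>x. indicator (ball 0 r) x * b x) \<in> Lp w p"
    proof (rule Lp_dominated[where c = 1])
      show "norm (indicator (ball 0 r) x * b x) \<le> 1 * norm (indicator Q x * (b x - m) + m * indicator Q x)" for x
        using sub by (auto simp: indicator_def)
      have "ball (0 :: real^'n) r \<in> sets lebesgue" by simp
      then show "(\<lambda>x. indicator (ball 0 r) x * b x) \<in> borel_measurable lebesgue"
        by (intro borel_measurable_times borel_measurable_indicator bm)
    qed
  qed
qed

lemma Lp_norm_null_weight:
  fixes w :: "real^'n::finite \<Rightarrow> real"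
  assumes "AE x in lebesgue. w x = 0" shows "Lp_norm w p f = ennpowr 0 (1 / p)"
proof -
  have "(\<integral>\<^sup>+x. ennreal (norm (f x) powr p * w x) \<partial>lebesgue) = (\<integral>\<^sup>+(x :: real^'n). 0 \<partial>lebesgue)"
  proof (rule nn_integral_cong_AE)
    show "AE x in lebesgue. ennreal (norm (f x) powr p * w x) = 0"
      using assms by eventually_elim simp
  qed
  then show ?thesis by (simp add: Lp_norm_def)
qed

lemma AE_null_weight:
  assumes "w \<in> borel_measurable lebesgue" "AE x in lebesgue. w x = 0"
  shows "AE x in density lebesgue (\<lambda>x. ennreal (w x)). P x"
  using assms by (subst AE_density) (auto elim: eventually_mono)

text \<open>The zero operator extends every operator, since almost everywhere with respect to \<open>w\<close> is a void
  requirement.\<close>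

lemma bounded_on_null_weight:
  assumes p: "p > 0" and wm: "w \<in> borel_measurable lebesgue" and w: "AE x in lebesgue. w x = 0"
  shows "bounded_on_Lp w p T"
  unfolding bounded_on_Lp_def
proof (rule exI[of _ "\<lambda>f x. 0"])
  show "bounded_extension w p T (\<lambda>f x. 0)"
    unfolding bounded_extension_def Lp_def Lp_norm_null_weight[OF w] using p AE_null_weight[OF wm w] by auto
qed

text \<open>The kernel estimates hold for a representative of the symbol that is good for every \<open>x\<close>; it gives the same
  operator almost everywhere. The absolute convergence required by \<open>psido_eq_kernel\<close> is itself a consequence of
  the weighted bound for the majorant kernel.\<close>

lemma psido_bounds_nondegenerate:
  fixes a :: "real^'n::finite \<Rightarrow> real^'n \<Rightarrow> complex" and m \<rho> :: real
  assumes \<rho>: "\<rho> \<in> {0..1}" and m: "m < real CARD('n) * (\<rho> - 1)" and a: "a \<in> symbol_class m \<rho>"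
    and dw: "dual_weights p q (\<lambda>x. ennreal (w x)) V C \<theta>" and w0: "\<And>x. 0 \<le> w x" and wm [measurable]: "w \<in> borel_measurable lebesgue"
  obtains K where "(\<lambda>(x, y). K x y) \<in> borel_measurable (lebesgue \<Otimes>\<^sub>M lebesgue)"
    "\<And>D. scale_test p q (\<lambda>x. ennreal (w x)) V D \<Longrightarrow> (\<lambda>(x, y). D x y) \<in> borel_measurable (lebesgue \<Otimes>\<^sub>M lebesgue) \<Longrightarrow>
       \<exists>C' :: real. \<forall>F\<in>borel_measurable lebesgue.
       (\<integral>\<^sup>+x. ennpowr (\<integral>\<^sup>+y. ennreal (norm (K x y)) * D x y * F y \<partial>lebesgue) p * ennreal (w x) \<partial>lebesgue)
         \<le> ennreal C' * (\<integral>\<^sup>+y. ennpowr (F y) p * ennreal (w y) \<partial>lebesgue)"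
    "\<And>f. f \<in> test_functions \<Longrightarrow> AE x in density lebesgue w. psido a f x = kernel_operator K f x"
proof -
  interpret weighted_Lp w p by (rule dual_weights_weighted_Lp[OF dw w0 wm])
  have \<rho>': "0 \<le> \<rho>" "\<rho> \<le> 1" using \<rho> by auto
  have "real CARD('n) * (\<rho> - 1) \<le> 0" using \<rho>' by (simp add: mult_nonneg_nonpos)
  then have m0: "m \<le> 0" using m by linarith
  obtain a' Ca where a': "AE x in lebesgue. a' x = a x" "\<And>x. symbol_bound m \<rho> Ca (a' x)"
    and am: "(\<lambda>(x, \<xi>). a' x \<xi>) \<in> borel_measurable (lebesgue \<Otimes>\<^sub>M borel)"
    by (rule symbol_class_representative[OF a]) (rule that)
  obtain \<epsilon> A B where \<epsilon>: "0 < \<epsilon>" and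
    near: "\<And>(a :: real^'n \<Rightarrow> complex) z. symbol_bound m \<rho> Ca a \<Longrightarrow> 0 < norm z \<Longrightarrow>
       (\<Sum>j. ennreal (norm (kernel_piece a j z))) \<le> ennreal (A * norm z powr (\<epsilon> - real CARD('n)))" and
    far: "\<And>L (a :: real^'n \<Rightarrow> complex) z. symbol_bound m \<rho> Ca a \<Longrightarrow> 1 \<le> norm z \<Longrightarrow>
       (\<Sum>j. ennreal (norm (kernel_piece a j z))) \<le> ennreal (B L * norm z powr (- L))"
    by (rule kernel_pieces_sum_bound[where 'n='n, OF \<rho>' m, of Ca]) (rule that)
  define G where "G x y = (\<Sum>j. ennreal (norm (kernel_piece (a' x) j (x - y))))" for x y
  define c0 where "c0 = complex_of_real (1 / (2 * pi) ^ CARD('n))"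
  define K where "K x y = c0 * full_kernel (a' x) (x - y)" for x y
  have pm [measurable]: "(\<lambda>u. kernel_piece (a' (fst u)) j (fst u - snd u)) \<in> borel_measurable (lebesgue \<Otimes>\<^sub>M lebesgue)" for j
  proof (rule borel_measurable_kernel_piece[OF am])
    show "fst \<in> lebesgue \<Otimes>\<^sub>M lebesgue \<rightarrow>\<^sub>M lebesgue" by (rule measurable_fst)
    show "(\<lambda>u :: (real^'n) \<times> (real^'n). fst u - snd u) \<in> borel_measurable (lebesgue \<Otimes>\<^sub>M lebesgue)"
      by (intro borel_measurable_diff measurable_fst_lebesgue measurable_snd_lebesgue)
  qed
  have Gm [measurable]: "(\<lambda>(x, y). G x y) \<in> borel_measurable (lebesgue \<Otimes>\<^sub>M lebesgue)"
    unfolding G_def case_prod_unfold by measurable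
  have Km: "(\<lambda>(x, y). K x y) \<in> borel_measurable (lebesgue \<Otimes>\<^sub>M lebesgue)"
    unfolding K_def full_kernel_def case_prod_unfold by measurable
  have c0: "norm c0 \<le> 1"
  proof -
    have "1 \<le> (2 * pi) ^ CARD('n)" using pi_gt3 by (intro one_le_power) simp
    then show ?thesis by (simp add: c0_def norm_divide norm_power norm_mult)
  qed
  have KG: "ennreal (norm (K x y)) \<le> G x y" for x y
  proof -
    have "norm (K x y) \<le> norm (full_kernel (a' x) (x - y))"
      unfolding K_def norm_mult using c0 by (intro mult_left_le_one_le) auto
    then show ?thesis unfolding G_def by (rule order_trans[OF ennreal_leI norm_full_kernel_le])
  qed
  have GD: "\<exists>C' :: real. \<forall>F\<in>borel_measurable lebesgue.
       (\<integral>\<^sup>+x. ennpowr (\<integral>\<^sup>+y. G x y * D x y * F y \<partial>lebesgue) p * ennreal (w x) \<partial>lebesgue)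
         \<le> ennreal C' * (\<integral>\<^sup>+y. ennpowr (F y) p * ennreal (w y) \<partial>lebesgue)"
    if D: "scale_test p q (\<lambda>x. ennreal (w x)) V D" "(\<lambda>(x, y). D x y) \<in> borel_measurable (lebesgue \<Otimes>\<^sub>M lebesgue)" for D
  proof -
    have n: "G x y * D x y \<le> ennreal (A * norm (x - y) powr (\<epsilon> - real CARD('n))) * D x y"
      if "0 < norm (x - y)" "norm (x - y) \<le> 1" for x y
      unfolding G_def using that by (intro mult_right_mono near a') auto
    have f: "\<exists>B. \<forall>x y. 1 \<le> norm (x - y) \<longrightarrow> G x y * D x y \<le> ennreal (B * norm (x - y) powr (- L)) * D x y" for L
      unfolding G_def by (intro exI[of _ "B L"] allI impI mult_right_mono far a') auto
    obtain C' :: real where "\<And>F. F \<in> borel_measurable lebesgue \<Longrightarrow>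
       (\<integral>\<^sup>+x. ennpowr (\<integral>\<^sup>+y. G x y * D x y * F y \<partial>lebesgue) p * ennreal (w x) \<partial>lebesgue)
         \<le> ennreal C' * (\<integral>\<^sup>+y. ennpowr (F y) p * ennreal (w y) \<partial>lebesgue)"
    proof (rule decaying_kernel_bound[OF dw D \<epsilon>, where k = "\<lambda>x y. G x y * D x y"])
      fix x y :: "real^'n" assume "0 < norm (x - y)" "norm (x - y) \<le> 1"
      then show "G x y * D x y \<le> ennreal (A * norm (x - y) powr (\<epsilon> - real CARD('n))) * D x y" by (rule n)
    next
      fix L show "\<exists>B. \<forall>x y. 1 \<le> norm (x - y) \<longrightarrow> G x y * D x y \<le> ennreal (B * norm (x - y) powr (- L)) * D x y" by (rule f)
    qed (rule that)
    then show ?thesis by blast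
  qed
  show ?thesis
  proof (rule that[OF Km])
    fix D assume D: "scale_test p q (\<lambda>x. ennreal (w x)) V D" "(\<lambda>(x, y). D x y) \<in> borel_measurable (lebesgue \<Otimes>\<^sub>M lebesgue)"
    obtain C' where C': "\<And>F. F \<in> borel_measurable lebesgue \<Longrightarrow>
       (\<integral>\<^sup>+x. ennpowr (\<integral>\<^sup>+y. G x y * D x y * F y \<partial>lebesgue) p * ennreal (w x) \<partial>lebesgue)
         \<le> ennreal C' * (\<integral>\<^sup>+y. ennpowr (F y) p * ennreal (w y) \<partial>lebesgue)"
      using GD[OF D] by blast
    show "\<exists>C' :: real. \<forall>F\<in>borel_measurable lebesgue.
       (\<integral>\<^sup>+x. ennpowr (\<integral>\<^sup>+y. ennreal (norm (K x y)) * D x y * F y \<partial>lebesgue) p * ennreal (w x) \<partial>lebesgue)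
         \<le> ennreal C' * (\<integral>\<^sup>+y. ennpowr (F y) p * ennreal (w y) \<partial>lebesgue)"
    proof (intro exI[of _ C'] ballI order_trans[OF _ C'])
      fix F :: "real^'n \<Rightarrow> ennreal"
      show "(\<integral>\<^sup>+x. ennpowr (\<integral>\<^sup>+y. ennreal (norm (K x y)) * D x y * F y \<partial>lebesgue) p * ennreal (w x) \<partial>lebesgue)
         \<le> (\<integral>\<^sup>+x. ennpowr (\<integral>\<^sup>+y. G x y * D x y * F y \<partial>lebesgue) p * ennreal (w x) \<partial>lebesgue)"
        by (intro nn_integral_mono mult_right_mono ennpowr_mono p0 KG) auto
    qed
  next
    fix f :: "real^'n \<Rightarrow> complex" assume f: "f \<in> test_functions"
    obtain C' :: real where C': "\<And>F. F \<in> borel_measurable lebesgue \<Longrightarrow>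
       (\<integral>\<^sup>+x. ennpowr (\<integral>\<^sup>+y. G x y * 1 * F y \<partial>lebesgue) p * ennreal (w x) \<partial>lebesgue)
         \<le> ennreal C' * (\<integral>\<^sup>+y. ennpowr (F y) p * ennreal (w y) \<partial>lebesgue)"
      using GD[OF scale_test_one[OF dw]] by auto
    have fL: "f \<in> Lp w p" by (rule test_functions_Lp[OF f])
    then have [measurable]: "f \<in> borel_measurable lebesgue" by (simp add: Lp_iff)
    have "(\<integral>\<^sup>+x. ennpowr (\<integral>\<^sup>+y. G x y * ennreal (norm (f y)) \<partial>lebesgue) p * ennreal (w x) \<partial>lebesgue) \<le> ennreal C' * weighted_mass w p f"
      using C'[of "\<lambda>y. ennreal (norm (f y))"] by (simp add: weighted_mass_def)
    also have "\<dots> < top" using fL by (simp add: Lp_iff ennreal_mult_less_top)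
    finally have "AE x in density lebesgue w. (\<integral>\<^sup>+y. G x y * ennreal (norm (f y)) \<partial>lebesgue) < top"
      by (intro AE_density_finite[OF p0(1) wm]) measurable
    moreover have "AE x in density lebesgue w. a' x = a x"
      using a'(1) by (subst AE_density) (auto elim: eventually_mono)
    ultimately show "AE x in density lebesgue w. psido a f x = kernel_operator K f x"
    proof eventually_elim
      case (elim x)
      have "psido a f x = psido a' f x" using elim(2) by (simp add: psido_def)
      also have "\<dots> = kernel_operator K f x"
        unfolding kernel_operator_def K_def c0_def
        by (rule psido_eq_kernel[OF a'(2) m0 f]) (use elim(1) in \<open>simp add: G_def\<close>)
      finally show ?case .
    qed
  qed
qed

theorem corollary1p5:
  fixes a :: "real^'n::finite \<Rightarrow> real^'n \<Rightarrow> complex" and m \<rho> :: real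
  assumes "\<rho> \<in> {0..1}"
    and "m < real CARD('n) * (\<rho> - 1)"
    and "a \<in> symbol_class m \<rho>"
  shows "(\<forall>p>1. \<forall>w\<in>Ap_infty p. bounded_on_Lp w p (psido a)) \<and>
    (\<forall>b\<in>BMO_infty. \<forall>p>1. \<forall>w\<in>Ap_infty p. commutator_bounded_on_Lp w p b (psido a))"
proof -
  have both: "bounded_on_Lp w p (psido a) \<and> (\<forall>b\<in>BMO_infty. commutator_bounded_on_Lp w p b (psido a))"
    if p: "p > 1" and w: "w \<in> Ap_infty p" for p and w :: "real^'n \<Rightarrow> real"
  proof -
    have wt: "weight w" using w by (auto simp: Ap_infty_def Ap_theta_def)
    have w0: "0 \<le> w x" for x using wt by (simp add: weight_def)
    have wm [measurable]: "w \<in> borel_measurable lebesgue"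
      using wt by (auto simp: weight_def intro: borel_measurable_locally_integrable)
    have bm: "b \<in> borel_measurable lebesgue" if "b \<in> BMO_infty" for b :: "real^'n \<Rightarrow> complex"
      using that by (auto simp: BMO_infty_def BMO_def intro: borel_measurable_locally_integrable)
    show ?thesis
    proof (cases "AE x in lebesgue. w x = 0")
      case True
      have bd: "bounded_on_Lp w p T" for T using p by (intro bounded_on_null_weight wm True) simp
      have "(\<lambda>x. b x * f x) \<in> Lp w p" if "b \<in> BMO_infty" "f \<in> test_functions" for b f
      proof -
        have "f \<in> borel_measurable lebesgue" by (rule measurable_completion) (simp add: test_function_measurable[OF that(2)])
        then show ?thesis using bm[OF that(1)] p by (simp add: Lp_def Lp_norm_null_weight[OF True])
      qed
      moreover have "\<exists>S. bounded_extension w p (psido a) S" using bd by (simp only: bounded_on_Lp_def)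
      ultimately show ?thesis using bd unfolding commutator_bounded_on_Lp_def by (intro conjI ballI allI impI)
    next
      case False
      obtain V C \<theta> where dw: "dual_weights p (p / (p - 1)) (\<lambda>x. ennreal (w x)) V C \<theta>"
        by (rule Ap_infty_dual_weights[OF p w False])
      interpret weighted_Lp w p by (rule dual_weights_weighted_Lp[OF dw w0 wm])
      obtain K where Km [measurable]: "(\<lambda>(x, y). K x y) \<in> borel_measurable (lebesgue \<Otimes>\<^sub>M lebesgue)" and
        Kbd: "\<And>D. scale_test p (p / (p - 1)) (\<lambda>x. ennreal (w x)) V D \<Longrightarrow> (\<lambda>(x, y). D x y) \<in> borel_measurable (lebesgue \<Otimes>\<^sub>M lebesgue) \<Longrightarrow>
          \<exists>C' :: real. \<forall>F\<in>borel_measurable lebesgue.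
          (\<integral>\<^sup>+x. ennpowr (\<integral>\<^sup>+y. ennreal (norm (K x y)) * D x y * F y \<partial>lebesgue) p * ennreal (w x) \<partial>lebesgue)
          \<le> ennreal C' * (\<integral>\<^sup>+y. ennpowr (F y) p * ennreal (w y) \<partial>lebesgue)" and
        KT: "\<And>f. f \<in> test_functions \<Longrightarrow> AE x in density lebesgue w. psido a f x = kernel_operator K f x"
        by (rule psido_bounds_nondegenerate[OF assms dw w0 wm]) (rule that)
      obtain C1 :: real where C1: "\<And>F. F \<in> borel_measurable lebesgue \<Longrightarrow>
          (\<integral>\<^sup>+x. ennpowr (\<integral>\<^sup>+y. ennreal (norm (K x y)) * F y \<partial>lebesgue) p * ennreal (w x) \<partial>lebesgue)
          \<le> ennreal C1 * (\<integral>\<^sup>+y. ennpowr (F y) p * ennreal (w y) \<partial>lebesgue)"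
        using Kbd[OF scale_test_one[OF dw]] by auto
      have Kint: "AE x in density lebesgue w. integrable lebesgue (\<lambda>y. K x y * f y)" if "f \<in> Lp w p" for f
        by (rule kernel_operator_bounded(1)[OF p w0 wm Km _ that]) (rule C1)
      have Kext: "bounded_extension w p (psido a) (kernel_operator K)"
        by (rule kernel_operator_bounded(2)[OF p w0 wm Km]) (rule C1 KT, assumption)+
      have comm: "commutator_bounded_on_Lp w p b (psido a)" if b: "b \<in> BMO_infty" for b
      proof -
        obtain \<theta>b where \<theta>b: "0 < \<theta>b" "b \<in> BMO \<theta>b" using b by (auto simp: BMO_infty_def)
        have [measurable]: "b \<in> borel_measurable lebesgue" by (rule bm[OF b])
        have b1: "(\<lambda>u. b (fst u)) \<in> borel_measurable (lebesgue \<Otimes>\<^sub>M (lebesgue :: (real^'n) measure))"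
          "(\<lambda>u. b (snd u)) \<in> borel_measurable ((lebesgue :: (real^'n) measure) \<Otimes>\<^sub>M lebesgue)"
          by (rule measurable_compose[OF measurable_fst bm[OF b]] measurable_compose[OF measurable_snd bm[OF b]])+
        note [measurable] = b1
        have bf: "(\<lambda>x. b x * f x) \<in> Lp w p" if "f \<in> test_functions" for f
          by (rule BMO_times_test_function[OF dw w0 wm \<theta>b(2,1) that])
        define Kb where "Kb x y = K x y * (b x - b y)" for x y
        have "(\<lambda>u. K (fst u) (snd u)) \<in> borel_measurable (lebesgue \<Otimes>\<^sub>M lebesgue)" using Km by (simp only: case_prod_unfold)
        then have Kbm: "(\<lambda>(x, y). Kb x y) \<in> borel_measurable (lebesgue \<Otimes>\<^sub>M lebesgue)"
          unfolding Kb_def case_prod_unfold by measurable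
        have "(\<lambda>(x, y). ennreal (norm (b x - b y))) \<in> borel_measurable (lebesgue \<Otimes>\<^sub>M lebesgue)"
          unfolding case_prod_unfold by measurable
        from Kbd[OF scale_test_oscillation[OF dw \<theta>b(2,1)] this]
        obtain C2 :: real where "\<And>F. F \<in> borel_measurable lebesgue \<Longrightarrow>
          (\<integral>\<^sup>+x. ennpowr (\<integral>\<^sup>+y. ennreal (norm (K x y)) * ennreal (norm (b x - b y)) * F y \<partial>lebesgue) p * ennreal (w x) \<partial>lebesgue)
          \<le> ennreal C2 * (\<integral>\<^sup>+y. ennpowr (F y) p * ennreal (w y) \<partial>lebesgue)" by blast
        moreover have "ennreal (norm (Kb x y)) = ennreal (norm (K x y)) * ennreal (norm (b x - b y))" for x y
          by (simp add: Kb_def norm_mult ennreal_mult)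
        ultimately have C2: "\<And>F. F \<in> borel_measurable lebesgue \<Longrightarrow>
          (\<integral>\<^sup>+x. ennpowr (\<integral>\<^sup>+y. ennreal (norm (Kb x y)) * F y \<partial>lebesgue) p * ennreal (w x) \<partial>lebesgue)
          \<le> ennreal C2 * (\<integral>\<^sup>+y. ennpowr (F y) p * ennreal (w y) \<partial>lebesgue)"
          by simp
        have *: "bounded_extension w p (commutator b S) (kernel_operator Kb)" if S: "bounded_extension w p (psido a) S" for S
        proof (rule kernel_operator_bounded(2)[OF p w0 wm Kbm])
          fix F :: "real^'n \<Rightarrow> ennreal" assume "F \<in> borel_measurable lebesgue"
          then show "(\<integral>\<^sup>+x. ennpowr (\<integral>\<^sup>+y. ennreal (norm (Kb x y)) * F y \<partial>lebesgue) p * ennreal (w x) \<partial>lebesgue)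
            \<le> ennreal C2 * (\<integral>\<^sup>+y. ennpowr (F y) p * ennreal (w y) \<partial>lebesgue)" by (rule C2)
        next
          fix f :: "real^'n \<Rightarrow> complex" assume f: "f \<in> test_functions"
          have fL: "f \<in> Lp w p" by (rule test_functions_Lp[OF f])
          show "AE x in density lebesgue w. commutator b S f x = kernel_operator Kb f x"
            using extensions_agree[OF S Kext fL] extensions_agree[OF S Kext bf[OF f]] Kint[OF fL] Kint[OF bf[OF f]]
          proof eventually_elim
            case (elim x)
            have "kernel_operator Kb f x = (LINT y|lebesgue. b x * (K x y * f y) - K x y * (b y * f y))"
              unfolding kernel_operator_def Kb_def by (rule Bochner_Integration.integral_cong) (auto simp: algebra_simps)
            also have "\<dots> = b x * (LINT y|lebesgue. K x y * f y) - (LINT y|lebesgue. K x y * (b y * f y))"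
              using elim(3,4) by simp
            finally show ?case using elim(1,2) by (simp add: commutator_def kernel_operator_def)
          qed
        qed
        have ext: "bounded_on_Lp w p (commutator b S)" if "bounded_extension w p (psido a) S" for S
          unfolding bounded_on_Lp_def by (rule exI[of _ "kernel_operator Kb"]) (rule *[OF that])
        show ?thesis
          unfolding commutator_bounded_on_Lp_def
        proof (intro conjI ballI allI impI)
          show "\<exists>S. bounded_extension w p (psido a) S" by (rule exI[of _ "kernel_operator K"]) (rule Kext)
        qed (rule bf ext, assumption)+
      qed
      have "bounded_on_Lp w p (psido a)" unfolding bounded_on_Lp_def by (rule exI[of _ "kernel_operator K"]) (rule Kext)
      then show ?thesis using comm by (intro conjI ballI)
    qed
  qed
  then show ?thesis by blast
qed

end
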